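(* Let $w$ be an annular web of degree $n$, and let $I$ be a radial cut of $w$ with initial thickness $\alpha$. For $1\le j\le n$ put $$b_j(w,I;q):=\sum_{\mathcal L\in\mathrm{SLD}(w,I)}\ \sum_{\tau\in\mathrm{SYT}(j,1^{n-j})}q^{\mathrm{inv}_{\mathcal L}(\tau)},$$ and $b_0=b_{n+1}=0$. Then for $0\le k\le n$ the coefficient of $a^{2k-n}$ in the HOMFLY--PT polynomial $P_w(a,q)$ is $$[a^{2k-n}]P_w=\frac{(-1)^{n-k}\bigl(b_k(w,I;q)+b_{k+1}(w,I;q)\bigr)}{[\alpha]!\,(q-q^{-1})^n},$$ and all other coefficients of $P_w$ in $a$ vanish.
   Context: **Annular webs.** Let $\mathbb A=[0,1]\times[0,1]/\big((x,0)\sim(x,1)\big)$ be the annulus; left/right refer to the first coordinate, upward to the second. An annular web $w$ is a finite trivalent graph embedded in $\mathbb A$ (vertex-free essential circles are allowed as edges), all of whose edges are oriented upward (the second coordinate increases along each edge), together with a thickness $t(e)\in\mathbb Z_{>0}$ for each edge $e$, such that at every vertex the total incoming thickness equals the total outgoing thickness. Every vertex is a merge (two incoming edges, one outgoing) or a split (one incoming, two outgoing). The degree $\deg(w)$ is $\sum t(e)$ over the edges crossed by any radial (horizontal) segment transverse to $w$ and avoiding vertices. **$X_w$ and $P_w$.** Let $\mathbb N=\{1,2,\dots\}$. A coloring $c$ of $w$ assigns to each edge $e$ a finite set $c(e)\subset\mathbb N$ with $|c(e)|=t(e)$ such that at every vertex the union of the color sets on incoming edges equals the union on outgoing edges; $\mathcal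 C(w)$ is the set of colorings. Put $\mathrm{inv}_w(c)=\sum_m\sum_{a\in c(e_R),\,b\in c(e_L)}\mathrm{sgn}(a-b)$ over all merges $m$, with $e_L,e_R$ the left and right incoming edges of $m$. $\Gamma_i(c)$ is the union of the edges $e$ with $i\in c(e)$ (a disjoint union of circles), $x^c=\prod_ix_i^{|\Gamma_i(c)|}$ with $|\cdot|$ the number of components, and $X_w[\mathbf x;q]=\sum_{c\in\mathcal C(w)}q^{\mathrm{inv}_w(c)}x^c$, which is a symmetric function. The HOMFLY--PT polynomial of $w$ is defined by plethystic substitution, $P_w(a,q):=X_w\!\left[\frac{a-a^{-1}}{q-q^{-1}};q\right]$, i.e. the image of $X_w$ under the $\mathbb Q(q)$-algebra homomorphism from symmetric functions to $\mathbb Q(a,q)$ with $p_m\mapsto\frac{a^m-a^{-m}}{q^m-q^{-m}}$ for all power sums $p_m$, $m\ge1$. **Radial cut, labeled loop decompositions.** A radial cut $I$ is a radial (horizontal) segment across $\mathbb A$ transverse to $w$ and disjoint from its vertices. Let $e_1,\dots,e_r$ be the edges meeting $I$, from left to right; the initial thickness is $t(I)=(t(e_1),\dots,t(e_r))$. For a composition $\alpha=(\alpha_1,\dots,\alpha_r)$, $[\alpha]!=[\alpha_1]!\cdots[\alpha_r]!$ with $[k]!=[1]\cdots[k]$ and $[k]=\frac{q^k-q^{-k}}{q-q^{-1}}$. Let $B_j=\{t(e_1)+\cdots+t(e_{j-1})+1,\dots,t(e_1)+\cdots+t(e_j)\}\subset[n]=\{1,\dots,n\}$. A standard labeled loop decomposition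 of $(w,I)$ is a map $\mathcal L$ from edges of $w$ to subsets of $[n]$ with (1) $\mathcal L(e_j)=B_j$ for all $j$; (2) $|\mathcal L(e)|=t(e)$ for all $e$; (3) at every merge or split, the label set of the single edge on one side is the disjoint union of the label sets of the two edges on the other side. $\mathrm{SLD}(w,I)$ is the set of these. For $u\in[n]$, $L_u$ is the loop formed by the edges whose label set contains $u$. **Inversions.** For $\mathcal L\in\mathrm{SLD}(w,I)$, the multiset $\mathsf A_I(\mathcal L)$ of ordered attacking pairs consists of: one pair $(u,v)$ for each block $B_j$ and each $u<v$ in $B_j$; and, for each merge, one pair $(u,v)$ whenever $L_u$ enters the merge from the left and $L_v$ from the right (all counted with multiplicity). For $\sigma:[n]\to\mathbb Z_{>0}$ put $\epsilon_\sigma(u,v)=+1$ if $\sigma(v)>\sigma(u)$, or $\sigma(v)=\sigma(u)$ and $v<u$; and $\epsilon_\sigma(u,v)=-1$ otherwise. Put $\mathrm{inv}_{\mathcal L}(\sigma)=\sum_{(u,v)\in\mathsf A_I(\mathcal L)}\epsilon_\sigma(u,v)$. $\mathrm{SYT}(j,1^{n-j})$ is the set of standard Young tableaux of hook shape $(j,1^{n-j})$ (entries $1,\dots,n$, increasing left to right along rows and top to bottom along columns, first row of length $j$). For such a tableau $\tau$, $\mathrm{inv}_{\mathcal L}(\tau):=\mathrm{inv}_{\mathcal L}(\sigma_\tau)$, where $\sigma_\tau(u)=i$ if $u$ lies in the $i$-th row of $\tau$. *)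

theory Defs
  imports
    "HOL-Analysis.Analysis"
    "HOL-Computational_Algebra.Computational_Algebra"
    "HOL-Library.Poly_Mapping"
    "HOL-Library.Multiset"
begin

text \<open>
  The annulus \<open>[0,1] \<times> [0,1] / ((x,0) \<sim> (x,1))\<close> is realised as \<open>[0,1] \<times> S\<^sup>1\<close>
  in \<^typ>\<open>real \<times> complex\<close>; \<open>annulus_point x y\<close> is its universal covering by the strip
  \<open>[0,1] \<times> \<real>\<close>, so that left/right is the first coordinate and upward is the direction of
  increasing \<open>y\<close>.
\<close>

definition annulus_point :: "real \<Rightarrow> real \<Rightarrow> real \<times> complex" where
  "annulus_point x y = (x, cis (2 * pi * y))"

text \<open>
  Every edge is oriented upward, hence its lift to the strip is the graph of a continuous function
  of the height. The edge \<open>e\<close> is the image of \<open>y \<mapsto> (xcoord w e y, y)\<close> with \<open>y\<close> running from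
  \<open>lower w e\<close> to \<open>upper w e\<close>; only the heights modulo 1 matter, and an edge may pass through
  height 0.
\<close>

record 'e web =
  edges :: "'e set"
  vertices :: "(real \<times> complex) set"
  lower :: "'e \<Rightarrow> real"
  upper :: "'e \<Rightarrow> real"
  xcoord :: "'e \<Rightarrow> real \<Rightarrow> real"
  thickness :: "'e \<Rightarrow> nat"

definition edge_point :: "'e web \<Rightarrow> 'e \<Rightarrow> real \<Rightarrow> real \<times> complex" where
  "edge_point w e y = annulus_point (xcoord w e y) y"

definition edge_image :: "'e web \<Rightarrow> 'e \<Rightarrow> (real \<times> complex) set" where
  "edge_image w e = edge_point w e ` {lower w e..upper w e}"

definition source :: "'e web \<Rightarrow> 'e \<Rightarrow> real \<times> complex" where
  "source w e = edge_point w e (lower w e)"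

definition target :: "'e web \<Rightarrow> 'e \<Rightarrow> real \<times> complex" where
  "target w e = edge_point w e (upper w e)"

definition essential_circle :: "'e web \<Rightarrow> 'e \<Rightarrow> bool" where
  "essential_circle w e \<longleftrightarrow> source w e = target w e \<and> source w e \<notin> vertices w"

text \<open>
  Heights of the points of an edge that are not vertices. The base point of a circle is an ordinary
  point of the circle and is counted once.
\<close>

definition nonvertex_heights :: "'e web \<Rightarrow> 'e \<Rightarrow> real set" where
  "nonvertex_heights w e =
     (if essential_circle w e then {lower w e..<upper w e} else {lower w e<..<upper w e})"

definition in_edges :: "'e web \<Rightarrow> real \<times> complex \<Rightarrow> 'e set" where
  "in_edges w v = {e \<in> edges w. target w e = v}"

definition out_edges :: "'e web \<Rightarrow> real \<times> complex \<Rightarrow> 'e set" where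
  "out_edges w v = {e \<in> edges w. source w e = v}"

definition merges :: "'e web \<Rightarrow> (real \<times> complex) set" where
  "merges w = {v \<in> vertices w. card (in_edges w v) = 2 \<and> card (out_edges w v) = 1}"

definition splits :: "'e web \<Rightarrow> (real \<times> complex) set" where
  "splits w = {v \<in> vertices w. card (in_edges w v) = 1 \<and> card (out_edges w v) = 2}"

definition annular_web :: "'e web \<Rightarrow> bool" where
  "annular_web w \<longleftrightarrow>
     finite (edges w) \<and> finite (vertices w) \<and>
     (\<forall>e\<in>edges w.
        lower w e < upper w e \<and>
        continuous_on {lower w e..upper w e} (xcoord w e) \<and>
        xcoord w e ` {lower w e..upper w e} \<subseteq> {0..1} \<and>
        thickness w e > 0 \<and>
        (source w e \<in> vertices w \<and> target w e \<in> vertices w \<or> essential_circle w e)) \<and>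
     inj_on (\<lambda>(e, y). edge_point w e y) (SIGMA e:edges w. nonvertex_heights w e) \<and>
     (\<forall>e\<in>edges w. \<forall>y\<in>nonvertex_heights w e. edge_point w e y \<notin> vertices w) \<and>
     vertices w = merges w \<union> splits w \<and>
     (\<forall>v\<in>vertices w. sum (thickness w) (in_edges w v) = sum (thickness w) (out_edges w v))"

text \<open>At a merge, left and right are read off just below the vertex.\<close>

definition left_of_below_target :: "'e web \<Rightarrow> 'e \<Rightarrow> 'e \<Rightarrow> bool" where
  "left_of_below_target w e e' \<longleftrightarrow>
     (\<forall>\<^sub>F d in at_right 0. xcoord w e (upper w e - d) < xcoord w e' (upper w e' - d))"

definition left_edge :: "'e web \<Rightarrow> real \<times> complex \<Rightarrow> 'e" where
  "left_edge w v =
     (THE e. e \<in> in_edges w v \<and> (\<exists>e'\<in>in_edges w v. left_of_below_target w e e'))"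

definition right_edge :: "'e web \<Rightarrow> real \<times> complex \<Rightarrow> 'e" where
  "right_edge w v =
     (THE e. e \<in> in_edges w v \<and> (\<exists>e'\<in>in_edges w v. left_of_below_target w e' e))"

text \<open>
  A radial cut is the horizontal segment at height \<open>h\<close>. Edges are strictly increasing in height, so
  such a segment is transverse to them as soon as it avoids the vertices.
\<close>

definition radial_segment :: "real \<Rightarrow> (real \<times> complex) set" where
  "radial_segment h = (\<lambda>x. annulus_point x h) ` {0..1}"

definition radial_cut :: "'e web \<Rightarrow> real \<Rightarrow> bool" where
  "radial_cut w h \<longleftrightarrow> radial_segment h \<inter> vertices w = {}"

definition cut_positions :: "'e web \<Rightarrow> real \<Rightarrow> real set" where
  "cut_positions w h = {x. annulus_point x h \<in> radial_segment h \<inter> (\<Union>e\<in>edges w. edge_image w e)}"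

definition cut_edges :: "'e web \<Rightarrow> real \<Rightarrow> 'e list" where
  "cut_edges w h =
     map (\<lambda>x. THE e. e \<in> edges w \<and> annulus_point x h \<in> edge_image w e)
         (sorted_list_of_set (cut_positions w h))"

definition initial_thickness :: "'e web \<Rightarrow> real \<Rightarrow> nat list" where
  "initial_thickness w h = map (thickness w) (cut_edges w h)"

text \<open>The sum is the same for all radial cuts.\<close>

definition web_degree :: "'e web \<Rightarrow> nat" where
  "web_degree w = (THE n. \<forall>h. radial_cut w h \<longrightarrow> sum_list (initial_thickness w h) = n)"

type_synonym rat_q = "rat poly fract"
type_synonym rat_aq = "rat poly fract poly fract"

definition q_var :: rat_q where
  "q_var = to_fract [:0, 1:]"

definition const_aq :: "rat_q \<Rightarrow> rat_aq" where
  "const_aq c = to_fract [:c:]"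

definition a_var :: rat_aq where
  "a_var = to_fract [:0, 1:]"

definition q_int :: "nat \<Rightarrow> rat_q" where
  "q_int k = (q_var ^ k - inverse q_var ^ k) / (q_var - inverse q_var)"

definition q_fact :: "nat \<Rightarrow> rat_q" where
  "q_fact k = (\<Prod>i=1..k. q_int i)"

definition q_fact_comp :: "nat list \<Rightarrow> rat_q" where
  "q_fact_comp \<alpha> = prod_list (map q_fact \<alpha>)"

definition laurent_expansion :: "rat_aq \<Rightarrow> (int \<Rightarrow> rat_q) \<Rightarrow> bool" where
  "laurent_expansion P c \<longleftrightarrow>
     finite {m. c m \<noteq> 0} \<and> P = (\<Sum>m | c m \<noteq> 0. const_aq (c m) * a_var powi m)"

definition laurent_polynomial :: "rat_aq \<Rightarrow> bool" where
  "laurent_polynomial P \<longleftrightarrow> (\<exists>c. laurent_expansion P c)"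

definition a_coeff :: "rat_aq \<Rightarrow> int \<Rightarrow> rat_q" where
  "a_coeff P = (THE c. laurent_expansion P c)"

text \<open>
  A formal power series over \<open>\<rat>(q)\<close> in countably many variables is given by its coefficients; an
  exponent vector \<open>m\<close> stands for the monomial \<open>\<Prod>i. x\<^bsub>i+1\<^esub> ^ (lookup m i)\<close>.
\<close>

type_synonym series = "(nat \<Rightarrow>\<^sub>0 nat) \<Rightarrow> rat_q"

definition total_degree :: "(nat \<Rightarrow>\<^sub>0 nat) \<Rightarrow> nat" where
  "total_degree m = (\<Sum>i\<in>Poly_Mapping.keys m. Poly_Mapping.lookup m i)"

definition symmetric_functions :: "series set" where
  "symmetric_functions =
     {f. (\<exists>d. \<forall>m. f m \<noteq> 0 \<longrightarrow> total_degree m \<le> d) \<and>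
         (\<forall>\<pi> m. bij \<pi> \<longrightarrow> f (Poly_Mapping.map_key \<pi> m) = f m)}"

definition series_one :: series where
  "series_one = (\<lambda>m. if m = 0 then 1 else 0)"

definition series_add :: "series \<Rightarrow> series \<Rightarrow> series" where
  "series_add f g = (\<lambda>m. f m + g m)"

definition series_scale :: "rat_q \<Rightarrow> series \<Rightarrow> series" where
  "series_scale c f = (\<lambda>m. c * f m)"

definition series_mult :: "series \<Rightarrow> series \<Rightarrow> series" where
  "series_mult f g = (\<lambda>m. \<Sum>(k, l) | k + l = m. f k * g l)"

definition power_sum :: "nat \<Rightarrow> series" where
  "power_sum k = (\<lambda>m. if \<exists>i. m = Poly_Mapping.single i k then 1 else 0)"

definition symmetric_algebra_hom :: "(series \<Rightarrow> rat_aq) \<Rightarrow> bool" where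
  "symmetric_algebra_hom \<phi> \<longleftrightarrow>
     \<phi> series_one = 1 \<and>
     (\<forall>f\<in>symmetric_functions. \<forall>g\<in>symmetric_functions.
        \<phi> (series_add f g) = \<phi> f + \<phi> g \<and> \<phi> (series_mult f g) = \<phi> f * \<phi> g) \<and>
     (\<forall>c. \<forall>f\<in>symmetric_functions. \<phi> (series_scale c f) = const_aq c * \<phi> f)"

text \<open>
  The power sums generate the symmetric functions freely over \<open>\<rat>(q)\<close>, so the homomorphism below
  exists and its values on symmetric functions are unique.
\<close>

definition homfly_substitution :: "series \<Rightarrow> rat_aq" where
  "homfly_substitution =
     (SOME \<phi>. symmetric_algebra_hom \<phi> \<and>
        (\<forall>m\<ge>1. \<phi> (power_sum m) = (a_var ^ m - inverse a_var ^ m) / const_aq (q_var ^ m - inverse q_var ^ m)))"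

definition colorings :: "'e web \<Rightarrow> ('e \<Rightarrow> nat set) set" where
  "colorings w =
     {c \<in> (\<Pi>\<^sub>E e\<in>edges w. {S. finite S \<and> S \<subseteq> {1..} \<and> card S = thickness w e}).
        \<forall>v\<in>vertices w. (\<Union>e\<in>in_edges w v. c e) = (\<Union>e\<in>out_edges w v. c e)}"

definition coloring_inv :: "'e web \<Rightarrow> ('e \<Rightarrow> nat set) \<Rightarrow> int" where
  "coloring_inv w c =
     (\<Sum>v\<in>merges w. \<Sum>r\<in>c (right_edge w v). \<Sum>l\<in>c (left_edge w v). sgn (int r - int l))"

definition color_curve :: "'e web \<Rightarrow> ('e \<Rightarrow> nat set) \<Rightarrow> nat \<Rightarrow> (real \<times> complex) set" where
  "color_curve w c i = (\<Union>e\<in>{e \<in> edges w. i \<in> c e}. edge_image w e)"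

definition coloring_monomial :: "'e web \<Rightarrow> ('e \<Rightarrow> nat set) \<Rightarrow> nat \<Rightarrow>\<^sub>0 nat" where
  "coloring_monomial w c =
     Abs_poly_mapping (\<lambda>i. card (components (color_curve w c (Suc i))))"

definition web_series :: "'e web \<Rightarrow> series" where
  "web_series w =
     (\<lambda>m. \<Sum>c | c \<in> colorings w \<and> coloring_monomial w c = m. q_var powi coloring_inv w c)"

definition homfly :: "'e web \<Rightarrow> rat_aq" where
  "homfly w = homfly_substitution (web_series w)"

text \<open>Blocks, like list positions, are indexed from 0.\<close>

definition block :: "nat list \<Rightarrow> nat \<Rightarrow> nat set" where
  "block \<alpha> j = {sum_list (take j \<alpha>) + 1..sum_list (take (Suc j) \<alpha>)}"

definition SLD :: "'e web \<Rightarrow> real \<Rightarrow> ('e \<Rightarrow> nat set) set" where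
  "SLD w h =
     {L \<in> (\<Pi>\<^sub>E e\<in>edges w. {S. S \<subseteq> {1..web_degree w} \<and> card S = thickness w e}).
        (\<forall>j<length (cut_edges w h). L (cut_edges w h ! j) = block (initial_thickness w h) j) \<and>
        (\<forall>v\<in>vertices w.
           disjoint_family_on L (in_edges w v) \<and> disjoint_family_on L (out_edges w v) \<and>
           (\<Union>e\<in>in_edges w v. L e) = (\<Union>e\<in>out_edges w v. L e))}"

definition attacking_pairs :: "'e web \<Rightarrow> real \<Rightarrow> ('e \<Rightarrow> nat set) \<Rightarrow> (nat \<times> nat) multiset" where
  "attacking_pairs w h L =
     (\<Sum>j<length (cut_edges w h).
        mset_set {(u, v). u \<in> block (initial_thickness w h) j \<and>
                          v \<in> block (initial_thickness w h) j \<and> u < v}) +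
     (\<Sum>p\<in>merges w. mset_set (L (left_edge w p) \<times> L (right_edge w p)))"

definition attack_sign :: "(nat \<Rightarrow> nat) \<Rightarrow> nat \<Rightarrow> nat \<Rightarrow> int" where
  "attack_sign \<sigma> u v = (if \<sigma> v > \<sigma> u \<or> \<sigma> v = \<sigma> u \<and> v < u then 1 else - 1)"

definition labeling_inv :: "'e web \<Rightarrow> real \<Rightarrow> ('e \<Rightarrow> nat set) \<Rightarrow> (nat \<Rightarrow> nat) \<Rightarrow> int" where
  "labeling_inv w h L \<sigma> = (\<Sum>(u, v)\<in>#attacking_pairs w h L. attack_sign \<sigma> u v)"

text \<open>A tableau is the list of its rows from top to bottom, in English notation.\<close>

definition SYT :: "nat list \<Rightarrow> nat list list set" where
  "SYT shape =
     {\<tau>. map length \<tau> = shape \<and>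
         distinct (concat \<tau>) \<and> set (concat \<tau>) = {1..sum_list shape} \<and>
         (\<forall>row\<in>set \<tau>. sorted_wrt (<) row) \<and>
         (\<forall>i j. Suc i < length \<tau> \<and> j < length (\<tau> ! Suc i) \<longrightarrow> \<tau> ! i ! j < \<tau> ! Suc i ! j)}"

definition row_of :: "nat list list \<Rightarrow> nat \<Rightarrow> nat" where
  "row_of \<tau> u = (THE i. 1 \<le> i \<and> i \<le> length \<tau> \<and> u \<in> set (\<tau> ! (i - 1)))"

definition hook :: "nat \<Rightarrow> nat \<Rightarrow> nat list" where
  "hook n j = j # replicate (n - j) 1"

definition hook_sum :: "'e web \<Rightarrow> real \<Rightarrow> nat \<Rightarrow> rat_q" where
  "hook_sum w h j =
     (if 1 \<le> j \<and> j \<le> web_degree w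
      then \<Sum>L\<in>SLD w h. \<Sum>\<tau>\<in>SYT (hook (web_degree w) j). q_var powi labeling_inv w h L (row_of \<tau>)
      else 0)"

end

theory Submission
  imports Defs "HOL-Combinatorics.Permutations"
begin

text \<open>
  A coloring is a list of loops \<open>g\<close>, one for each color, where the number of inversions is
  \<open>\<Sum> cross g g'\<close> over the pairs of colors for a bilinear antisymmetric form \<open>cross\<close> on flows, and by
  planarity the number of components of a loop is the number of its intersections with the cut. Hence
  \<open>X\<^sub>w\<close> is a coefficient of a product of generating functions of loops in the quantum torus of
  \<open>cross\<close>. Two loops evolve along the web by transfer operators commuting with quantum \<open>sl(2)\<close>; taking
  traces shows that the generating functions commute, so that \<open>X\<^sub>w\<close> is symmetric. A symmetric function
  is determined by its values at \<open>q\<^bsup>N-1\<^esup>, q\<^bsup>N-3\<^esup>, \<dots>, q\<^bsup>1-N\<^esup>\<close>. Moving a loop that meets the cut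
  only in its last occupied edge through the product at these values telescopes and removes one
  label, with a factor \<open>[N - d]\<close>; iterating yields
  \<open>[\<alpha>]! X\<^sub>w = \<Sum>\<^sub>L \<Prod>\<^sub>v [N - d\<^sub>v(L)]\<close>. Finally the inversions of a hook tableau depend only on whether
  the larger label of each attacking pair lies in the first row, so expanding the product in powers
  of \<open>a = q\<^sup>N\<close> produces the hook sums.
\<close>

section \<open>Two-coloured transfer operators on words\<close>

text \<open>Since \<open>cross\<close> is a sum over pairs, the commutation of two generating
  functions concerns only two loops with a fixed sum \<open>t\<close>. Every edge is then in one of
  four states, and an edge of size 0, 1 or 2 carries an exterior power of a two-dimensional space.
  Commutation asks that pairs with cut sizes (k, l) and (l, k) have the same weighted count.
  Exchanging the two loops inverts all weights, so it does not prove this; the counts are read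
  instead as traces on opposite weight spaces. Removing a label concerns a finer count, in which the
  second loop meets the cut once, at the far right. Here single diagonal entries are needed rather
  than traces, and a comparison of z with 1/z along the path of that loop supplies them. The other
  obstacle is topological. The web consists of continuous curves, an edge might a priori pass the
  height of the cut repeatedly, and base points of circles may lie on the cut. Sweeping through the
  universal cover extracts the combinatorial steps; the flow to the left of an edge then serves as
  the substitute for planarity. The plethystic homomorphism is itself obtained by interpolation at
  the points a = q^N.\<close>

datatype letter = LO | LT | LF | LB

text \<open>A letter records which of two loops T and F run along an edge: none, one of them, or
  both. \<open>lok\<close> is disjointness and \<open>lmu\<close> the union formed at a vertex. The
  weight \<open>lwt\<close> vanishes on \<open>LO\<close> and \<open>LB\<close> because these span
  the trivial exterior powers of the two-dimensional representation.\<close>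

fun lsz :: "letter => nat" where
 "lsz LO = 0" | "lsz LT = 1" | "lsz LF = 1" | "lsz LB = 2"

fun lok :: "letter => letter => bool" where
 "lok LO b = True" | "lok a LO = True" | "lok LT LF = True" | "lok LF LT = True" | "lok _ _ = False"

fun lmu :: "letter => letter => letter" where
 "lmu LO b = b" | "lmu a LO = a" | "lmu _ _ = LB"

fun lwt :: "letter => int" where
 "lwt LT = 1" | "lwt LF = - 1" | "lwt _ = 0"

text \<open>The exponent of z is the contribution of one merge to \<open>cross g g'\<close> when T
  traces \<open>g\<close> and F traces \<open>g'\<close>. The value 0 forbids a loop to enter a
  merge from both sides.\<close>

definition mwt :: "'a::field => letter => letter => 'a" where
 "mwt z a b = (if \<not> lok a b then 0 else if a = LT & b = LF then z
  else if a = LF & b = LT then inverse z else 1)"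

text \<open>The operators act by pull-back: the value at the word before a vertex is a weighted sum
  of values at the words after it. Hence \<open>app_steps\<close> applies the first step of the list
  outermost.\<close>

fun mrg :: "'a::field => nat => (letter list => 'a) => letter list => 'a" where
 "mrg z 0 f (a # b # s) = mwt z a b * f (lmu a b # s)"
| "mrg z (Suc i) f (a # s) = mrg z i (%s. f (a # s)) s"
| "mrg z _ f _ = 0"

text \<open>The sizes of both outgoing edges are prescribed, since the letter of the incoming edge
  does not determine how its size is distributed.\<close>

fun spl :: "nat => nat => nat => (letter list => 'a::field) => letter list => 'a" where
 "spl 0 m n f (a # s) = (\<Sum>b\<in>{LO,LT,LF,LB}. \<Sum>c\<in>{LO,LT,LF,LB}.
  if lok b c & lmu b c = a & lsz b = m & lsz c = n then f (b # c # s) else 0)"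
| "spl (Suc i) m n f (a # s) = spl i m n (%s. f (a # s)) s"
| "spl _ m n f _ = 0"

datatype lstep = Mrg nat | Spl nat nat nat

fun app_step :: "'a::field => lstep => (letter list => 'a) => letter list => 'a" where
 "app_step z (Mrg i) = mrg z i" | "app_step z (Spl i m n) = spl i m n"

fun app_steps :: "'a::field => lstep list => (letter list => 'a) => letter list => 'a" where
 "app_steps z [] f = f" | "app_steps z (s # ss) f = app_step z s (app_steps z ss f)"

fun size_step :: "lstep => nat list => nat list => bool" where
 "size_step (Mrg 0) (m # n # l) l' = (l' = (m + n) # l)"
| "size_step (Mrg (Suc i)) (m # l) (n # l') = (m = n & size_step (Mrg i) l l')"
| "size_step (Spl 0 m n) (k # l) l' = (k = m + n & l' = m # n # l)"
| "size_step (Spl (Suc i) m n) (k # l) (k' # l') = (k = k' & size_step (Spl i m n) l l')"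
| "size_step _ _ _ = False"

fun size_steps :: "lstep list => nat list => nat list => bool" where
 "size_steps [] l l' = (l = l')"
| "size_steps (s # ss) l l' = (EX l1. size_step s l l1 & size_steps ss l1 l')"

definition lists_sz :: "nat list => letter list set" where
 "lists_sz l = {s. map lsz s = l}"

definition swt :: "letter list => int" where "swt s = sum_list (map lwt s)"

lemma letter_UNIV: "(UNIV :: letter set) = {LO,LT,LF,LB}"
 using letter.exhaust by auto

lemma finite_lists_sz: "finite (lists_sz l)"
proof -
 have "lists_sz l <= {s. set s <= {LO,LT,LF,LB} & length s = length l}"
  unfolding lists_sz_def using letter_UNIV by auto
 then show ?thesis by (rule finite_subset) (simp add: finite_lists_length_eq)
qed

text \<open>Operators on functions that restrict to linear maps from functions on \<open>S'\<close> to functions on \<open>S\<close>.\<close>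

definition lin_op :: "'s set => 's set => (('s => 'a::field) => 's => 'a) => bool" where
 "lin_op S S' X \<longleftrightarrow>
  (ALL f g. \<forall>C\<in>S. X (%s. f s + g s) C = X f C + X g C) &
  (ALL c f. \<forall>C\<in>S. X (%s. c * f s) C = c * X f C) &
  (ALL f. \<forall>C\<in>S. (\<forall>s\<in>S'. f s = 0) --> X f C = 0)"

definition dlt :: "'s => 's => 'a::field" where "dlt C = (%s. if s = C then 1 else 0)"

definition tr_op :: "'s set => (('s => 'a::field) => 's => 'a) => 'a" where
 "tr_op S X = (\<Sum>C\<in>S. X (dlt C) C)"

lemma lin_op_add: "lin_op S S' X ==> C \<in> S ==> X (%s. f s + g s) C = X f C + X g C"
 and lin_op_scale: "lin_op S S' X ==> C \<in> S ==> X (%s. c * f s) C = c * X f C"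
 and lin_op_zero: "lin_op S S' X ==> C \<in> S ==> (!!s. s \<in> S' ==> f s = 0) ==> X f C = 0"
 unfolding lin_op_def by auto

lemma lin_op_cong:
 assumes "lin_op S S' X" "C \<in> S" "!!s. s \<in> S' ==> f s = g s"
 shows "X f C = X g C"
proof -
 have "X f C = X (%s. g s + (f s - g s)) C" by simp
 also have "... = X g C + X (%s. f s - g s) C" by (rule lin_op_add[OF assms(1,2)])
 also have "X (%s. f s - g s) C = 0" by (rule lin_op_zero[OF assms(1,2)]) (simp add: assms(3))
 finally show ?thesis by simp
qed

lemma lin_op_diff:
 assumes "lin_op S S' X" "C \<in> S"
 shows "X (%s. f s - g s) C = X f C - X g C"
proof -
 have "X (%s. f s - g s) C = X (%s. f s + (-1) * g s) C" by simp
 also have "... = X f C + X (%s. (-1) * g s) C" by (rule lin_op_add[OF assms])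
 also have "X (%s. (-1) * g s) C = (-1) * X g C" by (rule lin_op_scale[OF assms])
 finally show ?thesis by simp
qed

lemma lin_op_comp:
 assumes "lin_op S S' X" "lin_op S' S'' Y"
 shows "lin_op S S'' (%f. X (Y f))"
 unfolding lin_op_def
proof (intro conjI allI ballI impI)
 fix f g :: "'a => 'b" and C assume C: "C \<in> S"
 have "X (Y (%s. f s + g s)) C = X (%s. Y f s + Y g s) C"
  by (rule lin_op_cong[OF assms(1) C]) (rule lin_op_add[OF assms(2)])
 then show "X (Y (%s. f s + g s)) C = X (Y f) C + X (Y g) C" by (simp add: lin_op_add[OF assms(1) C])
next
 fix f :: "'a => 'b" and c C assume C: "C \<in> S"
 have "X (Y (%s. c * f s)) C = X (%s. c * Y f s) C"
  by (rule lin_op_cong[OF assms(1) C]) (rule lin_op_scale[OF assms(2)])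
 then show "X (Y (%s. c * f s)) C = c * X (Y f) C" by (simp add: lin_op_scale[OF assms(1) C])
next
 fix f :: "'a => 'b" and C assume C: "C \<in> S" and z: "\<forall>s\<in>S''. f s = 0"
 show "X (Y f) C = 0" by (rule lin_op_zero[OF assms(1) C], rule lin_op_zero[OF assms(2)]) (use z in auto)
qed

lemma lin_op_expand:
 assumes "lin_op S S' X" "C \<in> S" "finite S'"
 shows "X f C = (\<Sum>s\<in>S'. f s * X (dlt s) C)"
proof -
 have *: "X (%s. \<Sum>s'\<in>A. f s' * dlt s' s) C = (\<Sum>s\<in>A. f s * X (dlt s) C)" if "finite A" for A
  using that
 proof (induction A)
  case empty
  then show ?case using lin_op_zero[OF assms(1,2), of "%_. 0"] by simp
 next
  case (insert a A)
  then show ?case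
   by (simp add: lin_op_add[OF assms(1,2)] lin_op_scale[OF assms(1,2)])
 qed
 have "X f C = X (%s. \<Sum>s'\<in>S'. f s' * dlt s' s) C"
  by (rule lin_op_cong[OF assms(1,2)]) (simp add: dlt_def assms(3) if_distrib sum.delta' cong: if_cong)
 then show ?thesis using *[OF assms(3)] by simp
qed

lemma tr_op_comm:
 assumes "lin_op S S X" "lin_op S S Y" "finite S"
 shows "tr_op S (%f. X (Y f)) = tr_op S (%f. Y (X f))"
proof -
 have "tr_op S (%f. X (Y f)) = (\<Sum>C\<in>S. \<Sum>s\<in>S. Y (dlt C) s * X (dlt s) C)"
  unfolding tr_op_def by (rule sum.cong[OF refl]) (rule lin_op_expand[OF assms(1) _ assms(3)])
 also have "... = (\<Sum>s\<in>S. \<Sum>C\<in>S. X (dlt s) C * Y (dlt C) s)"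
  by (subst sum.swap) (simp add: mult.commute)
 also have "... = tr_op S (%f. Y (X f))"
  unfolding tr_op_def by (rule sum.cong[OF refl]) (rule lin_op_expand[OF assms(2) _ assms(3), symmetric])
 finally show ?thesis .
qed

lemma tr_op_cong: "(!!f C. C \<in> S ==> X f C = Y f C) ==> tr_op S X = tr_op S Y"
 unfolding tr_op_def by simp

section \<open>Linearity, locality and weight grading of the merge and split operators\<close>

lemma mrg_add: "mrg z i (%s. f s + g s) C = mrg z i f C + mrg z i g C"
proof (induction i arbitrary: f g C)
 case 0
 show ?case by (cases C; cases "tl C") (auto simp: algebra_simps)
next
 case (Suc i)
 then show ?case by (cases C) auto
qed
lemma mrg_scale: "mrg z i (%s. c * f s) C = c * mrg z i f C"
 by (induction z i f C rule: mrg.induct) (auto simp: algebra_simps)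
lemma spl_add: "spl i m n (%s. f s + g s) C = spl i m n f C + spl i m n g C"
proof (induction i arbitrary: f g C)
 case 0
 show ?case by (cases C) (auto simp: algebra_simps)
next
 case (Suc i)
 then show ?case by (cases C) auto
qed
lemma spl_scale: "spl i m n (%s. c * f s) C = c * spl i m n f C"
 by (induction i m n f C rule: spl.induct) (auto simp: algebra_simps)

lemma lsz_lmu: "lok a b ==> lsz (lmu a b) = lsz a + lsz b"
 by (cases a; cases b) auto

text \<open>Locality makes the operators linear maps between the finite-dimensional spaces of
  functions on \<open>lists_sz l\<close>, on which traces are available.\<close>

lemma mrg_local:
 "size_step (Mrg i) (map lsz C) l' ==> (!!s. map lsz s = l' ==> f s = 0) ==> mrg z i f C = 0"
proof (induction z i f C arbitrary: l' rule: mrg.induct)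
 case (1 z f a b s)
 then show ?case by (cases "lok a b") (auto simp: mwt_def lsz_lmu)
next
 case (2 z i f a s)
 then obtain n l where l: "l' = n # l" by (cases l') auto
 show ?case using "2.IH"[of l] "2.prems" l by (simp)
qed auto

lemma spl_local:
 "size_step (Spl i m n) (map lsz C) l' ==> (!!s. map lsz s = l' ==> f s = 0) ==> spl i m n f C = 0"
proof (induction i m n f C arbitrary: l' rule: spl.induct)
 case (1 m n f a s)
 then show ?case by (auto intro!: sum.neutral)
next
 case (2 i m n f a s)
 then obtain k l where l: "l' = k # l" by (cases l') auto
 show ?case using "2.IH"[of l] "2.prems" l by (simp)
qed auto

lemma lin_app_step:
 assumes "size_step s l l'"
 shows "lin_op (lists_sz l) (lists_sz l') (app_step z s)"
 using assms by (cases s) (auto simp: lin_op_def lists_sz_def mrg_add mrg_scale spl_add spl_scale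
   intro: mrg_local spl_local)

lemma lin_app_steps:
 "size_steps ss l l' ==> lin_op (lists_sz l) (lists_sz l') (app_steps z ss)"
proof (induction ss arbitrary: l)
 case Nil
 then show ?case by (simp add: lin_op_def)
next
 case (Cons s ss)
 then obtain l1 where "size_step s l l1" "size_steps ss l1 l'" by auto
 then show ?case using lin_op_comp[OF lin_app_step Cons.IH] by simp
qed

lemma lwt_lmu: "lok a b ==> lwt (lmu a b) = lwt a + lwt b"
 by (cases a; cases b) auto

lemma swt_Cons [simp]: "swt (a # s) = lwt a + swt s" and swt_Nil [simp]: "swt [] = 0"
 by (auto simp: swt_def)

text \<open>Merging preserves the total weight. The function \<open>ph\<close> is arbitrary because
  the induction shifts its argument by the weight of the first letter; the indicator of a weight
  space is the instance needed for traces.\<close>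

lemma mrg_weight: "mrg z i (%s. ph (swt s) * f s) C = ph (swt C) * mrg z i f C"
proof (induction z i f C arbitrary: ph rule: mrg.induct)
 case (1 z f a b s)
 then show ?case by (cases "lok a b") (auto simp: mwt_def lwt_lmu add.assoc)
next
 case (2 z i f a s)
 show ?case using "2.IH"[of "%x. ph (lwt a + x)"] by simp
qed auto

lemma spl_weight: "spl i m n (%s. ph (swt s) * f s) C = ph (swt C) * spl i m n f C"
proof (induction i m n f C arbitrary: ph rule: spl.induct)
 case (1 m n f a s)
 then show ?case by (cases a) (simp_all add: algebra_simps)
next
 case (2 i m n f a s)
 show ?case using "2.IH"[of "%x. ph (lwt a + x)"] by simp
qed auto

text \<open>Chevalley generators of quantum \<open>sl(2)\<close> acting on words: change one letter \<open>src\<close> into \<open>dst\<close>, with the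
  factor \<open>kr\<close> for every letter to the right and \<open>kl\<close> for every letter to the left.\<close>

fun chev :: "letter => letter => (letter => 'a::field) => (letter => 'a) =>
  (letter list => 'a) => letter list => 'a" where
 "chev src dst kr kl f [] = 0"
| "chev src dst kr kl f (a # s) = (if a = src then prod_list (map kr s) * f (dst # s) else 0)
  + kl a * chev src dst kr kl (%s. f (a # s)) s"

lemma chev_add: "chev x y kr kl (%s. f s + g s) C = chev x y kr kl f C + chev x y kr kl g C"
 by (induction C arbitrary: f g) (auto simp: algebra_simps)
lemma chev_scale: "chev x y kr kl (%s. c * f s) C = c * chev x y kr kl f C"
 by (induction C arbitrary: f) (auto simp: algebra_simps)
lemma chev_zero [simp]: "chev x y kr kl (%s. 0) C = 0"
 by (induction C) (auto simp: algebra_simps)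

lemma chev_local:
 "lsz x = lsz y ==> (!!s. map lsz s = map lsz C ==> f s = 0) ==> chev x y kr kl f C = 0"
 by (induction C arbitrary: f) auto

lemma lin_chev:
 "lsz x = lsz y ==> lin_op (lists_sz l) (lists_sz l) (chev x y kr kl)"
 by (auto simp: lin_op_def lists_sz_def chev_add chev_scale intro: chev_local)

lemma chev_weight:
 "chev x y kr kl (%s. ph (swt s) * f s) C = ph (swt C + lwt y - lwt x) * chev x y kr kl f C"
proof (induction C arbitrary: f ph)
 case Nil
 then show ?case by simp
next
 case (Cons a s)
 show ?case using Cons[of "%v. ph (lwt a + v)" "%s. f (a # s)"]
  by (simp add: algebra_simps)
qed

section \<open>Intertwining of the Chevalley generators with merges and splits\<close>

definition mult_letter :: "(letter => 'a::field) => bool" where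
 "mult_letter k \<longleftrightarrow> (ALL a b. lok a b --> k (lmu a b) = k a * k b)"

lemma mrg_mult_letter:
 assumes "mult_letter k"
 shows "mrg z i (%s. prod_list (map k s) * f s) C = prod_list (map k C) * mrg z i f C"
proof (induction z i f C rule: mrg.induct)
 case (1 z f a b s)
 then show ?case using assms by (cases "lok a b") (auto simp: mwt_def mult_letter_def)
next
 case (2 z i f a s)
 then show ?case by (simp add: mult.assoc mrg_scale)
qed auto

lemma spl_mult_letter:
 assumes "mult_letter k"
 shows "spl i m n (%s. prod_list (map k s) * f s) C = prod_list (map k C) * spl i m n f C"
proof (induction i m n f C rule: spl.induct)
 case (1 m n f a s)
 have "(if lok b c & lmu b c = a & lsz b = m & lsz c = n
     then prod_list (map k (b # c # s)) * f (b # c # s) else 0)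
   = prod_list (map k (a # s)) * (if lok b c & lmu b c = a & lsz b = m & lsz c = n
     then f (b # c # s) else 0)" for b c
  using assms by (auto simp: mult_letter_def)
 then show ?case unfolding spl.simps by (simp only: sum_distrib_left)
next
 case (2 i m n f a s)
 then show ?case by (simp add: mult.assoc spl_scale)
qed auto

text \<open>Multiplicativity of \<open>kr\<close> and \<open>kl\<close> lets every letter away from
  the merge see the same factor before and after it. So the claim reduces to the two letters
  involved, which is the hypothesis \<open>base\<close>.\<close>

lemma chev_mrg:
 assumes kr: "mult_letter kr" and kl: "mult_letter kl"
  and base: "!!a b f s. chev x y kr kl (mrg z 0 f) [a, b] = mrg z 0 (chev x y kr kl f) [a, b]"
  and i: "Suc i < length C"
 shows "chev x y kr kl (mrg z i f) C = mrg z i (chev x y kr kl f) C"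
 using i
proof (induction i arbitrary: C f)
 case 0
 then obtain a b s where C: "C = a # b # s" by (cases C; cases "tl C") auto
 define R where "R = prod_list (map kr s)"
 \<comment> \<open>A function on one-letter words with the tail \<open>s\<close> frozen in, to which
   the two-letter identity \<open>base\<close> applies.\<close>
 let ?g = "%t. case t of c # _ => f (c # s) | [] => 0"
 have b1: "(if a = x then kr b * (mwt z y b * ?g [lmu y b]) else 0) +
   kl a * (if b = x then mwt z a y * ?g [lmu a y] else 0)
  = mwt z a b * (if lmu a b = x then ?g [y] else 0)"
  using base[of ?g a b] by (auto split: if_splits)
 have "chev x y kr kl (mrg z 0 f) C =
  R * ((if a = x then kr b * (mwt z y b * ?g [lmu y b]) else 0) +
   kl a * (if b = x then mwt z a y * ?g [lmu a y] else 0))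
  + kl a * kl b * (mwt z a b * chev x y kr kl (%s. f (lmu a b # s)) s)"
  by (simp add: C R_def algebra_simps chev_scale)
 also have "kl a * kl b * (mwt z a b * chev x y kr kl (%s. f (lmu a b # s)) s) =
   mwt z a b * (kl (lmu a b) * chev x y kr kl (%s. f (lmu a b # s)) s)"
  using kl by (cases "lok a b") (auto simp: mult_letter_def mwt_def)
 finally show ?case unfolding b1 by (simp add: C R_def algebra_simps)
next
 case (Suc i)
 then obtain a s where C: "C = a # s" by (cases C) auto
 have IH: "chev x y kr kl (mrg z i (%s. f (a # s))) s = mrg z i (chev x y kr kl (%s. f (a # s))) s"
  using Suc C by simp
 show ?case
  using IH mrg_scale[of z i 0 "%s. 0" s] by (auto simp add: C mrg_add mrg_scale mrg_mult_letter[OF kr])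
qed

definition split_pairs :: "letter => nat => nat => (letter \<times> letter) set" where
 "split_pairs a m n = {(b, c). lok b c & lmu b c = a & lsz b = m & lsz c = n}"

lemma spl_pairs: "spl 0 m n f (a # s) = (\<Sum>(b, c)\<in>split_pairs a m n. f (b # c # s))"
proof -
 have fin: "finite (UNIV :: letter set)" unfolding letter_UNIV by simp
 have "(\<Sum>(b, c)\<in>split_pairs a m n. f (b # c # s)) =
   (\<Sum>(b, c)\<in>UNIV \<times> UNIV. if lok b c & lmu b c = a & lsz b = m & lsz c = n
    then f (b # c # s) else 0)"
  by (intro sum.mono_neutral_cong_left finite_cartesian_product fin)
   (auto simp: split_pairs_def split: if_splits)
 then show ?thesis unfolding spl.simps letter_UNIV[symmetric] by (simp only: sum.cartesian_product)
qed

lemma chev_sum: "chev x y kr kl (%s. \<Sum>p\<in>A. f p s) C = (\<Sum>p\<in>A. chev x y kr kl (f p) C)"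
 by (induction A rule: infinite_finite_induct) (simp_all add: chev_add)

lemma chev_spl:
 assumes kr: "mult_letter kr" and kl: "mult_letter kl"
  and base: "!!a f. chev x y kr kl (spl 0 m n f) [a] = spl 0 m n (chev x y kr kl f) [a]"
  and i: "i < length C"
 shows "chev x y kr kl (spl i m n f) C = spl i m n (chev x y kr kl f) C"
 using i
proof (induction i arbitrary: C f)
 case 0
 then obtain a s where C: "C = a # s" by (cases C) auto
 define R where "R = prod_list (map kr s)"
 define h where "h b c = (if b = x then kr c * f (y # c # s) else 0) + kl b * (if c = x then f (b # y # s) else 0)" for b c
 let ?g = "%t. f (t ! 0 # t ! 1 # s)"
 have b1: "(if a = x then \<Sum>(b, c)\<in>split_pairs y m n. f (b # c # s) else 0) = (\<Sum>(b, c)\<in>split_pairs a m n. h b c)"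
  using base[of ?g a] unfolding h_def by (cases "a = x") (simp_all add: spl_pairs del: spl.simps cong: if_cong)
 have "spl 0 m n (chev x y kr kl f) C = (\<Sum>(b, c)\<in>split_pairs a m n.
   R * h b c + kl a * chev x y kr kl (%s. f (b # c # s)) s)"
  unfolding C spl_pairs
 proof (intro sum.cong refl, clarify)
  fix b c assume "(b, c) \<in> split_pairs a m n"
  then have "kl a = kl b * kl c" using kl by (auto simp: split_pairs_def mult_letter_def)
  then show "chev x y kr kl f (b # c # s) = R * h b c + kl a * chev x y kr kl (%s. f (b # c # s)) s"
   by (simp add: R_def h_def distrib_left mult.assoc mult.left_commute)
 qed
 also have "... = R * (\<Sum>(b, c)\<in>split_pairs a m n. h b c)
   + kl a * chev x y kr kl (%s. \<Sum>(b, c)\<in>split_pairs a m n. f (b # c # s)) s"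
  by (simp add: sum.distrib sum_distrib_left chev_sum case_prod_unfold)
 finally show ?case unfolding b1[symmetric] by (simp add: C R_def spl_pairs del: spl.simps(1))
next
 case (Suc i)
 then obtain a s where C: "C = a # s" by (cases C) auto
 have IH: "chev x y kr kl (spl i m n (%s. f (a # s))) s = spl i m n (chev x y kr kl (%s. f (a # s))) s"
  using Suc C by simp
 show ?case
  using IH spl_scale[of i m n 0 "%s. 0" s] by (auto simp add: C spl_add spl_scale spl_mult_letter[OF kr])
qed

text \<open>The coproduct of E is "E tensor \<open>e_right\<close> plus \<open>e_left\<close> tensor
  E", and similarly for F. The constants are tuned so that a merge of equal letters remains zero:
  applying E at \<open>[LF, LF]\<close> gives z and -z^2 / z, applying F at \<open>[LT, LT]\<close>
  gives -z^2 / z and z. Moreover \<open>e_right * f_right\<close> is z to the weight of the letter,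
  the usual group-like element.\<close>

fun e_right :: "'a::field => letter => 'a" where
 "e_right z LO = 1" | "e_right z LT = - inverse z" | "e_right z LF = 1" | "e_right z LB = - inverse z"
fun e_left :: "'a::field => letter => 'a" where
 "e_left z LO = 1" | "e_left z LT = inverse z" | "e_left z LF = - z * z" | "e_left z LB = - z"
fun f_right :: "'a::field => letter => 'a" where
 "f_right z LO = 1" | "f_right z LT = - z * z" | "f_right z LF = inverse z" | "f_right z LB = - z"
fun f_left :: "'a::field => letter => 'a" where
 "f_left z LO = 1" | "f_left z LT = 1" | "f_left z LF = - inverse z" | "f_left z LB = - inverse z"

abbreviation opE :: "'a::field => (letter list => 'a) => letter list => 'a" where
 "opE z \<equiv> chev LF LT (e_right z) (e_left z)"
abbreviation opF :: "'a::field => (letter list => 'a) => letter list => 'a" where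
 "opF z \<equiv> chev LT LF (f_right z) (f_left z)"

lemma mult_letter_ef:
 assumes "z ~= 0"
 shows "mult_letter (e_right z)" "mult_letter (e_left z)" "mult_letter (f_right z)" "mult_letter (f_left z)"
proof -
 have "lok a b ==> e_right z (lmu a b) = e_right z a * e_right z b"
  "lok a b ==> e_left z (lmu a b) = e_left z a * e_left z b"
  "lok a b ==> f_right z (lmu a b) = f_right z a * f_right z b"
  "lok a b ==> f_left z (lmu a b) = f_left z a * f_left z b" for a b
  using assms by (cases a; cases b; simp add: field_simps)+
 then show "mult_letter (e_right z)" "mult_letter (e_left z)" "mult_letter (f_right z)" "mult_letter (f_left z)"
  by (auto simp: mult_letter_def)
qed

lemma size_step_Mrg_length: "size_step (Mrg i) l l' ==> Suc i < length l"
proof (induction i arbitrary: l l')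
 case 0 then show ?case by (cases l; cases "tl l") auto
next
 case (Suc i) then show ?case by (cases l; cases l') auto
qed

lemma size_step_Spl_length: "size_step (Spl i m n) l l' ==> i < length l"
proof (induction i arbitrary: l l')
 case 0 then show ?case by (cases l) auto
next
 case (Suc i) then show ?case by (cases l; cases l') auto
qed

lemma ef_step_comm:
 assumes z: "z ~= 0" and s: "size_step st (map lsz C) l'"
 shows "opE z (app_step z st f) C = app_step z st (opE z f) C"
  and "opF z (app_step z st f) C = app_step z st (opF z f) C"
proof -
 have 1: "chev LF LT (e_right z) (e_left z) (mrg z 0 f) [a, b] = mrg z 0 (chev LF LT (e_right z) (e_left z) f) [a, b]"
  "chev LT LF (f_right z) (f_left z) (mrg z 0 f) [a, b] = mrg z 0 (chev LT LF (f_right z) (f_left z) f) [a, b]"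
  for a b f
  using z by (cases a; cases b; simp add: mwt_def field_simps)+
 have 2: "chev LF LT (e_right z) (e_left z) (spl 0 m n f) [a] = spl 0 m n (chev LF LT (e_right z) (e_left z) f) [a]"
  "chev LT LF (f_right z) (f_left z) (spl 0 m n f) [a] = spl 0 m n (chev LT LF (f_right z) (f_left z) f) [a]"
  for a f m n
  using z by (cases a; simp add: field_simps)+
 note ml = mult_letter_ef[OF z]
 show "opE z (app_step z st f) C = app_step z st (opE z f) C"
 proof (cases st)
  case (Mrg i)
  show ?thesis unfolding Mrg app_step.simps
   by (rule chev_mrg[OF ml(1,2) 1(1)]) (use size_step_Mrg_length[of i "map lsz C" l'] s Mrg in simp)
 next
  case (Spl i m n)
  show ?thesis unfolding Spl app_step.simps
   by (rule chev_spl[OF ml(1,2) 2(1)]) (use size_step_Spl_length[of i m n "map lsz C" l'] s Spl in simp)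
 qed
 show "opF z (app_step z st f) C = app_step z st (opF z f) C"
 proof (cases st)
  case (Mrg i)
  show ?thesis unfolding Mrg app_step.simps
   by (rule chev_mrg[OF ml(3,4) 1(2)]) (use size_step_Mrg_length[of i "map lsz C" l'] s Mrg in simp)
 next
  case (Spl i m n)
  show ?thesis unfolding Spl app_step.simps
   by (rule chev_spl[OF ml(3,4) 2(2)]) (use size_step_Spl_length[of i m n "map lsz C" l'] s Spl in simp)
 qed
qed

lemma ef_steps_comm:
 assumes z: "z ~= 0"
 shows "size_steps ss l l' ==> C \<in> lists_sz l ==> opE z (app_steps z ss f) C = app_steps z ss (opE z f) C"
  and "size_steps ss l l' ==> C \<in> lists_sz l ==> opF z (app_steps z ss f) C = app_steps z ss (opF z f) C"
proof (induction ss arbitrary: l C)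
 case (Cons s ss)
 { case 1
  then obtain l1 where l1: "size_step s l l1" "size_steps ss l1 l'" by auto
  have "opE z (app_step z s (app_steps z ss f)) C = app_step z s (opE z (app_steps z ss f)) C"
   using ef_step_comm(1)[OF z] 1 l1 by (auto simp: lists_sz_def)
  also have "... = app_step z s (app_steps z ss (opE z f)) C"
   by (rule lin_op_cong[OF lin_app_step[OF l1(1)] 1(2)]) (rule Cons.IH(1)[OF l1(2)])
  finally show ?case by simp
 next
  case 2
  then obtain l1 where l1: "size_step s l l1" "size_steps ss l1 l'" by auto
  have "opF z (app_step z s (app_steps z ss f)) C = app_step z s (opF z (app_steps z ss f)) C"
   using ef_step_comm(2)[OF z] 2 l1 by (auto simp: lists_sz_def)
  also have "... = app_step z s (app_steps z ss (opF z f)) C"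
   by (rule lin_op_cong[OF lin_app_step[OF l1(1)] 2(2)]) (rule Cons.IH(2)[OF l1(2)])
  finally show ?case by simp }
qed auto

lemma app_steps_weight:
 "size_steps ss l l' ==> C \<in> lists_sz l ==>
 app_steps z ss (%s. ph (swt s) * f s) C = ph (swt C) * app_steps z ss f C"
proof (induction ss arbitrary: l C)
 case (Cons s ss)
 then obtain l1 where l1: "size_step s l l1" "size_steps ss l1 l'" by auto
 have "app_step z s (app_steps z ss (%s. ph (swt s) * f s)) C = app_step z s (%s. ph (swt s) * app_steps z ss f s) C"
  by (rule lin_op_cong[OF lin_app_step[OF l1(1)] Cons.prems(2)]) (rule Cons.IH[OF l1(2)])
 then show ?case by (cases s) (simp_all add: mrg_weight spl_weight)
qed auto

definition qn :: "'a::field => int => 'a" where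
 "qn z m = (z powi m - z powi (- m)) / (z - inverse z)"

lemma chev_minus: "chev x y kr kl (%s. - f s) C = - chev x y kr kl f C"
 using chev_scale[of x y kr kl "-1" f C] by simp

lemma chev_diff: "chev x y kr kl (%s. f s - g s) C = chev x y kr kl f C - chev x y kr kl g C"
 using chev_add[of x y kr kl f "%s. - g s" C] by (simp add: chev_minus)

text \<open>Turning one \<open>LF\<close> into \<open>LT\<close> multiplies the product of the
  \<open>f_right\<close> by -z^2 divided by 1/z. In the next lemma the reverse change multiplies the
  product of the \<open>e_right\<close> by 1 divided by -1/z.\<close>

lemma opE_f_right: assumes "z ~= 0" shows
 "opE z (%s. prod_list (map (f_right z) s) * g s) C = - (z ^ 3) * prod_list (map (f_right z) C) * opE z g C"
proof (induction C arbitrary: g)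
 case (Cons a s)
 have "opE z (%s. f_right z a * prod_list (map (f_right z) s) * g (a # s)) s
   = opE z (%s. f_right z a * (prod_list (map (f_right z) s) * g (a # s))) s" by (simp only: mult.assoc)
 also have "... = f_right z a * (- (z ^ 3) * prod_list (map (f_right z) s) * opE z (%s. g (a # s)) s)"
  unfolding chev_scale Cons ..
 finally have 1: "opE z (%s. f_right z a * prod_list (map (f_right z) s) * g (a # s)) s = ..." .
 define kk ll Y where "kk = prod_list (map (e_right z) s)" and "ll = prod_list (map (f_right z) s)"
  and "Y = opE z (%s. g (a # s)) s"
 have L: "opE z (%s. prod_list (map (f_right z) s) * g s) (a # s) =
   (if a = LF then kk * (f_right z LT * ll * g (LT # s)) else 0) + e_left z a * (f_right z a * (- (z ^ 3) * ll * Y))"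
  unfolding Y_def ll_def 1[symmetric] kk_def by simp
 have R: "opE z g (a # s) = (if a = LF then kk * g (LT # s) else 0) + e_left z a * Y"
  by (simp add: kk_def Y_def)
 have P: "prod_list (map (f_right z) (a # s)) = f_right z a * ll" by (simp add: ll_def)
 show ?case unfolding L R P using assms
  by (cases a) (simp_all add: power3_eq_cube field_simps)
qed auto

lemma opF_e_right: assumes "z ~= 0" shows
 "opF z (%s. prod_list (map (e_right z) s) * g s) C = - z * prod_list (map (e_right z) C) * opF z g C"
proof (induction C arbitrary: g)
 case (Cons a s)
 have "opF z (%s. e_right z a * prod_list (map (e_right z) s) * g (a # s)) s
   = opF z (%s. e_right z a * (prod_list (map (e_right z) s) * g (a # s))) s" by (simp only: mult.assoc)
 also have "... = e_right z a * (- z * prod_list (map (e_right z) s) * opF z (%s. g (a # s)) s)"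
  unfolding chev_scale Cons ..
 finally have 1: "opF z (%s. e_right z a * prod_list (map (e_right z) s) * g (a # s)) s = ..." .
 define kk ll Y where "kk = prod_list (map (e_right z) s)" and "ll = prod_list (map (f_right z) s)"
  and "Y = opF z (%s. g (a # s)) s"
 have L: "opF z (%s. prod_list (map (e_right z) s) * g s) (a # s) =
   (if a = LT then ll * (e_right z LF * kk * g (LF # s)) else 0) + f_left z a * (e_right z a * (- z * kk * Y))"
  unfolding Y_def kk_def 1[symmetric] ll_def by simp
 have R: "opF z g (a # s) = (if a = LT then ll * g (LF # s) else 0) + f_left z a * Y"
  by (simp add: ll_def Y_def)
 have P: "prod_list (map (e_right z) (a # s)) = e_right z a * kk" by (simp add: kk_def)
 show ?case unfolding L R P using assms
  by (cases a) (simp_all add: field_simps)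
qed auto

lemma ef_right: "z ~= 0 ==> prod_list (map (e_right z) s) * prod_list (map (f_right z) s) = z powi swt s"
proof (induction s)
 case (Cons a s)
 then have 1: "prod_list (map (e_right z) s) * prod_list (map (f_right z) s) = z powi swt s" by simp
 have "prod_list (map (e_right z) (a # s)) * prod_list (map (f_right z) (a # s)) = (e_right z a * f_right z a) * z powi swt s"
  unfolding 1[symmetric] by simp
 also have "e_right z a * f_right z a = z powi lwt a"
  using Cons.prems by (cases a) (simp_all add: field_simps)
 finally show ?case using Cons.prems by (simp add: power_int_add)
qed auto

lemma qn_rec:
 assumes "z ~= (0::'a::field)" "z * z ~= 1"
 shows "qn z (m + 1) = inverse z * qn z m + z powi m" "qn z (m - 1) = z * qn z m - z powi m"
proof -
 define D where "D = z - inverse z"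
 have nz: "D ~= 0" using assms by (auto simp: D_def field_simps)
 define P Q where "P = z powi m" and "Q = z powi (- m)"
 have *: "z powi (m + 1) = P * z" "z powi (-(m+1)) = Q * inverse z"
  "z powi (m - 1) = P * inverse z" "z powi (-(m-1)) = Q * z"
  using assms by (simp_all add: P_def Q_def power_int_add power_int_diff power_int_minus field_simps)
 have P: "P = P * D / D" using nz by simp
 have "qn z (m + 1) = (P * z - Q * inverse z) / D" by (simp only: qn_def * D_def)
 also have "P * z - Q * inverse z = inverse z * (P - Q) + P * D" by (simp add: D_def algebra_simps)
 also have "... / D = inverse z * ((P - Q) / D) + P * D / D" by (simp add: add_divide_distrib)
 finally show "qn z (m + 1) = inverse z * qn z m + z powi m" unfolding P[symmetric] by (simp add: P_def Q_def D_def qn_def)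
 have "qn z (m - 1) = (P * inverse z - Q * z) / D" by (simp only: qn_def * D_def)
 also have "P * inverse z - Q * z = z * (P - Q) - P * D" by (simp add: D_def algebra_simps)
 also have "... / D = z * ((P - Q) / D) - P * D / D" by (simp add: diff_divide_distrib right_diff_distrib)
 finally show "qn z (m - 1) = z * qn z m - z powi m" unfolding P[symmetric] by (simp add: P_def Q_def D_def qn_def)
qed

text \<open>Induction on the word: the terms in which E and F act on different sides of the first
  letter cancel by the two relations above, and the remaining ones add up by \<open>qn_rec\<close>.
  The sign is opposite to the usual one because pull-back reverses compositions.\<close>

lemma ef_commutator:
 assumes z: "z ~= 0" "z * z ~= 1"
 shows "opE z (opF z f) C - opF z (opE z f) C = - qn z (swt C) * f C"
proof (induction C arbitrary: f)
 case Nil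
 then show ?case by (simp add: qn_def)
next
 case (Cons a s)
 let ?f = "%s. f (a # s)"
 define kk ll where "kk = prod_list (map (e_right z) s)" and "ll = prod_list (map (f_right z) s)"
 have kl: "kk * ll = z powi swt s" unfolding kk_def ll_def by (rule ef_right[OF z(1)])
 have d: "opE z (opF z ?f) s - opF z (opE z ?f) s = - qn z (swt s) * ?f s"
  by (rule Cons)
 have r: "qn z (1 + swt s) = inverse z * qn z (swt s) + z powi swt s"
  "qn z (swt s - 1) = z * qn z (swt s) - z powi swt s"
  using qn_rec[OF z, of "swt s"] by (simp_all add: add.commute)
 have izz: "inverse z * z = 1" using z(1) by simp
 define P Q where "P = opE z (opF z ?f) s" and "Q = opF z (opE z ?f) s"
 have PQ: "P = Q - qn z (swt s) * ?f s" using d by (simp add: P_def Q_def algebra_simps)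
 show ?case
 proof (cases a)
  case LT
  define X where "X = opE z (%s. f (LF # s)) s"
  have A: "opE z (%s. prod_list (map (f_right z) s) * f (LF # s)) s = - (z ^ 3) * ll * X"
   unfolding X_def ll_def by (rule opE_f_right[OF z(1)])
  have 1: "opE z (opF z f) (LT # s) =
   inverse z * (opE z (%s. prod_list (map (f_right z) s) * f (LF # s)) s + P)"
   unfolding P_def LT by (simp add: chev_add)
  have 2: "opF z (opE z f) (LT # s) = ll * (kk * f (LT # s) - z * z * X) + inverse z * Q"
   by (simp add: chev_scale X_def kk_def ll_def Q_def LT)
  have "opE z (opF z f) (LT # s) - opF z (opE z f) (LT # s) =
   - (inverse z * qn z (swt s) + kk * ll) * f (LT # s) + (1 - inverse z * z) * z * z * ll * X"
   unfolding 1 2 A PQ LT by (simp add: algebra_simps power3_eq_cube)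
  then show ?thesis unfolding kl izz by (simp add: LT r)
 next
  case LF
  define X where "X = opF z (%s. f (LT # s)) s"
  have A: "opF z (%s. prod_list (map (e_right z) s) * f (LT # s)) s = - z * kk * X"
   unfolding X_def kk_def by (rule opF_e_right[OF z(1)])
  have 1: "opE z (opF z f) (LF # s) = kk * (ll * f (LF # s) + X) + z * (z * (inverse z * P))"
   unfolding P_def LF by (simp add: chev_scale chev_minus X_def kk_def ll_def algebra_simps)
  have 2: "opF z (opE z f) (LF # s) = - inverse z * (opF z (%s. prod_list (map (e_right z) s) * f (LT # s)) s
   + - (z * (z * Q)))"
   unfolding Q_def LF by (simp add: chev_diff chev_add chev_minus chev_scale mult.assoc)
  have "opE z (opF z f) (LF # s) - opF z (opE z f) (LF # s) =
   kk * ll * f (LF # s) + (1 - inverse z * z) * kk * X - (inverse z * z) * z * qn z (swt s) * f (LF # s)"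
   unfolding 1 2 A PQ LF by (simp add: algebra_simps)
  then show ?thesis unfolding kl izz by (simp add: LF r algebra_simps)
 next
  case LO
  then show ?thesis using d by simp
 next
  case LB
  have "opE z (opF z f) (LB # s) - opF z (opE z f) (LB # s) = (inverse z * z) * (P - Q)"
   unfolding P_def Q_def LB by (simp add: chev_scale chev_minus algebra_simps)
  then show ?thesis unfolding PQ izz by (simp add: LB)
 qed
qed

text \<open>The traces of an intertwiner on opposite weight spaces agree: separate the eigenvalues
  \<open>cas z (m + 1)\<close> of the Casimir operator.\<close>

definition cas :: "'a::field => int => 'a" where
 "cas z j = (z powi j + z powi (- j)) / (z - inverse z)\<^sup>2"

definition opC :: "'a::field => (letter list => 'a) => letter list => 'a" where
 "opC z f = (%C. opE z (opF z f) C + cas z (swt C + 1) * f C)"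

fun opCs :: "'a::field => int list => (letter list => 'a) => letter list => 'a" where
 "opCs z [] f = f"
| "opCs z (j # js) f = (%C. opC z (opCs z js f) C - cas z j * opCs z js f C)"

lemma cas_neg: "cas z (- j) = cas z j" by (simp add: cas_def add.commute)

lemma cas_diff:
 assumes z: "z ~= (0::'a::field)" "z * z ~= 1"
 shows "cas z (m + 1) - cas z (m - 1) = qn z m"
proof -
 define D P Q where "D = z - inverse z" and "P = z powi m" and "Q = z powi (- m)"
 have nz: "D ~= 0" using assms by (auto simp: D_def field_simps)
 have *: "z powi (m + 1) = P * z" "z powi (-(m+1)) = Q * inverse z"
  "z powi (m - 1) = P * inverse z" "z powi (-(m-1)) = Q * z"
  using assms by (simp_all add: P_def Q_def power_int_add power_int_diff power_int_minus field_simps)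
 have "cas z (m + 1) - cas z (m - 1) = (P * z + Q * inverse z - (P * inverse z + Q * z)) / D\<^sup>2"
  unfolding cas_def * D_def by (simp add: diff_divide_distrib)
 also have "P * z + Q * inverse z - (P * inverse z + Q * z) = (P - Q) * D"
  by (simp add: D_def algebra_simps)
 finally show ?thesis using nz by (simp add: qn_def P_def Q_def D_def power2_eq_square)
qed

text \<open>The difference of z^i + z^(-i) and z^j + z^(-j) factors as (z^i - z^j)(1 - z^(-i-j)). As
  z is not a root of unity, only i = j and i = -j are left.\<close>

lemma cas_inj:
 assumes z: "z ~= (0::'a::field)" "!!n::nat. n > 0 ==> z ^ n ~= 1" and ij: "\<bar>i\<bar> ~= \<bar>j\<bar>"
 shows "cas z i ~= cas z j"
proof
 assume eq: "cas z i = cas z j"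
 have z1: "z powi k ~= 1" if "k ~= 0" for k
 proof (cases "k > 0")
  case True
  then show ?thesis using z(2)[of "nat k"] by (simp add: power_int_def)
 next
  case False
  then show ?thesis using z(2)[of "nat (- k)"] that z(1)
   by (simp add: power_int_def power_inverse)
 qed
 have "z - inverse z ~= 0" using z(1) z(2)[of 2] by (auto simp: field_simps power2_eq_square)
 then have "z powi i + z powi (- i) = z powi j + z powi (- j)" using eq by (simp add: cas_def)
 moreover have "(z powi i - z powi j) * z powi (- i - j) = z powi (- j) - z powi (- i)"
  using z(1) by (simp add: left_diff_distrib power_int_add[symmetric])
 ultimately have "(z powi i - z powi j) * (1 - z powi (- i - j)) = 0"
  by (simp add: right_diff_distrib) (simp add: algebra_simps)
 then have "z powi i = z powi j \<or> z powi (- i - j) = 1" by auto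
 moreover have "z powi i = z powi j ==> z powi (i - j) = 1" using z(1) by (simp add: power_int_diff)
 ultimately show False using z1[of "i - j"] z1[of "- i - j"] ij by linarith
qed

lemma lin_opE: "lin_op (lists_sz l) (lists_sz l) (opE z)"
 and lin_opF: "lin_op (lists_sz l) (lists_sz l) (opF z)"
 by (simp_all add: lin_chev)

lemma lin_op_mult: "lin_op S S X ==> lin_op S S (%f C. X f C + ph C * f C)"
 unfolding lin_op_def by (auto simp: algebra_simps)

lemma lin_opC: "lin_op (lists_sz l) (lists_sz l) (opC z)"
 unfolding opC_def by (intro lin_op_mult lin_op_comp[OF lin_opE lin_opF])

lemma lin_op_sub: "lin_op S S X ==> lin_op S S Y ==> lin_op S S (%f C. X f C - c * Y f C)"
 unfolding lin_op_def by (auto simp: algebra_simps)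

lemma lin_opCs: "lin_op (lists_sz l) (lists_sz l) (opCs z js)"
proof (induction js)
 case Nil
 then show ?case by (simp add: lin_op_def)
next
 case (Cons j js)
 show ?case by (simp only: opCs.simps) (intro lin_op_sub lin_op_comp[OF lin_opC] Cons)
qed

text \<open>At weight m the commutator contributes [m + 2] inside E, and \<open>cas_diff\<close>
  turns \<open>cas z (m + 1)\<close> plus this term into \<open>cas z (m + 3)\<close>, the value
  that C uses after E has raised the weight by 2.\<close>

lemma opC_opE:
 assumes z: "z ~= 0" "z * z ~= 1"
 shows "opC z (opE z f) C = opE z (opC z f) C"
proof -
 have *: "opF z (opE z f) s = opE z (opF z f) s + qn z (swt s) * f s" for s
  using ef_commutator[OF z, of f s] by (simp add: algebra_simps)
 then have **: "opF z (opE z f) = (%s. opE z (opF z f) s + qn z (swt s) * f s)" by blast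
 have "opC z (opE z f) C = opE z (%s. opE z (opF z f) s + qn z (swt s) * f s) C + cas z (swt C + 1) * opE z f C"
  unfolding opC_def by (simp only: **)
 also have "... = opE z (opE z (opF z f)) C + (qn z (swt C + 2) + cas z (swt C + 1)) * opE z f C"
  using chev_weight[of LF LT "e_right z" "e_left z" "qn z" f C] by (simp add: chev_add distrib_right add.commute[of 2])
 also have "qn z (swt C + 2) + cas z (swt C + 1) = cas z (swt C + 3)"
  using cas_diff[OF z, of "swt C + 2"] by (simp add: algebra_simps)
 also have "opE z (opE z (opF z f)) C + cas z (swt C + 3) * opE z f C = opE z (opC z f) C"
  using chev_weight[of LF LT "e_right z" "e_left z" "%v. cas z (v + 1)" f C]
  by (simp add: opC_def chev_add algebra_simps)
 finally show ?thesis .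
qed

lemma opCs_opE:
 assumes z: "z ~= 0" "z * z ~= 1"
 shows "opCs z js (opE z f) C = opE z (opCs z js f) C"
proof (induction js arbitrary: C)
 case (Cons j js)
 have eq: "opCs z js (opE z f) = opE z (opCs z js f)" using Cons by blast
 show ?case by (simp add: eq opC_opE[OF z] chev_diff chev_scale)
qed simp

section \<open>Traces of an intertwiner on weight spaces\<close>

definition wproj :: "int => (letter list => 'a::field) => letter list => 'a" where
 "wproj m f = (%s. (if swt s = m then 1 else 0) * f s)"

lemma lin_wproj: "lin_op S S (wproj m)"
 unfolding lin_op_def wproj_def by (auto simp: algebra_simps)

lemma opE_wproj: "opE z (wproj (m + 2) f) C = wproj m (opE z f) C"
 unfolding wproj_def
 using chev_weight[of LF LT "e_right z" "e_left z" "%v. if v = m + 2 then 1 else 0" f C] by simp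

definition wtr :: "'a::field => nat list => lstep list => int list => int => 'a" where
 "wtr z l ss js m = tr_op (lists_sz l) (%f. wproj m (app_steps z ss (opCs z js f)))"

context
 fixes z :: "'a::field" and l :: "nat list" and ss :: "lstep list"
 assumes z0: "z ~= 0" and zn: "!!n::nat. n > 0 ==> z ^ n ~= 1" and ss: "size_steps ss l l"
begin

lemma z2: "z * z ~= 1" using zn[of 2] by (simp add: power2_eq_square)

lemma linT: "lin_op (lists_sz l) (lists_sz l) (app_steps z ss)"
 by (rule lin_app_steps[OF ss])

lemma T_wproj: "C \<in> lists_sz l ==> app_steps z ss (wproj m f) C = wproj m (app_steps z ss f) C"
 unfolding wproj_def by (rule app_steps_weight[OF ss])

text \<open>On weight m the factor C - \<open>cas z (m + 1)\<close> is E F, and on weight m + 2 it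
  is F E, by the commutator and \<open>cas_diff\<close>. Since E commutes with the web operator and
  with C, moving it around the trace passes from one weight space to the other.\<close>

lemma wtr_shift: "wtr z l ss ((m + 1) # js) m = wtr z l ss ((m + 1) # js) (m + 2)"
proof -
 let ?S = "lists_sz l" and ?T = "app_steps z ss"
 define Y where "Y = opCs z js"
 have linY: "lin_op ?S ?S Y" unfolding Y_def by (rule lin_opCs)
 have a: "wproj m (?T (opCs z ((m + 1) # js) f)) C = opE z (wproj (m + 2) (?T (opF z (Y f)))) C"
  if C: "C \<in> ?S" for f C
 proof -
  have "wproj m (?T (opCs z ((m + 1) # js) f)) C = ?T (wproj m (opCs z ((m + 1) # js) f)) C"
   by (rule T_wproj[OF C, symmetric])
  also have "wproj m (opCs z ((m + 1) # js) f) = wproj m (opE z (opF z (Y f)))"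
   by (auto simp: wproj_def fun_eq_iff opC_def Y_def)
  also have "?T ... C = wproj m (?T (opE z (opF z (Y f)))) C" by (rule T_wproj[OF C])
  also have "... = wproj m (opE z (?T (opF z (Y f)))) C"
   using ef_steps_comm(1)[OF z0 ss C] by (simp add: wproj_def)
  finally show ?thesis unfolding opE_wproj .
 qed
 have b: "wproj (m + 2) (?T (opF z (Y (opE z f)))) C = wproj (m + 2) (?T (opCs z ((m + 1) # js) f)) C"
  if C: "C \<in> ?S" for f C
 proof -
  have Y: "Y (opE z f) = opE z (Y f)" unfolding Y_def using opCs_opE[OF z0 z2] by blast
  have "wproj (m + 2) (?T (opF z (Y (opE z f)))) C = ?T (wproj (m + 2) (opF z (opE z (Y f)))) C"
   unfolding Y by (rule T_wproj[OF C, symmetric])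
  also have "wproj (m + 2) (opF z (opE z (Y f))) = wproj (m + 2) (opCs z ((m + 1) # js) f)"
  proof (rule ext)
   fix s
   have "opF z (opE z (Y f)) s = opE z (opF z (Y f)) s + qn z (swt s) * Y f s"
    using ef_commutator[OF z0 z2, of "Y f" s] by (simp add: algebra_simps)
   moreover have "qn z (m + 2) = cas z (m + 3) - cas z (m + 1)"
    using cas_diff[OF z0 z2, of "m + 2"] by (simp add: algebra_simps)
   ultimately show "wproj (m + 2) (opF z (opE z (Y f))) s = wproj (m + 2) (opCs z ((m + 1) # js) f) s"
    by (cases "swt s = m + 2") (simp_all add: wproj_def opC_def Y_def left_diff_distrib add.commute[of 3 m])
  qed
  also have "?T ... C = wproj (m + 2) (?T (opCs z ((m + 1) # js) f)) C" by (rule T_wproj[OF C])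
  finally show ?thesis .
 qed
 have "wtr z l ss ((m + 1) # js) m = tr_op ?S (%f. opE z (wproj (m + 2) (?T (opF z (Y f)))))"
  unfolding wtr_def by (rule tr_op_cong[OF a])
 also have "... = tr_op ?S (%f. wproj (m + 2) (?T (opF z (Y (opE z f)))))"
  by (rule tr_op_comm[OF lin_opE _ finite_lists_sz])
   (intro lin_op_comp[OF lin_wproj] lin_op_comp[OF linT] lin_op_comp[OF lin_opF] linY)
 also have "... = wtr z l ss ((m + 1) # js) (m + 2)"
  unfolding wtr_def by (rule tr_op_cong[OF b])
 finally show ?thesis .
qed

definition "dtr js m = wtr z l ss js m - wtr z l ss js (m + 2)"

text \<open>Differences of traces on adjacent weight spaces behave as if C were the scalar
  \<open>cas z (m + 1)\<close>: one more factor C - \<open>cas z j\<close> multiplies them by the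
  difference of scalars. This separates the eigenvalues at the level of traces.\<close>

lemma dtr_Cons: "dtr (j # js) m = (cas z (m + 1) - cas z j) * dtr js m"
proof -
 let ?S = "lists_sz l" and ?T = "app_steps z ss"
 define W where "W k = tr_op ?S (%f. wproj k (?T (opC z (opCs z js f))))" for k
 have a: "wtr z l ss (i # js) k = W k - cas z i * wtr z l ss js k" for i k
 proof -
  have "wproj k (?T (opCs z (i # js) f)) C
   = wproj k (?T (opC z (opCs z js f))) C - cas z i * wproj k (?T (opCs z js f)) C"
   if C: "C \<in> ?S" for f C
   using lin_op_diff[OF linT C, of "opC z (opCs z js f)" "%C. cas z i * opCs z js f C"]
    lin_op_scale[OF linT C, of "cas z i" "opCs z js f"] by (simp add: wproj_def)
  then show ?thesis unfolding wtr_def W_def tr_op_def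
   by (simp add: sum_subtractf sum_distrib_left)
 qed
 have "dtr ((m + 1) # js) m = 0" unfolding dtr_def using wtr_shift[of m js] by simp
 then have "W m - W (m + 2) = cas z (m + 1) * dtr js m" unfolding dtr_def a by (simp add: algebra_simps)
 then show ?thesis unfolding dtr_def a by (simp add: algebra_simps)
qed

lemma dtr_prod: "dtr js m = (\<Prod>j\<leftarrow>js. cas z (m + 1) - cas z j) * dtr [] m"
 by (induction js) (simp_all add: dtr_Cons)

lemma swt_bound: "C \<in> lists_sz l ==> \<bar>swt C\<bar> <= int (length l)"
proof -
 have "\<bar>swt s\<bar> <= int (length s)" for s
 proof (induction s)
  case (Cons a s) then show ?case by (cases a) auto
 qed simp
 then show "C \<in> lists_sz l ==> \<bar>swt C\<bar> <= int (length l)" by (auto simp: lists_sz_def)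
qed

lemma wtr_zero: "\<bar>m\<bar> > int (length l) ==> wtr z l ss js m = 0"
 unfolding wtr_def tr_op_def wproj_def by (intro sum.neutral) (auto dest!: swt_bound)

text \<open>Let \<open>js\<close> contain all Casimir indices that can occur except m + 1. Of all
  differences of adjacent traces only those at m and -m - 2 survive, as \<open>cas\<close> is even
  and takes the same value there. All differences telescope to 0 over a window wider than the
  support, and the common nonzero scalar can be cancelled. Increasing m by 2 repeatedly then leaves
  the support.\<close>

lemma wtr_symmetric: "wtr z l ss [] (- m) = wtr z l ss [] m"
proof -
 define N where "N = int (length l) + 1"
 have step: "wtr z l ss [] m - wtr z l ss [] (- m) = wtr z l ss [] (m + 2) - wtr z l ss [] (- (m + 2))"
  if m: "m >= 0" for m
 proof (cases "m > N + 2")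
  case True
  then show ?thesis by (simp add: wtr_zero N_def)
 next
  case False
  \<comment> \<open>The window reaches from m - 2K to m + 2K, beyond the word length on both sides.
    Its index K is the weight m and its index K - m - 1 the weight -m - 2. The upper end of
    \<open>js\<close> is chosen large enough to contain |x + 1| for every weight x in the
    window.\<close>
  define K where "K = nat (N + m + 4)"
  define js where "js = filter (%j. j ~= m + 1) [0..2 * N + 3 * m + 20]"
  have tele: "(\<Sum>i<k. dtr js (b + 2 * int i)) = wtr z l ss js b - wtr z l ss js (b + 2 * int k)" for b k
   by (induction k) (simp_all add: dtr_def algebra_simps)
  let ?b = "m - 2 * int K"
  have "(\<Sum>i<2*K. dtr js (?b + 2 * int i)) = 0"
   unfolding tele using m by (simp add: wtr_zero K_def N_def)
  moreover have "(\<Sum>i<2*K. dtr js (?b + 2 * int i)) = (\<Sum>i\<in>{K, nat (int K - m - 1)}. dtr js (?b + 2 * int i))"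
  proof (rule sum.mono_neutral_right)
   show "\<forall>i\<in>{..<2*K} - {K, nat (int K - m - 1)}. dtr js (?b + 2 * int i) = 0"
   proof
    fix i assume i: "i \<in> {..<2*K} - {K, nat (int K - m - 1)}"
    define x where "x = ?b + 2 * int i"
    have "int K = N + m + 4" using m by (simp add: K_def N_def)
    then have "x ~= m" "x ~= - m - 2" "\<bar>x + 1\<bar> <= 2 * N + 3 * m + 20"
     using i m by (auto simp: x_def N_def)
    then have "\<bar>x + 1\<bar> \<in> set js" using m by (auto simp: js_def)
    then have "0 \<in> set (map (%j. cas z (x + 1) - cas z j) js)"
     using cas_neg[of z "x + 1"] by (auto simp: abs_if image_iff split: if_splits intro!: bexI[of _ "\<bar>x + 1\<bar>"])
    then show "dtr js (?b + 2 * int i) = 0"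
     unfolding dtr_prod[of js] x_def[symmetric] by (simp add: prod_list_zero_iff)
   qed
  qed (use m in \<open>auto simp: K_def N_def\<close>)
  moreover have "K ~= nat (int K - m - 1)" using m by (auto simp: K_def N_def)
  moreover have "m - 2 * int K + 2 * int (nat (int K - m - 1)) = - m - 2" using m by (simp add: K_def N_def)
  ultimately have "dtr js m + dtr js (- m - 2) = 0" by simp
  moreover have "cas z (- m - 2 + 1) = cas z (m + 1)" using cas_neg[of z "m + 1"] by (simp add: algebra_simps)
  ultimately have "(\<Prod>j\<leftarrow>js. cas z (m + 1) - cas z j) * (dtr [] m + dtr [] (- m - 2)) = 0"
   unfolding dtr_prod[of js] by (simp add: algebra_simps)
  moreover have "(\<Prod>j\<leftarrow>js. cas z (m + 1) - cas z j) ~= 0"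
   using cas_inj[OF z0 zn] m by (auto simp: prod_list_zero_iff js_def)
  ultimately have "dtr [] m + dtr [] (- m - 2) = 0" by (metis mult_eq_0_iff)
  then show ?thesis by (simp add: dtr_def algebra_simps)
 qed
 have pos: "wtr z l ss [] m - wtr z l ss [] (- m) = 0" if m: "m >= 0" for m
 proof -
  have "wtr z l ss [] m - wtr z l ss [] (- m) =
   wtr z l ss [] (m + 2 * int k) - wtr z l ss [] (- (m + 2 * int k))" for k
  proof (induction k)
   case (Suc k)
   show ?case unfolding Suc using step[of "m + 2 * int k"] m by (simp add: algebra_simps)
  qed simp
  from this[of "length l + 1"] show ?thesis using m by (simp add: wtr_zero)
 qed
 show ?thesis using pos[of m] pos[of "- m"] by (cases "m >= 0") auto
qed

lemma trace_symmetric: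
 "(\<Sum>C | C \<in> lists_sz l & swt C = m. app_steps z ss (dlt C) C) =
 (\<Sum>C | C \<in> lists_sz l & swt C = - m. app_steps z ss (dlt C) C)"
proof -
 have "(\<Sum>C | C \<in> lists_sz l & swt C = m. app_steps z ss (dlt C) C) = wtr z l ss [] m" for m
  unfolding wtr_def tr_op_def wproj_def
  by (simp add: sum.inter_filter[OF finite_lists_sz] if_distrib cong: if_cong)
   (auto intro!: sum.cong simp: if_distrib)
 then show ?thesis using wtr_symmetric[of m] by simp
qed

end


section \<open>A single F-strand among T-strands, and the exchange of z with its inverse\<close>

definition thin :: "nat list => bool" where "thin l \<longleftrightarrow> (\<forall>k\<in>set l. k <= 1)"

fun one_thick :: "nat list => bool" where
 "one_thick [] = False"
| "one_thick (k # l) = (if k = 2 then thin l else k <= 1 & one_thick l)"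

fun thick_pos :: "nat list => nat" where
 "thick_pos [] = 0"
| "thick_pos (k # l) = (if k = 2 then 0 else k + thick_pos l)"

text \<open>The relevant words: in \<open>Wl\<close> the walker F is hidden in the edge of size 2,
  if there is one; in \<open>Vl l p\<close> it occupies the p-th nonempty edge, counted from 0. All
  other strands are T.\<close>

definition Wl :: "nat list => letter list" where
 "Wl l = map (%k. if k = 0 then LO else if k = 1 then LT else LB) l"

fun Vl :: "nat list => nat => letter list" where
 "Vl [] p = []"
| "Vl (k # l) p = (if k = 0 then LO # Vl l p else (case p of 0 => LF # Wl l | Suc p => LT # Vl l p))"

lemma thin_simps [simp]: "thin []" "thin (k # l) \<longleftrightarrow> k <= 1 & thin l"
 by (auto simp: thin_def)
lemma Wl_simps [simp]: "Wl [] = []"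
 "Wl (k # l) = (if k = 0 then LO else if k = 1 then LT else LB) # Wl l"
 by (auto simp: Wl_def)

lemma one_thick_not_thin: "one_thick l ==> \<not> thin l" by (induction l) (auto split: if_splits)

lemma le1: "(k::nat) <= 1 \<longleftrightarrow> k = 0 \<or> k = 1" "k <= Suc 0 \<longleftrightarrow> k = 0 \<or> k = 1" by auto

lemma mrg_thin_Wl:
 "size_step (Mrg i) l l' ==> thin l ==> mrg z i f (Wl l) = (if thin l' then f (Wl l') else 0)"
proof (induction i arbitrary: l l' f)
 case 0
 then obtain a b r where "l = a # b # r" by (cases l; cases "tl l") auto
 with 0 show ?case by (auto simp: mwt_def le1)
next
 case (Suc i)
 then obtain k r r' where l: "l = k # r" "l' = k # r'" "size_step (Mrg i) r r'" by (cases l; cases l') auto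
 then show ?case using Suc.IH[OF l(3), of "%s. f (_ # s)"] Suc.prems by (auto simp: le1)
qed

lemma mrg_Wl:
 "size_step (Mrg i) l l' ==> one_thick l ==>
 mrg z i f (Wl l) = (if one_thick l' then f (Wl l') else 0) & (one_thick l' --> thick_pos l' = thick_pos l)"
proof (induction i arbitrary: l l' f)
 case 0
 then obtain a b r where "l = a # b # r" by (cases l; cases "tl l") auto
 with 0 show ?case by (auto simp: mwt_def le1 one_thick_not_thin split: if_splits dest: one_thick_not_thin)
next
 case (Suc i)
 then obtain k r r' where l: "l = k # r" "l' = k # r'" "size_step (Mrg i) r r'" by (cases l; cases l') auto
 show ?case
 proof (cases "k = 2")
  case True
  then show ?thesis using l Suc.prems mrg_thin_Wl[OF l(3), of z "%s. f (LB # s)"] by auto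
 next
  case False
  then show ?thesis using l Suc.prems Suc.IH[OF l(3), of "%s. f (_ # s)"] by (auto simp: le1)
 qed
qed

text \<open>Two T-strands cannot merge, so a merge of two occupied edges forces the walker to be one
  of them: it contributes 1/z from the left and z from the right.\<close>

lemma mrg_Vl:
 "size_step (Mrg i) l l' ==> thin l ==> p < sum_list l ==>
 (thin l' --> mrg z i f (Vl l p) = f (Vl l' p)) &
 (\<not> thin l' --> one_thick l' & mrg z i f (Vl l p) = (if p = thick_pos l' then inverse z * f (Wl l')
   else if p = Suc (thick_pos l') then z * f (Wl l') else 0)) & sum_list l' = sum_list l"
proof (induction i arbitrary: l l' f p)
 case 0
 then obtain a b r where l: "l = a # b # r" by (cases l; cases "tl l") auto
 consider "a = 0" | "a = 1" "b = 0" | "a = 1" "b = 1" using 0 l by (auto simp: le1)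
 then show ?case
 proof cases
  case 3
  then show ?thesis using 0 l
   by (cases p; cases "p - 1") (auto simp: mwt_def)
 qed (use 0 l in \<open>cases p; auto simp: mwt_def le1\<close>)+
next
 case (Suc i)
 then obtain k r r' where l: "l = k # r" "l' = k # r'" "size_step (Mrg i) r r'" by (cases l; cases l') auto
 have sr: "sum_list r' = sum_list r" if "size_step (Mrg i) r r'" for r r' i
  using that
 proof (induction i arbitrary: r r')
  case 0 then show ?case by (cases r; cases "tl r") auto
 next
  case (Suc i) then show ?case by (cases r; cases r') auto
 qed
 consider "k = 0" | "k = 1" "p = 0" | q where "k = 1" "p = Suc q" using Suc.prems l by (cases p) (auto simp: le1)
 then show ?case
 proof cases
  case 1
  then show ?thesis using l Suc.prems Suc.IH[OF l(3), of p "%s. f (LO # s)"] by auto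
 next
  case 2
  have "one_thick r'" if "\<not> thin r'"
   using that l(3) Suc.prems(2) l(1)
  proof -
   have "thin r ==> size_step (Mrg i) r r' ==> \<not> thin r' ==> one_thick r'" for r r' i
   proof (induction i arbitrary: r r')
    case 0 then show ?case by (cases r; cases "tl r") (auto simp: le1)
   next
    case (Suc i) then show ?case by (cases r; cases r') auto
   qed
   then show ?thesis using that l Suc.prems by auto
  qed
  then show ?thesis using 2 l Suc.prems mrg_thin_Wl[OF l(3), of z "%s. f (LF # s)"] sr[OF l(3)] by auto
 next
  case 3
  then show ?thesis using l Suc.prems Suc.IH[OF l(3), of q "%s. f (LT # s)"] by auto
 qed
qed

lemma spl_thin_Wl:
 "size_step (Spl i m n) l l' ==> thin l ==> thin l' & spl i m n f (Wl l) = f (Wl l')"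
proof (induction i arbitrary: l l' f)
 case 0
 then obtain a r where l: "l = a # r" by (cases l) auto
 have "m + n <= 1" using 0 l by simp
 then consider "m = 0" "n = 0" | "m = 1" "n = 0" | "m = 0" "n = 1" by (cases m; cases n) auto
 then show ?case using 0 l by cases auto
next
 case (Suc i)
 then obtain k r r' where l: "l = k # r" "l' = k # r'" "size_step (Spl i m n) r r'" by (cases l; cases l') auto
 then show ?case using Suc.IH[OF l(3), of "%s. f (_ # s)"] Suc.prems by (auto simp: le1)
qed

lemma spl_Vl:
 "size_step (Spl i m n) l l' ==> thin l ==> p < sum_list l ==>
  thin l' & sum_list l' = sum_list l & spl i m n f (Vl l p) = f (Vl l' p)"
proof (induction i arbitrary: l l' f p)
 case 0
 then obtain a r where l: "l = a # r" by (cases l) auto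
 have "m + n <= 1" using 0 l by simp
 then consider "m = 0" "n = 0" | "m = 1" "n = 0" | "m = 0" "n = 1" by (cases m; cases n) auto
 then show ?case using 0 l by cases (cases p; auto)+
next
 case (Suc i)
 then obtain k r r' where l: "l = k # r" "l' = k # r'" "size_step (Spl i m n) r r'" by (cases l; cases l') auto
 have sr: "sum_list r' = sum_list r" if "size_step (Spl i m n) r r'" for r r' i
  using that
 proof (induction i arbitrary: r r')
  case 0 then show ?case by (cases r) auto
 next
  case (Suc i) then show ?case by (cases r; cases r') auto
 qed
 consider "k = 0" | "k = 1" "p = 0" | q where "k = 1" "p = Suc q" using Suc.prems l by (cases p) (auto simp: le1)
 then show ?case
 proof cases
  case 1
  then show ?thesis using l Suc.prems Suc.IH[OF l(3), of p "%s. f (LO # s)"] by auto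
 next
  case 2
  then show ?thesis using l Suc.prems spl_thin_Wl[OF l(3), of "%s. f (LF # s)"] sr[OF l(3)] by auto
 next
  case 3
  then show ?thesis using l Suc.prems Suc.IH[OF l(3), of q "%s. f (LT # s)"] by auto
 qed
qed

text \<open>Splitting the edge of size 2 into 1 + 1 releases the walker into two adjacent positions
  with equal weight. This is why the invariant below speaks of sums over adjacent positions.\<close>

lemma spl_Wl:
 "size_step (Spl i m n) l l' ==> one_thick l ==>
 one_thick l' & thick_pos l' = thick_pos l & spl i m n f (Wl l) = f (Wl l') \<or>
 thin l' & Suc (thick_pos l) < sum_list l' &
  spl i m n f (Wl l) = f (Vl l' (thick_pos l)) + f (Vl l' (Suc (thick_pos l)))"
proof (induction i arbitrary: l l' f)
 case 0
 then obtain a r where l: "l = a # r" by (cases l) auto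
 have mn: "m + n <= 2" using 0 l by (auto split: if_splits)
 consider "m = 0" "n = 0" | "m = 1" "n = 0" | "m = 0" "n = 1" | "m = 1" "n = 1" | "m = 2" "n = 0" | "m = 0" "n = 2"
  using mn by (cases m; cases n; cases "m - 1"; cases "n - 1") auto
 then show ?case using 0 l by cases auto
next
 case (Suc i)
 then obtain k r r' where l: "l = k # r" "l' = k # r'" "size_step (Spl i m n) r r'" by (cases l; cases l') auto
 show ?case
 proof (cases "k = 2")
  case True
  then show ?thesis using l Suc.prems spl_thin_Wl[OF l(3), of "%s. f (LB # s)"] by auto
 next
  case False
  then have "k = 0 \<or> k = 1" "one_thick r" using Suc.prems l by auto
  then show ?thesis using l Suc.IH[OF l(3), of "%s. f (_ # s)"] by auto
 qed
qed

text \<open>A walker \<open>LF\<close> crossing the thin strands \<open>LT\<close> picks up a power of \<open>z\<close> given by its position,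
  up to a factor that is invariant under \<open>z \<leftrightarrow> 1/z\<close>.\<close>

definition walk_rel :: "'a::field => 'a => nat list => (letter list => 'a) => (letter list => 'a) => bool" where
 "walk_rel z c l f f' \<longleftrightarrow>
  (one_thick l --> c * f (Wl l) = z ^ (2 * thick_pos l) * f' (Wl l)) &
  (thin l --> (ALL p. Suc p < sum_list l -->
    c * (f (Vl l p) + f (Vl l (Suc p))) = z ^ (2 * p) * (f' (Vl l p) + f' (Vl l (Suc p)))))"

text \<open>Let t be the position of a merge and p, p + 1 the pair considered. For t = p the factor
  1/z + z is invariant. For t = p - 1 or t = p + 1 only one summand survives, with factor z or 1/z,
  and the asymmetry is absorbed by the passage from z^(2t) to z^(2p). Otherwise both sides
  vanish.\<close>

lemma walk_rel_step:
 assumes z: "z ~= 0" and st: "size_step s l l'" and R: "walk_rel z c l' f f'"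
 shows "walk_rel z c l (app_step z s f) (app_step (inverse z) s f')"
proof (cases s)
 case (Mrg i)
 note st' = st[unfolded Mrg]
 show ?thesis unfolding walk_rel_def Mrg app_step.simps
 proof (intro conjI impI allI)
  assume "one_thick l"
  then show "c * mrg z i f (Wl l) = z ^ (2 * thick_pos l) * mrg (inverse z) i f' (Wl l)"
   using mrg_Wl[OF st', of z f] mrg_Wl[OF st', of "inverse z" f'] R by (auto simp: walk_rel_def)
 next
  fix p assume th: "thin l" and p: "Suc p < sum_list l"
  note a = mrg_Vl[OF st' th, of _ z f] mrg_Vl[OF st' th, of _ "inverse z" f']
  show "c * (mrg z i f (Vl l p) + mrg z i f (Vl l (Suc p)))
   = z ^ (2 * p) * (mrg (inverse z) i f' (Vl l p) + mrg (inverse z) i f' (Vl l (Suc p)))"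
  proof (cases "thin l'")
   case True
   then show ?thesis using a[of p] a[of "Suc p"] p R by (auto simp: walk_rel_def)
  next
   case False
   then have o: "one_thick l'" using a(1)[of p] p by auto
   then have r: "c * f (Wl l') = z ^ (2 * thick_pos l') * f' (Wl l')" using R by (auto simp: walk_rel_def)
   define x x' where "x = f (Wl l')" and "x' = f' (Wl l')"
   note r = r[folded x_def x'_def]
   consider "p = thick_pos l'" | "p = Suc (thick_pos l')" | "Suc p = thick_pos l'"
    | "p ~= thick_pos l'" "p ~= Suc (thick_pos l')" "Suc p ~= thick_pos l'" by blast
   then show ?thesis
   proof cases
    case 1
    have "c * (inverse z * x + z * x) = (inverse z + z) * (c * x)" by (simp add: algebra_simps)
    also have "... = z ^ (2 * p) * (z * x' + inverse z * x')" unfolding r 1 by (simp add: algebra_simps)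
    finally show ?thesis using 1 a[of p] a[of "Suc p"] p False by (simp add: x_def x'_def)
   next
    case 2
    have "c * (z * x) = z * (c * x)" by simp
    also have "... = z ^ (2 * p) * (inverse z * x')" unfolding r 2 using z by (simp add: field_simps)
    finally show ?thesis using 2 a[of p] a[of "Suc p"] p False by (simp add: x_def x'_def)
   next
    case 3
    have "c * (inverse z * x) = inverse z * (c * x)" by simp
    also have "... = z ^ (2 * p) * (z * x')" unfolding r 3[symmetric] using z by (simp add: field_simps)
    finally show ?thesis using 3[symmetric] a[of p] a[of "Suc p"] p False by (simp add: x_def x'_def)
   next
    case 4
    then show ?thesis using a[of p] a[of "Suc p"] p False by simp
   qed
  qed
 qed
next
 case (Spl i m n)
 note st' = st[unfolded Spl]
 show ?thesis unfolding walk_rel_def Spl app_step.simps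
 proof (intro conjI impI allI)
  assume "one_thick l"
  then show "c * spl i m n f (Wl l) = z ^ (2 * thick_pos l) * spl i m n f' (Wl l)"
   using spl_Wl[OF st', of f] spl_Wl[OF st', of f'] R one_thick_not_thin[of l'] by (auto simp: walk_rel_def)
 next
  fix p assume th: "thin l" and p: "Suc p < sum_list l"
  show "c * (spl i m n f (Vl l p) + spl i m n f (Vl l (Suc p)))
   = z ^ (2 * p) * (spl i m n f' (Vl l p) + spl i m n f' (Vl l (Suc p)))"
   using spl_Vl[OF st' th, of p f] spl_Vl[OF st' th, of "Suc p" f] spl_Vl[OF st' th, of p f']
    spl_Vl[OF st' th, of "Suc p" f'] p R by (auto simp: walk_rel_def)
 qed
qed

lemma walk_rel_steps:
 assumes z: "z ~= 0"
 shows "size_steps ss l l' ==> walk_rel z c l' f f' ==>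
  walk_rel z c l (app_steps z ss f) (app_steps (inverse z) ss f')"
proof (induction ss arbitrary: l)
 case (Cons s ss)
 then show ?case using walk_rel_step[OF z] by fastforce
qed simp

lemma Vl_inj: "thin l ==> p < sum_list l ==> p' < sum_list l ==> Vl l p = Vl l p' ==> p = p'"
proof (induction l arbitrary: p p')
 case (Cons k l)
 consider "k = 0" | "k = 1" using Cons.prems by (auto simp: le1)
 then show ?case using Cons by cases (auto split: nat.splits)
qed simp

lemma walk_thick:
 assumes z: "z ~= 0" and ss: "size_steps ss l l" and l: "one_thick l"
 shows "app_steps z ss (dlt (Wl l)) (Wl l) = app_steps (inverse z) ss (dlt (Wl l)) (Wl l)"
proof -
 have "walk_rel z (z ^ (2 * thick_pos l)) l (dlt (Wl l)) (dlt (Wl l))"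
  using one_thick_not_thin[OF l] by (auto simp: walk_rel_def)
 from walk_rel_steps[OF z ss this] show ?thesis using l z by (auto simp: walk_rel_def)
qed

text \<open>For the steps of a full sweep this says that the total flow is itself in
  \<open>loops\<close>; see \<open>thin_path_evolve\<close> and
  \<open>flow_in_loops_iff\<close>.\<close>

fun thin_path :: "lstep list => nat list => bool" where
 "thin_path [] l = thin l"
| "thin_path (s # ss) l = (thin l & (ALL l1. size_step s l l1 --> thin_path ss l1))"

lemma size_step_det: "size_step s l l1 ==> size_step s l l2 ==> l1 = l2"
proof -
 have M: "size_step (Mrg i) l l1 ==> size_step (Mrg i) l l2 ==> l1 = l2" for i
 proof (induction i arbitrary: l l1 l2)
  case 0 then show ?case by (cases l; cases "tl l") auto
 next
  case (Suc i) then show ?case by (cases l; cases l1; cases l2) auto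
 qed
 have S: "size_step (Spl i m n) l l1 ==> size_step (Spl i m n) l l2 ==> l1 = l2" for i m n
 proof (induction i arbitrary: l l1 l2)
  case 0 then show ?case by (cases l) auto
 next
  case (Suc i) then show ?case by (cases l; cases l1; cases l2) auto
 qed
 show "size_step s l l1 ==> size_step s l l2 ==> l1 = l2" using M S by (cases s) auto
qed

text \<open>The walker starts on the last strand. At the first merge of two occupied edges it is
  either absent, giving 0, or enters from the right with factor z; then the relation for thick words
  takes over. The constant z^(2(m-1)) belongs to the last adjacent pair, the only one that contains
  position m.\<close>

lemma walk_thin:
 assumes z: "(z::'a::field) ~= 0" and l: "thin l" and m: "Suc m = sum_list l"
 shows "size_steps ss l1 l ==> thin l1 ==> sum_list l1 = sum_list l ==>
  (thin_path ss l1 --> app_steps z ss (dlt (Vl l m)) (Vl l1 m) = 1) &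
  (\<not> thin_path ss l1 --> inverse z * app_steps z ss (dlt (Vl l m)) (Vl l1 m)
   = z * app_steps (inverse z) ss (dlt (Vl l m)) (Vl l1 m))"
proof (induction ss arbitrary: l1)
 case Nil
 then show ?case by (simp add: dlt_def)
next
 case (Cons s ss)
 then obtain l2 where l2: "size_step s l1 l2" "size_steps ss l2 l" by auto
 have tp: "thin_path (s # ss) l1 \<longleftrightarrow> thin_path ss l2"
  using Cons.prems l2 size_step_det by auto
 have mlt: "m < sum_list l1" using Cons.prems m by simp
 show ?case
 proof (cases s)
  case (Spl i k n)
  have a: "thin l2" "sum_list l2 = sum_list l1" "!!f :: letter list => 'a. spl i k n f (Vl l1 m) = f (Vl l2 m)"
   using spl_Vl[OF l2(1)[unfolded Spl] Cons.prems(2) mlt] by blast+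
  then show ?thesis using Cons.IH[OF l2(2)] Cons.prems(3) unfolding tp by (simp add: Spl)
 next
  case (Mrg i)
  note a = mrg_Vl[OF l2(1)[unfolded Mrg] Cons.prems(2) mlt, of z undefined]
  show ?thesis
  proof (cases "thin l2")
   case True
   then have "!!(z::'a) f. mrg z i f (Vl l1 m) = f (Vl l2 m)"
    using mrg_Vl[OF l2(1)[unfolded Mrg] Cons.prems(2) mlt] by blast
   then show ?thesis using True a Cons.IH[OF l2(2)] Cons.prems(3) unfolding tp by (simp add: Mrg)
  next
   case False
   then have ntp: "\<not> thin_path ss l2" by (cases ss) auto
   have o: "one_thick l2" and s2: "sum_list l2 = sum_list l" using a False Cons.prems by auto
   \<comment> \<open>The thick edge and everything right of it carry at least two units, so a walker
     in the last position cannot be its left half.\<close>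
   have "thick_pos l2 + 2 <= sum_list l2" using o
    by (induction l2) (auto split: if_splits)
   then have pl: "Suc (thick_pos l2) <= m" using s2 m by simp
   have base: "walk_rel z (z ^ (2 * (m - 1))) l (dlt (Vl l m)) (dlt (Vl l m))"
    unfolding walk_rel_def
   proof (intro conjI impI allI)
    assume "one_thick l" then show "z ^ (2 * (m - 1)) * dlt (Vl l m) (Wl l) = z ^ (2 * thick_pos l) * dlt (Vl l m) (Wl l)"
     using l one_thick_not_thin by auto
   next
    fix p assume p: "Suc p < sum_list l"
    have "Vl l p = Vl l m \<longleftrightarrow> p = m" "Vl l (Suc p) = Vl l m \<longleftrightarrow> Suc p = m"
     using Vl_inj[OF l, of p m] Vl_inj[OF l, of "Suc p" m] p m by auto
    then show "z ^ (2 * (m - 1)) * (dlt (Vl l m) (Vl l p) + dlt (Vl l m) (Vl l (Suc p)))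
     = z ^ (2 * p) * (dlt (Vl l m) (Vl l p) + dlt (Vl l m) (Vl l (Suc p)))"
     using p m by (auto simp: dlt_def)
   qed
   from walk_rel_steps[OF z l2(2) this] o
   have r: "z ^ (2 * (m - 1)) * app_steps z ss (dlt (Vl l m)) (Wl l2)
    = z ^ (2 * thick_pos l2) * app_steps (inverse z) ss (dlt (Vl l m)) (Wl l2)"
    by (auto simp: walk_rel_def)
   show ?thesis
   proof (cases "m = Suc (thick_pos l2)")
    case True
    then have "app_steps z ss (dlt (Vl l m)) (Wl l2) = app_steps (inverse z) ss (dlt (Vl l m)) (Wl l2)"
     using r z by simp
    moreover have "app_step z s (app_steps z ss (dlt (Vl l m))) (Vl l1 m) = z * app_steps z ss (dlt (Vl l m)) (Wl l2)"
     "app_step (inverse z) s (app_steps (inverse z) ss (dlt (Vl l m))) (Vl l1 m) = inverse z * app_steps (inverse z) ss (dlt (Vl l m)) (Wl l2)"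
     using mrg_Vl[OF l2(1)[unfolded Mrg] Cons.prems(2) mlt, of z "app_steps z ss (dlt (Vl l m))"]
      mrg_Vl[OF l2(1)[unfolded Mrg] Cons.prems(2) mlt, of "inverse z" "app_steps (inverse z) ss (dlt (Vl l m))"]
      False True by (simp_all add: Mrg)
    ultimately show ?thesis unfolding tp using ntp z by simp
   next
    case nm: False
    have "app_step z s (app_steps z ss (dlt (Vl l m))) (Vl l1 m) = 0"
     "app_step (inverse z) s (app_steps (inverse z) ss (dlt (Vl l m))) (Vl l1 m) = 0"
     using mrg_Vl[OF l2(1)[unfolded Mrg] Cons.prems(2) mlt, of z "app_steps z ss (dlt (Vl l m))"]
      mrg_Vl[OF l2(1)[unfolded Mrg] Cons.prems(2) mlt, of "inverse z" "app_steps (inverse z) ss (dlt (Vl l m))"]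
      False nm pl by (simp_all add: Mrg)
    then show ?thesis unfolding tp using ntp by simp
   qed
  qed
 qed
qed

section \<open>Symmetric functions and principal specialisation\<close>

abbreviation lkp :: "('a \<Rightarrow>\<^sub>0 'b::zero) => 'a => 'b" where "lkp \<equiv> Poly_Mapping.lookup"
abbreviation sngl :: "'a => 'b::zero => ('a \<Rightarrow>\<^sub>0 'b)" where "sngl \<equiv> Poly_Mapping.single"
abbreviation kys :: "('a \<Rightarrow>\<^sub>0 'b::zero) => 'a set" where "kys \<equiv> Poly_Mapping.keys"

section \<open>Exponent vectors, permutations of variables, closure properties\<close>

lemma finite_bounded_pm:
 fixes A :: "nat set"
 assumes "finite A"
 shows "finite {m :: nat \<Rightarrow>\<^sub>0 nat. kys m <= A & (ALL i. lkp m i <= b)}"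
proof (rule finite_imageD)
 have "lkp ` {m :: nat \<Rightarrow>\<^sub>0 nat. kys m <= A & (ALL i. lkp m i <= b)} <=
   {f. ALL x. (x \<in> A --> f x \<in> {..b}) & (x ~: A --> f x = 0)}"
  by (auto simp: in_keys_iff subset_iff)
 then show "finite (lkp ` {m :: nat \<Rightarrow>\<^sub>0 nat. kys m <= A & (ALL i. lkp m i <= b)})"
  by (rule finite_subset) (intro finite_set_of_finite_funs assms finite_atMost)
qed (auto intro!: inj_onI poly_mapping_eqI)

lemma total_degree_superset:
 "finite A ==> kys m <= A ==> total_degree m = (\<Sum>i\<in>A. lkp m i)"
 unfolding total_degree_def by (rule sum.mono_neutral_left) (auto simp: in_keys_iff)

lemma kys_plus: "kys (k + l) = kys k Un kys (l :: nat \<Rightarrow>\<^sub>0 nat)"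
 by (auto simp: in_keys_iff lookup_add)

lemma total_degree_plus: "total_degree (k + l) = total_degree k + total_degree l"
proof -
 have "finite (kys k Un kys l)" by simp
 then show ?thesis
  using total_degree_superset[of "kys k Un kys l"] by (simp add: kys_plus lookup_add sum.distrib)
qed

lemma lookup_le_total_degree: "lkp m i <= total_degree m"
proof (cases "i \<in> kys m")
 case True
 then show ?thesis unfolding total_degree_def by (intro member_le_sum) auto
qed (auto simp: in_keys_iff)

lemma finite_splits: "finite {(k, l). k + l = (m :: nat \<Rightarrow>\<^sub>0 nat)}"
proof -
 let ?B = "{k :: nat \<Rightarrow>\<^sub>0 nat. kys k <= kys m & (ALL i. lkp k i <= total_degree m)}"
 have "{(k, l). k + l = m} <= ?B \<times> ?B"
 proof
  fix x assume "x \<in> {(k, l). k + l = m}"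
  then obtain k l where x: "x = (k, l)" "m = k + l" by auto
  have "lkp k i <= total_degree (k + l)" "lkp l i <= total_degree (k + l)" for i
   using lookup_le_total_degree[of "k + l" i] by (auto simp: lookup_add)
  then show "x \<in> ?B \<times> ?B" using x by (auto simp: kys_plus)
 qed
 then show ?thesis by (rule finite_subset) (intro finite_cartesian_product finite_bounded_pm finite_keys)
qed

lemma lookup_map_key: "inj pm ==> lkp (Poly_Mapping.map_key pm m) i = lkp m (pm i)"
 by (simp add: Poly_Mapping.map_key.rep_eq)

lemma map_key_inverse:
 assumes "bij (pm :: nat => nat)"
 shows "Poly_Mapping.map_key (inv pm) (Poly_Mapping.map_key pm m) = (m :: nat \<Rightarrow>\<^sub>0 nat)"
  "Poly_Mapping.map_key pm (Poly_Mapping.map_key (inv pm) m) = m"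
 using assms by (auto intro!: poly_mapping_eqI
  simp: lookup_map_key bij_is_inj bij_imp_bij_inv bij_is_surj surj_f_inv_f)

lemma series_mult_symmetric:
 fixes pm :: "nat => nat"
 assumes "!!(pm :: nat => nat) m. bij pm ==> f (Poly_Mapping.map_key pm m) = f m"
  and "!!(pm :: nat => nat) m. bij pm ==> g (Poly_Mapping.map_key pm m) = g m" and "bij pm"
 shows "series_mult f g (Poly_Mapping.map_key pm m) = series_mult f g m"
 unfolding series_mult_def
proof (rule sum.reindex_bij_witness[of _ "map_prod (Poly_Mapping.map_key pm) (Poly_Mapping.map_key pm)"
   "map_prod (Poly_Mapping.map_key (inv pm)) (Poly_Mapping.map_key (inv pm))"])
 have inj: "inj pm" "inj (inv pm)" using assms(3) by (auto simp: bij_is_inj bij_imp_bij_inv)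
 show "!!b. b \<in> {(k, l). k + l = m} ==>
    map_prod (Poly_Mapping.map_key pm) (Poly_Mapping.map_key pm) b \<in> {(k, l). k + l = Poly_Mapping.map_key pm m}"
  using inj by (auto simp: map_key_plus[symmetric])
 show "!!a. a \<in> {(k, l). k + l = Poly_Mapping.map_key pm m} ==>
    map_prod (Poly_Mapping.map_key (inv pm)) (Poly_Mapping.map_key (inv pm)) a \<in> {(k, l). k + l = m}"
  using inj by (auto simp: map_key_plus[symmetric] map_key_inverse[OF assms(3)])
qed (use assms in \<open>auto simp: map_key_inverse bij_imp_bij_inv\<close>)

lemma sym_bounded: "f \<in> symmetric_functions ==> EX d. ALL m. f m ~= 0 --> total_degree m <= d"
 and sym_invariant: "f \<in> symmetric_functions ==> bij pm ==> f (Poly_Mapping.map_key pm m) = f m"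
 by (auto simp: symmetric_functions_def)

lemma symmetric_one: "series_one \<in> symmetric_functions"
proof -
 have "Poly_Mapping.map_key pm m = 0 \<longleftrightarrow> m = 0" if b: "bij pm" for pm :: "nat => nat" and m :: "nat \<Rightarrow>\<^sub>0 nat"
 proof
  assume "Poly_Mapping.map_key pm m = 0"
  then have "Poly_Mapping.map_key (inv pm) (Poly_Mapping.map_key pm m) = Poly_Mapping.map_key (inv pm) 0" by simp
  then show "m = 0" unfolding map_key_inverse(1)[OF b] map_key_zero[OF bij_is_inj[OF bij_imp_bij_inv[OF b]]] .
 qed (simp add: map_key_zero[OF bij_is_inj[OF b]])
 then show ?thesis by (auto simp: symmetric_functions_def series_one_def total_degree_def)
qed

lemma symmetric_add:
 assumes "f \<in> symmetric_functions" "g \<in> symmetric_functions"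
 shows "series_add f g \<in> symmetric_functions"
proof -
 from assms obtain d1 d2 where d: "ALL m. f m ~= 0 --> total_degree m <= d1" "ALL m. g m ~= 0 --> total_degree m <= d2"
  using sym_bounded[OF assms(1)] sym_bounded[OF assms(2)] by metis
 have "total_degree m <= max d1 d2" if "series_add f g m ~= 0" for m
  using d(1)[rule_format, of m] d(2)[rule_format, of m] that
  by (cases "f m = 0") (simp_all add: series_add_def le_max_iff_disj)
 then show ?thesis using sym_invariant[OF assms(1)] sym_invariant[OF assms(2)]
  unfolding symmetric_functions_def by (auto simp: series_add_def)
qed

lemma symmetric_scale: "f \<in> symmetric_functions ==> series_scale c f \<in> symmetric_functions"
 by (auto simp: symmetric_functions_def series_scale_def)

lemma symmetric_mult:
 assumes "f \<in> symmetric_functions" "g \<in> symmetric_functions"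
 shows "series_mult f g \<in> symmetric_functions"
proof -
 from assms obtain d1 d2 where d: "ALL m. f m ~= 0 --> total_degree m <= d1" "ALL m. g m ~= 0 --> total_degree m <= d2"
  using sym_bounded[OF assms(1)] sym_bounded[OF assms(2)] by metis
 have A: "total_degree m <= d1 + d2" if nz: "series_mult f g m ~= 0" for m
 proof -
  obtain k l where kl: "k + l = m" "f k * g l ~= 0"
  proof (rule ccontr)
   assume "\<not> thesis"
   then have "series_mult f g m = 0" unfolding series_mult_def using that by (intro sum.neutral) auto
   then show False using nz by simp
  qed
  then have "total_degree k <= d1" "total_degree l <= d2" using d by auto
  then show ?thesis using kl(1) total_degree_plus[of k l] by simp
 qed
 have B: "series_mult f g (Poly_Mapping.map_key pm m) = series_mult f g m" if "bij pm" for pm m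
  by (rule series_mult_symmetric[OF sym_invariant[OF assms(1)] sym_invariant[OF assms(2)] that])
 show ?thesis unfolding symmetric_functions_def using A B by blast
qed

lemma map_key_eq_single:
 assumes "bij (pm :: nat => nat)"
 shows "(EX i. Poly_Mapping.map_key pm m = sngl i k) \<longleftrightarrow> (EX i. m = sngl i (k::nat))"
proof -
 have 1: "Poly_Mapping.map_key pm (sngl (pm i) k) = sngl i k" if "bij pm" for pm :: "nat => nat" and i
  using map_key_single[OF bij_is_inj[OF that]] .
 have "Poly_Mapping.map_key pm m = sngl i k ==> m = sngl (pm i) k" for i
  using 1[OF bij_imp_bij_inv[OF assms], of "pm i"] map_key_inverse(1)[OF assms, of m] assms
  by (simp add: bij_is_inj)
 moreover have "m = sngl i k ==> Poly_Mapping.map_key pm m = sngl (inv pm i) k" for i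
  using 1[OF assms, of "inv pm i"] assms by (simp add: bij_is_surj surj_f_inv_f)
 ultimately show ?thesis by blast
qed

lemma symmetric_power_sum: "power_sum k \<in> symmetric_functions"
proof -
 have "total_degree (sngl i k) <= k" for i by (simp add: total_degree_def)
 then have A: "power_sum k m ~= 0 ==> total_degree m <= k" for m
  by (auto simp: power_sum_def split: if_splits)
 have B: "power_sum k (Poly_Mapping.map_key pm m) = power_sum k m" if "bij pm" for pm m
  unfolding power_sum_def map_key_eq_single[OF that] ..
 show ?thesis unfolding symmetric_functions_def using A B by blast
qed

section \<open>Power sums generate all symmetric functions\<close>

inductive_set power_sum_algebra :: "series set" where
 one: "series_one \<in> power_sum_algebra"
| ps: "k >= 1 ==> power_sum k \<in> power_sum_algebra"
| add: "f \<in> power_sum_algebra ==> g \<in> power_sum_algebra ==> series_add f g \<in> power_sum_algebra"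
| mult: "f \<in> power_sum_algebra ==> g \<in> power_sum_algebra ==> series_mult f g \<in> power_sum_algebra"
| scale: "f \<in> power_sum_algebra ==> series_scale c f \<in> power_sum_algebra"

lemma power_sum_algebra_symmetric: "f \<in> power_sum_algebra ==> f \<in> symmetric_functions"
 by (induction rule: power_sum_algebra.induct)
  (auto intro: symmetric_one symmetric_power_sum symmetric_add symmetric_mult symmetric_scale)

fun pprod :: "nat list => series" where
 "pprod [] = series_one" | "pprod (k # ks) = series_mult (power_sum k) (pprod ks)"

text \<open>The coefficient of the monomial \<open>m\<close> in the product of power sums, kept as a
  natural number so that its nonvanishing carries over to the coefficient field of characteristic
  0.\<close>

fun pcount :: "nat list => (nat \<Rightarrow>\<^sub>0 nat) => nat" where
 "pcount [] m = (if m = 0 then 1 else 0)"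
| "pcount (k # ks) m = (\<Sum>i | i \<in> kys m & k <= lkp m i. pcount ks (m - sngl i k))"

lemma series_mult_power_sum:
 assumes "k >= 1"
 shows "series_mult (power_sum k) f m = (\<Sum>i | i \<in> kys m & k <= lkp m i. f (m - sngl i k))"
proof -
 let ?A = "(%i. (sngl i k, m - sngl i k)) ` {i. i \<in> kys m & k <= lkp m i}"
 have sub: "?A <= {(a, b). a + b = m}"
  by (auto intro!: poly_mapping_eqI simp: lookup_add lookup_minus lookup_single when_def)
 have "(\<Sum>(a, b) | a + b = m. power_sum k a * f b) = (\<Sum>(a, b)\<in>?A. power_sum k a * f b)"
 proof (rule sum.mono_neutral_right[OF finite_splits sub], clarify)
  fix a b :: "nat \<Rightarrow>\<^sub>0 nat" assume nA: "(a, b) ~: (%i. (sngl i k, a + b - sngl i k)) ` {i. i \<in> kys (a + b) & k <= lkp (a + b) i}"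
  show "power_sum k a * f b = 0"
  proof (rule ccontr)
   assume "power_sum k a * f b ~= 0"
   then obtain i where "a = sngl i k" by (auto simp: power_sum_def split: if_splits)
   then have "(a, b) \<in> (%i. (sngl i k, a + b - sngl i k)) ` {i. i \<in> kys (a + b) & k <= lkp (a + b) i}"
    using assms by (intro image_eqI[of _ _ i]) (auto simp: kys_plus lookup_add)
   then show False using nA by contradiction
  qed
 qed
 also have "... = (\<Sum>i | i \<in> kys m & k <= lkp m i. power_sum k (sngl i k) * f (m - sngl i k))"
 proof (subst sum.reindex)
  show "inj_on (%i. (sngl i k, m - sngl i k)) {i. i \<in> kys m & k <= lkp m i}"
   using assms by (auto intro!: inj_onI dest!: arg_cong[where f = kys] split: if_splits)
 qed simp
 also have "... = (\<Sum>i | i \<in> kys m & k <= lkp m i. f (m - sngl i k))"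
  by (rule sum.cong) (auto simp: power_sum_def)
 finally show ?thesis unfolding series_mult_def .
qed

lemma pprod_count: "(\<forall>k\<in>set ks. k >= 1) ==> pprod ks m = of_nat (pcount ks m)"
 by (induction ks arbitrary: m) (auto simp: series_one_def series_mult_power_sum)

lemma pprod_in_algebra: "(\<forall>k\<in>set ks. k >= 1) ==> pprod ks \<in> power_sum_algebra"
 by (induction ks) (auto intro!: power_sum_algebra.one power_sum_algebra.mult power_sum_algebra.ps)

text \<open>The partition formed by the nonzero exponents: it determines the orbit of the monomial
  under permutations of the variables.\<close>

definition vals :: "(nat \<Rightarrow>\<^sub>0 nat) => nat multiset" where
 "vals m = image_mset (lkp m) (mset_set (kys m))"

lemma minus_single:
 assumes "i \<in> kys m" "k <= lkp m i" "k >= 1"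
 shows "kys (m - sngl i k) = (if lkp m i = k then kys m - {i} else kys m)"
  "lkp m i = k ==> vals m = add_mset k (vals (m - sngl i k))"
  "total_degree m = k + total_degree (m - sngl i k)"
proof -
 show K: "kys (m - sngl i k) = (if lkp m i = k then kys m - {i} else kys m)"
  using assms by (auto simp: in_keys_iff lookup_minus lookup_single when_def split: if_splits)
 show "vals m = add_mset k (vals (m - sngl i k))" if "lkp m i = k"
 proof -
  have "mset_set (kys m) = add_mset i (mset_set (kys m - {i}))"
   using assms(1) by (metis finite_keys mset_set.remove)
  moreover have "image_mset (lkp m) (mset_set (kys m - {i})) = image_mset (lkp (m - sngl i k)) (mset_set (kys m - {i}))"
   by (rule image_mset_cong) (auto simp: lookup_minus lookup_single when_def)
  ultimately show ?thesis using that K by (simp add: vals_def)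
 qed
 have "m = sngl i k + (m - sngl i k)"
  using assms by (auto intro!: poly_mapping_eqI simp: lookup_add lookup_minus lookup_single when_def)
 then show "total_degree m = k + total_degree (m - sngl i k)"
  using total_degree_plus[of "sngl i k" "m - sngl i k"] by (simp add: total_degree_def[of "sngl i k"])
qed

text \<open>Triangularity: each factor contributes a power of one variable, so r power sums involve
  at most r variables, and if all r variables are different the exponents are exactly the given
  parts.\<close>

lemma pcount_nonzero:
 "(\<forall>k\<in>set ks. k >= 1) ==> pcount ks m ~= 0 ==>
 card (kys m) <= length ks & (card (kys m) = length ks --> vals m = mset ks) & total_degree m = sum_list ks"
proof (induction ks arbitrary: m)
 case Nil
 then show ?case by (auto simp: vals_def total_degree_def split: if_splits)
next
 case (Cons k ks)
 then obtain i where i: "i \<in> kys m" "k <= lkp m i" "pcount ks (m - sngl i k) ~= 0"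
 proof -
  have "\<exists>i\<in>{i. i \<in> kys m & k <= lkp m i}. pcount ks (m - sngl i k) ~= 0"
   using Cons.prems(2) by (rule contrapos_np) simp
  then show ?thesis using that by blast
 qed
 have IH: "card (kys (m - sngl i k)) <= length ks"
  "card (kys (m - sngl i k)) = length ks ==> vals (m - sngl i k) = mset ks"
  "total_degree (m - sngl i k) = sum_list ks"
  using Cons.IH[OF _ i(3)] Cons.prems by auto
 have k: "k >= 1" using Cons.prems by simp
 note ms1 = minus_single(1)[OF i(1,2) k] and ms2 = minus_single(2)[OF i(1,2) k]
  and ms3 = minus_single(3)[OF i(1,2) k]
 have "card (kys m) > 0" using i(1) by (auto simp: card_gt_0_iff)
 show ?case
 proof (cases "lkp m i = k")
  case True
  then have "card (kys (m - sngl i k)) = card (kys m) - 1" using ms1 i(1) by simp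
  then show ?thesis using IH ms2[OF True] ms3 \<open>card (kys m) > 0\<close> by auto
 next
  case False
  then show ?thesis using IH(1,3) ms1 ms3 by simp
 qed
qed

lemma pcount_vals:
 "(\<forall>k\<in>set ks. k >= 1) ==> vals m = mset ks ==> pcount ks m ~= 0"
proof (induction ks arbitrary: m)
 case Nil
 then have "kys m = {}" by (simp add: vals_def mset_set_empty_iff)
 then show ?case by simp
next
 case (Cons k ks)
 then have "k \<in># vals m" by simp
 then obtain i where i: "i \<in> kys m" "lkp m i = k" by (auto simp: vals_def)
 have "vals m = add_mset k (vals (m - sngl i k))" using minus_single(2)[OF i(1)] i Cons.prems by auto
 then have nz: "pcount ks (m - sngl i k) ~= 0" using Cons by simp
 have "pcount ks (m - sngl i k) <= pcount (k # ks) m"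
  unfolding pcount.simps using i by (intro member_le_sum) auto
 then show ?case using nz by linarith
qed

lemma vals_card: "size (vals m) = card (kys m)" and vals_sum: "sum_mset (vals m) = total_degree m"
 by (auto simp: vals_def total_degree_def sum_unfold_sum_mset)

text \<open>Padded by zeros, the exponents on the union of both supports form equal multisets. This
  yields a permutation of finitely many variables that carries one monomial into the other.\<close>

lemma vals_eq_symmetric:
 assumes f: "f \<in> symmetric_functions" and v: "vals m = vals m'"
 shows "f m = f m'"
proof -
 let ?A = "kys m Un kys m'"
 have *: "image_mset (lkp a) (mset_set ?A) = vals a + replicate_mset (card ?A - card (kys a)) 0"
  if a: "kys a <= ?A" for a :: "nat \<Rightarrow>\<^sub>0 nat"
 proof -
  have "mset_set ?A = mset_set (kys a) + mset_set (?A - kys a)"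
   using a by (metis finite_keys finite_Diff finite_UnI mset_set_Union Diff_disjoint Un_Diff_cancel Un_absorb1)
  moreover have "image_mset (lkp a) (mset_set (?A - kys a)) = image_mset (%_. 0) (mset_set (?A - kys a))"
   by (rule image_mset_cong) (auto simp: in_keys_iff)
  moreover have "card (?A - kys a) = card ?A - card (kys a)" using a by (simp add: card_Diff_subset)
  ultimately show ?thesis by (simp add: vals_def image_mset_const_eq)
 qed
 have "card (kys m) = card (kys m')" using v vals_card by metis
 then have "image_mset (lkp m) (mset_set ?A) = image_mset (lkp m') (mset_set ?A)"
  using *[of m] *[of m'] v by simp
 then obtain p where p: "p permutes ?A" "\<forall>x\<in>?A. lkp m x = lkp m' (p x)"
  using image_mset_eq_implies_permutes[of ?A "lkp m" "lkp m'"] by auto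
 have bij: "bij p" using p(1) by (rule permutes_bij)
 have "lkp m x = lkp m' (p x)" for x
 proof (cases "x \<in> ?A")
  case True
  then show ?thesis using p(2) by blast
 next
  case False
  then have "p x = x" using permutes_not_in[OF p(1)] by blast
  then show ?thesis using False by (simp add: in_keys_iff)
 qed
 then have "Poly_Mapping.map_key p m' = m"
  by (intro poly_mapping_eqI) (simp add: lookup_map_key[OF bij_is_inj[OF bij]])
 then show ?thesis using sym_invariant[OF f bij, of m'] by simp
qed

lemma vals_surj:
 assumes "\<forall>k\<in>set ks. k >= 1"
 shows "EX m. vals m = mset ks"
proof -
 define f where "f i = (if i < length ks then ks ! i else 0)" for i
 have fin: "finite {i. f i ~= 0}" by (rule finite_subset[of _ "{..<length ks}"]) (auto simp: f_def)
 have l: "lkp (Abs_poly_mapping f) = f" using fin by (simp add: Abs_poly_mapping_inverse)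
 have k: "kys (Abs_poly_mapping f) = {..<length ks}"
 proof -
  have "f i ~= 0 \<longleftrightarrow> i < length ks" for i
  proof (cases "i < length ks")
   case True
   then have "ks ! i >= 1" using assms nth_mem by blast
   then show ?thesis using True by (simp add: f_def)
  qed (simp add: f_def)
  then have "{i. f i ~= 0} = {..<length ks}" by blast
  then show ?thesis unfolding keys.rep_eq l .
 qed
 have "image_mset f (mset_set {..<length ks}) = image_mset ((!) ks) (mset_set {..<length ks})"
 proof (rule image_mset_cong)
  fix x assume "x \<in># mset_set {..<length ks}"
  then have "x < length ks" by simp
  then show "f x = ks ! x" by (simp only: f_def if_True)
 qed
 also have "... = mset (map ((!) ks) [0..<length ks])"
  by (simp only: mset_map mset_upt lessThan_atLeast0)
 also have "... = mset ks" by (simp only: map_nth)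
 finally have "vals (Abs_poly_mapping f) = mset ks" by (simp only: vals_def l k)
 then show ?thesis by blast
qed

text \<open>Subtracting suitable multiples of products of \<open>K\<close> power sums removes all monomials in
  \<open>K\<close> variables without creating monomials in more variables.\<close>

lemma symmetric_generated_bounded:
 assumes "f \<in> symmetric_functions" "!!m. f m ~= 0 ==> total_degree m <= d" "!!m. f m ~= 0 ==> card (kys m) <= K"
 shows "f \<in> power_sum_algebra"
 using assms
proof (induction K arbitrary: f)
 case 0
 have "f m = series_scale (f 0) series_one m" for m
 proof (cases "m = 0")
  case False
  then have "card (kys m) ~= 0" by simp
  then have "f m = 0" using "0.prems"(3)[of m] by auto
  then show ?thesis using False by (simp add: series_scale_def series_one_def)
 qed (simp add: series_scale_def series_one_def)
 then have "f = series_scale (f 0) series_one" by blast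
 then show ?case using power_sum_algebra.scale[OF power_sum_algebra.one, of "f 0"] by simp
next
 case (Suc K)
 define \<Lambda> where "\<Lambda> = {ks. set ks <= {1..d} & length ks = Suc K & sorted ks & sum_list ks <= d}"
 have fin: "finite \<Lambda>"
  by (rule finite_subset[OF _ finite_lists_length_eq[of "{1..d}" "Suc K"]]) (auto simp: \<Lambda>_def)
 define mm where "mm ks = (SOME m. vals m = mset ks)" for ks
 have mm: "vals (mm ks) = mset ks" if "ks \<in> \<Lambda>" for ks
  unfolding mm_def by (rule someI_ex, rule vals_surj) (use that in \<open>auto simp: \<Lambda>_def\<close>)
 \<comment> \<open>The coefficient that cancels the orbit of type \<open>ks\<close>;
   \<open>pcount_vals\<close> makes the denominator nonzero, and by \<open>pcount_nonzero\<close> no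
   other member of \<Lambda> reaches this orbit.\<close>
 define c where "c ks = - f (mm ks) / pprod ks (mm ks)" for ks
 have part: "A <= \<Lambda> ==> (%m. \<Sum>ks\<in>A. c ks * pprod ks m) \<in> power_sum_algebra" if "finite A" for A
  using that
 proof (induction A)
  case empty
  have "(%m. \<Sum>ks\<in>{}. c ks * pprod ks m) = series_scale 0 series_one" by (simp add: series_scale_def)
  then show ?case using power_sum_algebra.scale[OF power_sum_algebra.one] by simp
 next
  case (insert ks A)
  then have "series_add (series_scale (c ks) (pprod ks)) (%m. \<Sum>ks\<in>A. c ks * pprod ks m) \<in> power_sum_algebra"
   by (intro power_sum_algebra.add power_sum_algebra.scale pprod_in_algebra) (auto simp: \<Lambda>_def)
  moreover have "series_add (series_scale (c ks) (pprod ks)) (%m. \<Sum>ks\<in>A. c ks * pprod ks m)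
    = (%m. \<Sum>ks\<in>insert ks A. c ks * pprod ks m)"
   unfolding series_add_def series_scale_def sum.insert[OF insert.hyps(1,2)] ..
  ultimately show ?case by simp
 qed
 define S where "S = (%m. \<Sum>ks\<in>\<Lambda>. c ks * pprod ks m)"
 have S: "S \<in> power_sum_algebra" using part[OF fin] by (simp add: S_def)
 have nz: "pprod ks m ~= 0 \<longleftrightarrow> pcount ks m ~= 0" if "ks \<in> \<Lambda>" for ks m
 proof -
  have "\<forall>k\<in>set ks. k >= 1" using that by (auto simp: \<Lambda>_def)
  from pprod_count[OF this, of m] show ?thesis by simp
 qed
 define g where "g = series_add f S"
 have "g \<in> power_sum_algebra"
 proof (rule Suc.IH)
  show gs: "g \<in> symmetric_functions" unfolding g_def
   by (rule symmetric_add[OF Suc.prems(1) power_sum_algebra_symmetric[OF S]])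
  have Snz: "\<exists>ks\<in>\<Lambda>. pcount ks m ~= 0" if "S m ~= 0" for m
  proof (rule ccontr)
   assume "\<not> (\<exists>ks\<in>\<Lambda>. pcount ks m ~= 0)"
   then have "S m = 0" unfolding S_def using nz by (intro sum.neutral) auto
   then show False using that by simp
  qed
  have Sn: "total_degree m <= d & card (kys m) <= Suc K" if "S m ~= 0" for m
  proof -
   from Snz[OF that] obtain ks where ks: "ks \<in> \<Lambda>" "pcount ks m ~= 0" by blast
   then have "\<forall>k\<in>set ks. k >= 1" by (auto simp: \<Lambda>_def)
   from pcount_nonzero[OF this ks(2)] ks(1) show ?thesis by (simp add: \<Lambda>_def)
  qed
  show gd: "total_degree m <= d" if "g m ~= 0" for m
   using that Suc.prems(2)[of m] Sn[of m] by (cases "f m = 0") (simp_all add: g_def series_add_def)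
  show "card (kys m) <= K" if gm: "g m ~= 0" for m
  proof (rule ccontr)
   assume "\<not> card (kys m) <= K"
   then have cK: "card (kys m) = Suc K"
    using gm Suc.prems(3)[of m] Sn[of m] by (cases "f m = 0") (simp_all add: g_def series_add_def)
   have td: "total_degree m <= d" using gd gm by simp
   define k0 where "k0 = sorted_list_of_multiset (vals m)"
   have mk: "mset k0 = vals m" by (simp add: k0_def)
   have sk: "set k0 <= {1..d}"
   proof
    fix x assume "x \<in> set k0"
    then have "x \<in># vals m" unfolding k0_def by simp
    then obtain i where "i \<in> kys m" "x = lkp m i" by (auto simp: vals_def)
    then show "x \<in> {1..d}" using lookup_le_total_degree[of m i] td by (auto simp: in_keys_iff)
   qed
   have "k0 \<in> \<Lambda>" unfolding \<Lambda>_def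
   proof (intro CollectI conjI sk)
    show "length k0 = Suc K" using mk cK vals_card[of m] by (metis size_mset)
    show "sum_list k0 <= d" using mk td vals_sum[of m] by (metis sum_mset_sum_list)
   qed (simp add: k0_def)
   then have k1: "\<forall>k\<in>set k0. k >= 1" by (auto simp: \<Lambda>_def)
   have other: "pprod ks m = 0" if "ks \<in> \<Lambda>" "ks ~= k0" for ks
   proof (rule ccontr)
    assume "pprod ks m ~= 0"
    moreover have "\<forall>k\<in>set ks. k >= 1" "length ks = Suc K" "sorted ks" using that(1) by (auto simp: \<Lambda>_def)
    ultimately have "vals m = mset ks" using nz[OF that(1), of m] pcount_nonzero[of ks m] cK by simp
    then have "ks = k0" using \<open>sorted ks\<close> unfolding k0_def by (simp add: sorted_sort_id)
    then show False using that by simp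
   qed
   have "S m = (\<Sum>ks\<in>{k0}. c ks * pprod ks m)" unfolding S_def
    by (rule sum.mono_neutral_right[OF fin]) (use \<open>k0 \<in> \<Lambda>\<close> other in auto)
   also have "... = c k0 * pprod k0 (mm k0)"
    using vals_eq_symmetric[OF power_sum_algebra_symmetric[OF pprod_in_algebra[of k0]], of m "mm k0"]
     mm[OF \<open>k0 \<in> \<Lambda>\<close>] mk k1 by simp
   also have "... = - f (mm k0)"
    using nz[OF \<open>k0 \<in> \<Lambda>\<close>, of "mm k0"] pcount_vals[OF k1 mm[OF \<open>k0 \<in> \<Lambda>\<close>]]
    by (simp add: c_def)
   also have "f (mm k0) = f m" using vals_eq_symmetric[OF Suc.prems(1)] mm[OF \<open>k0 \<in> \<Lambda>\<close>] mk by metis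
   finally show False using gm by (simp add: g_def series_add_def)
  qed
 qed
 then have "series_add g (series_scale (- 1) S) \<in> power_sum_algebra"
  using S by (intro power_sum_algebra.intros)
 moreover have "series_add g (series_scale (- 1) S) = f"
  by (simp add: g_def series_add_def series_scale_def)
 ultimately show ?case by simp
qed

theorem symmetric_generated: "symmetric_functions = power_sum_algebra"
proof (intro equalityI subsetI)
 fix f assume f: "f \<in> symmetric_functions"
 then obtain d where d: "ALL m. f m ~= 0 --> total_degree m <= d" using sym_bounded by blast
 have "card (kys m) <= total_degree m" for m
  unfolding total_degree_def by (rule order_trans[OF _ sum_bounded_below[where K = 1]]) (auto simp: in_keys_iff)
 then show "f \<in> power_sum_algebra" using symmetric_generated_bounded[OF f, of d d] d le_trans by blast
qed (rule power_sum_algebra_symmetric)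

section \<open>The fields of rational functions in q and in a\<close>

lemma q_var_nz: "q_var ~= 0"
 by (simp add: q_var_def)

lemma to_fract_power: "to_fract (p ^ n) = to_fract p ^ n"
 by (induction n) auto

lemma q_var_power_neq_1: "n > 0 ==> q_var ^ n ~= 1"
proof
 assume n: "n > 0" and "q_var ^ n = 1"
 then have "to_fract ([:0, 1:] ^ n :: rat poly) = to_fract 1"
  unfolding q_var_def by (simp add: to_fract_power del: to_fract_eq_iff)
 then have "([:0, 1:] :: rat poly) ^ n = 1" unfolding to_fract_eq_iff .
 then have "degree (([:0, 1:] :: rat poly) ^ n) = 0" by simp
 then show False using n by (simp add: degree_power_eq)
qed

lemma q_var_power_inj: "q_var ^ m = q_var ^ n ==> m = n"
proof (induction m n rule: linorder_wlog)
 case (le a b)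
 show ?case
 proof (rule ccontr)
  assume "a ~= b"
  have "q_var ^ (b - a) * q_var ^ a = q_var ^ b" using le(1) by (simp flip: power_add)
  then have "q_var ^ (b - a) * q_var ^ a = q_var ^ a" using le(2) by simp
  then show False using q_var_power_neq_1[of "b - a"] q_var_nz le \<open>a ~= b\<close> by simp
 qed
qed simp

lemma a_var_nz: "a_var ~= 0"
 by (simp add: a_var_def)

lemma const_aq_simps [simp]: "const_aq 0 = 0" "const_aq 1 = 1"
 "const_aq (x + y) = const_aq x + const_aq y" "const_aq (x * y) = const_aq x * const_aq y"
proof -
 show "const_aq 1 = 1" by (simp only: const_aq_def one_pCons[symmetric] to_fract_1)
qed (simp_all add: const_aq_def flip: to_fract_add to_fract_mult)

lemma const_aq_eq_0_iff [simp]: "const_aq x = 0 \<longleftrightarrow> x = 0"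
 by (simp add: const_aq_def)

lemma const_aq_diff: "const_aq (x - y) = const_aq x - const_aq y"
 by (simp add: const_aq_def flip: to_fract_diff)

lemma const_aq_divide: "const_aq (x / y) = const_aq x / const_aq y"
proof (cases "y = 0")
 case False
 then have "const_aq (x / y) * const_aq y = const_aq x" by (simp flip: const_aq_simps)
 then show ?thesis using False by (simp add: field_simps)
qed simp

lemma to_fract_monom: "to_fract (monom c n) = const_aq c * a_var ^ n"
proof -
 have "monom c n = [:c:] * [:0, 1:] ^ n"
  by (simp add: monom_altdef)
 then show ?thesis by (simp only: const_aq_def a_var_def to_fract_power to_fract_mult)
qed

section \<open>Evaluation at finitely many values\<close>

definition pm_bounded :: "nat => nat => (nat \<Rightarrow>\<^sub>0 nat) set" where
 "pm_bounded N d = {m. kys m <= {..<N} & total_degree m <= d}"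

lemma finite_pm_bounded: "finite (pm_bounded N d)"
proof -
 have "pm_bounded N d <= {m. kys m <= {..<N} & (ALL i. lkp m i <= d)}"
  using lookup_le_total_degree le_trans unfolding pm_bounded_def by blast
 then show ?thesis by (rule finite_subset) (intro finite_bounded_pm finite_lessThan)
qed

definition pm_eval :: "rat_q list => (nat \<Rightarrow>\<^sub>0 nat) => rat_q" where
 "pm_eval xs m = (\<Prod>i<length xs. xs ! i ^ lkp m i)"

text \<open>Variables beyond the list are set to 0. Summing only over \<open>f m ~= 0\<close> keeps
  the index set finite for every series of bounded degree.\<close>

definition series_eval :: "rat_q list => series => rat_q" where
 "series_eval xs f = (\<Sum>m | kys m <= {..<length xs} & f m ~= 0. f m * pm_eval xs m)"

lemma series_eval_bounded:
 assumes "!!m. f m ~= 0 ==> total_degree m <= d"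
 shows "series_eval xs f = (\<Sum>m\<in>pm_bounded (length xs) d. f m * pm_eval xs m)"
 unfolding series_eval_def using assms
 by (intro sum.mono_neutral_left finite_pm_bounded) (auto simp: pm_bounded_def)

lemma pm_eval_plus: "pm_eval xs (k + l) = pm_eval xs k * pm_eval xs l"
 by (simp add: pm_eval_def lookup_add power_add prod.distrib)

lemma series_eval_add:
 assumes "f \<in> symmetric_functions" "g \<in> symmetric_functions"
 shows "series_eval xs (series_add f g) = series_eval xs f + series_eval xs g"
proof -
 obtain d1 d2 where d: "ALL m. f m ~= 0 --> total_degree m <= d1" "ALL m. g m ~= 0 --> total_degree m <= d2"
  using sym_bounded[OF assms(1)] sym_bounded[OF assms(2)] by metis
 define D where "D = max d1 d2"
 have f: "f m ~= 0 ==> total_degree m <= D" and g: "g m ~= 0 ==> total_degree m <= D" for m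
  using d by (auto simp: D_def le_max_iff_disj)
 have fg: "series_add f g m ~= 0 ==> total_degree m <= D" for m
  using f[of m] g[of m] by (cases "f m = 0") (auto simp: series_add_def)
 show ?thesis
  by (simp add: series_eval_bounded[OF f] series_eval_bounded[OF g] series_eval_bounded[OF fg])
   (simp add: series_add_def algebra_simps sum.distrib)
qed

lemma series_eval_scale:
 assumes "f \<in> symmetric_functions"
 shows "series_eval xs (series_scale c f) = c * series_eval xs f"
proof -
 obtain d where d: "ALL m. f m ~= 0 --> total_degree m <= d" using sym_bounded[OF assms] by metis
 then have f: "f m ~= 0 ==> total_degree m <= d" and cf: "series_scale c f m ~= 0 ==> total_degree m <= d" for m
  by (auto simp: series_scale_def)
 show ?thesis
  by (simp add: series_eval_bounded[OF f] series_eval_bounded[OF cf])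
   (simp add: series_scale_def sum_distrib_left mult.assoc)
qed

lemma series_eval_mult:
 assumes "f \<in> symmetric_functions" "g \<in> symmetric_functions"
 shows "series_eval xs (series_mult f g) = series_eval xs f * series_eval xs g"
proof -
 obtain d1 d2 where d: "ALL m. f m ~= 0 --> total_degree m <= d1" "ALL m. g m ~= 0 --> total_degree m <= d2"
  using sym_bounded[OF assms(1)] sym_bounded[OF assms(2)] by metis
 let ?N = "length xs"
 have fg: "total_degree m <= d1 + d2" if nz: "series_mult f g m ~= 0" for m
 proof (rule ccontr)
  assume "\<not> total_degree m <= d1 + d2"
  then have "f k * g l = 0" if "k + l = m" for k l
   using d(1)[rule_format, of k] d(2)[rule_format, of l] that total_degree_plus[of k l] by fastforce
  then have "series_mult f g m = 0" unfolding series_mult_def by (intro sum.neutral) auto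
  then show False using nz by simp
 qed
 let ?S = "SIGMA m:pm_bounded ?N (d1 + d2). {(k, l). k + l = m}"
 have finS: "finite ?S" by (rule finite_SigmaI[OF finite_pm_bounded finite_splits])
 have "series_eval xs (series_mult f g) =
   (\<Sum>m\<in>pm_bounded ?N (d1 + d2). \<Sum>(k, l) | k + l = m. f k * g l * pm_eval xs m)"
 proof -
  have "series_eval xs (series_mult f g) = (\<Sum>m\<in>pm_bounded ?N (d1 + d2). series_mult f g m * pm_eval xs m)"
   by (rule series_eval_bounded) (rule fg)
  then show ?thesis by (simp only: series_mult_def sum_distrib_right case_prod_unfold)
 qed
 also have "... = (\<Sum>(m, k, l)\<in>?S. f k * g l * pm_eval xs m)"
  by (subst sum.Sigma) (auto simp: finite_pm_bounded finite_splits)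
 also have "... = (\<Sum>(k, l)\<in>pm_bounded ?N d1 \<times> pm_bounded ?N d2. f k * pm_eval xs k * (g l * pm_eval xs l))"
 proof (rule sum.mono_neutral_cong_right[OF finS, of "(%(k, l). (k + l, k, l)) ` (pm_bounded ?N d1 \<times> pm_bounded ?N d2)",
   THEN trans])
  show "(%(k, l). (k + l, k, l)) ` (pm_bounded ?N d1 \<times> pm_bounded ?N d2) <= ?S"
   by (auto simp: pm_bounded_def kys_plus total_degree_plus)
  show "\<forall>i\<in>?S - (%(k, l). (k + l, k, l)) ` (pm_bounded ?N d1 \<times> pm_bounded ?N d2).
   (case i of (m, k, l) => f k * g l * pm_eval xs m) = 0"
  proof clarify
   fix k l assume kl: "k + l \<in> pm_bounded ?N (d1 + d2)"
    "(k + l, k, l) ~: (%(k, l). (k + l, k, l)) ` (pm_bounded ?N d1 \<times> pm_bounded ?N d2)"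
   then have "k ~: pm_bounded ?N d1 \<or> l ~: pm_bounded ?N d2" by (auto simp: image_iff)
   then have "\<not> total_degree k <= d1 \<or> \<not> total_degree l <= d2"
    using kl(1) by (auto simp: pm_bounded_def kys_plus)
   then show "f k * g l * pm_eval xs (k + l) = 0" using d by auto
  qed
  show "(\<Sum>x\<in>(%(k, l). (k + l, k, l)) ` (pm_bounded ?N d1 \<times> pm_bounded ?N d2).
    (case x of (m, k, l) => f k * pm_eval xs k * (g l * pm_eval xs l)))
   = (\<Sum>(k, l)\<in>pm_bounded ?N d1 \<times> pm_bounded ?N d2. f k * pm_eval xs k * (g l * pm_eval xs l))"
   by (subst sum.reindex) (auto simp: inj_on_def case_prod_unfold)
 qed (auto simp: pm_eval_plus)
 also have "... = series_eval xs f * series_eval xs g"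
 proof -
  have "series_eval xs f = (\<Sum>m\<in>pm_bounded ?N d1. f m * pm_eval xs m)"
   by (rule series_eval_bounded) (use d in blast)
  moreover have "series_eval xs g = (\<Sum>m\<in>pm_bounded ?N d2. g m * pm_eval xs m)"
   by (rule series_eval_bounded) (use d in blast)
  ultimately show ?thesis by (simp only: sum_product sum.cartesian_product)
 qed
 finally show ?thesis .
qed

lemma series_eval_one: "series_eval xs series_one = 1"
proof -
 have "{m. kys m <= {..<length xs} & series_one m ~= 0} = {0}" by (auto simp: series_one_def)
 then show ?thesis by (simp add: series_eval_def pm_eval_def series_one_def)
qed

lemma series_eval_power_sum:
 assumes "k >= 1"
 shows "series_eval xs (power_sum k) = (\<Sum>x\<leftarrow>xs. x ^ k)"
proof -
 have "{m. kys m <= {..<length xs} & power_sum k m ~= 0} = (%i. sngl i k) ` {..<length xs}"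
 proof (intro equalityI subsetI)
  fix m assume m: "m \<in> {m. kys m <= {..<length xs} & power_sum k m ~= 0}"
  then obtain i where i: "m = sngl i k" by (auto simp: power_sum_def split: if_splits)
  then have "i < length xs" using m assms by simp
  then show "m \<in> (%i. sngl i k) ` {..<length xs}" using i by blast
 next
  fix m assume "m \<in> (%i. sngl i k) ` {..<length xs}"
  then obtain i where "m = sngl i k" "i < length xs" by blast
  then show "m \<in> {m. kys m <= {..<length xs} & power_sum k m ~= 0}"
   using assms by (auto simp: power_sum_def)
 qed
 moreover have "inj_on (%i. sngl i k) {..<length xs}"
  using assms by (auto intro!: inj_onI dest!: arg_cong[where f = kys] split: if_splits)
 moreover have "pm_eval xs (sngl i k) = xs ! i ^ k" if i: "i < length xs" for i
 proof -
  have "pm_eval xs (sngl i k) = (\<Prod>j<length xs. if j = i then xs ! i ^ k else 1)"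
   unfolding pm_eval_def by (rule prod.cong) (auto simp: lookup_single when_def)
  then show ?thesis using i by simp
 qed
 moreover have "power_sum k (sngl i k) = 1" for i by (auto simp: power_sum_def)
 ultimately have "series_eval xs (power_sum k) = (\<Sum>i<length xs. xs ! i ^ k)"
  unfolding series_eval_def by (simp add: sum.reindex)
 then show ?thesis by (simp add: sum_list_sum_nth lessThan_atLeast0)
qed

section \<open>Principal specialisation and interpolation in a\<close>

definition princ :: "nat => rat_q list" where
 "princ N = map (%i. q_var powi (int N - 1 - 2 * int i)) [0..<N]"

text \<open>\<open>princ_interp f P\<close>: the Laurent polynomial \<open>P\<close> takes at \<open>a = q\<^sup>N\<close> the value
  \<open>f(q\<^bsup>N-1\<^esup>, q\<^bsup>N-3\<^esup>, \<dots>, q\<^bsup>1-N\<^esup>)\<close>.\<close>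

definition princ_interp :: "series => rat_aq => bool" where
 "princ_interp f P \<longleftrightarrow> (EX p j. P = to_fract p / a_var ^ j &
  (ALL N. poly p (q_var ^ N) = q_var ^ (N * j) * series_eval (princ N) f))"

text \<open>After clearing powers of a, two candidates differ by a polynomial that vanishes at the
  infinitely many points q^N.\<close>

lemma princ_interp_unique:
 assumes "princ_interp f P" "princ_interp f P'"
 shows "P = P'"
proof -
 from assms obtain p j p' j' where
  P: "P = to_fract p / a_var ^ j" "!!N. poly p (q_var ^ N) = q_var ^ (N * j) * series_eval (princ N) f" and
  P': "P' = to_fract p' / a_var ^ j'" "!!N. poly p' (q_var ^ N) = q_var ^ (N * j') * series_eval (princ N) f"
  unfolding princ_interp_def by blast
 define d where "d = p * monom 1 j' - p' * monom 1 j"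
 have "poly d (q_var ^ N) = 0" for N
  by (simp add: d_def P(2) P'(2) poly_monom power_mult[symmetric] mult.commute)
 then have "range (%N. q_var ^ N) <= {x. poly d x = 0}" by auto
 moreover have "infinite (range (%N::nat. q_var ^ N))"
  by (rule range_inj_infinite) (auto intro!: injI q_var_power_inj)
 ultimately have "d = 0" using poly_roots_finite finite_subset by blast
 then have "to_fract p * a_var ^ j' = to_fract p' * a_var ^ j"
  unfolding d_def by (metis (no_types, lifting) to_fract_monom to_fract_mult const_aq_simps(2)
    eq_iff_diff_eq_0 mult.left_neutral)
 then show ?thesis unfolding P P' using a_var_nz by (simp add: field_simps)
qed

lemma princ_interp_one: "princ_interp series_one 1"
 unfolding princ_interp_def by (intro exI[of _ 1] exI[of _ 0]) (simp add: series_eval_one)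

lemma princ_interp_add:
 assumes "princ_interp f P" "princ_interp g R" "f \<in> symmetric_functions" "g \<in> symmetric_functions"
 shows "princ_interp (series_add f g) (P + R)"
proof -
 from assms obtain p j p' j' where
  P: "P = to_fract p / a_var ^ j" "!!N. poly p (q_var ^ N) = q_var ^ (N * j) * series_eval (princ N) f" and
  P': "R = to_fract p' / a_var ^ j'" "!!N. poly p' (q_var ^ N) = q_var ^ (N * j') * series_eval (princ N) g"
  unfolding princ_interp_def by blast
 have "P + R = to_fract (p * monom 1 j' + p' * monom 1 j) / a_var ^ (j + j')"
  using a_var_nz by (simp add: P P' to_fract_monom power_add field_simps)
 moreover have "poly (p * monom 1 j' + p' * monom 1 j) (q_var ^ N)
  = q_var ^ (N * (j + j')) * series_eval (princ N) (series_add f g)" for N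
  by (simp add: P(2) P'(2) series_eval_add assms(3,4) poly_monom power_mult[symmetric] power_add algebra_simps)
 ultimately show ?thesis unfolding princ_interp_def by blast
qed

lemma princ_interp_mult:
 assumes "princ_interp f P" "princ_interp g R" "f \<in> symmetric_functions" "g \<in> symmetric_functions"
 shows "princ_interp (series_mult f g) (P * R)"
proof -
 from assms obtain p j p' j' where
  P: "P = to_fract p / a_var ^ j" "!!N. poly p (q_var ^ N) = q_var ^ (N * j) * series_eval (princ N) f" and
  P': "R = to_fract p' / a_var ^ j'" "!!N. poly p' (q_var ^ N) = q_var ^ (N * j') * series_eval (princ N) g"
  unfolding princ_interp_def by blast
 have "P * R = to_fract (p * p') / a_var ^ (j + j')"
  using a_var_nz by (simp add: P P' power_add field_simps)
 moreover have "poly (p * p') (q_var ^ N) = q_var ^ (N * (j + j')) * series_eval (princ N) (series_mult f g)" for N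
  by (simp add: P(2) P'(2) series_eval_mult assms(3,4) power_add algebra_simps)
 ultimately show ?thesis unfolding princ_interp_def by blast
qed

lemma princ_interp_scale:
 assumes "princ_interp f P" "f \<in> symmetric_functions"
 shows "princ_interp (series_scale c f) (const_aq c * P)"
proof -
 from assms obtain p j where
  P: "P = to_fract p / a_var ^ j" "!!N. poly p (q_var ^ N) = q_var ^ (N * j) * series_eval (princ N) f"
  unfolding princ_interp_def by blast
 have "const_aq c * P = to_fract ([:c:] * p) / a_var ^ j"
  unfolding to_fract_mult by (simp add: P const_aq_def)
 moreover have "poly ([:c:] * p) (q_var ^ N) = q_var ^ (N * j) * series_eval (princ N) (series_scale c f)" for N
  by (simp add: P(2) series_eval_scale assms(2) algebra_simps)
 ultimately show ?thesis unfolding princ_interp_def by blast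
qed

text \<open>A geometric sum: multiplication by q^k - q^(-k) telescopes to q^(Nk) - q^(-Nk), which is
  the numerator of the plethystic image at a = q^N.\<close>

lemma princ_power_sum:
 assumes "k >= 1"
 shows "(\<Sum>x\<leftarrow>princ N. x ^ k) * (q_var ^ k - inverse q_var ^ k) = q_var ^ (N * k) - inverse q_var ^ (N * k)"
proof -
 define g where "g i = q_var powi (int k * (int N - 2 * int i))" for i
 have "(\<Sum>x\<leftarrow>princ N. x ^ k) = (\<Sum>i<N. q_var powi (int k * (int N - 1 - 2 * int i)))"
  unfolding princ_def
  by (simp add: sum_list_sum_nth lessThan_atLeast0 power_int_mult_distrib mult.commute flip: power_int_mult power_int_of_nat)
 also have "... * (q_var ^ k - inverse q_var ^ k) = (\<Sum>i<N. g i - g (Suc i))"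
  unfolding sum_distrib_right
 proof (rule sum.cong[OF refl])
  fix i
  have "q_var powi (int k * (int N - 1 - 2 * int i)) * q_var ^ k = g i"
   using q_var_nz by (simp add: g_def algebra_simps flip: power_int_of_nat power_int_add)
  moreover have "q_var powi (int k * (int N - 1 - 2 * int i)) * inverse q_var ^ k = g (Suc i)"
  proof -
   have "inverse q_var ^ k = q_var powi (- int k)" by (simp add: power_int_minus power_inverse)
   then show ?thesis using q_var_nz by (simp add: g_def algebra_simps flip: power_int_add)
  qed
  ultimately show "q_var powi (int k * (int N - 1 - 2 * int i)) * (q_var ^ k - inverse q_var ^ k) = g i - g (Suc i)"
   by (simp add: algebra_simps)
 qed
 also have "... = g 0 - g N" by (rule sum_lessThan_telescope')
 also have "g 0 = q_var ^ (N * k)" by (simp add: g_def mult.commute flip: power_int_of_nat)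
 also have "g N = inverse q_var ^ (N * k)"
 proof -
  have "int k * (int N - 2 * int N) = - int (N * k)" by (simp add: algebra_simps)
  then show ?thesis by (simp only: g_def power_int_minus power_int_of_nat power_inverse)
 qed
 finally show ?thesis .
qed

lemma q_pow_diff_nz: "k >= 1 ==> q_var ^ k - inverse q_var ^ k ~= 0"
proof
 assume k: "k >= 1" and "q_var ^ k - inverse q_var ^ k = 0"
 then have "q_var ^ k * q_var ^ k = 1" using q_var_nz by (simp add: field_simps)
 then show False using q_var_power_neq_1[of "k + k"] k by (simp add: power_add)
qed

lemma princ_interp_power_sum:
 assumes k: "k >= 1"
 shows "princ_interp (power_sum k) ((a_var ^ k - inverse a_var ^ k) / const_aq (q_var ^ k - inverse q_var ^ k))"
proof -
 let ?c = "q_var ^ k - inverse q_var ^ k"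
 let ?p = "monom (1 / ?c) (2 * k) - monom (1 / ?c) 0"
 have "(a_var ^ k - inverse a_var ^ k) / const_aq ?c = to_fract ?p / a_var ^ k"
  unfolding to_fract_diff to_fract_monom const_aq_divide
  using a_var_nz q_pow_diff_nz[OF k] by (simp add: divide_simps mult_2 power_add)
 moreover have "poly ?p (q_var ^ N) = q_var ^ (N * k) * series_eval (princ N) (power_sum k)" for N
 proof -
  have "series_eval (princ N) (power_sum k) = (q_var ^ (N * k) - inverse q_var ^ (N * k)) / ?c"
   unfolding series_eval_power_sum[OF k] using princ_power_sum[OF k, of N] q_pow_diff_nz[OF k] by (simp add: eq_divide_eq)
  moreover have "q_var ^ (N * k) * (q_var ^ (N * k) - inverse q_var ^ (N * k)) = (q_var ^ N) ^ (2 * k) - 1"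
   using q_var_nz by (simp add: right_diff_distrib power_mult power_inverse power2_eq_square mult_2 power_add)
  ultimately have "q_var ^ (N * k) * series_eval (princ N) (power_sum k) = ((q_var ^ N) ^ (2 * k) - 1) / ?c"
   by (simp only: times_divide_eq_right)
  then show ?thesis by (simp add: poly_monom diff_divide_distrib)
 qed
 ultimately show ?thesis unfolding princ_interp_def by blast
qed

lemma princ_interp_exists: "f \<in> symmetric_functions ==> EX P. princ_interp f P"
 unfolding symmetric_generated
proof (induction rule: power_sum_algebra.induct)
qed (use princ_interp_one princ_interp_power_sum princ_interp_add princ_interp_mult princ_interp_scale
  power_sum_algebra_symmetric in metis)+

text \<open>The choice operator needs a witness. Uniqueness makes interpolation additive and
  multiplicative, so it is a homomorphism with the prescribed power sums. Whatever homomorphism is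
  chosen agrees with it on these generators and hence everywhere.\<close>

theorem homfly_substitution_interp:
 assumes "f \<in> symmetric_functions"
 shows "princ_interp f (homfly_substitution f)"
proof -
 let ?ok = "%ph. symmetric_algebra_hom ph & (\<forall>m\<ge>1. ph (power_sum m) =
   (a_var ^ m - inverse a_var ^ m) / const_aq (q_var ^ m - inverse q_var ^ m))"
 define ph0 where "ph0 f = (THE P. princ_interp f P)" for f
 have ph0: "ph0 f = P" if "princ_interp f P" for f P
  unfolding ph0_def by (rule the_equality[where P = "princ_interp f"]) (use that princ_interp_unique in auto)
 have "?ok ph0"
  unfolding symmetric_algebra_hom_def
 proof (intro conjI ballI allI impI)
  show "ph0 series_one = 1" by (rule ph0[OF princ_interp_one])
 next
  fix f g assume fg: "f \<in> symmetric_functions" "g \<in> symmetric_functions"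
  then obtain P R where "princ_interp f P" "princ_interp g R" using princ_interp_exists by blast
  then show "ph0 (series_add f g) = ph0 f + ph0 g" "ph0 (series_mult f g) = ph0 f * ph0 g"
   using ph0 princ_interp_add princ_interp_mult fg by metis+
 next
  fix c f assume f: "f \<in> symmetric_functions"
  then obtain P where "princ_interp f P" using princ_interp_exists by blast
  then show "ph0 (series_scale c f) = const_aq c * ph0 f" using ph0 princ_interp_scale f by metis
 next
  fix m :: nat assume "1 <= m"
  then show "ph0 (power_sum m) = (a_var ^ m - inverse a_var ^ m) / const_aq (q_var ^ m - inverse q_var ^ m)"
   by (intro ph0 princ_interp_power_sum)
 qed
 then have "?ok homfly_substitution" unfolding homfly_substitution_def by (rule someI[where P = ?ok])
 then have ok: "homfly_substitution series_one = 1"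
  "!!f g. f \<in> symmetric_functions ==> g \<in> symmetric_functions ==>
    homfly_substitution (series_add f g) = homfly_substitution f + homfly_substitution g"
  "!!f g. f \<in> symmetric_functions ==> g \<in> symmetric_functions ==>
    homfly_substitution (series_mult f g) = homfly_substitution f * homfly_substitution g"
  "!!c f. f \<in> symmetric_functions ==> homfly_substitution (series_scale c f) = const_aq c * homfly_substitution f"
  "!!m. m >= 1 ==> homfly_substitution (power_sum m) =
   (a_var ^ m - inverse a_var ^ m) / const_aq (q_var ^ m - inverse q_var ^ m)"
  unfolding symmetric_algebra_hom_def by auto
 show ?thesis using assms unfolding symmetric_generated
 proof (induction rule: power_sum_algebra.induct)
  case one
  then show ?case using princ_interp_one by (simp add: ok(1))
 next
  case (ps k)
  then show ?case using princ_interp_power_sum by (simp add: ok(5))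
 next
  case (add f g)
  then show ?case using princ_interp_add power_sum_algebra_symmetric ok(2) by simp
 next
  case (mult f g)
  then show ?case using princ_interp_mult power_sum_algebra_symmetric ok(3) by simp
 next
  case (scale f c)
  then show ?case using princ_interp_scale power_sum_algebra_symmetric ok(4) by simp
 qed
qed

section \<open>Uniqueness of Laurent coefficients in a\<close>

lemma laurent_zero:
 assumes fin: "finite A" and z: "(\<Sum>m\<in>A. const_aq (d m) * a_var powi m) = 0" and m: "m \<in> A"
 shows "d m = 0"
proof -
 define M where "M = (\<Sum>m\<in>A. \<bar>m\<bar>)"
 have M: "\<bar>i\<bar> <= M" if "i \<in> A" for i unfolding M_def using that fin by (intro member_le_sum) auto
 have "0 = (\<Sum>m\<in>A. const_aq (d m) * a_var powi m) * a_var powi M" using z by simp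
 also have "... = (\<Sum>m\<in>A. to_fract (monom (d m) (nat (m + M))))"
  unfolding sum_distrib_right
 proof (rule sum.cong[OF refl])
  fix i assume i: "i \<in> A"
  have "a_var powi i * a_var powi M = a_var powi (i + M)" using a_var_nz by (simp add: power_int_add)
  also have "... = a_var ^ nat (i + M)" using M[OF i] by (simp add: power_int_def)
  finally show "const_aq (d i) * a_var powi i * a_var powi M = to_fract (monom (d i) (nat (i + M)))"
   by (simp add: to_fract_monom mult.assoc)
 qed
 also have "... = to_fract (\<Sum>m\<in>A. monom (d m) (nat (m + M)))"
  by (induction A rule: infinite_finite_induct) auto
 finally have "(\<Sum>m\<in>A. monom (d m) (nat (m + M))) = 0" using to_fract_eq_0_iff by metis
 then have "0 = coeff (\<Sum>m\<in>A. monom (d m) (nat (m + M))) (nat (m + M))" by simp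
 also have "... = (\<Sum>i\<in>A. if i = m then d m else 0)"
  unfolding coeff_sum
 proof (rule sum.cong[OF refl])
  fix x assume x: "x \<in> A"
  show "coeff (monom (d x) (nat (x + M))) (nat (m + M)) = (if x = m then d m else 0)"
   using M[OF x] M[OF m] by (auto simp: eq_nat_nat_iff)
 qed
 finally show ?thesis using fin m by simp
qed

lemma laurent_expansion_superset:
 assumes "laurent_expansion P c" "finite A" "{m. c m ~= 0} <= A"
 shows "P = (\<Sum>m\<in>A. const_aq (c m) * a_var powi m)"
 using assms unfolding laurent_expansion_def by (auto intro: sum.mono_neutral_left)

lemma laurent_unique:
 assumes c: "laurent_expansion P c" and c': "laurent_expansion P c'"
 shows "c = c'"
proof
 fix m
 let ?A = "insert m ({m. c m ~= 0} Un {m. c' m ~= 0})"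
 have fin: "finite ?A" using assms by (auto simp: laurent_expansion_def)
 have "P = (\<Sum>m\<in>?A. const_aq (c m) * a_var powi m)" by (rule laurent_expansion_superset[OF c fin]) auto
 moreover have "P = (\<Sum>m\<in>?A. const_aq (c' m) * a_var powi m)" by (rule laurent_expansion_superset[OF c' fin]) auto
 ultimately have "(\<Sum>m\<in>?A. const_aq (c m - c' m) * a_var powi m) = 0"
  by (simp add: const_aq_diff left_diff_distrib sum_subtractf)
 from laurent_zero[OF fin this, of m] show "c m = c' m" by simp
qed

lemma a_coeff_eq: "laurent_expansion P c ==> a_coeff P = c"
 unfolding a_coeff_def by (rule the_equality) (auto intro: laurent_unique)

text \<open>A symmetric function is determined by its principal specialisations.\<close>

lemma homfly_from_princ:
 assumes f: "f \<in> symmetric_functions"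
  and ev: "!!N. series_eval (princ N) f = (\<Sum>k\<le>n. c k * (q_var ^ N) powi (2 * int k - int n))"
 shows "laurent_expansion (homfly_substitution f)
  (%m. if \<exists>k\<le>n. m = 2 * int k - int n then c (nat ((m + int n) div 2)) else 0)"
proof -
 let ?c = "%m. if \<exists>k\<le>n. m = 2 * int k - int n then c (nat ((m + int n) div 2)) else 0"
 define P where "P = (\<Sum>k\<le>n. const_aq (c k) * a_var powi (2 * int k - int n))"
 let ?p = "\<Sum>k\<le>n. monom (c k) (2 * k)"
 have tf: "to_fract ?p = (\<Sum>k\<le>n. const_aq (c k) * a_var ^ (2 * k))"
  by (induction n) (simp_all add: to_fract_monom)
 have "P * a_var ^ n = to_fract ?p"
  unfolding P_def tf sum_distrib_right
 proof (rule sum.cong[OF refl])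
  fix k
  have "a_var powi (2 * int k - int n) * a_var ^ n = a_var powi (2 * int k)"
   using a_var_nz by (simp flip: power_int_of_nat power_int_add)
  also have "... = a_var ^ (2 * k)" by (metis of_nat_mult of_nat_numeral power_int_of_nat)
  finally show "const_aq (c k) * a_var powi (2 * int k - int n) * a_var ^ n = const_aq (c k) * a_var ^ (2 * k)"
   by (simp add: mult.assoc)
 qed
 then have 1: "P = to_fract ?p / a_var ^ n" using a_var_nz by (simp add: eq_divide_eq)
 have 2: "poly ?p (q_var ^ N) = q_var ^ (N * n) * series_eval (princ N) f" for N
  unfolding ev poly_sum poly_monom sum_distrib_left
 proof (rule sum.cong[OF refl])
  fix k
  define y where "y = q_var ^ N"
  have y: "y ~= 0" using q_var_nz by (simp add: y_def)
  have "y ^ (2 * k) = y powi int (2 * k)" by (simp only: power_int_of_nat)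
  also have "int (2 * k) = (2 * int k - int n) + int n" by simp
  also have "y powi ... = y powi (2 * int k - int n) * y ^ n"
   by (subst power_int_add) (use y in \<open>simp_all only: power_int_of_nat simp_thms\<close>)
  finally show "c k * (q_var ^ N) ^ (2 * k) = q_var ^ (N * n) * (c k * (q_var ^ N) powi (2 * int k - int n))"
   unfolding power_mult[of q_var N n] y_def[symmetric] by (simp only: mult.assoc mult.commute mult.left_commute)
 qed
 have "princ_interp f P" unfolding princ_interp_def using 1 2 by blast
 then have hP: "homfly_substitution f = P" using princ_interp_unique homfly_substitution_interp[OF f] by blast
 have inj: "inj_on (%k. 2 * int k - int n) {..n}" by (auto intro: inj_onI)
 have supp: "{m. ?c m ~= 0} <= (%k. 2 * int k - int n) ` {..n}" by (auto split: if_splits)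
 then have fin: "finite {m. ?c m ~= 0}" by (rule finite_subset) simp
 have "P = (\<Sum>m\<in>(%k. 2 * int k - int n) ` {..n}. const_aq (?c m) * a_var powi m)"
  unfolding P_def sum.reindex[OF inj] by (rule sum.cong) auto
 also have "... = (\<Sum>m | ?c m ~= 0. const_aq (?c m) * a_var powi m)"
  by (rule sum.mono_neutral_right) (use supp in auto)
 finally show ?thesis unfolding laurent_expansion_def hP using fin by simp
qed

section \<open>Sweeping a radial segment around the annulus\<close>

lemma annulus_point_eq_iff:
 "annulus_point x y = annulus_point x' y' \<longleftrightarrow> x = x' & (\<exists>n::int. y' = y + of_int n)"
proof -
 have "cis (2 * pi * y) = cis (2 * pi * y') \<longleftrightarrow> (\<exists>n::int. 2 * pi * y' = 2 * pi * y + 2 * pi * of_int n)"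
  using sin_cos_eq_iff[of "2 * pi * y'" "2 * pi * y"] by (auto simp: complex_eq_iff)
 also have "... \<longleftrightarrow> (\<exists>n::int. y' = y + of_int n)"
  by (simp flip: distrib_left)
 finally show ?thesis by (simp add: annulus_point_def)
qed

lemma annulus_point_shift: "annulus_point x (y + of_int n) = annulus_point x y"
 using annulus_point_eq_iff by metis

lemma ex_strict_sorted_list:
 fixes f :: "'c => real"
 assumes "finite A" "inj_on f A"
 shows "EX L. distinct L & set L = A & sorted_wrt (%a b. f a < f b) L"
proof -
 obtain L0 where L0: "set L0 = A" "distinct L0" using finite_distinct_list[OF assms(1)] by blast
 define L where "L = sort_key f L0"
 have "distinct (map f L)" using L0 assms(2) by (simp add: L_def distinct_map)
 then have "sorted_wrt (<) (map f L)" by (simp add: strict_sorted_iff L_def)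
 then show ?thesis using L0 by (intro exI[of _ L]) (auto simp: L_def sorted_wrt_map)
qed

lemma strict_sorted_list_unique:
 fixes f :: "'c => real"
 assumes "sorted_wrt (%a b. f a < f b) L" "sorted_wrt (%a b. f a < f b) L'" "set L = set L'" "inj_on f (set L)"
 shows "L = L'"
proof -
 have "map f L = map f L'"
  using assms by (intro strict_sorted_equal) (auto simp: sorted_wrt_map)
 then show ?thesis using assms(3,4) by (metis inj_on_map_eq_map sup.idem)
qed

text \<open>With \<open>f\<close> the horizontal position at a special height, this shows that the
  strands meeting in one point form a contiguous part of the sorted level.\<close>

lemma concat_filter_levels:
 fixes f :: "'c => real"
 assumes "sorted (map f L)" "sorted_wrt (<) P" "f ` set L <= set P"
 shows "concat (map (%x. filter (%a. f a = x) L) P) = L"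
 using assms
proof (induction P arbitrary: L)
 case (Cons p P)
 define T D where "T = filter (%a. f a = p) L" and "D = filter (%a. f a ~= p) L"
 have "sorted (map f L) ==> \<forall>a\<in>set L. p <= f a ==> filter (%a. f a = p) L @ filter (%a. f a ~= p) L = L" for L
 proof (induction L)
  case (Cons a L)
  show ?case
  proof (cases "f a = p")
   case False
   then have "\<forall>b\<in>set L. f b ~= p" using Cons.prems by force
   then have "filter (%a. f a = p) L = []" "filter (%a. f a ~= p) L = L" by (auto simp: filter_empty_conv)
   then show ?thesis using False by simp
  qed (use Cons in simp)
 qed simp
 moreover have "\<forall>a\<in>set L. p <= f a" using Cons.prems by force
 ultimately have TD: "T @ D = L" using Cons.prems by (simp add: T_def D_def)
 have "sorted (map f D)" using Cons.prems(1) unfolding D_def by (rule sorted_filter)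
 moreover have "f ` set D <= set P" using Cons.prems(3) by (auto simp: D_def)
 ultimately have "concat (map (%x. filter (%a. f a = x) D) P) = D" using Cons.IH Cons.prems(2) by simp
 moreover have "map (%x. filter (%a. f a = x) D) P = map (%x. filter (%a. f a = x) L) P"
 proof (rule map_cong[OF refl])
  fix x assume "x \<in> set P"
  then have "x ~= p" using Cons.prems(2) by auto
  then show "filter (%a. f a = x) D = filter (%a. f a = x) L"
   by (auto simp: D_def intro!: filter_cong)
 qed
 ultimately show ?case using TD by (simp add: T_def)
qed simp

lemma negative_backwards:
 fixes f :: "real => real"
 assumes "continuous_on {a..b} f" "a < b" "f b < 0" "!!y. a <= y ==> y < b ==> f y ~= 0"
 shows "f a < 0"
proof (rule ccontr)
 assume "\<not> f a < 0"
 then obtain y where "a <= y" "y <= b" "f y = 0"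
  using IVT2'[of f b 0 a] assms by auto
 then show False using assms(3,4) by (cases "y = b") auto
qed

lemma negative_forwards:
 fixes f :: "real => real"
 assumes "continuous_on {a..b} f" "a < b" "f a < 0" "!!y. a < y ==> y <= b ==> f y ~= 0"
 shows "f b < 0"
proof (rule ccontr)
 assume "\<not> f b < 0"
 then obtain y where "a <= y" "y <= b" "f y = 0"
  using IVT'[of f a 0 b] assms by auto
 then show False using assms(3,4) by (cases "y = a") auto
qed

section \<open>Lists of strands changed by local steps\<close>

type_synonym ('c, 'v) lvstep = "'c list \<times> 'c list \<times> 'c list \<times> 'v option"

text \<open>\<open>A\<close> collects the strands that have occurred so far. Freshness of
  \<open>outs\<close> is what later allows functions on strands to be extended step by step without
  touching old values.\<close>

fun evolve :: "('c list => 'c list => 'v option => bool) => 'c set => 'c list => ('c, 'v) lvstep list => 'c list => bool"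
where
 "evolve ok A L [] L' = (L = L')"
| "evolve ok A L ((xs, ins, outs, v) # ss) L' = (EX ys. L = xs @ ins @ ys & ok ins outs v &
   set outs Int A = {} & distinct outs & evolve ok (A Un set outs) (xs @ outs @ ys) ss L')"

fun step_outs :: "('c, 'v) lvstep => 'c set" where "step_outs (xs, ins, outs, v) = set outs"
fun step_vertex :: "('c, 'v) lvstep => 'v list" where
 "step_vertex (xs, ins, outs, v) = (case v of None => [] | Some x => [x])"

definition all_outs :: "('c, 'v) lvstep list => 'c set" where "all_outs ss = (\<Union>s\<in>set ss. step_outs s)"
definition all_vertices :: "('c, 'v) lvstep list => 'v list" where "all_vertices ss = concat (map step_vertex ss)"

lemma all_outs_simps [simp]: "all_outs [] = {}" "all_outs (s # ss) = step_outs s Un all_outs ss"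
 "all_outs (ss @ ss') = all_outs ss Un all_outs ss'"
 by (auto simp: all_outs_def)
lemma all_vertices_simps [simp]: "all_vertices [] = []" "all_vertices (s # ss) = step_vertex s @ all_vertices ss"
 "all_vertices (ss @ ss') = all_vertices ss @ all_vertices ss'"
 by (auto simp: all_vertices_def)

lemma evolve_append:
 "evolve ok A L ss L1 ==> evolve ok (A Un all_outs ss) L1 ss' L2 ==> evolve ok A L (ss @ ss') L2"
 by (induction ok A L ss L1 rule: evolve.induct) (auto simp: Un_assoc)

text \<open>Events at one height are simultaneous; they are carried out from left to right, with
  \<open>pre\<close> the part already processed.\<close>

lemma evolve_concat:
 assumes "!!x. x \<in> set P ==> I x = J x \<or> ok (I x) (J x) (V x) & distinct (J x) & set (J x) Int A = {}"
  and "!!x x'. x \<in> set P ==> x' \<in> set P ==> x ~= x' ==> set (J x) Int set (J x') = {}"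
  and "distinct P"
 shows "EX ss. evolve ok A (pre @ concat (map I P)) ss (pre @ concat (map J P)) &
  all_outs ss = (\<Union>x\<in>{x \<in> set P. I x ~= J x}. set (J x)) &
  all_vertices ss = concat (map (%x. if I x = J x then [] else (case V x of None => [] | Some v => [v])) P)"
 using assms
proof (induction P arbitrary: pre A)
 case Nil
 then show ?case by (intro exI[of _ "[]"]) simp
next
 case (Cons p P)
 show ?case
 proof (cases "I p = J p")
  case True
  have "EX ss. evolve ok A ((pre @ J p) @ concat (map I P)) ss ((pre @ J p) @ concat (map J P)) &
   all_outs ss = (\<Union>x\<in>{x \<in> set P. I x ~= J x}. set (J x)) &
   all_vertices ss = concat (map (%x. if I x = J x then [] else (case V x of None => [] | Some v => [v])) P)"
   by (rule Cons.IH) (use Cons.prems in auto)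
  moreover have "{x \<in> set (p # P). I x ~= J x} = {x \<in> set P. I x ~= J x}" using True by auto
  ultimately show ?thesis using True by (simp only: ) simp
 next
  case False
  then have p: "ok (I p) (J p) (V p)" "distinct (J p)" "set (J p) Int A = {}" using Cons.prems(1)[of p] by auto
  have "EX ss. evolve ok (A Un set (J p)) ((pre @ J p) @ concat (map I P)) ss ((pre @ J p) @ concat (map J P)) &
   all_outs ss = (\<Union>x\<in>{x \<in> set P. I x ~= J x}. set (J x)) &
   all_vertices ss = concat (map (%x. if I x = J x then [] else (case V x of None => [] | Some v => [v])) P)"
  proof (rule Cons.IH)
   fix x assume x: "x \<in> set P"
   then have "set (J x) Int set (J p) = {}" using Cons.prems(2)[of x p] Cons.prems(3) by auto
   then show "I x = J x \<or> ok (I x) (J x) (V x) & distinct (J x) & set (J x) Int (A Un set (J p)) = {}"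
    using Cons.prems(1)[of x] x by auto
  qed (use Cons.prems in auto)
  then obtain ss where ss: "evolve ok (A Un set (J p)) ((pre @ J p) @ concat (map I P)) ss ((pre @ J p) @ concat (map J P))"
   "all_outs ss = (\<Union>x\<in>{x \<in> set P. I x ~= J x}. set (J x))"
   "all_vertices ss = concat (map (%x. if I x = J x then [] else (case V x of None => [] | Some v => [v])) P)" by blast
  have "{x \<in> set (p # P). I x ~= J x} = insert p {x \<in> set P. I x ~= J x}" using False by auto
  then show ?thesis using False p ss
   by (intro exI[of _ "(pre, I p, J p, V p) # ss"]) (auto intro!: exI[of _ "concat (map I P)"])
 qed
qed

section \<open>Lifts of the edges to the universal cover\<close>

locale annular_graph =
 fixes w :: "'e web"
 assumes aw: "annular_web w"
begin

text \<open>The pair (e, k) stands for the lift of e translated upward by k. A lift meets every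
  height at most once, even if its edge winds around the annulus; \<open>crossings\<close> is the
  set of all lifts.\<close>

definition lo :: "'e \<times> int => real" where "lo a = lower w (fst a) + of_int (snd a)"
definition up :: "'e \<times> int => real" where "up a = upper w (fst a) + of_int (snd a)"
definition xc :: "'e \<times> int => real => real" where "xc a y = xcoord w (fst a) (y - of_int (snd a))"
definition crossings :: "('e \<times> int) set" where "crossings = {a. fst a \<in> edges w}"
definition active :: "real => ('e \<times> int) set" where "active y = {a \<in> crossings. lo a < y & y < up a}"
definition below :: "real => ('e \<times> int) set" where "below y = {a \<in> crossings. lo a < y & y <= up a}"
definition above :: "real => ('e \<times> int) set" where "above y = {a \<in> crossings. lo a <= y & y < up a}"
definition generic_on :: "real set => bool" where
 "generic_on S \<longleftrightarrow> (\<forall>a\<in>crossings. lo a ~: S & up a ~: S)"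
definition level :: "real => ('e \<times> int) list => bool" where
 "level y L \<longleftrightarrow> distinct L & set L = active y & sorted_wrt (%a b. xc a y < xc b y) L"

lemma edge_facts:
 assumes "e \<in> edges w"
 shows "lower w e < upper w e" "continuous_on {lower w e..upper w e} (xcoord w e)" "thickness w e > 0"
  "source w e \<in> vertices w & target w e \<in> vertices w \<or> essential_circle w e"
  "xcoord w e ` {lower w e..upper w e} <= {0..1}"
 using aw assms unfolding annular_web_def by auto

lemma finite_edges: "finite (edges w)" and finite_vertices: "finite (vertices w)"
 using aw unfolding annular_web_def by auto

lemma nonvertex_inj:
 assumes "e \<in> edges w" "e' \<in> edges w" "y \<in> nonvertex_heights w e" "y' \<in> nonvertex_heights w e'"
  "edge_point w e y = edge_point w e' y'"
 shows "e = e' & y = y'"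
proof -
 have inj: "inj_on (%(e, y). edge_point w e y) (SIGMA e:edges w. nonvertex_heights w e)"
  using aw unfolding annular_web_def by blast
 show ?thesis using inj_onD[OF inj, of "(e, y)" "(e', y')"] assms by auto
qed

lemma nonvertex_not_vertex: "e \<in> edges w ==> y \<in> nonvertex_heights w e ==> edge_point w e y ~: vertices w"
 using aw unfolding annular_web_def by blast

lemma interior_nonvertex: "lower w e < y ==> y < upper w e ==> y \<in> nonvertex_heights w e"
 by (simp add: nonvertex_heights_def)

lemma edge_point_xc: "edge_point w (fst a) (y - of_int (snd a)) = annulus_point (xc a y) y"
 using annulus_point_shift[of "xc a y" "y - of_int (snd a)" "snd a"] by (simp add: edge_point_def xc_def)

lemma lo_less_up: "a \<in> crossings ==> lo a < up a"
 using edge_facts(1) by (auto simp: crossings_def lo_def up_def)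

text \<open>Embeddedness in the annulus separates all lifts over a common interior height, including
  different translates of one edge, whose parameters differ.\<close>

lemma xc_inj:
 assumes "a \<in> crossings" "b \<in> crossings" "lo a < y" "y < up a" "lo b < y" "y < up b" "xc a y = xc b y"
 shows "a = b"
proof -
 have "edge_point w (fst a) (y - of_int (snd a)) = edge_point w (fst b) (y - of_int (snd b))"
  unfolding edge_point_xc assms(7) ..
 moreover have "y - of_int (snd a) \<in> nonvertex_heights w (fst a)" "y - of_int (snd b) \<in> nonvertex_heights w (fst b)"
  using assms by (auto intro!: interior_nonvertex simp: lo_def up_def)
 moreover have "fst a \<in> edges w" "fst b \<in> edges w" using assms(1,2) by (auto simp: crossings_def)
 ultimately have "fst a = fst b & y - of_int (snd a) = y - of_int (snd b)" by (intro nonvertex_inj)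
 then show ?thesis by (simp add: prod_eq_iff)
qed

lemma xc_continuous: "a \<in> crossings ==> S <= {lo a..up a} ==> continuous_on S (xc a)"
proof -
 assume a: "a \<in> crossings" and S: "S <= {lo a..up a}"
 have "continuous_on {lower w (fst a)..upper w (fst a)} (xcoord w (fst a))"
  using a edge_facts(2) by (simp add: crossings_def)
 then have "continuous_on S (xcoord w (fst a) \<circ> (%y. y - of_int (snd a)))"
  using S by (intro continuous_on_compose continuous_intros) (auto elim!: continuous_on_subset simp: lo_def up_def)
 then show ?thesis unfolding xc_def comp_def .
qed

text \<open>Disjoint continuous graphs keep their order. The upper end y0 may be the end of both
  strands, as happens at a vertex, so strictness is assumed there and disjointness is used only
  below it.\<close>

lemma xc_order_backwards:
 assumes "a \<in> crossings" "b \<in> crossings" "a ~= b" "lo a < y1" "lo b < y1" "y1 < y0" "y0 <= up a" "y0 <= up b"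
  and "xc a y0 < xc b y0"
 shows "xc a y1 < xc b y1"
proof -
 have "xc a y1 - xc b y1 < 0"
 proof (rule negative_backwards[of y1 y0 "%y. xc a y - xc b y"])
  show "continuous_on {y1..y0} (%y. xc a y - xc b y)"
   using assms by (intro continuous_intros xc_continuous) auto
  show "xc a y - xc b y ~= 0" if "y1 <= y" "y < y0" for y
   using xc_inj[of a b y] that assms by auto
 qed (use assms in auto)
 then show ?thesis by simp
qed

lemma xc_order_forwards:
 assumes "a \<in> crossings" "b \<in> crossings" "a ~= b" "lo a <= y0" "lo b <= y0" "y0 < y2" "y2 < up a" "y2 < up b"
  and "xc a y0 < xc b y0"
 shows "xc a y2 < xc b y2"
proof -
 have "xc a y2 - xc b y2 < 0"
 proof (rule negative_forwards[of y0 y2 "%y. xc a y - xc b y"])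
  show "continuous_on {y0..y2} (%y. xc a y - xc b y)"
   using assms by (intro continuous_intros xc_continuous) auto
  show "xc a y - xc b y ~= 0" if "y0 < y" "y <= y2" for y
   using xc_inj[of a b y] that assms by auto
 qed (use assms in auto)
 then show ?thesis by simp
qed

lemma finite_int_window: "finite {k::int. c < of_int k + (u::real) & of_int k + u < d}"
proof (rule finite_subset)
 show "{k::int. c < of_int k + u & of_int k + u < d} <= {\<lfloor>c - u\<rfloor>..\<lceil>d - u\<rceil>}"
  by (auto simp: floor_le_iff le_ceiling_iff)
qed simp

lemma finite_window: "finite {a \<in> crossings. lo a < d & c < up a}"
proof (rule finite_subset)
 show "{a \<in> crossings. lo a < d & c < up a} <=
  (SIGMA e:edges w. {k::int. c - upper w e < of_int k + 0 & of_int k + 0 < d - lower w e})"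
  by (auto simp: crossings_def lo_def up_def algebra_simps)
qed (intro finite_SigmaI finite_edges finite_int_window)

lemma finite_active: "finite (active y)"
 by (rule finite_subset[OF _ finite_window[of y y]]) (auto simp: active_def)

lemma active_inj: "inj_on (%a. xc a y) (active y)"
proof (rule inj_onI)
 fix a b assume "a \<in> active y" "b \<in> active y" "xc a y = xc b y"
 then show "a = b" using xc_inj[of a b y] by (auto simp: active_def)
qed

lemma level_exists: "EX L. level y L"
 using ex_strict_sorted_list[OF finite_active active_inj] unfolding level_def by blast

lemma level_unique: "level y L ==> level y L' ==> L = L'"
 unfolding level_def using strict_sorted_list_unique[of "%a. xc a y" L L'] active_inj by metis

lemma active_below: "generic_on {y1..<y0} ==> y1 < y0 ==> active y1 = below y0"
 unfolding active_def below_def generic_on_def by (force simp: not_less)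

lemma active_above: "generic_on {y0<..y2} ==> y0 < y2 ==> active y2 = above y0"
 unfolding active_def above_def generic_on_def by (force simp: not_less)

lemma level_const:
 assumes "generic_on {y1..y2}" "y1 < y2" "level y1 L"
 shows "level y2 L"
proof -
 have act: "active y2 = active y1" using assms(1,2) unfolding active_def generic_on_def by (force simp: not_less)
 have "sorted_wrt (%a b. xc a y2 < xc b y2) L"
 proof (rule sorted_wrt_mono_rel)
  show "sorted_wrt (%a b. xc a y1 < xc b y1) L" using assms(3) by (simp add: level_def)
  fix a b assume ab: "a \<in> set L" "b \<in> set L" "xc a y1 < xc b y1"
  then have m: "a \<in> active y1" "b \<in> active y1" "a \<in> active y2" "b \<in> active y2" "a ~= b"
   using assms(3) act by (auto simp: level_def)
  show "xc a y2 < xc b y2"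
   by (rule xc_order_forwards[of a b y1 y2]) (use m ab assms(2) in \<open>auto simp: active_def\<close>)
 qed
 then show ?thesis using assms(3) act by (auto simp: level_def)
qed

definition ins_at :: "real => real => ('e \<times> int) set" where "ins_at y x = {a \<in> below y. xc a y = x}"
definition outs_at :: "real => real => ('e \<times> int) set" where "outs_at y x = {a \<in> above y. xc a y = x}"

lemma height_shift:
 assumes "annulus_point x s = annulus_point x' y"
 shows "\<exists>k::int. s + of_int k = y" "x = x'"
 using assms annulus_point_eq_iff by metis+

lemma ins_at_vertex:
 assumes v: "annulus_point x y \<in> vertices w"
 shows "bij_betw fst (ins_at y x) (in_edges w (annulus_point x y))" "\<forall>a\<in>ins_at y x. up a = y"
proof -
 show u: "\<forall>a\<in>ins_at y x. up a = y"
 proof (rule ballI, rule ccontr)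
  fix b assume b: "b \<in> ins_at y x" "up b ~= y"
  obtain e k where "b = (e, k)" by (cases b)
  then have a: "(e, k) \<in> ins_at y x" "up (e, k) ~= y" using b by auto
  then have "y - of_int k \<in> nonvertex_heights w e" "e \<in> edges w"
   by (auto simp: ins_at_def below_def crossings_def lo_def up_def intro!: interior_nonvertex)
  then have "edge_point w e (y - of_int k) ~: vertices w" using nonvertex_not_vertex by blast
  then show False using edge_point_xc[of "(e, k)" y] v a by (simp add: ins_at_def)
 qed
 show "bij_betw fst (ins_at y x) (in_edges w (annulus_point x y))"
  unfolding bij_betw_def
 proof
  show "inj_on fst (ins_at y x)"
  proof (rule inj_onI)
   fix a b assume "a \<in> ins_at y x" "b \<in> ins_at y x" "fst a = fst b"
   moreover from this have "up a = y" "up b = y" using u by blast+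
   ultimately show "a = b" by (simp add: up_def prod_eq_iff)
  qed
  show "fst ` ins_at y x = in_edges w (annulus_point x y)"
  proof (intro equalityI subsetI)
   fix e assume "e \<in> fst ` ins_at y x"
   then obtain k where a: "(e, k) \<in> ins_at y x" by auto
   then have "up (e, k) = y" using u by blast
   then have "y - of_int k = upper w e" by (auto simp: up_def)
   then have "target w e = annulus_point x y"
    using edge_point_xc[of "(e, k)" y] a by (simp add: ins_at_def target_def)
   then show "e \<in> in_edges w (annulus_point x y)"
    using a by (auto simp: in_edges_def ins_at_def below_def crossings_def)
  next
   fix e assume e: "e \<in> in_edges w (annulus_point x y)"
   then have t: "annulus_point (xcoord w e (upper w e)) (upper w e) = annulus_point x y" and ee: "e \<in> edges w"
    by (auto simp: in_edges_def target_def edge_point_def)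
   from height_shift[OF t] obtain k :: int where k: "upper w e + of_int k = y" "xcoord w e (upper w e) = x" by blast
   have "(e, k) \<in> ins_at y x"
    using k ee edge_facts(1)[OF ee] by (auto simp: ins_at_def below_def crossings_def lo_def up_def xc_def)
   then show "e \<in> fst ` ins_at y x" by force
  qed
 qed
qed

lemma outs_at_vertex:
 assumes v: "annulus_point x y \<in> vertices w"
 shows "bij_betw fst (outs_at y x) (out_edges w (annulus_point x y))" "\<forall>a\<in>outs_at y x. lo a = y"
proof -
 show u: "\<forall>a\<in>outs_at y x. lo a = y"
 proof (rule ballI, rule ccontr)
  fix b assume b: "b \<in> outs_at y x" "lo b ~= y"
  obtain e k where "b = (e, k)" by (cases b)
  then have a: "(e, k) \<in> outs_at y x" "lo (e, k) ~= y" using b by auto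
  then have "y - of_int k \<in> nonvertex_heights w e" "e \<in> edges w"
   by (auto simp: outs_at_def above_def crossings_def lo_def up_def intro!: interior_nonvertex)
  then have "edge_point w e (y - of_int k) ~: vertices w" using nonvertex_not_vertex by blast
  then show False using edge_point_xc[of "(e, k)" y] v a by (simp add: outs_at_def)
 qed
 show "bij_betw fst (outs_at y x) (out_edges w (annulus_point x y))"
  unfolding bij_betw_def
 proof
  show "inj_on fst (outs_at y x)"
  proof (rule inj_onI)
   fix a b assume "a \<in> outs_at y x" "b \<in> outs_at y x" "fst a = fst b"
   moreover from this have "lo a = y" "lo b = y" using u by blast+
   ultimately show "a = b" by (simp add: lo_def prod_eq_iff)
  qed
  show "fst ` outs_at y x = out_edges w (annulus_point x y)"
  proof (intro equalityI subsetI)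
   fix e assume "e \<in> fst ` outs_at y x"
   then obtain k where a: "(e, k) \<in> outs_at y x" by auto
   then have "lo (e, k) = y" using u by blast
   then have "y - of_int k = lower w e" by (auto simp: lo_def)
   then have "source w e = annulus_point x y"
    using edge_point_xc[of "(e, k)" y] a by (simp add: outs_at_def source_def)
   then show "e \<in> out_edges w (annulus_point x y)"
    using a by (auto simp: out_edges_def outs_at_def above_def crossings_def)
  next
   fix e assume e: "e \<in> out_edges w (annulus_point x y)"
   then have t: "annulus_point (xcoord w e (lower w e)) (lower w e) = annulus_point x y" and ee: "e \<in> edges w"
    by (auto simp: out_edges_def source_def edge_point_def)
   from height_shift[OF t] obtain k :: int where k: "lower w e + of_int k = y" "xcoord w e (lower w e) = x" by blast
   have "(e, k) \<in> outs_at y x"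
    using k ee edge_facts(1)[OF ee] by (auto simp: outs_at_def above_def crossings_def lo_def up_def xc_def)
   then show "e \<in> fst ` outs_at y x" by force
  qed
 qed
qed

text \<open>Away from the vertices a strand can begin or end only at the base point of an essential
  circle. That point is represented by the parameter \<open>lower\<close>, the one endpoint
  contained in \<open>nonvertex_heights\<close>.\<close>

lemma at_nonvertex_rep:
 assumes v: "annulus_point x y ~: vertices w" and a: "a \<in> ins_at y x Un outs_at y x"
 shows "\<exists>s\<in>nonvertex_heights w (fst a). edge_point w (fst a) s = annulus_point x y &
  (s = y - of_int (snd a) & lo a < y & y < up a \<or> s = lower w (fst a) & (y = up a \<or> y = lo a))"
proof -
 obtain e k where ek: "a = (e, k)" by (cases a)
 have e: "e \<in> edges w" and x: "xc (e, k) y = x" using a ek by (auto simp: ins_at_def outs_at_def below_def above_def crossings_def)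
 have pt: "edge_point w e (y - of_int k) = annulus_point x y" using edge_point_xc[of "(e, k)" y] x by simp
 consider "lo a < y & y < up a" | "y = up a" | "y = lo a"
  using a by (force simp: ins_at_def outs_at_def below_def above_def)
 then show ?thesis
 proof cases
  case 1
  then show ?thesis using pt ek by (intro bexI[of _ "y - of_int k"]) (auto intro!: interior_nonvertex simp: lo_def up_def)
 next
  case 2
  then have "y - of_int k = upper w e" using ek by (simp add: up_def)
  then have "target w e = annulus_point x y" using pt by (simp add: target_def)
  then have "essential_circle w e" using edge_facts(4)[OF e] v by auto
  then show ?thesis using 2 ek edge_facts(1)[OF e] \<open>target w e = _\<close>
   by (intro bexI[of _ "lower w e"]) (auto simp: nonvertex_heights_def essential_circle_def source_def)
 next
  case 3
  then have "y - of_int k = lower w e" using ek by (simp add: lo_def)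
  then have s: "source w e = annulus_point x y" using pt by (simp add: source_def)
  then have "essential_circle w e" using edge_facts(4)[OF e] v by auto
  then show ?thesis using 3 ek edge_facts(1)[OF e] s
   by (intro bexI[of _ "lower w e"]) (auto simp: nonvertex_heights_def essential_circle_def source_def)
 qed
qed

text \<open>By injectivity a single edge is involved: either its strand passes through the point, or
  the point is the base point of a circle and one lift is succeeded by another.\<close>

lemma at_nonvertex:
 assumes v: "annulus_point x y ~: vertices w" and ne: "ins_at y x Un outs_at y x ~= {}"
 shows "EX a b. ins_at y x = {a} & outs_at y x = {b} & fst a = fst b & (a = b \<or> lo b = y)"
proof -
 from ne obtain c where c: "c \<in> ins_at y x Un outs_at y x" by blast
 from at_nonvertex_rep[OF v c] obtain s where s: "s \<in> nonvertex_heights w (fst c)" "edge_point w (fst c) s = annulus_point x y"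
  "s = y - of_int (snd c) & lo c < y & y < up c \<or> s = lower w (fst c) & (y = up c \<or> y = lo c)" by blast
 define e where "e = fst c"
 have e: "e \<in> edges w" using c by (auto simp: e_def ins_at_def outs_at_def below_def above_def crossings_def)
 have all: "fst d = e & (if s = lower w e then y = up d \<or> y = lo d else s = y - of_int (snd d) & lo d < y & y < up d)"
  if d: "d \<in> ins_at y x Un outs_at y x" for d
 proof -
  from at_nonvertex_rep[OF v d] obtain r where r: "r \<in> nonvertex_heights w (fst d)" "edge_point w (fst d) r = annulus_point x y"
   "r = y - of_int (snd d) & lo d < y & y < up d \<or> r = lower w (fst d) & (y = up d \<or> y = lo d)" by blast
  have "fst d \<in> edges w" using d by (auto simp: ins_at_def outs_at_def below_def above_def crossings_def)
  moreover have "edge_point w (fst d) r = edge_point w e s" unfolding r(2) e_def s(2) ..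
  ultimately have de: "fst d = e" "r = s" using nonvertex_inj[OF _ e r(1) s(1)[folded e_def]] by blast+
  have "s ~= lower w e" if "s = y - of_int (snd d)" "lo d < y"
   using that de(1) by (simp add: lo_def)
  then show ?thesis using r(3) de by metis
 qed
 show ?thesis
 proof (cases "s = lower w e")
  case False
  then have c': "s = y - of_int (snd c)" "lo c < y" "y < up c" using all[OF c] by auto
  have "d = c" if "d \<in> ins_at y x Un outs_at y x" for d
   using all[OF that] False c' by (auto simp: prod_eq_iff e_def)
  moreover have "c \<in> ins_at y x" "c \<in> outs_at y x" using c c' by (auto simp: ins_at_def outs_at_def below_def above_def)
  ultimately have "ins_at y x = {c}" "outs_at y x = {c}" by auto
  then show ?thesis by blast
 next
  case True
  have src: "source w e = annulus_point x y" using s(2) True by (simp add: e_def source_def)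
  then have circ: "essential_circle w e" using edge_facts(4)[OF e] v by auto
  then have tgt: "target w e = annulus_point x y" using src by (simp add: essential_circle_def)
  from height_shift[of "xcoord w e (lower w e)" "lower w e" x y] src obtain k :: int where
   k: "lower w e + of_int k = y" "xcoord w e (lower w e) = x" by (auto simp: source_def edge_point_def)
  from height_shift[of "xcoord w e (upper w e)" "upper w e" x y] tgt obtain l :: int where
   l: "upper w e + of_int l = y" "xcoord w e (upper w e) = x" by (auto simp: target_def edge_point_def)
  have kb: "(e, k) \<in> outs_at y x" using k e edge_facts(1)[OF e]
   by (auto simp: outs_at_def above_def crossings_def lo_def up_def xc_def)
  have la: "(e, l) \<in> ins_at y x" using l e edge_facts(1)[OF e]
   by (auto simp: ins_at_def below_def crossings_def lo_def up_def xc_def)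
  have "d = (e, l)" if d: "d \<in> ins_at y x" for d
  proof -
   have "fst d = e" "y = up d" using all[of d] d True by (auto simp: ins_at_def below_def)
   then show ?thesis using l(1) by (auto simp: prod_eq_iff up_def)
  qed
  moreover have "d = (e, k)" if d: "d \<in> outs_at y x" for d
  proof -
   have "fst d = e" "y = lo d" using all[of d] d True by (auto simp: outs_at_def above_def)
   then show ?thesis using k(1) by (auto simp: prod_eq_iff lo_def)
  qed
  ultimately have "ins_at y x = {(e, l)}" "outs_at y x = {(e, k)}" using kb la by blast+
  then show ?thesis using k(1) by (intro exI[of _ "(e, l)"] exI[of _ "(e, k)"]) (simp add: lo_def)
 qed
qed

end

section \<open>Passing one special height\<close>

context annular_graph begin

text \<open>The case \<open>None\<close> is the passage through the base point of a circle: the lift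
  changes while the edge stays the same.\<close>

fun wok :: "('e \<times> int) list => ('e \<times> int) list => (real \<times> complex) option => bool" where
 "wok ins outs None = (EX a b. ins = [a] & outs = [b] & fst a = fst b)"
| "wok ins outs (Some v) =
  ((v \<in> merges w & (EX a b c. ins = [a, b] & outs = [c] & fst a = left_edge w v & fst b = right_edge w v &
    fst a ~= fst b & in_edges w v = {fst a, fst b} & out_edges w v = {fst c})) \<or>
  (v \<in> splits w & (EX a b c. ins = [a] & outs = [b, c] & fst b ~= fst c &
    in_edges w v = {fst a} & out_edges w v = {fst b, fst c})))"

lemma vertex_kind: "v \<in> vertices w ==> v \<in> merges w \<or> v \<in> splits w"
 using aw unfolding annular_web_def by blast

lemma merges_splits_disjoint: "merges w Int splits w = {}"
 by (auto simp: merges_def splits_def)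

text \<open>The order of the two strands is constant below the vertex, so the germ condition in
  \<open>left_of_below_target\<close> can be tested at the single height y1.\<close>

lemma left_of_iff:
 assumes ab: "a \<in> crossings" "b \<in> crossings" "a ~= b" "up a = y0" "up b = y0" "lo a < y1" "lo b < y1" "y1 < y0"
 shows "left_of_below_target w (fst a) (fst b) \<longleftrightarrow> xc a y1 < xc b y1"
proof -
 have eq: "xcoord w (fst c) (upper w (fst c) - d) = xc c (y0 - d)" if "up c = y0" for c d
 proof -
  have "upper w (fst c) - d = y0 - d - of_int (snd c)" using that by (simp add: up_def)
  then show ?thesis unfolding xc_def by (simp only:)
 qed
 show ?thesis unfolding left_of_below_target_def eq[OF ab(4)] eq[OF ab(5)]
 proof
  assume "\<forall>\<^sub>F d in at_right 0. xc a (y0 - d) < xc b (y0 - d)"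
  moreover have "\<forall>\<^sub>F d in at_right 0. d \<in> {0<..<y0 - y1}"
   using ab by (intro eventually_at_right_real) auto
  ultimately have "\<forall>\<^sub>F d in at_right 0. xc a (y0 - d) < xc b (y0 - d) & d \<in> {0<..<y0 - y1}"
   by (rule eventually_conj)
  then obtain d where "xc a (y0 - d) < xc b (y0 - d)" "d \<in> {0<..<y0 - y1}"
   using eventually_happens[of _ "at_right (0::real)"] by (auto simp: trivial_limit_at_right_real)
  then show "xc a y1 < xc b y1"
   using xc_order_backwards[of a b y1 "y0 - d"] ab by auto
 next
  assume lt: "xc a y1 < xc b y1"
  have "\<forall>\<^sub>F d in at_right 0. d \<in> {0<..<y0 - y1}"
   using ab by (intro eventually_at_right_real) auto
  then show "\<forall>\<^sub>F d in at_right 0. xc a (y0 - d) < xc b (y0 - d)"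
  proof (rule eventually_mono)
   fix d assume "d \<in> {0<..<y0 - y1}"
   then show "xc a (y0 - d) < xc b (y0 - d)"
    using xc_order_forwards[of a b y1 "y0 - d"] ab lt by auto
  qed
 qed
qed

lemma left_of_irrefl: "\<not> left_of_below_target w e e"
 by (simp add: left_of_below_target_def trivial_limit_at_right_real)

lemma left_right_edge:
 assumes ab: "a \<in> crossings" "b \<in> crossings" "a ~= b" "up a = y0" "up b = y0" "lo a < y1" "lo b < y1" "y1 < y0"
  and lt: "xc a y1 < xc b y1" and ins: "in_edges w v = {fst a, fst b}"
 shows "left_edge w v = fst a" "right_edge w v = fst b"
proof -
 have 1: "left_of_below_target w (fst a) (fst b)" using left_of_iff[OF ab] lt by simp
 have 2: "\<not> left_of_below_target w (fst b) (fst a)"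
  using left_of_iff[of b a y0 y1] ab lt by simp
 show "left_edge w v = fst a" unfolding left_edge_def ins
  by (rule the_equality) (use 1 2 left_of_irrefl in auto)
 show "right_edge w v = fst b" unfolding right_edge_def ins
  by (rule the_equality) (use 1 2 left_of_irrefl in auto)
qed

lemma list_of_card1: "distinct l ==> card (set l) = 1 ==> EX a. l = [a]"
 by (metis card_1_singletonE distinct_card length_0_conv length_Suc_conv One_nat_def)

lemma list_of_card2: "distinct l ==> card (set l) = 2 ==> EX a b. l = [a, b] & a ~= b"
proof -
 assume d: "distinct l" "card (set l) = 2"
 then have "length l = Suc (Suc 0)" by (simp add: distinct_card)
 then obtain a b where "l = [a, b]" by (auto simp: length_Suc_conv)
 then show ?thesis using d by auto
qed

lemma ins_outs_nonempty: "ins_at y x ~= {} \<longleftrightarrow> outs_at y x ~= {}"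
proof (cases "annulus_point x y \<in> vertices w")
 case True
 then have "card (in_edges w (annulus_point x y)) > 0" "card (out_edges w (annulus_point x y)) > 0"
  using vertex_kind[OF True] by (auto simp: merges_def splits_def)
 then have "in_edges w (annulus_point x y) ~= {}" "out_edges w (annulus_point x y) ~= {}" by auto
 then show ?thesis using ins_at_vertex(1)[OF True] outs_at_vertex(1)[OF True]
  by (auto simp: bij_betw_def)
next
 case False
 then show ?thesis using at_nonvertex[OF False] by fastforce
qed

lemma vertex_ins_nonempty: "annulus_point x y \<in> vertices w ==> ins_at y x ~= {}"
proof -
 assume v: "annulus_point x y \<in> vertices w"
 then have "card (in_edges w (annulus_point x y)) > 0"
  using vertex_kind[OF v] by (auto simp: merges_def splits_def)
 then show "ins_at y x ~= {}" using ins_at_vertex(1)[OF v] by (auto simp: bij_betw_def)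
qed

text \<open>Strands are grouped by their position x at the height y0: \<open>I x\<close> arrives at
  x and \<open>J x\<close> leaves it. Both neighbouring levels are sorted by this position, so they
  are concatenations of these groups over the same list of positions, and the groups can be
  exchanged one at a time.\<close>

lemma height_step:
 assumes y: "y1 < y0" "y0 < y2" and g1: "generic_on {y1..<y0}" and g2: "generic_on {y0<..y2}"
  and L1: "level y1 L1" and L2: "level y2 L2" and A: "A <= {a. lo a < y0}"
 shows "EX ss. evolve wok A L1 ss L2 & all_outs ss = {a \<in> crossings. lo a = y0} &
  distinct (all_vertices ss) & set (all_vertices ss) = {v \<in> vertices w. EX x. v = annulus_point x y0}"
proof -
 define f where "f a = xc a y0" for a
 have s1: "set L1 = below y0" using L1 active_below[OF g1 y(1)] by (simp add: level_def)
 have s2: "set L2 = above y0" using L2 active_above[OF g2 y(2)] by (simp add: level_def)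
 have d: "distinct L1" "distinct L2" using L1 L2 by (auto simp: level_def)
 have so1: "sorted_wrt (%a b. xc a y1 < xc b y1) L1" and so2: "sorted_wrt (%a b. xc a y2 < xc b y2) L2"
  using L1 L2 by (auto simp: level_def)
 have m1: "a \<in> crossings" "lo a < y1" "y0 <= up a" if "a \<in> set L1" for a
 proof -
  have "a \<in> active y1" "a \<in> below y0" using that L1 s1 by (auto simp: level_def)
  then show "a \<in> crossings" "lo a < y1" "y0 <= up a" by (auto simp: active_def below_def)
 qed
 have m2: "a \<in> crossings" "lo a <= y0" "y2 < up a" if "a \<in> set L2" for a
 proof -
  have "a \<in> active y2" "a \<in> above y0" using that L2 s2 by (auto simp: level_def)
  then show "a \<in> crossings" "lo a <= y0" "y2 < up a" by (auto simp: active_def above_def)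
 qed
 have sf1: "sorted (map f L1)"
  unfolding sorted_map
 proof (rule sorted_wrt_mono_rel[OF _ so1])
  fix a b assume ab: "a \<in> set L1" "b \<in> set L1" "xc a y1 < xc b y1"
  show "f a <= f b"
  proof (rule ccontr)
   assume "\<not> f a <= f b"
   then have "xc b y1 < xc a y1" using xc_order_backwards[of b a y1 y0] m1[OF ab(1)] m1[OF ab(2)] ab(3) y
    by (auto simp: f_def)
   then show False using ab by simp
  qed
 qed
 have sf2: "sorted (map f L2)"
  unfolding sorted_map
 proof (rule sorted_wrt_mono_rel[OF _ so2])
  fix a b assume ab: "a \<in> set L2" "b \<in> set L2" "xc a y2 < xc b y2"
  show "f a <= f b"
  proof (rule ccontr)
   assume "\<not> f a <= f b"
   then have "xc b y2 < xc a y2" using xc_order_forwards[of b a y0 y2] m2[OF ab(1)] m2[OF ab(2)] ab(3) y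
    by (auto simp: f_def)
   then show False using ab by simp
  qed
 qed
 define P where "P = sorted_list_of_set (f ` below y0)"
 have fin: "finite (f ` below y0)" using s1 by (metis finite_imageI List.finite_set)
 have setP: "set P = f ` below y0" and sP: "sorted_wrt (<) P" and dP: "distinct P"
  unfolding P_def using fin by (simp_all only: set_sorted_list_of_set strict_sorted_list_of_set distinct_sorted_list_of_set)
 have io: "x \<in> f ` below y0 \<longleftrightarrow> ins_at y0 x ~= {}" "x \<in> f ` above y0 \<longleftrightarrow> outs_at y0 x ~= {}" for x
  unfolding ins_at_def outs_at_def f_def by blast+
 have setP2: "set P = f ` above y0" 
 proof (rule set_eqI)
  fix x show "x \<in> set P \<longleftrightarrow> x \<in> f ` above y0"
   unfolding setP io(1) io(2) by (rule ins_outs_nonempty)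
 qed
 define I J where "I x = filter (%a. f a = x) L1" and "J x = filter (%a. f a = x) L2" for x
 have cI: "concat (map I P) = L1" unfolding I_def
  by (rule concat_filter_levels[OF sf1 sP]) (simp add: setP s1)
 have cJ: "concat (map J P) = L2" unfolding J_def
  by (rule concat_filter_levels[OF sf2 sP]) (simp add: setP2 s2)
 have sI: "set (I x) = ins_at y0 x" and sJ: "set (J x) = outs_at y0 x" and dI: "distinct (I x)" and dJ: "distinct (J x)" for x
  using d by (auto simp: I_def J_def ins_at_def outs_at_def s1 s2 f_def)
 define V where "V x = (if annulus_point x y0 \<in> vertices w then Some (annulus_point x y0) else None)" for x
 \<comment> \<open>At a vertex something changes: a strand in both groups would begin and end at the
   same height.\<close>
 have IJ_vertex: "I x ~= J x" if vx: "annulus_point x y0 \<in> vertices w" for x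
 proof
  assume "I x = J x"
  then have eq: "ins_at y0 x = outs_at y0 x" using sI[of x] sJ[of x] by simp
  have "EX a. a \<in> ins_at y0 x" using vertex_ins_nonempty[OF vx] unfolding ex_in_conv .
  then obtain a where a: "a \<in> ins_at y0 x" ..
  have "up a = y0" by (rule bspec[OF ins_at_vertex(2)[OF vx] a])
  moreover have "a \<in> outs_at y0 x" using a unfolding eq .
  then have "lo a = y0" by (rule bspec[OF outs_at_vertex(2)[OF vx]])
  moreover have "a \<in> crossings" using a unfolding ins_at_def below_def by blast
  ultimately show False using lo_less_up[of a] by simp
 qed
 have step: "I x = J x \<or> wok (I x) (J x) (V x) & distinct (J x) & set (J x) Int A = {}" if x: "x \<in> set P" for x
 proof (cases "annulus_point x y0 \<in> vertices w")
  case True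
  define v where "v = annulus_point x y0"
  have bi: "bij_betw fst (set (I x)) (in_edges w v)" and bo: "bij_betw fst (set (J x)) (out_edges w v)"
   unfolding sI sJ v_def by (rule ins_at_vertex(1)[OF True], rule outs_at_vertex(1)[OF True])
  have lo: "lo a = y0" if "a \<in> set (J x)" for a using that outs_at_vertex(2)[OF True] sJ by blast
  have fresh: "set (J x) Int A = {}" using lo A by fastforce
  have vk: "v \<in> merges w \<or> v \<in> splits w" using vertex_kind True by (simp add: v_def)
  have "wok (I x) (J x) (Some v)"
  proof (cases "v \<in> merges w")
   case m: True
   then have "card (set (I x)) = 2" "card (set (J x)) = 1"
    using bij_betw_same_card[OF bi] bij_betw_same_card[OF bo] by (auto simp: merges_def)
   then obtain a b c where abc: "I x = [a, b]" "a ~= b" "J x = [c]"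
    using list_of_card1[OF dJ[of x]] list_of_card2[OF dI[of x]] by metis
   have ie: "in_edges w v = {fst a, fst b}" "out_edges w v = {fst c}" "fst a ~= fst b"
    using bi bo abc by (auto simp: bij_betw_def)
   have ab: "a \<in> set L1" "b \<in> set L1" using abc(1) unfolding I_def
    by (metis filter_is_subset list.set_intros subset_iff)+
   have up: "up a = y0" "up b = y0" using abc(1) sI[of x] ins_at_vertex(2)[OF True] by auto
   have "sorted_wrt (%a b. xc a y1 < xc b y1) (I x)" unfolding I_def using so1 by (rule sorted_wrt_filter)
   then have lt: "xc a y1 < xc b y1" using abc by simp
   note lr = left_right_edge[OF m1(1)[OF ab(1)] m1(1)[OF ab(2)] abc(2) up m1(2)[OF ab(1)] m1(2)[OF ab(2)] y(1) lt ie(1)]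
   show ?thesis using m abc ie lr by auto
  next
   case False
   then have s: "v \<in> splits w" using vk by blast
   then have "card (set (I x)) = 1" "card (set (J x)) = 2"
    using bij_betw_same_card[OF bi] bij_betw_same_card[OF bo] by (auto simp: splits_def)
   then obtain a b c where abc: "J x = [b, c]" "b ~= c" "I x = [a]"
    using list_of_card1[OF dI[of x]] list_of_card2[OF dJ[of x]] by metis
   have "in_edges w v = {fst a}" "out_edges w v = {fst b, fst c}" "fst b ~= fst c"
    using bi bo abc by (auto simp: bij_betw_def)
   then show ?thesis using s abc by auto
  qed
  then show ?thesis using fresh dJ True by (simp add: V_def v_def)
 next
  case False
  have "ins_at y0 x Un outs_at y0 x ~= {}" using x io(1)[of x] setP by simp
  from at_nonvertex[OF False this] obtain a b where ab: "ins_at y0 x = {a}" "outs_at y0 x = {b}" "fst a = fst b" "a = b \<or> lo b = y0"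
   by blast
  have Ix: "I x = [a]" using list_of_card1[OF dI[of x]] sI[of x] ab(1) by fastforce
  have Jx: "J x = [b]" using list_of_card1[OF dJ[of x]] sJ[of x] ab(2) by fastforce
  show ?thesis
  proof (cases "a = b")
   case True then show ?thesis using Ix Jx by simp
  next
   case ne: False
   then have "lo b = y0" using ab by simp
   then have "b ~: A" using A by auto
   then show ?thesis using Ix Jx ab(3) False by (simp add: V_def)
  qed
 qed
 have disj: "set (J x) Int set (J x') = {}" if "x ~= x'" for x x' using that by (auto simp: J_def)
 obtain ss where ss: "evolve wok A ([] @ concat (map I P)) ss ([] @ concat (map J P))"
  "all_outs ss = (\<Union>x\<in>{x \<in> set P. I x ~= J x}. set (J x))"
  "all_vertices ss = concat (map (%x. if I x = J x then [] else (case V x of None => [] | Some v => [v])) P)"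
  using evolve_concat[of P I J wok V A "[]", OF step disj dP] by blast
 have oo: "all_outs ss = {a \<in> crossings. lo a = y0}"
 proof (intro equalityI subsetI)
  fix a assume "a \<in> all_outs ss"
  then obtain x where x: "x \<in> set P" "I x ~= J x" "a \<in> set (J x)" unfolding ss(2) by blast
  have "a \<in> crossings" using x(3) sJ by (auto simp: outs_at_def above_def)
  moreover have "lo a = y0"
  proof (cases "annulus_point x y0 \<in> vertices w")
   case True
   then show ?thesis using x(3) sJ outs_at_vertex(2)[OF True] by blast
  next
   case False
   have "ins_at y0 x Un outs_at y0 x ~= {}" using x io(1)[of x] setP by simp
   from at_nonvertex[OF False this] obtain a' b where ab: "ins_at y0 x = {a'}" "outs_at y0 x = {b}" "a' = b \<or> lo b = y0"
    by blast
   have "I x = [a']" using list_of_card1[OF dI[of x]] sI[of x] ab(1) by fastforce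
   moreover have "J x = [b]" using list_of_card1[OF dJ[of x]] sJ[of x] ab(2) by fastforce
   ultimately show ?thesis using x ab by auto
  qed
  ultimately show "a \<in> {a \<in> crossings. lo a = y0}" by simp
 next
  fix a assume "a \<in> {a \<in> crossings. lo a = y0}"
  then have a: "a \<in> crossings" "lo a = y0" by auto
  then have "a \<in> above y0" "a ~: below y0" using lo_less_up[of a] by (auto simp: above_def below_def)
  then have "a \<in> outs_at y0 (f a)" "a ~: ins_at y0 (f a)" "f a \<in> set P"
   using setP2 by (auto simp: outs_at_def ins_at_def f_def)
  moreover from this have "I (f a) ~= J (f a)" using sI[of "f a"] sJ[of "f a"] by force
  ultimately show "a \<in> all_outs ss" unfolding ss(2) using sJ[of "f a"] by blast
 qed
 have av: "all_vertices ss = map (%x. annulus_point x y0) (filter (%x. annulus_point x y0 \<in> vertices w) P)"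
 proof -
  have "(%x. if I x = J x then [] else (case V x of None => [] | Some v => [v]))
   = (%x. if annulus_point x y0 \<in> vertices w then [annulus_point x y0] else [])"
   using IJ_vertex by (auto simp: V_def fun_eq_iff)
  moreover have "concat (map (%x. if annulus_point x y0 \<in> vertices w then [annulus_point x y0] else []) Q)
   = map (%x. annulus_point x y0) (filter (%x. annulus_point x y0 \<in> vertices w) Q)" for Q
   by (induction Q) auto
  ultimately show ?thesis unfolding ss(3) by simp
 qed
 have dd: "distinct (all_vertices ss)"
  unfolding av distinct_map using dP by (auto intro!: inj_onI simp: annulus_point_def)
 have vv: "set (all_vertices ss) = {v \<in> vertices w. EX x. v = annulus_point x y0}"
 proof -
  have "x \<in> set P" if "annulus_point x y0 \<in> vertices w" for x
   using vertex_ins_nonempty[OF that] io(1)[of x] setP by simp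
  then show ?thesis unfolding av by auto
 qed
 have ev: "evolve wok A L1 ss L2" using ss(1) unfolding append_Nil cI cJ .
 show ?thesis by (intro exI[of _ ss] conjI ev oo dd vv)
qed

lemma vertex_up:
 assumes "annulus_point x y \<in> vertices w" shows "\<exists>a\<in>crossings. up a = y"
proof -
 have "EX a. a \<in> ins_at y x" using vertex_ins_nonempty[OF assms] unfolding ex_in_conv .
 then obtain a where a: "a \<in> ins_at y x" ..
 have "up a = y" by (rule bspec[OF ins_at_vertex(2)[OF assms] a])
 moreover have "a \<in> crossings" using a unfolding ins_at_def below_def by blast
 ultimately show ?thesis by blast
qed

section \<open>Sweeping an interval of heights and a full turn\<close>

definition specials :: "real => real => real set" where
 "specials y1 y2 = {y. y1 < y & y < y2 & (\<exists>a\<in>crossings. y = lo a \<or> y = up a)}"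

lemma finite_specials: "finite (specials y1 y2)"
proof (rule finite_subset)
 show "specials y1 y2 <= lo ` {a \<in> crossings. lo a < y2 & y1 < up a} Un up ` {a \<in> crossings. lo a < y2 & y1 < up a}"
 proof
  fix y assume "y \<in> specials y1 y2"
  then obtain a where a: "y1 < y" "y < y2" "a \<in> crossings" "y = lo a \<or> y = up a" by (auto simp: specials_def)
  then have "a \<in> {a \<in> crossings. lo a < y2 & y1 < up a}" using lo_less_up[of a] by auto
  then show "y \<in> lo ` {a \<in> crossings. lo a < y2 & y1 < up a} Un up ` {a \<in> crossings. lo a < y2 & y1 < up a}"
   using a(4) by blast
 qed
qed (intro finite_UnI finite_imageI finite_window)

lemma next_generic: "y0 < y2 ==> EX y'. y0 < y' & y' < y2 & generic_on {y0<..y'}"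
proof -
 assume y: "y0 < y2"
 define m where "m = Min (insert y2 (specials y0 y2))"
 have m: "m \<in> insert y2 (specials y0 y2)" "!!z. z \<in> specials y0 y2 ==> m <= z" "m <= y2"
 proof -
  have fin: "finite (insert y2 (specials y0 y2))" using finite_specials by simp
  show "m \<in> insert y2 (specials y0 y2)" unfolding m_def by (rule Min_in[OF fin]) simp
  show "!!z. z \<in> specials y0 y2 ==> m <= z" "m <= y2" unfolding m_def by (rule Min_le[OF fin], simp)+
 qed
 have m0: "y0 < m" using m(1) y by (auto simp: specials_def)
 have "generic_on {y0<..(y0 + m) / 2}"
  unfolding generic_on_def
 proof (intro ballI)
  fix a assume a: "a \<in> crossings"
  have "z ~: {y0<..(y0 + m) / 2}" if "z = lo a \<or> z = up a" for z
  proof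
   assume z: "z \<in> {y0<..(y0 + m) / 2}"
   then have "z \<in> specials y0 y2" using a that m0 m(3) by (auto simp: specials_def)
   then show False using m(2)[of z] z m0 by auto
  qed
  then show "lo a ~: {y0<..(y0 + m) / 2} & up a ~: {y0<..(y0 + m) / 2}" by blast
 qed
 then show ?thesis using m0 m(3) y by (intro exI[of _ "(y0 + m) / 2"]) (auto simp: field_simps)
qed

text \<open>Induction on the number of special heights in between. Distinctness of the vertices is
  claimed only for length at most 1, since a longer sweep meets the same vertex again one turn
  later. New strands begin above y1 and are therefore not in \<open>A\<close>.\<close>

lemma evolve_levels:
 assumes "y1 < y2" "generic_on {y1}" "generic_on {y2}" "level y1 L1" "level y2 L2" "A <= {a. lo a < y1}"
 shows "EX ss. evolve wok A L1 ss L2 & all_outs ss = {a \<in> crossings. y1 < lo a & lo a < y2} &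
  (y2 - y1 <= 1 --> distinct (all_vertices ss)) &
  set (all_vertices ss) = {v \<in> vertices w. EX x y. y1 < y & y < y2 & v = annulus_point x y}"
 using assms
proof (induction "card (specials y1 y2)" arbitrary: y1 L1 A rule: less_induct)
 case less
 show ?case
 proof (cases "specials y1 y2 = {}")
  case True
  have g: "generic_on {y1..y2}"
   unfolding generic_on_def
  proof (intro ballI)
   fix a assume a: "a \<in> crossings"
   have "z ~: {y1..y2}" if z: "z = lo a \<or> z = up a" for z
   proof
    assume "z \<in> {y1..y2}"
    moreover have "z ~= y1" "z ~= y2" using z a less.prems(2,3) unfolding generic_on_def by blast+
    ultimately have "z \<in> specials y1 y2" using z a by (auto simp: specials_def)
    then show False using True by simp
   qed
   then show "lo a ~: {y1..y2} & up a ~: {y1..y2}" by blast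
  qed
  then have "L1 = L2" using level_const[OF g less.prems(1,4)] level_unique less.prems(5) by blast
  moreover have "{a \<in> crossings. y1 < lo a & lo a < y2} = {}" using g unfolding generic_on_def by force
  moreover have "{v \<in> vertices w. EX x y. y1 < y & y < y2 & v = annulus_point x y} = {}"
  proof -
   have "False" if v: "annulus_point x y \<in> vertices w" "y1 < y" "y < y2" for x y
   proof -
    obtain a where "a \<in> crossings" "up a = y" using vertex_up[OF v(1)] by blast
    then show False using g v unfolding generic_on_def by force
   qed
   then show ?thesis by blast
  qed
  ultimately show ?thesis by (intro exI[of _ "[]"]) simp
 next
  case False
  define y0 where "y0 = Min (specials y1 y2)"
  have y0: "y0 \<in> specials y1 y2" "!!z. z \<in> specials y1 y2 ==> y0 <= z"
   unfolding y0_def using finite_specials False by auto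
  have y: "y1 < y0" "y0 < y2" using y0(1) by (auto simp: specials_def)
  obtain y' where y': "y0 < y'" "y' < y2" "generic_on {y0<..y'}" using next_generic[OF y(2)] by blast
  have gy': "generic_on {y'}" using y' unfolding generic_on_def by auto
  have g1: "generic_on {y1..<y0}" unfolding generic_on_def
  proof (intro ballI)
   fix a assume a: "a \<in> crossings"
   have "z ~: {y1..<y0}" if z: "z = lo a \<or> z = up a" for z
   proof
    assume zz: "z \<in> {y1..<y0}"
    moreover have "z ~= y1" using z a less.prems(2) unfolding generic_on_def by blast
    ultimately have "z \<in> specials y1 y2" using z a y by (auto simp: specials_def)
    then show False using y0(2)[of z] zz by simp
   qed
   then show "lo a ~: {y1..<y0} & up a ~: {y1..<y0}" by blast
  qed
  obtain L' where L': "level y' L'" using level_exists by blast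
  obtain s1 where s1: "evolve wok A L1 s1 L'" "all_outs s1 = {a \<in> crossings. lo a = y0}"
   "distinct (all_vertices s1)" "set (all_vertices s1) = {v \<in> vertices w. EX x. v = annulus_point x y0}"
  proof -
   have "A <= {a. lo a < y0}" using less.prems(6) y(1) by fastforce
   from height_step[OF y(1) y'(1) g1 y'(3) less.prems(4) L' this] show ?thesis using that by blast
  qed
  have "specials y' y2 \<subset> specials y1 y2"
  proof
   show "specials y' y2 <= specials y1 y2" using y y' by (auto simp: specials_def)
   have "y0 ~: specials y' y2" using y' by (simp add: specials_def)
   then show "specials y' y2 ~= specials y1 y2" using y0(1) by blast
  qed
  then have card: "card (specials y' y2) < card (specials y1 y2)" by (rule psubset_card_mono[OF finite_specials])
  have A': "A Un all_outs s1 <= {a. lo a < y'}" 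
  proof
   fix a assume "a \<in> A Un all_outs s1"
   then have "lo a < y1 \<or> lo a = y0" using less.prems(6) s1(2) by blast
   then show "a \<in> {a. lo a < y'}" using y(1) y'(1) by auto
  qed
  obtain s2 where s2: "evolve wok (A Un all_outs s1) L' s2 L2"
   "all_outs s2 = {a \<in> crossings. y' < lo a & lo a < y2}" "y2 - y' <= 1 --> distinct (all_vertices s2)"
   "set (all_vertices s2) = {v \<in> vertices w. EX x y. y' < y & y < y2 & v = annulus_point x y}"
   using less.hyps[OF card y'(2) gy' less.prems(3) L' less.prems(5) A'] by blast
  have mid: "z = y0 \<or> y' < z" if "y1 < z" "z < y2" "a \<in> crossings" "z = lo a \<or> z = up a" for z a
  proof -
   have "z >= y0" using y0(2) that by (auto simp: specials_def)
   moreover have "z ~: {y0<..y'}" using y'(3) that(3,4) unfolding generic_on_def by blast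
   ultimately show ?thesis by auto
  qed
  have ev: "evolve wok A L1 (s1 @ s2) L2" by (rule evolve_append[OF s1(1) s2(1)])
  have oo: "all_outs (s1 @ s2) = {a \<in> crossings. y1 < lo a & lo a < y2}"
  proof (intro equalityI subsetI)
   fix a assume a: "a \<in> {a \<in> crossings. y1 < lo a & lo a < y2}"
   then show "a \<in> all_outs (s1 @ s2)" using mid[of "lo a" a] s1(2) s2(2) by simp
  qed (use s1(2) s2(2) y y' in auto)
  have vv: "set (all_vertices (s1 @ s2)) = {v \<in> vertices w. EX x y. y1 < y & y < y2 & v = annulus_point x y}"
  proof -
   have "y = y0 \<or> y' < y" if v: "annulus_point x y \<in> vertices w" "y1 < y" "y < y2" for x y
    using vertex_up[OF v(1)] mid[OF v(2,3)] by blast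
   then have "{v \<in> vertices w. EX x y. y1 < y & y < y2 & v = annulus_point x y} =
    {v \<in> vertices w. EX x. v = annulus_point x y0} Un {v \<in> vertices w. EX x y. y' < y & y < y2 & v = annulus_point x y}"
   proof (intro equalityI subsetI)
    fix v assume "v \<in> {v \<in> vertices w. EX x. v = annulus_point x y0} Un
     {v \<in> vertices w. EX x y. y' < y & y < y2 & v = annulus_point x y}"
    then consider x where "v \<in> vertices w" "v = annulus_point x y0"
     | x z where "v \<in> vertices w" "y' < z" "z < y2" "v = annulus_point x z" by blast
    then show "v \<in> {v \<in> vertices w. EX x y. y1 < y & y < y2 & v = annulus_point x y}"
    proof cases
     case 2
     then have "y1 < z" using y y' by linarith
     then show ?thesis using 2 by blast
    qed (use y in blast)
   qed blast
   then show ?thesis unfolding all_vertices_simps set_append s1(4) s2(4) by (rule sym)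
  qed
  have dd: "distinct (all_vertices (s1 @ s2))" if le1: "y2 - y1 <= 1"
  proof -
   have "set (all_vertices s1) Int set (all_vertices s2) = {}"
   proof -
    \<comment> \<open>Equal points of the annulus have heights differing by an integer, which here
      would lie strictly between 0 and 1.\<close>
    have False if hy: "annulus_point x y0 = annulus_point x' z" "y' < z" "z < y2" for x x' z
    proof -
     obtain k :: int where k: "z = y0 + of_int k" using conjunct2[OF iffD1[OF annulus_point_eq_iff hy(1)]] ..
     have "0 < (of_int k :: real)" "(of_int k :: real) < 1" using k hy(2,3) y(1) y'(1) le1 by linarith+
     then show False by simp
    qed
    note F = this
    have "v ~: set (all_vertices s2)" if v: "v \<in> set (all_vertices s1)" for v
    proof
     assume v2: "v \<in> set (all_vertices s2)"
     obtain x where x: "v = annulus_point x y0" using v unfolding s1(4) by blast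
     obtain x' z where "y' < z" "z < y2" "v = annulus_point x' z" using v2 unfolding s2(4) by blast
     then show False using F[of x x' z] x by simp
    qed
    then show ?thesis by blast
   qed
   moreover have "y2 - y' <= 1" using le1 y(1) y'(1) by linarith
   ultimately show ?thesis unfolding all_vertices_simps distinct_append using s1(3) s2(3) by blast
  qed
  show ?thesis by (intro exI[of _ "s1 @ s2"] conjI impI ev oo dd vv)
 qed
qed

text \<open>The generator of the deck transformations.\<close>

definition sh :: "'e \<times> int => 'e \<times> int" where "sh a = (fst a, snd a + 1)"

lemma sh_simps [simp]: "lo (sh a) = lo a + 1" "up (sh a) = up a + 1" "xc (sh a) (y + 1) = xc a y" "fst (sh a) = fst a"
 "sh a \<in> crossings \<longleftrightarrow> a \<in> crossings" "sh a = sh b \<longleftrightarrow> a = b"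
 by (auto simp: sh_def lo_def up_def xc_def crossings_def prod_eq_iff)

lemma sh_surj: "EX b. a = sh b"
 by (rule exI[of _ "(fst a, snd a - 1)"]) (simp add: sh_def)

lemma level_shift: "level y L ==> level (y + 1) (map sh L)"
proof -
 assume L: "level y L"
 have "active (y + 1) = sh ` active y"
 proof (intro equalityI subsetI)
  fix a assume a: "a \<in> active (y + 1)"
  obtain b where "a = sh b" using sh_surj by blast
  then show "a \<in> sh ` active y" using a by (auto simp: active_def)
 qed (auto simp: active_def)
 then show ?thesis using L unfolding level_def by (auto simp: distinct_map sorted_wrt_map intro!: inj_onI)
qed

lemma generic_shift: "generic_on {y} ==> generic_on {y + 1}"
 unfolding generic_on_def using sh_surj by (metis add_right_cancel sh_simps(1,2,5) singletonD singletonI)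

text \<open>The cut may run through base points of circles, where both ends of one edge lie on it.
  The strands just above it avoid this ambiguity; they meet the same edges, and continuity keeps the
  order down to the cut.\<close>

lemma cut_edges_level:
 assumes h: "radial_cut w h" and y: "h < y" "generic_on {h<..y}" and L: "level y L"
 shows "cut_edges w h = map fst L"
proof -
 have nv: "annulus_point x h ~: vertices w" for x
 proof
  assume v: "annulus_point x h \<in> vertices w"
  then obtain a where a: "a \<in> ins_at h x" using vertex_ins_nonempty by blast
  then have "a \<in> crossings" and c: "xc a h = x" "lo a < h" "h <= up a" by (auto simp: ins_at_def below_def)
  then have "xcoord w (fst a) (h - of_int (snd a)) \<in> {0..1}"
   using edge_facts(5)[of "fst a"] by (auto simp: crossings_def lo_def up_def image_subset_iff)
  then have "annulus_point x h \<in> radial_segment h" using c(1) by (auto simp: radial_segment_def xc_def)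
  then show False using v h by (auto simp: radial_cut_def)
 qed
 have sL: "set L = above h" using L active_above[OF y(2,1)] by (simp add: level_def)
 have uniq: "a = b" if "a \<in> above h" "b \<in> above h" "xc a h = xc b h" for a b
 proof -
  have o: "a \<in> outs_at h (xc a h)" "b \<in> outs_at h (xc a h)" using that by (simp_all add: outs_at_def)
  then have ne: "ins_at h (xc a h) Un outs_at h (xc a h) ~= {}" by blast
  from at_nonvertex[OF nv ne] obtain c where "outs_at h (xc a h) = {c}" by blast
  then show ?thesis using o by simp
 qed
 have mem: "annulus_point x h \<in> edge_image w e & e \<in> edges w \<longleftrightarrow> (\<exists>a\<in>above h. fst a = e & xc a h = x)" for x e
 proof
  assume r: "annulus_point x h \<in> edge_image w e & e \<in> edges w"
  then obtain s where s: "lower w e <= s" "s <= upper w e" "annulus_point (xcoord w e s) s = annulus_point x h"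
   by (auto simp: edge_image_def edge_point_def)
  obtain k :: int where k: "s + of_int k = h" "xcoord w e s = x" using height_shift[OF s(3)] by blast
  then have c: "(e, k) \<in> crossings" "xc (e, k) h = x" "lo (e, k) <= h" "h <= up (e, k)"
   using r s by (auto simp: crossings_def xc_def lo_def up_def)
  show "\<exists>a\<in>above h. fst a = e & xc a h = x"
  proof (cases "h < up (e, k)")
   case True
   then show ?thesis using c by (intro bexI[of _ "(e, k)"]) (auto simp: above_def)
  next
   case False
   then have i: "(e, k) \<in> ins_at h x" using c lo_less_up[OF c(1)] by (auto simp: ins_at_def below_def)
   then have ne: "ins_at h x Un outs_at h x ~= {}" by blast
   from at_nonvertex[OF nv ne] obtain a b where "ins_at h x = {a}" "outs_at h x = {b}" "fst a = fst b" by blast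
   then have "b \<in> outs_at h x" "fst b = e" using i by auto
   then show ?thesis by (auto simp: outs_at_def)
  qed
 next
  assume "\<exists>a\<in>above h. fst a = e & xc a h = x"
  then obtain a where a: "a \<in> above h" "fst a = e" "xc a h = x" by blast
  have "edge_point w (fst a) (h - of_int (snd a)) = annulus_point x h" using edge_point_xc[of a h] a by simp
  moreover have "h - of_int (snd a) \<in> {lower w e..upper w e}" using a by (auto simp: above_def lo_def up_def)
  ultimately show "annulus_point x h \<in> edge_image w e & e \<in> edges w"
   using a by (auto simp: edge_image_def above_def crossings_def intro!: image_eqI[of _ _ "h - of_int (snd a)"])
 qed
 have pos: "cut_positions w h = (%a. xc a h) ` above h"
 proof -
  have "x \<in> cut_positions w h \<longleftrightarrow> (\<exists>e\<in>edges w. annulus_point x h \<in> edge_image w e)" for x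
  proof
   assume "\<exists>e\<in>edges w. annulus_point x h \<in> edge_image w e"
   then obtain e where e: "e \<in> edges w" "annulus_point x h \<in> edge_image w e" by blast
   then obtain s where s: "s \<in> {lower w e..upper w e}" "annulus_point (xcoord w e s) s = annulus_point x h"
    by (auto simp: edge_image_def edge_point_def)
   then have "xcoord w e s = x" using height_shift by blast
   then have "x \<in> {0..1}" using edge_facts(5)[OF e(1)] s(1) by blast
   then show "x \<in> cut_positions w h" using e by (auto simp: cut_positions_def radial_segment_def)
  qed (auto simp: cut_positions_def)
  note P = this
  show ?thesis
  proof (intro equalityI subsetI)
   fix x assume "x \<in> cut_positions w h"
   then obtain e where e: "e \<in> edges w" "annulus_point x h \<in> edge_image w e" using P[of x] by auto
   then have "\<exists>a\<in>above h. fst a = e & xc a h = x" using mem[of x e] by simp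
   then show "x \<in> (%a. xc a h) ` above h" by auto
  next
   fix x assume "x \<in> (%a. xc a h) ` above h"
   then obtain a where "a \<in> above h" "x = xc a h" by auto
   then have "annulus_point x h \<in> edge_image w (fst a) & fst a \<in> edges w" using mem[of x "fst a"] by blast
   then show "x \<in> cut_positions w h" using P[of x] by blast
  qed
 qed
 have "sorted_wrt (%a b. xc a h < xc b h) L"
 proof (rule sorted_wrt_mono_rel)
  show "sorted_wrt (%a b. xc a y < xc b y) L" using L by (simp add: level_def)
  fix a b assume ab: "a \<in> set L" "b \<in> set L" "xc a y < xc b y"
  have m: "a \<in> above h" "b \<in> above h" "a \<in> active y" "b \<in> active y" using ab sL L by (auto simp: level_def)
  show "xc a h < xc b h"
  proof (rule ccontr)
   assume "\<not> xc a h < xc b h"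
   then have "xc b h < xc a h" using uniq[OF m(1,2)] ab(3) by fastforce
   then have "xc b y < xc a y" using xc_order_forwards[of b a h y] m y ab(3)
    by (auto simp: active_def above_def)
   then show False using ab(3) by simp
  qed
 qed
 then have "sorted_wrt (<) (map (%a. xc a h) L)" by (simp add: sorted_wrt_map)
 moreover have fin: "finite (cut_positions w h)" unfolding pos sL[symmetric] by simp
 ultimately have "sorted_list_of_set (cut_positions w h) = map (%a. xc a h) L"
  by (intro strict_sorted_equal) (auto simp: pos sL)
 then have "cut_edges w h = map (%a. THE e. e \<in> edges w & annulus_point (xc a h) h \<in> edge_image w e) L"
  by (simp add: cut_edges_def)
 also have "... = map fst L"
 proof (rule map_cong[OF refl])
  fix a assume a: "a \<in> set L"
  show "(THE e. e \<in> edges w & annulus_point (xc a h) h \<in> edge_image w e) = fst a"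
  proof (rule the_equality)
   have a': "a \<in> above h" using a sL by simp
   then show "fst a \<in> edges w & annulus_point (xc a h) h \<in> edge_image w (fst a)"
    using mem[of "xc a h" "fst a"] by blast
   fix e assume "e \<in> edges w & annulus_point (xc a h) h \<in> edge_image w e"
   then have "\<exists>b\<in>above h. fst b = e & xc b h = xc a h" using mem[of "xc a h" e] by simp
   then obtain b where "b \<in> above h" "fst b = e" "xc b h = xc a h" by blast
   then show "e = fst a" using uniq[OF _ a'] by blast
  qed
 qed
 finally show ?thesis .
qed

text \<open>The sweep starts at a generic height y slightly above the cut and ends one turn later
  with the same level translated by \<open>sh\<close>. Every vertex has a representative height in
  the half-open unit interval starting at y, and genericity excludes y itself.\<close>

theorem scheme_exists:
 assumes h: "radial_cut w h"
 shows "EX y L ss. h < y & generic_on {y} & level y L & map fst L = cut_edges w h &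
  evolve wok (set L) L ss (map sh L) & all_outs ss = {a \<in> crossings. y < lo a & lo a < y + 1} &
  distinct (all_vertices ss) & set (all_vertices ss) = vertices w"
proof -
 obtain y where y: "h < y" "y < h + 1" "generic_on {h<..y}" using next_generic[of h "h + 1"] by auto
 have g: "generic_on {y}" using y unfolding generic_on_def by auto
 obtain L where L: "level y L" using level_exists by blast
 have "set L <= {a. lo a < y}" using L by (auto simp: level_def active_def)
 from evolve_levels[OF _ g generic_shift[OF g] L level_shift[OF L] this] obtain ss where
  ss: "evolve wok (set L) L ss (map sh L)" "all_outs ss = {a \<in> crossings. y < lo a & lo a < y + 1}"
  "distinct (all_vertices ss)" "set (all_vertices ss) = {v \<in> vertices w. EX x z. y < z & z < y + 1 & v = annulus_point x z}"
  by auto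
 have "EX x z. y < z & z < y + 1 & v = annulus_point x z" if v: "v \<in> vertices w" for v
 proof -
  have "card (in_edges w v) > 0" using vertex_kind[OF v] by (auto simp: merges_def splits_def)
  then obtain e where e: "e \<in> edges w" "target w e = v" by (auto simp: in_edges_def card_gt_0_iff)
  define z where "z = upper w e - of_int \<lfloor>upper w e - y\<rfloor>"
  have vz: "v = annulus_point (xcoord w e (upper w e)) z"
   using e(2) annulus_point_shift[of "xcoord w e (upper w e)" z "\<lfloor>upper w e - y\<rfloor>"]
   by (simp add: z_def target_def edge_point_def)
  have z: "y <= z" "z < y + 1" unfolding z_def by linarith+
  obtain a where "a \<in> crossings" "up a = z" using vertex_up[of "xcoord w e (upper w e)" z] v vz by auto
  then have "z ~= y" using g unfolding generic_on_def by auto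
  then show ?thesis using vz z by (intro exI[of _ "xcoord w e (upper w e)"] exI[of _ z]) simp
 qed
 then have "set (all_vertices ss) = vertices w" unfolding ss(4) by blast
 then show ?thesis
  by (intro exI[of _ y] exI[of _ L] exI[of _ ss] conjI y(1) g L ss(1,2,3) cut_edges_level[OF h y(1,3) L, symmetric])
qed

end

section \<open>One fixed sweep; conserved flows as a substitute for planarity\<close>

locale cut_web = annular_graph w for w :: "'e web" +
 fixes h y :: real and L0 :: "('e \<times> int) list" and ss :: "('e \<times> int, real \<times> complex) lvstep list"
 assumes generic_y: "generic_on {y}" and level_L0: "level y L0" and map_L0: "map fst L0 = cut_edges w h"
  and evolve_ss: "evolve wok (set L0) L0 ss (map sh L0)"
  and outs_ss: "all_outs ss = {a \<in> crossings. y < lo a & lo a < y + 1}"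
  and distinct_ss: "distinct (all_vertices ss)" and vertices_ss: "set (all_vertices ss) = vertices w"

lemma cut_web_exists:
 assumes "annular_web w" "radial_cut w h"
 shows "EX y L0 ss. cut_web w h y L0 ss"
proof -
 interpret annular_graph w by unfold_locales (rule assms(1))
 obtain y L ss where *: "generic_on {y}" "level y L" "map fst L = cut_edges w h"
  "evolve wok (set L) L ss (map sh L)" "all_outs ss = {a \<in> crossings. y < lo a & lo a < y + 1}"
  "distinct (all_vertices ss)" "set (all_vertices ss) = vertices w"
  using scheme_exists[OF assms(2)] by (elim exE conjE)
 have "cut_web w h y L ss" by unfold_locales (rule *)+
 then show ?thesis by blast
qed

context annular_graph begin

definition conserved :: "('e => nat) => bool" where
 "conserved f \<longleftrightarrow> (\<forall>v\<in>vertices w. sum f (in_edges w v) = sum f (out_edges w v))"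

text \<open>Partial sums: \<open>th a\<close> is the amount of flow strictly to the left of the
  strand \<open>a\<close>, where \<open>b\<close> flows to the left of the whole list.\<close>

fun pfx :: "('e => nat) => ('e \<times> int => nat) => nat => ('e \<times> int) list => bool" where
 "pfx f th b [] = True"
| "pfx f th b (a # l) = (th a = b & pfx f th (b + f (fst a)) l)"

definition lsum :: "('e => nat) => ('e \<times> int) list => nat" where "lsum f l = (\<Sum>a\<leftarrow>l. f (fst a))"

lemma lsum_simps [simp]: "lsum f [] = 0" "lsum f (a # l) = f (fst a) + lsum f l" "lsum f (l @ l') = lsum f l + lsum f l'"
 by (auto simp: lsum_def)

lemma pfx_append [simp]: "pfx f th b (l @ l') \<longleftrightarrow> pfx f th b l & pfx f th (b + lsum f l) l'"
 by (induction l arbitrary: b) (auto simp: add.assoc)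

lemma pfx_cong: "(!!a. a \<in> set l ==> th a = th' a) ==> pfx f th b l = pfx f th' b l"
 by (induction l arbitrary: b) auto

lemma wok_lsum:
 assumes "conserved f" "wok ins outs v"
 shows "lsum f ins = lsum f outs"
proof (cases v)
 case None
 then show ?thesis using assms(2) by auto
next
 case (Some u)
 consider a b c where "u \<in> merges w" "ins = [a, b]" "outs = [c]" "fst a ~= fst b"
   "in_edges w u = {fst a, fst b}" "out_edges w u = {fst c}"
  | a b c where "u \<in> splits w" "ins = [a]" "outs = [b, c]" "fst b ~= fst c"
   "in_edges w u = {fst a}" "out_edges w u = {fst b, fst c}"
  using assms(2) unfolding Some wok.simps by blast
 then show ?thesis
 proof cases
  case 1
  then have "u \<in> vertices w" by (simp add: merges_def)
  then have "sum f (in_edges w u) = sum f (out_edges w u)" using assms(1) by (simp add: conserved_def)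
  then show ?thesis using 1 by simp
 next
  case 2
  then have "u \<in> vertices w" by (simp add: splits_def)
  then have "sum f (in_edges w u) = sum f (out_edges w u)" using assms(1) by (simp add: conserved_def)
  then show ?thesis using 2 by simp
 qed
qed

lemma wok_outs: "wok ins outs v ==> (EX c. outs = [c]) \<or> (EX b c. outs = [b, c])"
proof (cases v)
 case (Some u)
 assume "wok ins outs v"
 then show ?thesis unfolding Some wok.simps by blast
qed auto

lemma evolve_step_sub:
 "evolve wok A L s L' ==> set L <= A ==> (xs, ins, outs, v) \<in> set s ==>
  set ins <= A Un all_outs s & set outs <= A Un all_outs s"
proof (induction s arbitrary: A L)
 case (Cons p s)
 obtain xs' ins' outs' v' where p: "p = (xs', ins', outs', v')" by (cases p) auto
 from Cons.prems(1) obtain ys where L: "L = xs' @ ins' @ ys"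
  and ev: "evolve wok (A Un set outs') (xs' @ outs' @ ys) s L'" unfolding p evolve.simps by blast
 have sub: "set (xs' @ outs' @ ys) <= A Un set outs'" using Cons.prems(2) L by auto
 show ?case
 proof (cases "(xs, ins, outs, v) = p")
  case True
  then show ?thesis using Cons.prems(2) L p by auto
 next
  case False
  then show ?thesis using Cons.IH[OF ev sub] Cons.prems(3) p by auto
 qed
qed simp

text \<open>Conservation at the vertex keeps the left flow of all strands to its right unchanged, so
  only the fresh strands receive new values.\<close>

lemma evolve_prefix:
 assumes "conserved f"
 shows "evolve wok A L ss L' ==> set L <= A ==> pfx f th0 0 L ==>
  EX th. (\<forall>a\<in>A. th a = th0 a) & pfx f th 0 L' &
   (\<forall>(xs, ins, outs, v)\<in>set ss. pfx f th (lsum f xs) ins & pfx f th (lsum f xs) outs)"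
proof (induction ss arbitrary: A L th0)
 case Nil
 then show ?case by auto
next
 case (Cons s ss)
 obtain xs ins outs v where s: "s = (xs, ins, outs, v)" by (cases s) auto
 from Cons.prems(1) obtain ys where L: "L = xs @ ins @ ys" and ok: "wok ins outs v"
  and fresh: "set outs Int A = {}" and dist: "distinct outs" and ev: "evolve wok (A Un set outs) (xs @ outs @ ys) ss L'"
  unfolding s evolve.simps by blast
 obtain th1 where th1: "\<forall>a\<in>A. th1 a = th0 a" "pfx f th1 (lsum f xs) outs"
 proof -
  from wok_outs[OF ok] show ?thesis
  proof (elim disjE exE)
   fix c assume o: "outs = [c]"
   show ?thesis by (rule that[of "th0(c := lsum f xs)"]) (use o fresh in auto)
  next
   fix b c assume o: "outs = [b, c]"
   show ?thesis by (rule that[of "th0(b := lsum f xs, c := lsum f xs + f (fst b))"]) (use o fresh dist in auto)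
  qed
 qed
 have sub: "set xs <= A" "set ins <= A" "set ys <= A" using Cons.prems(2) L by auto
 have p0: "pfx f th0 0 xs" "pfx f th0 (lsum f xs) ins" "pfx f th0 (lsum f xs + lsum f ins) ys"
  using Cons.prems(3) unfolding L by simp_all
 have p1: "pfx f th1 b l" if "pfx f th0 b l" "set l <= A" for b l
  using pfx_cong[of l th1 th0 f b] that th1(1) by blast
 have "pfx f th1 0 (xs @ outs @ ys)"
  using p1[OF p0(1) sub(1)] p1[OF p0(3) sub(3)] th1(2) wok_lsum[OF assms ok] by simp
 moreover have "set (xs @ outs @ ys) <= A Un set outs" using sub by auto
 ultimately obtain th where th: "\<forall>a\<in>A Un set outs. th a = th1 a" "pfx f th 0 L'"
   "\<forall>(xs, ins, outs, v)\<in>set ss. pfx f th (lsum f xs) ins & pfx f th (lsum f xs) outs"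
  using Cons.IH[OF ev, of th1] by blast
 have "pfx f th (lsum f xs) ins"
  using pfx_cong[of ins th th1 f "lsum f xs"] th(1) sub(2) p1[OF p0(2) sub(2)] by blast
 moreover have "pfx f th (lsum f xs) outs"
  using pfx_cong[of outs th th1 f "lsum f xs"] th(1) th1(2) by blast
 moreover have "\<forall>a\<in>A. th a = th0 a" using th(1) th1(1) by simp
 ultimately show ?case using th(2,3) unfolding s by (intro exI[of _ th]) simp
qed

lemma evolve_lsum: "conserved f ==> evolve wok A L ss L' ==> lsum f L = lsum f L'"
proof (induction ss arbitrary: A L)
 case (Cons s ss)
 obtain xs ins outs v where s: "s = (xs, ins, outs, v)" by (cases s) auto
 from Cons.prems(2) obtain ys where L: "L = xs @ ins @ ys" and ok: "wok ins outs v"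
  and ev: "evolve wok (A Un set outs) (xs @ outs @ ys) ss L'"
  unfolding s evolve.simps by blast
 show ?case using Cons.IH[OF Cons.prems(1) ev] wok_lsum[OF Cons.prems(1) ok] by (simp add: L)
qed simp

lemma pfx_exists: "distinct l ==> EX th. pfx f th b l"
proof (induction l arbitrary: b)
 case (Cons a l)
 then obtain th where "pfx f th (b + f (fst a)) l" by auto
 then have "pfx f (th(a := b)) b (a # l)"
 proof -
  have "pfx f (th(a := b)) (b + f (fst a)) l = pfx f th (b + f (fst a)) l"
   by (rule pfx_cong) (use Cons.prems in auto)
  then show ?thesis using \<open>pfx f th (b + f (fst a)) l\<close> by simp
 qed
 then show ?case by blast
qed simp

lemma evolve_steps_ok: "evolve wok A L ss L' ==> (xs, ins, outs, v) \<in> set ss ==> wok ins outs v"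
proof (induction ss arbitrary: A L)
 case (Cons s ss)
 obtain xs' ins' outs' v' where s: "s = (xs', ins', outs', v')" by (cases s) auto
 from Cons.prems(1) show ?case using Cons.IH Cons.prems(2) unfolding s evolve.simps by auto
qed simp

end

context cut_web begin

abbreviation "es \<equiv> cut_edges w h"

definition seen :: "('e \<times> int) set" where "seen = set L0 Un all_outs ss"

lemma set_L0: "set L0 = {a \<in> crossings. lo a < y & y < up a}"
 using level_L0 by (auto simp: level_def active_def)

lemma seen_eq: "seen = {a \<in> crossings. lo a < y + 1 & y < up a}"
proof -
 have "lo a ~= y" if "a \<in> crossings" for a using generic_y that by (auto simp: generic_on_def)
 moreover have "lo a < up a" if "a \<in> crossings" for a by (rule lo_less_up[OF that])
 ultimately show ?thesis unfolding seen_def set_L0 outs_ss by force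
qed

lemma seen_fst: "a \<in> seen ==> fst a \<in> edges w"
 by (simp add: seen_eq crossings_def)

lemma seen_surj: assumes "e \<in> edges w" shows "\<exists>a\<in>seen. fst a = e"
proof -
 define k where "k = \<lceil>y + 1 - lower w e\<rceil> - 1"
 have "lower w e + of_int k < y + 1" "y <= lower w e + of_int k" unfolding k_def by linarith+
 moreover have "lower w e < upper w e" using edge_facts(1)[OF assms] .
 ultimately have "(e, k) \<in> seen" using assms by (simp add: seen_eq crossings_def lo_def up_def)
 then show ?thesis by force
qed

text \<open>Two visited lifts of one edge are joined by a chain of deck translates. Every member of
  the chain except the topmost crosses the height y, so it belongs to \<open>L0\<close>, where
  compatibility with \<open>sh\<close> is assumed.\<close>

lemma seen_well_defined:
 assumes "!!a. a \<in> set L0 ==> ph (sh a) = ph a"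
 shows "\<exists>ps. \<forall>a\<in>seen. ph a = ps (fst a)"
proof -
 have step: "ph (e, k + int n) = ph (e, k)" if "(e, k) \<in> seen" "(e, k + int n) \<in> seen" for e k n
  using that
 proof (induction n)
  case (Suc n)
  have lu: "lower w e < upper w e" using edge_facts(1) Suc.prems(1) seen_fst by fastforce
  have "lower w e + of_int (k + int n) < y" using Suc.prems(2) by (simp add: seen_eq lo_def)
  moreover have "y < upper w e + of_int (k + int n)" using Suc.prems(1) by (simp add: seen_eq up_def)
  ultimately have m: "(e, k + int n) \<in> set L0" using Suc.prems(1) by (simp add: set_L0 seen_eq crossings_def lo_def up_def)
  then have "ph (e, k + int n) = ph (e, k)" using Suc by (simp add: seen_def)
  moreover have "ph (e, k + int (Suc n)) = ph (e, k + int n)" 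
  proof -
   have "sh (e, k + int n) = (e, k + int (Suc n))" by (simp add: sh_def)
   then show ?thesis using assms[OF m] by simp
  qed
  ultimately show ?case by simp
 qed simp
 have eq: "ph (e, k) = ph (e, k')" if "(e, k) \<in> seen" "(e, k') \<in> seen" for e k k'
  using that
 proof (induction k k' rule: linorder_wlog)
  case (le a b)
  then show ?case using step[of e a "nat (b - a)"] by simp
 next
  case (sym a b)
  then show ?case by simp
 qed
 define ps where "ps e = ph (SOME a. a \<in> seen & fst a = e)" for e
 have "ph a = ps (fst a)" if a: "a \<in> seen" for a
 proof -
  define b where "b = (SOME b. b \<in> seen & fst b = fst a)"
  have b: "b \<in> seen & fst b = fst a" unfolding b_def by (rule someI[of _ a]) (simp add: a)
  then have "ph (fst a, snd a) = ph (fst a, snd b)" using eq[of "fst a" "snd a" "snd b"] a by (metis prod.collapse)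
  then show ?thesis using b by (simp add: ps_def b_def[symmetric]) (metis prod.collapse)
 qed
 then show ?thesis by blast
qed

lemma pfx_map_sh: "pfx f th b (map sh l) = pfx f (th \<circ> sh) b l"
 by (induction l arbitrary: b) auto

lemma pfx_unique: "pfx f th b l ==> pfx f th' b l ==> a \<in> set l ==> th a = th' a"
 by (induction l arbitrary: b) auto

lemma distinct_L0: "distinct L0" using level_L0 by (simp add: level_def)

text \<open>For a conserved flow, the amount of flow to the left is constant along every edge.\<close>

lemma left_flow:
 assumes "conserved f"
 obtains th where "pfx f (th \<circ> fst) 0 L0"
  "!!xs ins outs v. (xs, ins, outs, v) \<in> set ss ==>
   pfx f (th \<circ> fst) (lsum f xs) ins & pfx f (th \<circ> fst) (lsum f xs) outs"
proof -
 obtain th0 where "pfx f th0 0 L0" using pfx_exists[OF distinct_L0] by blast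
 from evolve_prefix[OF assms evolve_ss order_refl this] obtain th where
  th: "\<forall>a\<in>set L0. th a = th0 a" "pfx f th 0 (map sh L0)"
   "\<forall>(xs, ins, outs, v)\<in>set ss. pfx f th (lsum f xs) ins & pfx f th (lsum f xs) outs" by blast
 have p0: "pfx f th 0 L0" using pfx_cong[of L0 th th0 f 0] th(1) \<open>pfx f th0 0 L0\<close> by blast
 have "th (sh a) = th a" if "a \<in> set L0" for a
  using pfx_unique[OF th(2)[unfolded pfx_map_sh] p0 that] by simp
 then obtain ps where ps: "\<forall>a\<in>seen. th a = ps (fst a)" using seen_well_defined by blast
 show thesis
 proof (rule that[of ps])
  show "pfx f (ps \<circ> fst) 0 L0"
   using pfx_cong[of L0 th "ps \<circ> fst" f 0] p0 ps by (auto simp: seen_def)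
  fix xs ins outs v assume s: "(xs, ins, outs, v) \<in> set ss"
  have "set ins <= seen" "set outs <= seen"
   using evolve_step_sub[OF evolve_ss order_refl s] by (auto simp: seen_def)
  moreover have "pfx f th (lsum f xs) ins" "pfx f th (lsum f xs) outs" using bspec[OF th(3) s] by simp_all
  ultimately show "pfx f (ps \<circ> fst) (lsum f xs) ins & pfx f (ps \<circ> fst) (lsum f xs) outs"
   using pfx_cong[of ins th "ps \<circ> fst" f "lsum f xs"] pfx_cong[of outs th "ps \<circ> fst" f "lsum f xs"] ps
   by (auto simp: subset_iff)
 qed
qed

lemma conserved_thickness: "conserved (thickness w)"
 using aw unfolding annular_web_def conserved_def by blast

text \<open>For the flow given by the thickness, the left flow strictly increases along the cut
  while depending on the edge only. So no edge meets the cut twice.\<close>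

lemma distinct_es: "distinct es"
proof -
 obtain th where th: "pfx (thickness w) (th \<circ> fst) 0 L0" using left_flow[OF conserved_thickness] by metis
 have "pfx (thickness w) (th \<circ> fst) b l ==> (\<forall>a\<in>set l. thickness w (fst a) > 0) ==>
  distinct (map fst l) & (\<forall>a\<in>set l. th (fst a) >= b)" for b l
 proof (induction l arbitrary: b)
  case (Cons a l)
  then have IH: "distinct (map fst l)" "\<forall>c\<in>set l. th (fst c) >= b + thickness w (fst a)" by auto
  have "fst a ~: fst ` set l"
  proof
   assume "fst a \<in> fst ` set l"
   then obtain c where "c \<in> set l" "fst c = fst a" by force
   then have "th (fst a) >= b + thickness w (fst a)" using IH(2) by metis
   then show False using Cons.prems by auto
  qed
  then show ?case using IH Cons.prems by force
 qed simp
 from this[OF th] have "distinct (map fst L0)"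
  using edge_facts(3) set_L0 by (force simp: crossings_def)
 then show ?thesis by (simp add: map_L0)
qed

lemma set_es: "set es <= edges w"
 unfolding map_L0[symmetric] using set_L0 by (auto simp: crossings_def)

fun epfx :: "('e => nat) => ('e => nat) => nat => 'e list => bool" where
 "epfx f th b [] = True"
| "epfx f th b (a # l) = (th a = b & epfx f th (b + f a) l)"

lemma pfx_epfx: "pfx f (th \<circ> fst) b l = epfx f th b (map fst l)"
 by (induction l arbitrary: b) auto

lemma vertex_step:
 assumes "v \<in> vertices w"
 shows "EX xs ins outs. (xs, ins, outs, Some v) \<in> set ss"
proof -
 have "v \<in> set (all_vertices ss)" using assms vertices_ss by simp
 then obtain s where s: "s \<in> set ss" "v \<in> set (step_vertex s)" by (auto simp: all_vertices_def)
 obtain xs ins outs u where u: "s = (xs, ins, outs, u)" by (cases s) auto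
 have "u = Some v" using s(2) unfolding u by (cases u) auto
 then show ?thesis using s(1) u by blast
qed

text \<open>If at most one unit passes a vertex, the occupied edges there have the same flow to
  their left. Thus the left flow is constant along each loop and numbers the loops from left to
  right.\<close>

lemma left_flow_edges:
 assumes f: "conserved f"
 obtains th where "epfx f th 0 es"
  "!!v. v \<in> vertices w ==> (!!e. e \<in> in_edges w v Un out_edges w v ==> f e <= 1) ==>
   sum f (in_edges w v) <= 1 ==>
   EX x. \<forall>e\<in>in_edges w v Un out_edges w v. f e = 1 --> th e = x"
proof -
 obtain th where th: "pfx f (th \<circ> fst) 0 L0"
  "!!xs ins outs v. (xs, ins, outs, v) \<in> set ss ==>
   pfx f (th \<circ> fst) (lsum f xs) ins & pfx f (th \<circ> fst) (lsum f xs) outs"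
  using left_flow[OF f] by metis
 show thesis
 proof (rule that[of th])
  show "epfx f th 0 es" using th(1) by (simp add: pfx_epfx map_L0)
  fix v assume v: "v \<in> vertices w" and le: "sum f (in_edges w v) <= 1"
  obtain xs ins outs where s: "(xs, ins, outs, Some v) \<in> set ss" using vertex_step[OF v] by blast
  note p = th(2)[OF s]
  have ok: "wok ins outs (Some v)" by (rule evolve_steps_ok[OF evolve_ss s])
  then consider a b c where "ins = [a, b]" "outs = [c]" "fst a ~= fst b"
    "in_edges w v = {fst a, fst b}" "out_edges w v = {fst c}"
   | a b c where "ins = [a]" "outs = [b, c]" "fst b ~= fst c"
    "in_edges w v = {fst a}" "out_edges w v = {fst b, fst c}"
   unfolding wok.simps by blast
  then show "EX x. \<forall>e\<in>in_edges w v Un out_edges w v. f e = 1 --> th e = x"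
  proof cases
   case 1
   then have "f (fst a) + f (fst b) <= 1" using le by simp
   then show ?thesis using 1 p by (intro exI[of _ "lsum f xs"]) auto
  next
   case 2
   have "sum f (out_edges w v) <= 1" using le f v by (simp add: conserved_def)
   then have "f (fst b) + f (fst c) <= 1" using 2 by simp
   then show ?thesis using 2 p by (intro exI[of _ "lsum f xs"]) auto
  qed
 qed
qed

text \<open>Edges not meeting the cut are created at a vertex, later than the edges entering it.\<close>

lemma rank_exists:
 "\<exists>rank :: 'e => nat. \<forall>e\<in>edges w. e \<in> set es \<or>
  (\<exists>v\<in>vertices w. e \<in> out_edges w v & (\<forall>e'\<in>in_edges w v. rank e' < rank e))"
proof -
 have main: "evolve wok A L s L' ==> set L <= A ==> finite A ==>
  (\<forall>a\<in>A. fst a \<in> set es \<or> P (fst a)) ==>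
  (!!v e. v \<in> vertices w ==> e \<in> out_edges w v ==> (\<forall>e'\<in>in_edges w v. e' \<in> set es \<or> P e') ==> P e) ==>
  (\<forall>a\<in>A Un all_outs s. fst a \<in> set es \<or> P (fst a))" for A L s L' P
 proof (induction s arbitrary: A L)
  case (Cons p s)
  obtain xs ins outs v where p: "p = (xs, ins, outs, v)" by (cases p) auto
  from Cons.prems(1) obtain ys where L: "L = xs @ ins @ ys" and ok: "wok ins outs v"
   and ev: "evolve wok (A Un set outs) (xs @ outs @ ys) s L'" unfolding p evolve.simps by blast
  have sub: "set (xs @ outs @ ys) <= A Un set outs" and ins: "set ins <= A" using Cons.prems(2) L by auto
  have "fst a \<in> set es \<or> P (fst a)" if a: "a \<in> set outs" for a
  proof (cases v)
   case None
   then obtain b where "ins = [b]" "fst b = fst a" using ok a by auto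
   moreover from this have "b \<in> A" using ins by simp
   ultimately show ?thesis using bspec[OF Cons.prems(4), of b] by simp
  next
   case (Some u)
   have u: "u \<in> vertices w" "fst a \<in> out_edges w u" "in_edges w u = fst ` set ins"
    using ok a unfolding Some wok.simps by (auto simp: merges_def splits_def)
   have "\<forall>e'\<in>in_edges w u. e' \<in> set es \<or> P e'"
   proof
    fix e' assume "e' \<in> in_edges w u"
    then obtain b where b: "b \<in> set ins" "e' = fst b" unfolding u(3) by blast
    then have "b \<in> A" using ins by blast
    then show "e' \<in> set es \<or> P e'" using bspec[OF Cons.prems(4)] b(2) by simp
   qed
   then have "P (fst a)" by (rule Cons.prems(5)[OF u(1,2)])
   then show ?thesis ..
  qed
  then have "\<forall>a\<in>A Un set outs. fst a \<in> set es \<or> P (fst a)" using bspec[OF Cons.prems(4)] by (auto simp only: Un_iff)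
  from Cons.IH[OF ev sub _ this Cons.prems(5)] Cons.prems(3) show ?case by (simp add: p Un_assoc)
 qed simp
 \<comment> \<open>An edge enters a stage when all edges below it lie on the cut or in the previous
   stage. The rank is the first such stage; it is positive because stage 0 is empty, and the rank 0
   is reserved for edges on the cut.\<close>
 define stage where "stage = rec_nat {} (%_ S. S Un {e. \<exists>v\<in>vertices w. e \<in> out_edges w v & (\<forall>e'\<in>in_edges w v. e' \<in> set es \<or> e' \<in> S)})"
 have st: "stage 0 = {}" "stage (Suc n) = stage n Un
  {e. \<exists>v\<in>vertices w. e \<in> out_edges w v & (\<forall>e'\<in>in_edges w v. e' \<in> set es \<or> e' \<in> stage n)}" for n
  by (simp_all add: stage_def)
 have mono: "m <= n ==> stage m <= stage n" for m n
  by (rule lift_Suc_mono_le[of stage]) (auto simp: st)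
 define R where "R e = (if e \<in> set es then 0 else LEAST n. e \<in> stage n)" for e
 have all: "\<forall>a\<in>set L0 Un all_outs ss. fst a \<in> set es \<or> (EX n. fst a \<in> stage n)"
 proof (rule main[OF evolve_ss order_refl])
  show "\<forall>a\<in>set L0. fst a \<in> set es \<or> (EX n. fst a \<in> stage n)" by (simp add: map_L0[symmetric])
  fix v e assume v: "v \<in> vertices w" "e \<in> out_edges w v" and
   ie: "\<forall>e'\<in>in_edges w v. e' \<in> set es \<or> (EX n. e' \<in> stage n)"
  have fin: "finite (in_edges w v)" using finite_edges by (simp add: in_edges_def)
  have "EX n. \<forall>e'\<in>S. e' \<in> set es \<or> e' \<in> stage n" if "finite S" "S <= in_edges w v" for S
   using that
  proof (induction S)
   case (insert x S)
   then obtain n where n: "\<forall>e'\<in>S. e' \<in> set es \<or> e' \<in> stage n" by auto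
   obtain m where "x \<in> set es \<or> x \<in> stage m" using ie insert.prems by blast
   then show ?case using n mono[of n "max m n"] mono[of m "max m n"] by (intro exI[of _ "max m n"]) auto
  qed simp
  then obtain n where "\<forall>e'\<in>in_edges w v. e' \<in> set es \<or> e' \<in> stage n" using fin by blast
  then have "e \<in> stage (Suc n)" using v unfolding st by blast
  then show "EX n. e \<in> stage n" by blast
 qed simp
 have "e \<in> set es \<or> (\<exists>v\<in>vertices w. e \<in> out_edges w v & (\<forall>e'\<in>in_edges w v. R e' < R e))"
  if e: "e \<in> edges w" for e
 proof (cases "e \<in> set es")
  case False
  obtain a where "a \<in> seen" "fst a = e" using seen_surj[OF e] by blast
  then have "EX n. e \<in> stage n" using all False by (auto simp: seen_def)
  then have l: "e \<in> stage (LEAST n. e \<in> stage n)" by (rule LeastI_ex)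
  have Re: "R e = (LEAST n. e \<in> stage n)" using False by (simp add: R_def)
  have "R e ~= 0"
  proof
   assume "R e = 0"
   then have "e \<in> stage 0" using l Re by simp
   then show False unfolding st(1) by simp
  qed
  then obtain n where n: "R e = Suc n" using not0_implies_Suc by blast
  then have "e ~: stage n" using not_less_Least[of n "%n. e \<in> stage n"] Re by simp
  then obtain v where v: "v \<in> vertices w" "e \<in> out_edges w v" "\<forall>e'\<in>in_edges w v. e' \<in> set es \<or> e' \<in> stage n"
  proof -
   have "e \<in> stage (Suc n)" using l Re n by simp
   then show ?thesis using \<open>e ~: stage n\<close> that unfolding st(2) by blast
  qed
  have "R e' < R e" if e': "e' \<in> in_edges w v" for e'
  proof (cases "e' \<in> set es")
   case False
   then have "e' \<in> stage n" using v(3) e' by blast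
   then have "(LEAST n. e' \<in> stage n) <= n" by (rule Least_le)
   then show ?thesis using n False by (simp add: R_def)
  next
   case True
   then have "R e' = 0" by (simp add: R_def)
   then show ?thesis using n by simp
  qed
  then show ?thesis using v by blast
 qed simp
 then show ?thesis by blast
qed

end

section \<open>Loops and transfer operators\<close>

lemma card_components_disjoint_union:
 fixes U :: "'i => 'a::topological_space set"
 assumes I: "finite I" and U: "!!i. i \<in> I ==> closed (U i)" "!!i. i \<in> I ==> connected (U i)" "!!i. i \<in> I ==> U i ~= {}"
  and disj: "!!i j. i \<in> I ==> j \<in> I ==> i ~= j ==> U i Int U j = {}"
 shows "card (components (\<Union>i\<in>I. U i)) = card I"
proof -
 have sub: "\<exists>i\<in>I. C <= U i" if C: "connected C" "C <= (\<Union>i\<in>I. U i)" "C ~= {}" for C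
 proof -
  obtain x i where xi: "x \<in> C" "i \<in> I" "x \<in> U i" using C by blast
  define V where "V = (\<Union>j\<in>I - {i}. U j)"
  have cV: "closed V" unfolding V_def using I U(1) by (intro closed_UN) auto
  have CV: "C <= U i Un V" using C(2) by (auto simp: V_def)
  have "U i Int V Int C = {}"
  proof (rule equals0I)
   fix z assume "z \<in> U i Int V Int C"
   then obtain j where j: "j \<in> I" "i ~= j" "z \<in> U i Int U j" unfolding V_def by blast
   then show False unfolding disj[OF xi(2) j(1,2)] by simp
  qed
  note disjunct = connected_closedD[OF C(1) this CV U(1)[OF xi(2)] cV]
  have "U i Int C ~= {}" using xi(1,3) by blast
  with disjunct have VC: "V Int C = {}" by (elim disjE) (simp_all only: simp_thms)
  have "C <= U i"
  proof
   fix z assume "z \<in> C"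
   then show "z \<in> U i" using CV VC by blast
  qed
  then show ?thesis by (rule bexI[OF _ xi(2)])
 qed
 have "components (\<Union>i\<in>I. U i) = U ` I"
 proof (intro equalityI subsetI)
  fix C assume C: "C \<in> components (\<Union>i\<in>I. U i)"
  then have Cc: "C ~= {}" "C <= (\<Union>i\<in>I. U i)" "connected C"
   and mx: "!!d. d ~= {} ==> C <= d ==> d <= (\<Union>i\<in>I. U i) ==> connected d ==> d = C"
   unfolding in_components_maximal by simp_all
  from sub[OF Cc(3,2,1)] obtain i where i: "i \<in> I" "C <= U i" by (elim bexE)
  have "U i = C" using mx[OF U(3)[OF i(1)] i(2) UN_upper[OF i(1)] U(2)[OF i(1)]] .
  then have "C = U i" by (rule sym)
  then show "C \<in> U ` I" by (rule image_eqI) (rule i(1))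
 next
  fix C assume "C \<in> U ` I"
  then obtain i where i: "i \<in> I" "C = U i" by (elim imageE)
  have "d = C" if d: "d ~= {}" "C <= d" "d <= (\<Union>i\<in>I. U i)" "connected d" for d
  proof -
   from sub[OF d(4,3,1)] obtain j where j: "j \<in> I" "d <= U j" by (elim bexE)
   have ij: "U i <= U j" using order_trans[OF d(2) j(2)] unfolding i(2) .
   have "i = j"
   proof (rule ccontr)
    assume "i ~= j"
    from disj[OF i(1) j(1) this] ij have "U i = {}" by (simp add: inf.absorb1)
    then show False using U(3)[OF i(1)] by simp
   qed
   then show ?thesis using d(2) j(2) unfolding i(2) by (intro subset_antisym) simp_all
  qed
  moreover have "C ~= {}" "C <= (\<Union>i\<in>I. U i)" "connected C"
   unfolding i(2) by (rule U(3)[OF i(1)], rule UN_upper[OF i(1)], rule U(2)[OF i(1)])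
  ultimately show "C \<in> components (\<Union>i\<in>I. U i)" unfolding in_components_maximal by simp
 qed
 moreover have "inj_on U I"
 proof (rule inj_onI, rule ccontr)
  fix i j assume ij: "i \<in> I" "j \<in> I" "U i = U j" "i ~= j"
  show False using disj[OF ij(1,2,4)] ij(3) U(3)[OF ij(1)] by simp
 qed
 ultimately show ?thesis by (simp add: card_image)
qed

section \<open>Loops and their connected components\<close>

context annular_graph begin

text \<open>Multicurves rather than single circles: all edges carrying one color. The bound at the
  vertices keeps components from touching each other, and the empty curve is included.\<close>

definition loops :: "('e => nat) set" where
 "loops = {g. (ALL e. g e <= 1) & (ALL e. e ~: edges w --> g e = 0) & conserved g &
  (\<forall>v\<in>vertices w. sum g (in_edges w v) <= 1)}"

lemma loopsD: assumes "g \<in> loops"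
 shows "g e <= 1" "e ~: edges w ==> g e = 0" "conserved g" "v \<in> vertices w ==> sum g (in_edges w v) <= 1"
 using assms by (auto simp: loops_def)

lemma finite_loops: "finite loops"
proof (rule finite_subset)
 show "loops <= {g. ALL x. (x \<in> edges w --> g x \<in> {..1}) & (x ~: edges w --> g x = 0)}"
  by (auto simp: loops_def)
qed (intro finite_set_of_finite_funs finite_edges finite_atMost)

definition curve :: "('e => nat) => (real \<times> complex) set" where
 "curve g = (\<Union>e\<in>{e \<in> edges w. g e = 1}. edge_image w e)"

lemma edge_image_compact_connected:
 assumes "e \<in> edges w"
 shows "compact (edge_image w e)" "connected (edge_image w e)"
  "source w e \<in> edge_image w e" "target w e \<in> edge_image w e"
proof -
 have c: "continuous_on {lower w e..upper w e} (edge_point w e)"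
  unfolding edge_point_def annulus_point_def cis_conv_exp
  by (intro continuous_intros edge_facts(2) assms)
 show "compact (edge_image w e)" unfolding edge_image_def by (rule compact_continuous_image[OF c]) simp
 show "connected (edge_image w e)" unfolding edge_image_def by (rule connected_continuous_image[OF c]) simp
 show "source w e \<in> edge_image w e" "target w e \<in> edge_image w e"
  using edge_facts(1)[OF assms] by (auto simp: edge_image_def source_def target_def)
qed

lemma edge_images_meet:
 assumes e: "e \<in> edges w" "e' \<in> edges w" "e ~= e'" and x: "x \<in> edge_image w e" "x \<in> edge_image w e'"
 shows "x \<in> vertices w & e \<in> in_edges w x Un out_edges w x & e' \<in> in_edges w x Un out_edges w x"
proof -
 have rep: "(\<exists>s\<in>nonvertex_heights w e. edge_point w e s = x) & x ~: vertices w
   \<or> x \<in> vertices w & e \<in> in_edges w x Un out_edges w x"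
  if e: "e \<in> edges w" and x: "x \<in> edge_image w e" for e
 proof -
  obtain s where s: "lower w e <= s" "s <= upper w e" "x = edge_point w e s" using x by (auto simp: edge_image_def)
  show ?thesis
  proof (cases "x \<in> vertices w")
   case True
   then have "s ~: nonvertex_heights w e" using nonvertex_not_vertex[OF e] s by blast
   then have "s = lower w e \<or> s = upper w e" using interior_nonvertex[of e s] s by fastforce
   then have "x = source w e \<or> x = target w e" using s(3) by (auto simp: source_def target_def)
   then show ?thesis using True e by (auto simp: in_edges_def out_edges_def)
  next
   case False
   have "\<exists>s\<in>nonvertex_heights w e. edge_point w e s = x"
   proof (cases "lower w e < s & s < upper w e")
    case True
    then show ?thesis using s interior_nonvertex by blast
   next
    case nint: False
    then have st: "x = source w e \<or> x = target w e" using s by (auto simp: source_def target_def)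
    then have c: "essential_circle w e" using edge_facts(4)[OF e] False by auto
    then have "x = source w e" using st by (auto simp: essential_circle_def)
    then show ?thesis using c edge_facts(1)[OF e]
     by (intro bexI[of _ "lower w e"]) (auto simp: source_def nonvertex_heights_def)
   qed
   then show ?thesis using False by blast
  qed
 qed
 from rep[OF e(1) x(1)] rep[OF e(2) x(2)] nonvertex_inj[OF e(1,2)] e(3) show ?thesis by metis
qed

end

context cut_web begin

lemma epfx_range:
 "epfx g th b l ==> (!!e. g e <= 1) ==>
  bij_betw th {c \<in> set l. g c = 1} {b..<b + sum_list (map g l)}"
proof (induction l arbitrary: b)
 case (Cons a l)
 then have IH: "bij_betw th {c \<in> set l. g c = 1} {b + g a..<b + g a + sum_list (map g l)}" and ab: "th a = b" by auto
 have "g a = 0 \<or> g a = 1" using Cons.prems(2)[of a] by linarith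
 then show ?case
 proof
  assume "g a = 0"
  moreover from this have "{c \<in> set (a # l). g c = 1} = {c \<in> set l. g c = 1}" by auto
  ultimately show ?thesis using IH by simp
 next
  assume a: "g a = 1"
  then have "{c \<in> set (a # l). g c = 1} = insert a {c \<in> set l. g c = 1}"
   and "{b..<b + sum_list (map g (a # l))} = insert b {b + g a..<b + g a + sum_list (map g l)}" by auto
  moreover have "b ~: {b + g a..<b + g a + sum_list (map g l)}" using a by simp
  moreover have "a ~: {c \<in> set l. g c = 1}"
  proof
   assume "a \<in> {c \<in> set l. g c = 1}"
   then have "th a \<in> {b + g a..<b + g a + sum_list (map g l)}"
    using bij_betw_apply[OF IH] by blast
   then show False using ab a by simp
  qed
  ultimately show ?thesis using IH ab notIn_Un_bij_betw[of a "{c \<in> set l. g c = 1}" th] by simp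
 qed
qed (simp add: bij_betw_def)

text \<open>Edges meeting at a vertex have the same left flow, so its values cut the curve into
  disjoint closed pieces. Following edges backwards along the rank connects each piece to the cut,
  on which every value occurs exactly once; hence every piece is connected.\<close>

theorem components_curve:
 assumes g: "g \<in> loops"
 shows "card (components (curve g)) = sum_list (map g es)"
proof -
 define k where "k = sum_list (map g es)"
 obtain th where th: "epfx g th 0 es"
  "!!v. v \<in> vertices w ==> (!!e. e \<in> in_edges w v Un out_edges w v ==> g e <= 1) ==> sum g (in_edges w v) <= 1 ==>
   EX x. \<forall>e\<in>in_edges w v Un out_edges w v. g e = 1 --> th e = x"
  using left_flow_edges[OF loopsD(3)[OF g]] by metis
 have same: "th e = th e'" if v: "v \<in> vertices w" and e: "e \<in> in_edges w v Un out_edges w v" "e' \<in> in_edges w v Un out_edges w v"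
  "g e = 1" "g e' = 1" for v e e'
 proof -
  obtain x where "\<forall>e\<in>in_edges w v Un out_edges w v. g e = 1 --> th e = x"
   using th(2)[OF v loopsD(1)[OF g] loopsD(4)[OF g v]] by blast
  then show ?thesis using e by simp
 qed
 have bij: "bij_betw th {c \<in> set es. g c = 1} {0..<k}"
  using epfx_range[OF th(1) loopsD(1)[OF g]] by (simp add: k_def)
 define U where "U j = (\<Union>e\<in>{e \<in> edges w. g e = 1 & th e = j}. edge_image w e)" for j
 obtain rank :: "'e => nat" where rank: "\<forall>e\<in>edges w. e \<in> set es \<or>
  (\<exists>v\<in>vertices w. e \<in> out_edges w v & (\<forall>e'\<in>in_edges w v. rank e' < rank e))"
  using rank_exists by blast
 have conn: "\<exists>c\<in>set es. g c = 1 & th c = th e & connected_component (U (th e)) (source w e) (source w c)"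
  if "e \<in> edges w" "g e = 1" for e
  using that
 proof (induction "rank e" arbitrary: e rule: less_induct)
  case less
  have src: "source w e \<in> U (th e)" using edge_image_compact_connected(3)[OF less.prems(1)] less.prems by (auto simp: U_def)
  show ?case
  proof (cases "e \<in> set es")
   case True
   then show ?thesis using less.prems src by (intro bexI[of _ e]) auto
  next
   case False
   then obtain v where v: "v \<in> vertices w" "e \<in> out_edges w v" "\<forall>e'\<in>in_edges w v. rank e' < rank e"
    using rank less.prems(1) by blast
   have fin: "finite (out_edges w v)" "finite (in_edges w v)" using finite_edges by (auto simp: in_edges_def out_edges_def)
   have "g e <= sum g (out_edges w v)" using v(2) fin by (intro member_le_sum) auto
   then have "sum g (in_edges w v) ~= 0" using less.prems(2) loopsD(3)[OF g] v(1) by (simp add: conserved_def)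
   then obtain e' where e': "e' \<in> in_edges w v" "g e' ~= 0" using fin by (auto simp: sum_eq_0_iff)
   then have ge': "g e' = 1" "e' \<in> edges w" using loopsD(1)[OF g, of e'] by (auto simp: in_edges_def)
   have th: "th e' = th e" using same[OF v(1), of e' e] e' v(2) ge' less.prems by auto
   obtain c where c: "c \<in> set es" "g c = 1" "th c = th e'" "connected_component (U (th e')) (source w e') (source w c)"
    using less.hyps[of e'] v(3) e'(1) ge' by blast
   have "connected_component (U (th e)) (source w e) (source w e')"
    unfolding connected_component_def
   proof (intro exI[of _ "edge_image w e'"] conjI)
    show "source w e \<in> edge_image w e'"
     using edge_image_compact_connected(4)[OF ge'(2)] e'(1) v(2) by (simp add: in_edges_def out_edges_def)
    show "edge_image w e' <= U (th e)" using ge' th by (auto simp: U_def)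
   qed (use edge_image_compact_connected[OF ge'(2)] in auto)
   then show ?thesis using c th connected_component_trans[of "U (th e)"] by metis
  qed
 qed
 have theta_less: "th e < k" if eg: "e \<in> edges w" "g e = 1" for e
 proof -
  obtain c where "c \<in> set es" "g c = 1" "th c = th e" using conn[OF eg] by blast
  then have "th e \<in> th ` {c \<in> set es. g c = 1}" by (intro image_eqI[of _ _ c]) simp_all
  then show ?thesis using bij by (simp add: bij_betw_def)
 qed
 have cover: "curve g = (\<Union>j\<in>{0..<k}. U j)"
  using theta_less by (fastforce simp: curve_def U_def)
 have "card (components (\<Union>j\<in>{0..<k}. U j)) = card {0..<k}"
 proof (rule card_components_disjoint_union)
  fix j assume j: "j \<in> {0..<k}"
  show "closed (U j)" unfolding U_def
   using finite_edges edge_image_compact_connected(1) by (intro closed_UN) (auto intro: compact_imp_closed)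
  have jj: "j \<in> th ` {c \<in> set es. g c = 1}" using bij j by (simp add: bij_betw_def)
  then obtain c where c: "c \<in> set es" "g c = 1" "th c = j" by blast
  then have ce: "c \<in> edges w" using set_es by blast
  show "U j ~= {}" using edge_image_compact_connected(3)[OF ce] c ce by (auto simp: U_def)
  have "connected_component (U j) x (source w c)" if xU: "x \<in> U j" for x
  proof -
   obtain e where e: "e \<in> edges w" "g e = 1" "th e = j" "x \<in> edge_image w e" using xU by (auto simp: U_def)
   obtain c' where c': "c' \<in> set es" "g c' = 1" "th c' = j" "connected_component (U j) (source w e) (source w c')"
    using conn[OF e(1,2)] e(3) by auto
   have "c' = c" using inj_onD[OF bij_betw_imp_inj_on[OF bij], of c' c] c c' by simp
   moreover have "connected_component (U j) x (source w e)"
    unfolding connected_component_def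
    by (intro exI[of _ "edge_image w e"]) (use e edge_image_compact_connected[OF e(1)] in \<open>auto simp: U_def\<close>)
   ultimately show ?thesis using c'(4) connected_component_trans by metis
  qed
  then show "connected (U j)"
   unfolding connected_iff_connected_component by (metis connected_component_sym connected_component_trans)
 next
  fix i j assume ij: "i \<in> {0..<k}" "j \<in> {0..<k}" "i ~= j"
  show "U i Int U j = {}"
  proof (rule ccontr)
   assume "U i Int U j ~= {}"
   then obtain x e e' where x: "x \<in> edge_image w e" "x \<in> edge_image w e'" "e \<in> edges w" "e' \<in> edges w"
    "g e = 1" "g e' = 1" "th e = i" "th e' = j" by (auto simp: U_def)
   then have "e ~= e'" using ij by blast
   from edge_images_meet[OF x(3,4) this x(1,2)] same[of x e e'] x ij show False by blast
  qed
 qed simp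
 then show ?thesis unfolding cover by (simp add: k_def)
qed

end

section \<open>State sums of the transfer operators\<close>

fun ltr :: "nat => nat => letter" where
 "ltr a b = (if a = 0 then (if b = 0 then LO else LF) else (if b = 0 then LT else LB))"

fun cntT :: "letter => nat" where "cntT LT = 1" | "cntT LB = 1" | "cntT _ = 0"
fun cntF :: "letter => nat" where "cntF LF = 1" | "cntF LB = 1" | "cntF _ = 0"

lemma cnt_ltr [simp]: "a <= 1 ==> cntT (ltr a b) = a" "b <= 1 ==> cntF (ltr a b) = b" "ltr (cntT c) (cntF c) = c"
 "cntT c <= 1" "cntF c <= 1" "cntT c + cntF c = lsz c"
 by (cases c; auto)+

lemma lok_iff: "lok a b \<longleftrightarrow> cntT a + cntT b <= 1 & cntF a + cntF b <= 1"
 by (cases a; cases b; auto)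
lemma lmu_iff: "lok a b ==> c = lmu a b \<longleftrightarrow> cntT c = cntT a + cntT b & cntF c = cntF a + cntF b"
 by (cases a; cases b; cases c; auto)
lemma mwt_powi: "lok a b ==> mwt z a b = z powi (int (cntT a) * int (cntF b) - int (cntT b) * int (cntF a))"
 by (cases a; cases b; auto simp: mwt_def power_int_minus)

fun okl :: "('c => letter) => 'c list => 'c list => bool" where
 "okl d [a, b] [c] = (lok (d a) (d b) & d c = lmu (d a) (d b))"
| "okl d [a] [b, c] = (lok (d b) (d c) & d a = lmu (d b) (d c))"
| "okl d [a] [b] = (d a = d b)"
| "okl d _ _ = False"

fun wtl :: "'a::field => ('c => letter) => ('c, 'v) lvstep => 'a" where
 "wtl z d (xs, [a, b], outs, v) = mwt z (d a) (d b)"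
| "wtl z d _ = 1"

lemma mrg_at: "mrg z (length us) F (us @ a # b # vs) = mwt z a b * F (us @ lmu a b # vs)"
 by (induction us arbitrary: F) auto
lemma spl_at: "spl (length us) m n F (us @ a # vs) = (\<Sum>(b, c)\<in>split_pairs a m n. F (us @ b # c # vs))"
 by (induction us arbitrary: F) (simp_all add: spl_pairs del: spl.simps(1))
lemma size_step_Mrg_at: "size_step (Mrg (length us)) (us @ m # n # vs) l' \<longleftrightarrow> l' = us @ (m + n) # vs"
proof (induction us arbitrary: l')
 case (Cons u us) then show ?case by (cases l') auto
qed auto
lemma size_step_Spl_at: "size_step (Spl (length us) m n) (us @ k # vs) l' \<longleftrightarrow> k = m + n & l' = us @ m # n # vs"
proof (induction us arbitrary: l')
 case (Cons u us) then show ?case by (cases l') auto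
qed auto

context annular_graph begin

fun lstep_of :: "('e => nat) => ('e \<times> int, real \<times> complex) lvstep => lstep list" where
 "lstep_of t (xs, [a, b], outs, v) = [Mrg (length xs)]"
| "lstep_of t (xs, [a], [b, c], v) = [Spl (length xs) (t (fst b)) (t (fst c))]"
| "lstep_of t _ = []"

fun lsteps :: "('e => nat) => ('e \<times> int, real \<times> complex) lvstep list => lstep list" where
 "lsteps t [] = []" | "lsteps t (s # ss) = lstep_of t s @ lsteps t ss"

text \<open>States of the whole sweep that continue given letters on the initial strands. Outside
  the created strands they are pinned to \<open>c0\<close>, which makes the set finite.\<close>

definition exts :: "('e => nat) => ('e \<times> int, real \<times> complex) lvstep list => ('e \<times> int => letter) => ('e \<times> int => letter) set" where
 "exts t ss c0 = {d. (ALL x. x ~: all_outs ss --> d x = c0 x) &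
  (\<forall>(xs, ins, outs, v)\<in>set ss. okl d ins outs & (\<forall>a\<in>set outs. lsz (d a) = t (fst a)))}"

lemma wok_shape:
 assumes "wok ins outs v"
 shows "(EX a b c. ins = [a, b] & outs = [c]) \<or> (EX a b c. ins = [a] & outs = [b, c]) \<or> (EX a b. ins = [a] & outs = [b] & fst a = fst b)"
proof (cases v)
 case (Some u)
 then show ?thesis using assms unfolding Some wok.simps by blast
next
 case None
 then show ?thesis using assms by auto
qed

lemma evolve_fresh: "evolve wok A L ss L' ==> all_outs ss Int A = {}"
proof (induction ss arbitrary: A L)
 case (Cons s ss)
 obtain xs ins outs v where s: "s = (xs, ins, outs, v)" by (cases s) auto
 from Cons.prems obtain ys where "set outs Int A = {}" "evolve wok (A Un set outs) (xs @ outs @ ys) ss L'"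
  unfolding s evolve.simps by blast
 then show ?case using Cons.IH[of "A Un set outs"] unfolding s by auto
qed simp

lemma evolve_size_steps:
 assumes t: "conserved t"
 shows "evolve wok A L ss L' ==> size_steps (lsteps t ss) (map (t \<circ> fst) L) (map (t \<circ> fst) L')"
proof (induction ss arbitrary: A L)
 case (Cons s ss)
 obtain xs ins outs v where s: "s = (xs, ins, outs, v)" by (cases s) auto
 from Cons.prems obtain ys where L: "L = xs @ ins @ ys" and ok: "wok ins outs v"
  and ev: "evolve wok (A Un set outs) (xs @ outs @ ys) ss L'"
  unfolding s evolve.simps by blast
 note IH = Cons.IH[OF ev] and cs = wok_lsum[OF t ok]
 have len: "length xs = length (map (t \<circ> fst) xs)" by simp
 from wok_shape[OF ok] show ?case
 proof (elim disjE exE conjE)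
  fix a b c assume io: "ins = [a, b]" "outs = [c]"
  have "size_step (Mrg (length xs)) (map (t \<circ> fst) L) (map (t \<circ> fst) (xs @ outs @ ys))"
   using size_step_Mrg_at[of "map (t \<circ> fst) xs" "t (fst a)" "t (fst b)" "map (t \<circ> fst) ys"] cs
   by (simp add: io L)
  then show ?thesis using IH unfolding s io by (simp only: lsteps.simps lstep_of.simps append.simps size_steps.simps) blast
 next
  fix a b c assume io: "ins = [a]" "outs = [b, c]"
  have "size_step (Spl (length xs) (t (fst b)) (t (fst c))) (map (t \<circ> fst) L) (map (t \<circ> fst) (xs @ outs @ ys))"
   using size_step_Spl_at[of "map (t \<circ> fst) xs" "t (fst b)" "t (fst c)" "t (fst a)" "map (t \<circ> fst) ys"] cs
   by (simp add: io L)
  then show ?thesis using IH unfolding s io by (simp only: lsteps.simps lstep_of.simps append.simps size_steps.simps) blast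
 next
  fix a b assume io: "ins = [a]" "outs = [b]" "fst a = fst b"
  then show ?thesis using IH unfolding s L by simp
 qed
qed simp

text \<open>The letters of the strands created by the first step become initial data for the rest of
  the sweep; freshness guarantees that later steps do not overwrite them.\<close>

lemma exts_Cons:
 assumes ev: "evolve wok A L ((xs, ins, outs, v) # ss) L'" and sub: "set L <= A"
 shows "d \<in> exts t ((xs, ins, outs, v) # ss) c0 \<longleftrightarrow>
  d \<in> exts t ss (%x. if x \<in> set outs then d x else c0 x) &
  okl (%x. if x \<in> set outs then d x else c0 x) ins outs & (\<forall>a\<in>set outs. lsz (d a) = t (fst a))"
proof -
 from ev obtain ys where L: "L = xs @ ins @ ys" and ok: "wok ins outs v" and fr: "set outs Int A = {}"
  and ev': "evolve wok (A Un set outs) (xs @ outs @ ys) ss L'"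
  unfolding evolve.simps by blast
 have fr': "all_outs ss Int (A Un set outs) = {}" by (rule evolve_fresh[OF ev'])
 have oc: "okl d ins outs = okl d' ins outs" if "\<forall>x\<in>set ins Un set outs. d x = d' x" for d d'
  using wok_shape[OF ok] that by auto
 have ins: "x ~: all_outs ss" "x ~: set outs" if "x \<in> set ins" for x using that L sub fr fr' by auto
 have out: "x ~: all_outs ss" if "x \<in> set outs" for x using that fr' by auto
 let ?c1 = "%x. if x \<in> set outs then d x else c0 x"
 have base: "(ALL x. x ~: all_outs ((xs, ins, outs, v) # ss) --> d x = c0 x) \<longleftrightarrow> (ALL x. x ~: all_outs ss --> d x = ?c1 x)"
  using out by auto
 show ?thesis
 proof (cases "ALL x. x ~: all_outs ss --> d x = ?c1 x")
  case True
  have "okl d ins outs = okl ?c1 ins outs"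
  proof (rule oc, rule ballI)
   fix x assume "x \<in> set ins Un set outs"
   then show "d x = ?c1 x" using True[rule_format, OF ins(1)[of x]] by (cases "x \<in> set outs") auto
  qed
  then show ?thesis using base by (auto simp: exts_def)
 next
  case False
  then show ?thesis using base by (auto simp: exts_def)
 qed
qed

lemma finite_letters: "finite (UNIV :: letter set)" unfolding letter_UNIV by simp

lemma exts_finite: "finite (exts t ss c0)"
proof -
 have "finite (all_outs ss)" unfolding all_outs_def by (auto simp: prod_cases4)
 have "exts t ss c0 <= (%f x. if x \<in> all_outs ss then f x else c0 x) ` {f. ALL x. (x \<in> all_outs ss --> f x \<in> UNIV) & (x ~: all_outs ss --> f x = LO)}"
 proof
  fix d assume d: "d \<in> exts t ss c0"
  show "d \<in> (%f x. if x \<in> all_outs ss then f x else c0 x) ` {f. ALL x. (x \<in> all_outs ss --> f x \<in> UNIV) & (x ~: all_outs ss --> f x = LO)}"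
   by (rule image_eqI[of _ _ "%x. if x \<in> all_outs ss then d x else LO"]) (use d in \<open>auto simp: exts_def\<close>)
 qed
 then show ?thesis
  by (rule finite_subset) (intro finite_imageI finite_set_of_finite_funs \<open>finite (all_outs ss)\<close> finite_letters)
qed

text \<open>Path expansion of a product of operators. A merge or a passage determines the letter of
  the new strand, whereas a split sums over \<open>split_pairs\<close>; the states fibre over these
  choices.\<close>

theorem evolve_sum:
 assumes t: "conserved t"
 shows "evolve wok A L ss L' ==> set L <= A ==> (\<forall>a\<in>set L. lsz (c0 a) = t (fst a)) ==>
  app_steps z (lsteps t ss) F (map c0 L) =
   (\<Sum>d\<in>exts t ss c0. prod_list (map (wtl z d) ss) * F (map d L'))"
proof (induction ss arbitrary: A L c0)
 case Nil
 have "exts t [] c0 = {c0}" by (auto simp: exts_def)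
 then show ?case using Nil by simp
next
 case (Cons s ss)
 obtain xs ins outs v where s: "s = (xs, ins, outs, v)" by (cases s) auto
 note ev0 = Cons.prems(1)[unfolded s]
 from ev0 obtain ys where L: "L = xs @ ins @ ys" and ok: "wok ins outs v" and fr: "set outs Int A = {}"
  and do: "distinct outs" and ev: "evolve wok (A Un set outs) (xs @ outs @ ys) ss L'"
  unfolding evolve.simps by blast
 note mem = exts_Cons[OF ev0 Cons.prems(2)]
 have sub: "set (xs @ outs @ ys) <= A Un set outs" using Cons.prems(2) L by auto
 have nin: "x ~: set outs" if "x \<in> set xs Un set ins Un set ys" for x using that Cons.prems(2) L fr by auto
 have fr': "all_outs ss Int (A Un set outs) = {}" by (rule evolve_fresh[OF ev])
 have keep: "d x = c1 x" if "d \<in> exts t ss c1" "x \<in> A Un set outs" for d c1 x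
 proof -
  have "x ~: all_outs ss" using that(2) fr' by blast
  then show ?thesis using that(1) unfolding exts_def by blast
 qed
 note cs = wok_lsum[OF t ok]
 have IH: "app_steps z (lsteps t ss) F (map c1 (xs @ outs @ ys)) =
   (\<Sum>d\<in>exts t ss c1. prod_list (map (wtl z d) ss) * F (map d L'))"
  if c1: "!!x. x ~: set outs ==> c1 x = c0 x" "!!x. x \<in> set outs ==> lsz (c1 x) = t (fst x)" for c1
 proof (rule Cons.IH[OF ev sub])
  show "\<forall>a\<in>set (xs @ outs @ ys). lsz (c1 a) = t (fst a)"
   using Cons.prems(3) c1 nin unfolding L by auto
 qed
 from wok_shape[OF ok] show ?case
 proof (elim disjE exE conjE)
  fix a b c assume io: "ins = [a, b]" "outs = [c]"
  define c1 where "c1 = c0(c := lmu (c0 a) (c0 b))"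
  have ac: "a ~= c" "b ~= c" using nin io by auto
  have mc: "map c1 (xs @ outs @ ys) = map c0 xs @ lmu (c0 a) (c0 b) # map c0 ys"
   using nin io by (auto simp: c1_def)
  have st: "app_steps z (lsteps t (s # ss)) F (map c0 L) = mwt z (c0 a) (c0 b) * app_steps z (lsteps t ss) F (map c1 (xs @ outs @ ys))"
   unfolding mc using mrg_at[of z "map c0 xs" "app_steps z (lsteps t ss) F" "c0 a" "c0 b" "map c0 ys"]
   by (simp add: s io L)
  show ?thesis
  proof (cases "lok (c0 a) (c0 b)")
   case False
   have "exts t (s # ss) c0 = {}" using False ac unfolding s set_eq_iff mem by (auto simp: io)
   then show ?thesis using st False by (simp add: mwt_def)
  next
   case True
   have sz: "lsz (lmu (c0 a) (c0 b)) = t (fst c)"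
    using lsz_lmu[OF True] Cons.prems(3) cs L io by simp
   have ex: "exts t (s # ss) c0 = exts t ss c1"
   proof (intro set_eqI iffI)
    fix d assume "d \<in> exts t (s # ss) c0"
    then have d: "d \<in> exts t ss (%x. if x \<in> set outs then d x else c0 x)" "d c = lmu (c0 a) (c0 b)"
     unfolding s mem using ac by (auto simp: io)
    have "(%x. if x \<in> set outs then d x else c0 x) = c1" using d(2) by (auto simp: c1_def io)
    then show "d \<in> exts t ss c1" using d(1) by simp
   next
    fix d assume d: "d \<in> exts t ss c1"
    have dc: "d c = lmu (c0 a) (c0 b)" using keep[OF d, of c] by (simp add: io c1_def)
    have "(%x. if x \<in> set outs then d x else c0 x) = c1" using dc by (auto simp: c1_def io)
    then show "d \<in> exts t (s # ss) c0" unfolding s mem using d dc sz True ac by (simp add: io c1_def)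
   qed
   have "app_steps z (lsteps t (s # ss)) F (map c0 L) =
    mwt z (c0 a) (c0 b) * (\<Sum>d\<in>exts t ss c1. prod_list (map (wtl z d) ss) * F (map d L'))"
    unfolding st by (subst IH) (use io sz in \<open>auto simp: c1_def\<close>)
   also have "... = (\<Sum>d\<in>exts t ss c1. prod_list (map (wtl z d) (s # ss)) * F (map d L'))"
    unfolding sum_distrib_left
   proof (rule sum.cong[OF refl])
    fix d assume d: "d \<in> exts t ss c1"
    have "d a = c0 a" "d b = c0 b" using keep[OF d, of a] keep[OF d, of b] Cons.prems(2) L io ac by (auto simp: c1_def)
    then show "mwt z (c0 a) (c0 b) * (prod_list (map (wtl z d) ss) * F (map d L')) =
     prod_list (map (wtl z d) (s # ss)) * F (map d L')" by (simp add: s io mult.assoc)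
   qed
   finally show ?thesis unfolding ex .
  qed
 next
  fix a b assume io: "ins = [a]" "outs = [b]" "fst a = fst b"
  define c1 where "c1 = c0(b := c0 a)"
  have ab: "a ~= b" using nin io by auto
  have mc: "map c1 (xs @ outs @ ys) = map c0 L" using nin io L by (auto simp: c1_def)
  have sz: "lsz (c0 a) = t (fst b)" using Cons.prems(3) L io by simp
  have ex: "exts t (s # ss) c0 = exts t ss c1"
  proof (intro set_eqI iffI)
   fix d assume "d \<in> exts t (s # ss) c0"
   then have d: "d \<in> exts t ss (%x. if x \<in> set outs then d x else c0 x)" "d b = c0 a"
    unfolding s mem using ab by (auto simp: io)
   have "(%x. if x \<in> set outs then d x else c0 x) = c1" using d(2) by (auto simp: c1_def io)
   then show "d \<in> exts t ss c1" using d(1) by simp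
  next
   fix d assume d: "d \<in> exts t ss c1"
   have dc: "d b = c0 a" using keep[OF d, of b] by (simp add: io c1_def)
   have "(%x. if x \<in> set outs then d x else c0 x) = c1" using dc by (auto simp: c1_def io)
   then show "d \<in> exts t (s # ss) c0" unfolding s mem using d dc sz ab by (simp add: io c1_def)
  qed
  have "app_steps z (lsteps t ss) F (map c1 (xs @ outs @ ys)) =
   (\<Sum>d\<in>exts t ss c1. prod_list (map (wtl z d) ss) * F (map d L'))"
   by (rule IH) (use io sz in \<open>auto simp: c1_def\<close>)
  then show ?thesis unfolding ex mc by (simp add: s io)
 next
  fix a b c assume io: "ins = [a]" "outs = [b, c]"
  define c1 where "c1 p = c0(b := fst p, c := snd p)" for p :: "letter \<times> letter"
  have ac: "a ~= b" "a ~= c" "b ~= c" using nin io do by auto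
  define SP where "SP = split_pairs (c0 a) (t (fst b)) (t (fst c))"
  have finSP: "finite SP" by (rule finite_subset[OF subset_UNIV]) (simp add: finite_prod finite_letters)
  have mc: "map (c1 p) (xs @ outs @ ys) = map c0 xs @ fst p # snd p # map c0 ys" for p
   using nin io ac by (auto simp: c1_def)
  have st: "app_steps z (lsteps t (s # ss)) F (map c0 L) = (\<Sum>p\<in>SP. app_steps z (lsteps t ss) F (map (c1 p) (xs @ outs @ ys)))"
   using spl_at[of "map c0 xs" "t (fst b)" "t (fst c)" "app_steps z (lsteps t ss) F" "c0 a" "map c0 ys"]
   unfolding mc by (simp add: s io L SP_def case_prod_unfold)
  have img: "(%d. (d b, d c)) ` exts t (s # ss) c0 <= SP"
  proof (rule image_subsetI)
   fix d assume "d \<in> exts t (s # ss) c0"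
   then have "lok (d b) (d c)" "c0 a = lmu (d b) (d c)" "\<forall>a\<in>set outs. lsz (d a) = t (fst a)"
    unfolding s mem using ac by (simp_all add: io)
   moreover from this(3) have "lsz (d b) = t (fst b)" "lsz (d c) = t (fst c)" unfolding io by simp_all
   ultimately show "(d b, d c) \<in> SP" by (simp add: SP_def split_pairs_def)
  qed
  have fib: "{d \<in> exts t (s # ss) c0. (d b, d c) = p} = exts t ss (c1 p)" if p: "p \<in> SP" for p
  proof (intro set_eqI iffI)
   fix d assume "d \<in> {d \<in> exts t (s # ss) c0. (d b, d c) = p}"
   then have d: "d \<in> exts t ss (%x. if x \<in> set outs then d x else c0 x)" "d b = fst p" "d c = snd p"
    unfolding s mem by auto
   have "(%x. if x \<in> set outs then d x else c0 x) = c1 p" using d(2,3) by (auto simp: c1_def io)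
   then show "d \<in> exts t ss (c1 p)" using d(1) by simp
  next
   fix d assume d: "d \<in> exts t ss (c1 p)"
   have dc: "d b = fst p" "d c = snd p" using keep[OF d, of b] keep[OF d, of c] ac by (auto simp: io c1_def)
   have E: "(%x. if x \<in> set outs then d x else c0 x) = c1 p" using dc by (auto simp: c1_def io)
   show "d \<in> {d \<in> exts t (s # ss) c0. (d b, d c) = p}"
   proof -
    have "lok (fst p) (snd p)" "c0 a = lmu (fst p) (snd p)" "lsz (fst p) = t (fst b)" "lsz (snd p) = t (fst c)"
     using p by (auto simp: SP_def split_pairs_def)
    moreover have "c1 p a = c0 a" "c1 p b = fst p" "c1 p c = snd p" using ac by (simp_all add: c1_def)
    moreover have "(d b, d c) = p" unfolding dc by simp
    ultimately show ?thesis unfolding s mem_Collect_eq mem E using d dc by (simp add: io)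
   qed
  qed
  have "(\<Sum>p\<in>SP. app_steps z (lsteps t ss) F (map (c1 p) (xs @ outs @ ys))) =
   (\<Sum>p\<in>SP. \<Sum>d\<in>exts t ss (c1 p). prod_list (map (wtl z d) ss) * F (map d L'))"
   by (rule sum.cong[OF refl], rule IH) (use io ac in \<open>auto simp: c1_def SP_def split_pairs_def\<close>)
  also have "... = (\<Sum>p\<in>SP. \<Sum>d\<in>{d \<in> exts t (s # ss) c0. (d b, d c) = p}. prod_list (map (wtl z d) ss) * F (map d L'))"
   by (rule sum.cong[OF refl]) (simp only: fib)
  also have "... = (\<Sum>d\<in>exts t (s # ss) c0. prod_list (map (wtl z d) ss) * F (map d L'))"
   by (rule sum.group[OF exts_finite finSP img])
  finally show ?thesis unfolding st by (simp add: s io)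
 qed
qed

end

lemma map_exists:
 "distinct L ==> length C = length L ==> EX c. map c L = C & (ALL a. a ~: set L --> c a = d)"
proof (induction L arbitrary: C)
 case Nil
 then show ?case by (intro exI[of _ "%_. d"]) simp
next
 case (Cons a L)
 then obtain x C' where C: "C = x # C'" by (cases C) auto
 with Cons obtain c where c: "map c L = C'" "ALL a. a ~: set L --> c a = d" by auto
 have m: "map (c(a := x)) L = C'" unfolding c(1)[symmetric] using Cons.prems(1) by (intro map_cong refl) auto
 show ?case unfolding C
 proof (intro exI conjI)
  show "map (c(a := x)) (a # L) = x # C'" unfolding list.map m by (simp only: fun_upd_same)
  show "ALL b. b ~: set (a # L) --> (c(a := x)) b = d" using c(2) by simp
 qed
qed

context annular_graph begin

definition cross :: "('e => nat) => ('e => nat) => int" where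
 "cross f g = (\<Sum>v\<in>merges w. int (f (left_edge w v)) * int (g (right_edge w v))
  - int (f (right_edge w v)) * int (g (left_edge w v)))"

lemma thin_path_step:
 "size_step s l l1 ==> thin_path (s # ss) l \<longleftrightarrow> thin l & thin_path ss l1"
 using size_step_det by (auto; blast)

lemma thin_path_evolve:
 assumes t: "conserved t"
 shows "evolve wok A L ss L' ==>
  thin_path (lsteps t ss) (map (t \<circ> fst) L) \<longleftrightarrow> (\<forall>a\<in>set L Un all_outs ss. t (fst a) <= 1)"
proof (induction ss arbitrary: A L)
 case Nil
 then show ?case by (auto simp: thin_def)
next
 case (Cons s ss)
 obtain xs ins outs v where s: "s = (xs, ins, outs, v)" by (cases s) auto
 from Cons.prems obtain ys where L: "L = xs @ ins @ ys" and ok: "wok ins outs v"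
  and ev: "evolve wok (A Un set outs) (xs @ outs @ ys) ss L'"
  unfolding s evolve.simps by blast
 note IH = Cons.IH[OF ev] and cs = wok_lsum[OF t ok]
 have len: "length xs = length (map (t \<circ> fst) xs)" by simp
 have all: "all_outs (s # ss) = set outs Un all_outs ss" unfolding s by simp
 from wok_shape[OF ok] show ?case
 proof (elim disjE exE conjE)
  fix a b c assume io: "ins = [a, b]" "outs = [c]"
  have st: "size_step (Mrg (length xs)) (map (t \<circ> fst) L) (map (t \<circ> fst) (xs @ outs @ ys))"
   using size_step_Mrg_at[of "map (t \<circ> fst) xs" "t (fst a)" "t (fst b)" "map (t \<circ> fst) ys"] cs
   by (simp add: io L)
  have "lsteps t (s # ss) = Mrg (length xs) # lsteps t ss" by (simp add: s io)
  then have P: "thin_path (lsteps t (s # ss)) (map (t \<circ> fst) L) \<longleftrightarrow>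
    thin (map (t \<circ> fst) L) & (\<forall>a\<in>set (xs @ outs @ ys) Un all_outs ss. t (fst a) <= 1)"
   unfolding IH[symmetric] by (simp only: thin_path_step[OF st])
  have T: "thin (map (t \<circ> fst) L) \<longleftrightarrow> (\<forall>a\<in>set L. t (fst a) <= 1)" by (simp add: thin_def)
  have U: "set L Un (set (xs @ outs @ ys) Un all_outs ss) = set L Un (set outs Un all_outs ss)" unfolding L by auto
  show ?thesis unfolding all P T ball_Un[symmetric] U ..
 next
  fix a b c assume io: "ins = [a]" "outs = [b, c]"
  have st: "size_step (Spl (length xs) (t (fst b)) (t (fst c))) (map (t \<circ> fst) L) (map (t \<circ> fst) (xs @ outs @ ys))"
   using size_step_Spl_at[of "map (t \<circ> fst) xs" "t (fst b)" "t (fst c)" "t (fst a)" "map (t \<circ> fst) ys"] cs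
   by (simp add: io L)
  have "lsteps t (s # ss) = Spl (length xs) (t (fst b)) (t (fst c)) # lsteps t ss" by (simp add: s io)
  then have P: "thin_path (lsteps t (s # ss)) (map (t \<circ> fst) L) \<longleftrightarrow>
    thin (map (t \<circ> fst) L) & (\<forall>a\<in>set (xs @ outs @ ys) Un all_outs ss. t (fst a) <= 1)"
   unfolding IH[symmetric] by (simp only: thin_path_step[OF st])
  have T: "thin (map (t \<circ> fst) L) \<longleftrightarrow> (\<forall>a\<in>set L. t (fst a) <= 1)" by (simp add: thin_def)
  have U: "set L Un (set (xs @ outs @ ys) Un all_outs ss) = set L Un (set outs Un all_outs ss)" unfolding L by auto
  show ?thesis unfolding all P T ball_Un[symmetric] U ..
 next
  fix a b assume io: "ins = [a]" "outs = [b]" "fst a = fst b"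
  have "lsteps t (s # ss) = lsteps t ss" by (simp add: s io)
  moreover have "map (t \<circ> fst) L = map (t \<circ> fst) (xs @ outs @ ys)" by (simp add: L io)
  ultimately have P: "thin_path (lsteps t (s # ss)) (map (t \<circ> fst) L) \<longleftrightarrow>
    (\<forall>a\<in>set (xs @ outs @ ys) Un all_outs ss. t (fst a) <= 1)" using IH by (simp only:)
  have U: "(\<forall>a\<in>set L. t (fst a) <= 1) \<longleftrightarrow> (\<forall>a\<in>set (xs @ outs @ ys). t (fst a) <= 1)"
   unfolding L io by (simp add: io(3))
  have U': "(\<forall>a\<in>set outs. t (fst a) <= 1) \<longleftrightarrow> t (fst b) <= 1" unfolding io by simp
  have U'': "(\<forall>a\<in>set (xs @ outs @ ys). t (fst a) <= 1) ==> t (fst b) <= 1" unfolding io by simp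
  show ?thesis unfolding all P ball_Un U U' using U'' by argo
 qed
qed

end

section \<open>Diagonal entries as weighted sums over pairs of loops\<close>

context cut_web begin

definition flow :: "('e => nat) => bool" where
 "flow t \<longleftrightarrow> conserved t & (ALL e. e ~: edges w --> t e = 0)"

definition loop_pairs :: "('e => nat) => (('e => nat) \<times> ('e => nat)) set" where
 "loop_pairs t = {(g, g'). g \<in> loops & g' \<in> loops & (ALL e. g e + g' e = t e)}"

definition cut_letters :: "('e => nat) \<times> ('e => nat) => letter list" where
 "cut_letters p = map (%e. ltr (fst p e) (snd p e)) es"

lemma finite_loop_pairs: "finite (loop_pairs t)"
 by (rule finite_subset[OF _ finite_cartesian_product[OF finite_loops finite_loops]]) (auto simp: loop_pairs_def)

lemma step_seen: "(xs, ins, outs, v) \<in> set ss ==> set ins <= seen & set outs <= seen"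
 using evolve_step_sub[OF evolve_ss order_refl] by (simp add: seen_def)

lemma step_cases:
 assumes "(xs, ins, outs, v) \<in> set ss"
 obtains (Pass) a b where "v = None" "ins = [a]" "outs = [b]" "fst a = fst b" "a \<in> seen" "b \<in> seen"
  | (Merge) u a b c where "v = Some u" "u \<in> merges w" "ins = [a, b]" "outs = [c]" "fst a = left_edge w u"
   "fst b = right_edge w u" "fst a ~= fst b" "in_edges w u = {fst a, fst b}" "out_edges w u = {fst c}"
   "a \<in> seen" "b \<in> seen" "c \<in> seen"
  | (Split) u a b c where "v = Some u" "u \<in> splits w" "ins = [a]" "outs = [b, c]" "fst b ~= fst c"
   "in_edges w u = {fst a}" "out_edges w u = {fst b, fst c}" "a \<in> seen" "b \<in> seen" "c \<in> seen"
proof -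
 have ok: "wok ins outs v" by (rule evolve_steps_ok[OF evolve_ss assms])
 have sub: "set ins <= seen" "set outs <= seen" using step_seen[OF assms] by (rule conjunct1, rule conjunct2)
 show thesis
 proof (cases v)
  case None
  then obtain a b where "ins = [a]" "outs = [b]" "fst a = fst b" using ok by auto
  then show thesis using Pass[OF None, of a b] sub by simp
 next
  case (Some u)
  from ok[unfolded Some wok.simps] show thesis
  proof (elim disjE exE conjE)
   fix a b c assume *: "u \<in> merges w" "ins = [a, b]" "outs = [c]" "fst a = left_edge w u" "fst b = right_edge w u"
    "fst a ~= fst b" "in_edges w u = {fst a, fst b}" "out_edges w u = {fst c}"
   have "a \<in> seen" "b \<in> seen" "c \<in> seen" using sub unfolding *(2,3) by simp_all
   then show thesis by (rule Merge[OF Some *])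
  next
   fix a b c assume *: "u \<in> splits w" "ins = [a]" "outs = [b, c]" "fst b ~= fst c"
    "in_edges w u = {fst a}" "out_edges w u = {fst b, fst c}"
   have "a \<in> seen" "b \<in> seen" "c \<in> seen" using sub unfolding *(2,3) by simp_all
   then show thesis by (rule Split[OF Some *])
  qed
 qed
qed

definition merge_term :: "('e => nat) => ('e => nat) => real \<times> complex => int" where
 "merge_term f g v = (if v \<in> merges w then int (f (left_edge w v)) * int (g (right_edge w v))
  - int (f (right_edge w v)) * int (g (left_edge w v)) else 0)"

lemma merge_term_sum: "(\<Sum>v\<leftarrow>all_vertices ss. merge_term f g v) = cross f g"
proof -
 have "(\<Sum>v\<leftarrow>all_vertices ss. merge_term f g v) = (\<Sum>v\<in>vertices w. merge_term f g v)"
  using sum_list_distinct_conv_sum_set[OF distinct_ss, of "merge_term f g"] vertices_ss by simp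
 also have "... = (\<Sum>v\<in>merges w. merge_term f g v)"
  by (rule sum.mono_neutral_right[OF finite_vertices]) (auto simp: merges_def merge_term_def)
 also have "... = cross f g" unfolding cross_def by (rule sum.cong) (auto simp: merge_term_def)
 finally show ?thesis .
qed

lemma loops_steps:
 assumes g: "g \<in> loops" "g' \<in> loops" and d: "!!a. a \<in> seen ==> d a = ltr (g (fst a)) (g' (fst a))"
  and s: "(xs, ins, outs, v) \<in> set ss" and z: "z ~= 0"
 shows "okl d ins outs" "wtl z d (xs, ins, outs, v) = z powi (\<Sum>u\<leftarrow>step_vertex (xs, ins, outs, v). merge_term g g' u)"
proof -
 note le = loopsD(1)[OF g(1)] loopsD(1)[OF g(2)]
 have cT: "cntT (d a) = g (fst a)" "cntF (d a) = g' (fst a)" if "a \<in> seen" for a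
  unfolding d[OF that] by (rule cnt_ltr(1)[OF le(1)], rule cnt_ltr(2)[OF le(2)])
 have cons: "sum g (in_edges w u) = sum g (out_edges w u)" "sum g' (in_edges w u) = sum g' (out_edges w u)"
  "sum g (in_edges w u) <= 1" "sum g' (in_edges w u) <= 1" if "u \<in> vertices w" for u
  using loopsD(3,4)[OF g(1)] loopsD(3,4)[OF g(2)] that by (auto simp: conserved_def)
 have "okl d ins outs & wtl z d (xs, ins, outs, v) = z powi (\<Sum>u\<leftarrow>step_vertex (xs, ins, outs, v). merge_term g g' u)"
  using s
 proof (cases rule: step_cases)
  case (Pass a b)
  then show ?thesis by (simp add: d)
 next
  case (Merge u a b c)
  have u: "u \<in> vertices w" using Merge(2) by (simp add: merges_def)
  have e: "g (fst a) + g (fst b) = g (fst c)" "g' (fst a) + g' (fst b) = g' (fst c)" "g (fst a) + g (fst b) <= 1" "g' (fst a) + g' (fst b) <= 1"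
   using cons[OF u] unfolding Merge(8,9) using Merge(7) by simp_all
  have lk: "lok (d a) (d b)" unfolding lok_iff cT[OF Merge(10)] cT[OF Merge(11)] using e by simp
  have "d c = lmu (d a) (d b)" unfolding lmu_iff[OF lk] cT[OF Merge(10)] cT[OF Merge(11)] cT[OF Merge(12)] using e by simp
  moreover have "mwt z (d a) (d b) = z powi merge_term g g' u"
   unfolding mwt_powi[OF lk] cT[OF Merge(10)] cT[OF Merge(11)] using Merge(2) by (simp add: merge_term_def Merge(5,6) mult.commute)
  ultimately show ?thesis using lk by (simp add: Merge(1,3,4))
 next
  case (Split u a b c)
  have u: "u \<in> vertices w" using Split(2) by (simp add: splits_def)
  have e: "g (fst b) + g (fst c) = g (fst a)" "g' (fst b) + g' (fst c) = g' (fst a)" "g (fst b) + g (fst c) <= 1" "g' (fst b) + g' (fst c) <= 1"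
   using cons[OF u] unfolding Split(6,7) using Split(5) by simp_all
  have lk: "lok (d b) (d c)" unfolding lok_iff cT[OF Split(9)] cT[OF Split(10)] using e by simp
  have "d a = lmu (d b) (d c)" unfolding lmu_iff[OF lk] cT[OF Split(8)] cT[OF Split(9)] cT[OF Split(10)] using e by simp
  moreover have "merge_term g g' u = 0" using Split(2) merges_splits_disjoint by (auto simp: merge_term_def)
  ultimately show ?thesis using lk by (simp add: Split(1,3,4))
 qed
 then show "okl d ins outs" "wtl z d (xs, ins, outs, v) = z powi (\<Sum>u\<leftarrow>step_vertex (xs, ins, outs, v). merge_term g g' u)"
  by (rule conjunct1, rule conjunct2)
qed

lemma steps_loops:
 assumes g: "!!e. g e <= 1" "!!e. g' e <= 1" "!!e. e ~: edges w ==> g e = 0 & g' e = 0"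
  and d: "!!a. a \<in> seen ==> d a = ltr (g (fst a)) (g' (fst a))"
  and ok: "!!xs ins outs v. (xs, ins, outs, v) \<in> set ss ==> okl d ins outs"
 shows "g \<in> loops" "g' \<in> loops"
proof -
 have cT: "cntT (d a) = g (fst a)" "cntF (d a) = g' (fst a)" if "a \<in> seen" for a
  unfolding d[OF that] by (rule cnt_ltr(1)[OF g(1)], rule cnt_ltr(2)[OF g(2)])
 have all: "(sum g (in_edges w u) = sum g (out_edges w u) & sum g (in_edges w u) <= 1) &
  (sum g' (in_edges w u) = sum g' (out_edges w u) & sum g' (in_edges w u) <= 1)" if u: "u \<in> vertices w" for u
 proof -
  obtain xs ins outs where s: "(xs, ins, outs, Some u) \<in> set ss" using vertex_step[OF u] by (elim exE)
  note okl = ok[OF s]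
  from s show ?thesis
  proof (cases rule: step_cases)
   case (Merge u' a b c)
   have uu: "u' = u" using Merge(1) by simp
   have lk: "lok (d a) (d b)" "d c = lmu (d a) (d b)" using okl unfolding Merge(3,4) by simp_all
   show ?thesis using lk(1) lk(2)[unfolded lmu_iff[OF lk(1)]] Merge(7)
    unfolding Merge(8)[unfolded uu] Merge(9)[unfolded uu] lok_iff cT[OF Merge(10)] cT[OF Merge(11)] cT[OF Merge(12)] by simp
  next
   case (Split u' a b c)
   have uu: "u' = u" using Split(1) by simp
   have lk: "lok (d b) (d c)" "d a = lmu (d b) (d c)" using okl unfolding Split(3,4) by simp_all
   show ?thesis using lk(1) lk(2)[unfolded lmu_iff[OF lk(1)]] Split(5)
    unfolding Split(6)[unfolded uu] Split(7)[unfolded uu] lok_iff cT[OF Split(8)] cT[OF Split(9)] cT[OF Split(10)] by simp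
  qed simp
 qed
 have g0: "!!e. e ~: edges w ==> g e = 0" "!!e. e ~: edges w ==> g' e = 0" using g(3) by blast+
 note a1 = all[THEN conjunct1, THEN conjunct1] all[THEN conjunct1, THEN conjunct2]
  all[THEN conjunct2, THEN conjunct1] all[THEN conjunct2, THEN conjunct2]
 show "g \<in> loops" unfolding loops_def conserved_def mem_Collect_eq by (intro conjI allI ballI impI g(1) g0(1) a1)
 show "g' \<in> loops" unfolding loops_def conserved_def mem_Collect_eq by (intro conjI allI ballI impI g(2) g0(2) a1)
qed

text \<open>On the diagonal the letters after one turn repeat those at the start, so by
  \<open>seen_well_defined\<close> a state descends from strands to edges. Its T-layer and F-layer
  are loops with sum \<open>t\<close>, and since each vertex is swept exactly once the local weights
  multiply to z to the power \<open>cross\<close>.\<close>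

theorem trace_loop_pairs:
 assumes t: "flow t" and C: "map lsz C = map t es" and z: "(z :: 'a::field) ~= 0"
 shows "app_steps z (lsteps t ss) (dlt C) C =
  (\<Sum>p | p \<in> loop_pairs t & cut_letters p = C. z powi cross (fst p) (snd p))"
proof -
 have tc: "conserved t" and t0: "!!e. e ~: edges w ==> t e = 0" using t by (auto simp: flow_def)
 have len: "length C = length L0" using arg_cong[OF C, of length] map_L0[symmetric] by simp
 obtain c0 where c0: "map c0 L0 = C" "ALL a. a ~: set L0 --> c0 a = LO"
  using map_exists[OF distinct_L0 len, of LO] by (elim exE conjE)
 have C0: "\<forall>a\<in>set L0. lsz (c0 a) = t (fst a)"
 proof
  fix a assume a: "a \<in> set L0"
  have "map (lsz \<circ> c0) L0 = map (t \<circ> fst) L0" using C unfolding c0(1)[symmetric] map_L0[symmetric] by simp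
  then show "lsz (c0 a) = t (fst a)" using a by (simp add: map_eq_conv)
 qed
 define D where "D = {d \<in> exts t ss c0. map d (map sh L0) = C}"
 define W where "W d = prod_list (map (wtl z d) ss)" for d
 define Ph where "Ph p = (%a. if a \<in> seen then ltr (fst p (fst a)) (snd p (fst a)) else LO)" for p :: "('e => nat) \<times> ('e => nat)"
 \<comment> \<open>Some visited lift of e; the inverse map reads the letter of e there, which is
   legitimate since the letters descend to edges.\<close>
 define rep where "rep e = (SOME a. a \<in> seen & fst a = e)" for e
 have rep: "rep e \<in> seen" "fst (rep e) = e" if "e \<in> edges w" for e
  using someI_ex[of "%a. a \<in> seen & fst a = e"] seen_surj[OF that] unfolding rep_def by blast+
 define Gn where "Gn d = ((%e. if e \<in> edges w then cntT (d (rep e)) else 0), (%e. if e \<in> edges w then cntF (d (rep e)) else 0))" for d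
 have shL0: "sh a \<in> seen" if a: "a \<in> set L0" for a
 proof -
  have "a \<in> crossings" "lo a < y" "y < up a" using a unfolding set_L0 by auto
  then show ?thesis unfolding seen_eq by (auto simp: crossings_def)
 qed
 have L0seen: "a \<in> seen" if "a \<in> set L0" for a using that by (simp add: seen_def)
 have cut: "cut_letters p = map (Ph p) L0" for p
  unfolding cut_letters_def map_L0[symmetric] Ph_def using L0seen by simp
 have "app_steps z (lsteps t ss) (dlt C) C = (\<Sum>d\<in>exts t ss c0. W d * dlt C (map d (map sh L0)))"
  using evolve_sum[OF tc evolve_ss order_refl C0, of z "dlt C"] unfolding c0(1) W_def .
 also have "... = (\<Sum>d\<in>D. W d * dlt C (map d (map sh L0)))"
  unfolding D_def by (rule sum.mono_neutral_right[OF exts_finite]) (auto simp: dlt_def)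
 also have "... = (\<Sum>d\<in>D. W d)" by (rule sum.cong[OF refl]) (simp add: D_def dlt_def)
 also have "... = (\<Sum>p | p \<in> loop_pairs t & cut_letters p = C. z powi cross (fst p) (snd p))"
 proof (rule sum.reindex_bij_witness[of _ Gn Ph, symmetric])
  fix p assume p: "p \<in> {p \<in> loop_pairs t. cut_letters p = C}"
  obtain g g' where pg: "p = (g, g')" by (cases p)
  have g: "g \<in> loops" "g' \<in> loops" "!!e. g e + g' e = t e" using p unfolding pg loop_pairs_def by auto
  have le: "g e <= 1" "g' e <= 1" for e by (rule loopsD(1)[OF g(1)], rule loopsD(1)[OF g(2)])
  have dP: "Ph p a = ltr (g (fst a)) (g' (fst a))" if "a \<in> seen" for a using that by (simp add: Ph_def pg)
  show "Gn (Ph p) = p"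
  proof -
   have "(if e \<in> edges w then cntT (Ph p (rep e)) else 0) = g e" "(if e \<in> edges w then cntF (Ph p (rep e)) else 0) = g' e" for e
    using dP[OF rep(1), of e] rep(2)[of e] cnt_ltr(1)[OF le(1)] cnt_ltr(2)[OF le(2)] loopsD(2)[OF g(1), of e] loopsD(2)[OF g(2), of e] by simp_all
   then show ?thesis unfolding Gn_def pg by presburger
  qed
  have C1: "map (Ph p) L0 = C" using p cut[of p] by simp
  have C2: "map (Ph p) (map sh L0) = C"
  proof -
   have "map (Ph p) (map sh L0) = map (Ph p) L0" using L0seen shL0 by (simp add: Ph_def)
   then show ?thesis using C1 by simp
  qed
  have "Ph p \<in> exts t ss c0"
   unfolding exts_def mem_Collect_eq
  proof (intro conjI allI impI ballI)
   fix a assume a: "a ~: all_outs ss"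
   show "Ph p a = c0 a"
   proof (cases "a \<in> set L0")
    case True
    then show ?thesis using C1 c0(1) by (metis map_eq_conv)
   next
    case False
    then have "a ~: seen" using a by (simp add: seen_def)
    then have "Ph p a = LO" by (simp add: Ph_def)
    then show ?thesis using c0(2)[rule_format, OF False] by (simp only:)
   qed
  next
   fix s assume s: "s \<in> set ss"
   obtain xs ins outs v where s': "s = (xs, ins, outs, v)" by (cases s) auto
   have "lsz (Ph p a) = t (fst a)" if a: "a \<in> set outs" for a
   proof -
    have as: "a \<in> seen" using step_seen[OF s[unfolded s']] a by blast
    have "lsz (Ph p a) = cntT (Ph p a) + cntF (Ph p a)" by simp
    also have "... = g (fst a) + g' (fst a)" unfolding dP[OF as] by (simp only: cnt_ltr(1)[OF le(1)] cnt_ltr(2)[OF le(2)])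
    finally show ?thesis using g(3) by simp
   qed
   then show "case s of (xs, ins, outs, v) => okl (Ph p) ins outs & (\<forall>a\<in>set outs. lsz (Ph p a) = t (fst a))"
    using loops_steps(1)[OF g(1,2) dP s[unfolded s'] z] unfolding s' by simp
  qed
  then show "Ph p \<in> D" unfolding D_def using C2 by simp
  have "prod_list (map (wtl z (Ph p)) s) = z powi (\<Sum>u\<leftarrow>all_vertices s. merge_term g g' u)" if "set s <= set ss" for s
   using that
  proof (induction s)
   case (Cons x s)
   obtain xs ins outs v where x: "x = (xs, ins, outs, v)" by (cases x) auto
   have "wtl z (Ph p) x = z powi (\<Sum>u\<leftarrow>step_vertex x. merge_term g g' u)"
    using loops_steps(2)[OF g(1,2) dP _ z, of xs ins outs v] Cons.prems unfolding x by simp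
   then show ?case using Cons z by (simp add: power_int_add del: step_vertex.simps)
  qed simp
  from this[of ss] have "prod_list (map (wtl z (Ph p)) ss) = z powi cross g g'"
   unfolding merge_term_sum by simp
  then show "W (Ph p) = z powi cross (fst p) (snd p)" unfolding W_def pg fst_conv snd_conv .
 next
  fix d assume d: "d \<in> D"
  have dx: "!!x. x ~: all_outs ss ==> d x = c0 x"
   and dok: "!!xs ins outs v. (xs, ins, outs, v) \<in> set ss ==> okl d ins outs & (\<forall>a\<in>set outs. lsz (d a) = t (fst a))"
   and dC: "map d (map sh L0) = C"
   using d unfolding D_def exts_def by blast+
  have dL0: "d a = c0 a" if "a \<in> set L0" for a
  proof (rule dx)
   have "lo a < y" using that unfolding set_L0 by simp
   then show "a ~: all_outs ss" unfolding outs_ss by auto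
  qed
  have dsh: "d (sh a) = d a" if a: "a \<in> set L0" for a
  proof -
   have "map (d \<circ> sh) L0 = map c0 L0" using dC c0(1) by simp
   then have "(d \<circ> sh) a = c0 a" unfolding map_eq_conv using a by (rule bspec)
   then have "d (sh a) = c0 a" by simp
   then show ?thesis using dL0[OF a] by simp
  qed
  have "\<exists>ps. \<forall>a\<in>seen. d a = ps (fst a)" by (rule seen_well_defined) (rule dsh)
  then obtain ps where ps: "\<forall>a\<in>seen. d a = ps (fst a)" by (elim exE)
  have psr: "d a = ps (fst a)" if "a \<in> seen" for a using ps that by simp
  define g g' where "g = fst (Gn d)" and "g' = snd (Gn d)"
  have ge: "g e = (if e \<in> edges w then cntT (ps e) else 0)" "g' e = (if e \<in> edges w then cntF (ps e) else 0)" for e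
   using psr[OF rep(1), of e] rep(2)[of e] by (simp_all add: g_def g'_def Gn_def)
  have gd: "d a = ltr (g (fst a)) (g' (fst a))" if "a \<in> seen" for a
   unfolding ge using seen_fst[OF that] psr[OF that] by (simp only: if_True cnt_ltr(3))
  have le: "g e <= 1" "g' e <= 1" and g0: "e ~: edges w ==> g e = 0 & g' e = 0" for e
   unfolding ge using cnt_ltr(4,5)[of "ps e"] by (simp_all only: if_split) simp_all
  have ok: "okl d ins outs" if "(xs, ins, outs, v) \<in> set ss" for xs ins outs v using dok[OF that] by (rule conjunct1)
  have lp: "g \<in> loops" "g' \<in> loops"
   by (rule steps_loops(1)[OF le g0 gd ok], assumption+, rule steps_loops(2)[OF le g0 gd ok], assumption+)
  have dsz: "lsz (d a) = t (fst a)" if a: "a \<in> seen" for a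
  proof (cases "a \<in> set L0")
   case True
   then show ?thesis using C0 dL0 by simp
  next
   case False
   then have "a \<in> all_outs ss" using a by (simp add: seen_def)
   then obtain s where s: "s \<in> set ss" "a \<in> step_outs s" unfolding all_outs_def by (elim UN_E)
   obtain xs ins outs v where s': "s = (xs, ins, outs, v)" by (cases s) auto
   show ?thesis using dok[of xs ins outs v] s unfolding s' by simp
  qed
  have tg: "g e + g' e = t e" for e
  proof (cases "e \<in> edges w")
   case True
   have "lsz (ps e) = t e" using dsz[OF rep(1)[OF True]] psr[OF rep(1)[OF True]] rep(2)[OF True] by simp
   then show ?thesis unfolding ge using True by simp
  qed (simp add: ge t0)
  show PP: "Ph (Gn d) = d"
  proof
   fix a show "Ph (Gn d) a = d a"
   proof (cases "a \<in> seen")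
    case True
    then show ?thesis using gd[OF True] by (simp add: Ph_def g_def g'_def)
   next
    case False
    then have nn: "a ~: set L0" "a ~: all_outs ss" by (simp_all add: seen_def)
     have "d a = LO" unfolding dx[OF nn(2)] by (rule c0(2)[rule_format, OF nn(1)])
    then show ?thesis using False by (simp add: Ph_def)
   qed
  qed
  have "cut_letters (Gn d) = map c0 L0" unfolding cut PP using dL0 by simp
  moreover have "Gn d \<in> loop_pairs t" using lp tg unfolding loop_pairs_def g_def g'_def by (simp add: case_prod_unfold)
  ultimately show "Gn d \<in> {p \<in> loop_pairs t. cut_letters p = C}" using c0(1) by simp
 qed
 finally show ?thesis .
qed

definition cut_size :: "('e => nat) => nat" where "cut_size g = sum_list (map g es)"

definition tip :: "'e => ('e => nat) => bool" where
 "tip r g \<longleftrightarrow> (\<forall>e\<in>set es. g e = (if e = r then 1 else 0))"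

lemma size_steps_cut:
 assumes "flow t" shows "size_steps (lsteps t ss) (map t es) (map t es)"
proof -
 have "map (t \<circ> fst) L0 = map t es" "map (t \<circ> fst) (map sh L0) = map t es"
  unfolding map_L0[symmetric] by simp_all
 then show ?thesis using evolve_size_steps[OF _ evolve_ss, of t] assms by (simp add: flow_def)
qed

lemma loop_pairsD:
 assumes "p \<in> loop_pairs t"
 shows "fst p \<in> loops" "snd p \<in> loops" "fst p e + snd p e = t e" "fst p e <= 1" "snd p e <= 1"
proof -
 show l: "fst p \<in> loops" "snd p \<in> loops" "fst p e + snd p e = t e" using assms by (auto simp: loop_pairs_def)
 show "fst p e <= 1" "snd p e <= 1" by (rule loopsD(1)[OF l(1)], rule loopsD(1)[OF l(2)])
qed

lemma cut_letters_props:
 assumes p: "p \<in> loop_pairs t"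
 shows "map lsz (cut_letters p) = map t es" "swt (cut_letters p) = int (cut_size (fst p)) - int (cut_size (snd p))"
proof -
 note D = loop_pairsD(3,4,5)[OF p]
 have "lsz (ltr (fst p e) (snd p e)) = t e" for e
  using D[of e] by (cases "fst p e"; cases "snd p e") auto
 then show "map lsz (cut_letters p) = map t es" by (simp add: cut_letters_def del: ltr.simps)
 have l: "lwt (ltr (fst p e) (snd p e)) = int (fst p e) - int (snd p e)" for e
  using D[of e] by (cases "fst p e"; cases "snd p e") auto
 have "sum_list (map lwt (map (%e. ltr (fst p e) (snd p e)) l)) = int (sum_list (map (fst p) l)) - int (sum_list (map (snd p) l))" for l
 proof (induction l)
  case (Cons e l)
  then show ?case using l[of e] by (simp del: ltr.simps)
 qed simp
 then show "swt (cut_letters p) = int (cut_size (fst p)) - int (cut_size (snd p))"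
  unfolding swt_def cut_letters_def cut_size_def .
qed

text \<open>The weight of the cut word is the difference of the two cut sizes, so both sides are
  traces of the same operator on opposite weight spaces.\<close>

theorem loop_pairs_symmetric:
 assumes t: "flow t" and z: "(z :: 'a::field) ~= 0" and zn: "!!n::nat. n > 0 ==> z ^ n ~= 1"
 shows "(\<Sum>p | p \<in> loop_pairs t & int (cut_size (fst p)) - int (cut_size (snd p)) = m. z powi cross (fst p) (snd p)) =
  (\<Sum>p | p \<in> loop_pairs t & int (cut_size (fst p)) - int (cut_size (snd p)) = - m. z powi cross (fst p) (snd p))"
proof -
 have "(\<Sum>C | C \<in> lists_sz (map t es) & swt C = m. app_steps z (lsteps t ss) (dlt C) C) =
  (\<Sum>p | p \<in> loop_pairs t & int (cut_size (fst p)) - int (cut_size (snd p)) = m. z powi cross (fst p) (snd p))" for m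
 proof -
  let ?S = "{p. p \<in> loop_pairs t & int (cut_size (fst p)) - int (cut_size (snd p)) = m}"
  let ?T = "{C. C \<in> lists_sz (map t es) & swt C = m}"
  have "(\<Sum>C\<in>?T. app_steps z (lsteps t ss) (dlt C) C) = (\<Sum>C\<in>?T. \<Sum>p\<in>{p \<in> ?S. cut_letters p = C}. z powi cross (fst p) (snd p))"
  proof (rule sum.cong[OF refl])
   fix C assume "C \<in> ?T"
   then have C: "map lsz C = map t es" "swt C = m" by (auto simp: lists_sz_def)
   have "{p. p \<in> loop_pairs t & cut_letters p = C} = {p \<in> ?S. cut_letters p = C}"
    using cut_letters_props(2) C(2) by auto
   then show "app_steps z (lsteps t ss) (dlt C) C = (\<Sum>p\<in>{p \<in> ?S. cut_letters p = C}. z powi cross (fst p) (snd p))"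
    using trace_loop_pairs[OF t C(1) z] by simp
  qed
  also have "... = (\<Sum>p\<in>?S. z powi cross (fst p) (snd p))"
  proof (rule sum.group)
   show "finite ?S" by (rule finite_subset[OF _ finite_loop_pairs[of t]]) auto
   show "finite ?T" by (rule finite_subset[OF _ finite_lists_sz[of "map t es"]]) auto
   show "cut_letters ` ?S <= ?T"
   proof (rule image_subsetI)
    fix p assume "p \<in> ?S"
    then show "cut_letters p \<in> ?T" using cut_letters_props[of p t] by (simp add: lists_sz_def)
   qed
  qed
  finally show ?thesis .
 qed
 then show ?thesis using trace_symmetric[OF z zn size_steps_cut[OF t], of m] by simp
qed

lemma Vl_last: "thin l ==> Vl (l @ 1 # l') (sum_list l) = Wl l @ LF # Wl l'"
proof (induction l)
 case (Cons k l)
 then have "k = 0 \<or> k = 1" by auto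
 then show ?case using Cons by auto
qed simp

lemma one_thick_append: "thin l ==> thin l' ==> one_thick (l @ 2 # l')"
 by (induction l) (auto simp: le_Suc_eq)

text \<open>Every vertex has a single edge on one of its sides, so the bound 1 on edges already
  bounds the flow through the vertex.\<close>

lemma flow_in_loops_iff:
 assumes t: "flow t"
 shows "t \<in> loops \<longleftrightarrow> (\<forall>a\<in>seen. t (fst a) <= 1)"
proof
 assume "t \<in> loops"
 then show "\<forall>a\<in>seen. t (fst a) <= 1" using loopsD(1) by (intro ballI)
next
 assume l: "\<forall>a\<in>seen. t (fst a) <= 1"
 have tc: "conserved t" and t0: "!!e. e ~: edges w ==> t e = 0" using t by (auto simp: flow_def)
 have le: "t e <= 1" for e
 proof (cases "e \<in> edges w")
  case True
  from seen_surj[OF this] obtain a where a: "a \<in> seen" "fst a = e" by (elim bexE)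
  show ?thesis using bspec[OF l a(1)] unfolding a(2) .
 qed (simp add: t0)
 have "sum t (in_edges w v) <= 1" if v: "v \<in> vertices w" for v
 proof -
  have eq: "sum t (in_edges w v) = sum t (out_edges w v)" using tc v by (simp add: conserved_def)
  from vertex_kind[OF v] show ?thesis
  proof
   assume "v \<in> merges w"
   then have "card (out_edges w v) = 1" by (simp add: merges_def)
   then obtain e where e: "out_edges w v = {e}" by (rule card_1_singletonE)
   show ?thesis unfolding eq e using le by simp
  next
   assume "v \<in> splits w"
   then have "card (in_edges w v) = 1" by (simp add: splits_def)
   then obtain e where e: "in_edges w v = {e}" by (rule card_1_singletonE)
   show ?thesis unfolding e using le by simp
  qed
 qed
 then show "t \<in> loops" unfolding loops_def mem_Collect_eq by (intro conjI allI ballI impI le t0 tc)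
qed

text \<open>Let S(z) be the diagonal entry for the cut word in which F occupies r alone or together
  with T. The number 1 - \<open>fst p r\<close> is 1 or 0 accordingly, so the right side is z S(1/z)
  - S(z)/z or S(1/z) - S(z). By the walker lemmas it vanishes unless the total flow is in
  \<open>loops\<close>; then S = 1 and it equals z - 1/z.\<close>

theorem tip_pairs_sum:
 assumes t: "flow t" and z: "(z :: 'a::field) ~= 0"
  and es: "es = xs @ r # ys" and ys: "!!e. e \<in> set ys ==> t e = 0" and r: "t r > 0"
 shows "(if t \<in> loops then z powi int (t r) - z powi (- int (t r)) else 0) =
  (\<Sum>p | p \<in> loop_pairs t & tip r (snd p). z powi (1 - int (fst p r) - cross (fst p) (snd p))
   - z powi (- (1 - int (fst p r) - cross (fst p) (snd p))))"
proof -
 define P where "P = {p. p \<in> loop_pairs t & tip r (snd p)}"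
 let ?cf = "%p. cross (fst p) (snd p)"
 define S where "S x = (\<Sum>p\<in>P. x powi ?cf p)" for x :: 'a
 have Sinv: "S (inverse z) = (\<Sum>p\<in>P. z powi (- ?cf p))" unfolding S_def by (simp add: power_int_inverse power_int_minus)
 have r_nin: "r ~: set xs" "r ~: set ys" using distinct_es unfolding es by auto
 have r_in: "r \<in> set es" unfolding es by simp
 have pos: "(\<forall>e\<in>set xs. Q e) & Q r & (\<forall>e\<in>set ys. Q e) \<longleftrightarrow> (\<forall>e\<in>set es. Q e)" for Q unfolding es by auto
 have tipx: "tip r g \<longleftrightarrow> (\<forall>e\<in>set xs. g e = 0) & g r = 1 & (\<forall>e\<in>set ys. g e = 0)" for g
  unfolding tip_def pos[symmetric] using r_nin by auto
 let ?W = "%k::nat. if k = 0 then LO else if k = 1 then LT else LB"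
 have letter: "ltr (fst p e) (snd p e) = ?W (t e) \<longleftrightarrow> snd p e = 0" if "p \<in> loop_pairs t" "t e <= 1" for p e
  using loop_pairsD(3,4,5)[OF that(1), of e] that(2) by (cases "fst p e"; cases "snd p e") auto
 have letter_r: "ltr (fst p r) (snd p r) = (if t r = 1 then LF else LB) \<longleftrightarrow> snd p r = 1"
  if "p \<in> loop_pairs t" "t r <= 2" for p
  using loop_pairsD(3,4,5)[OF that(1), of r] that(2) r by (cases "fst p r"; cases "snd p r") auto
 have PC: "P = {p. p \<in> loop_pairs t & cut_letters p = Wl (map t xs) @ (if t r = 1 then LF else LB) # Wl (map t ys)}"
  if xs: "\<forall>e\<in>set xs. t e <= 1" and r2: "t r <= 2"
 proof -
  have "cut_letters p = Wl (map t xs) @ (if t r = 1 then LF else LB) # Wl (map t ys) \<longleftrightarrow> tip r (snd p)" if p: "p \<in> loop_pairs t" for p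
  proof -
   have "cut_letters p = Wl (map t xs) @ (if t r = 1 then LF else LB) # Wl (map t ys) \<longleftrightarrow>
    (\<forall>e\<in>set xs. ltr (fst p e) (snd p e) = ?W (t e)) & ltr (fst p r) (snd p r) = (if t r = 1 then LF else LB) &
    (\<forall>e\<in>set ys. ltr (fst p e) (snd p e) = ?W (t e))"
    unfolding cut_letters_def es Wl_def by (simp add: map_eq_conv append_eq_append_conv del: ltr.simps)
   also have "... \<longleftrightarrow> tip r (snd p)" unfolding tipx letter_r[OF p r2]
    by (intro conj_cong ball_cong refl letter[OF p]) (use xs ys in simp_all)
   finally show ?thesis .
  qed
  then show ?thesis unfolding P_def by blast
 qed
 have D1: "S x = app_steps x (lsteps t ss) (dlt C) C" if "P = {p. p \<in> loop_pairs t & cut_letters p = C}" "map lsz C = map t es" "x ~= 0" for x C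
  unfolding S_def that(1) using trace_loop_pairs[OF t that(2,3)] by simp
 have thinpath: "thin_path (lsteps t ss) (map t es) \<longleftrightarrow> t \<in> loops"
 proof -
  have "map (t \<circ> fst) L0 = map t es" unfolding map_L0[symmetric] by simp
  then show ?thesis using thin_path_evolve[OF _ evolve_ss, of t] t unfolding flow_in_loops_iff[OF t] seen_def flow_def by simp
 qed
 have rhs: "(\<Sum>p | p \<in> loop_pairs t & tip r (snd p). z powi (1 - int (fst p r) - ?cf p) - z powi (- (1 - int (fst p r) - ?cf p)))
   = z powi k * S (inverse z) - z powi (- k) * S z" if k: "!!p. p \<in> P ==> 1 - int (fst p r) = k" for k
  unfolding P_def[symmetric] Sinv unfolding S_def sum_distrib_left sum_subtractf[symmetric]
 proof (rule sum.cong[OF refl])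
  fix p assume p: "p \<in> P"
  have "z powi (k - ?cf p) = z powi k * z powi (- ?cf p)" "z powi (- (k - ?cf p)) = z powi (- k) * z powi ?cf p"
   using power_int_add[of z k "- ?cf p"] power_int_add[of z "- k" "?cf p"] z by simp_all
  then show "z powi (1 - int (fst p r) - ?cf p) - z powi (- (1 - int (fst p r) - ?cf p)) =
   z powi k * z powi (- ?cf p) - z powi (- k) * z powi ?cf p" unfolding k[OF p] by simp
 qed
 have Pr: "snd p r = 1" "fst p r + 1 = t r" "!!e. e \<in> set xs ==> t e <= 1" if p: "p \<in> P" for p
 proof -
  have lp: "p \<in> loop_pairs t" "tip r (snd p)" using p by (auto simp: P_def)
  show s: "snd p r = 1" using lp(2) unfolding tipx by simp
  show "fst p r + 1 = t r" using loop_pairsD(3)[OF lp(1), of r] s by simp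
  fix e assume "e \<in> set xs"
  then have "snd p e = 0" using lp(2) unfolding tipx by simp
  then show "t e <= 1" using loop_pairsD(3,4)[OF lp(1), of e] by simp
 qed
 show ?thesis
 proof (cases "thin (map t es)")
  case True
  have tr: "t r = 1" using True r unfolding es by (auto simp: thin_def)
  have xs1: "\<forall>e\<in>set xs. t e <= 1" using True unfolding es by (auto simp: thin_def)
  define m where "m = sum_list (map t xs)"
  have sys: "sum_list (map t ys) = 0" using ys by simp
  have V: "Vl (map t es) m = Wl (map t xs) @ LF # Wl (map t ys)"
   using Vl_last[of "map t xs" "map t ys"] xs1 tr unfolding es m_def by (simp add: thin_def)
  have PV: "P = {p. p \<in> loop_pairs t & cut_letters p = Vl (map t es) m}" using PC[OF xs1] tr unfolding V by simp
  have szV: "map lsz (Vl (map t es) m) = map t es"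
   using xs1 ys tr unfolding V unfolding es Wl_def by (auto simp: le_Suc_eq)
  have mm: "Suc m = sum_list (map t es)" unfolding es m_def using tr sys by simp
  note wt = walk_thin[OF _ True mm size_steps_cut[OF t] True refl]
  have k: "1 - int (fst p r) = 1" if "p \<in> P" for p using Pr(2)[OF that] tr by simp
  have iz: "inverse z ~= 0" using z by simp
  show ?thesis
  proof (cases "t \<in> loops")
   case lp: True
   have "S z = 1" "S (inverse z) = 1"
    using wt[OF z] wt[OF iz] lp thinpath D1[OF PV szV z] D1[OF PV szV iz] by simp_all
   then show ?thesis using rhs[OF k] lp tr by simp
  next
   case False
   have "inverse z * S z = z * S (inverse z)"
    using wt[OF z] False thinpath D1[OF PV szV z] D1[OF PV szV iz] by simp
   then show ?thesis using rhs[OF k] False by (simp add: power_int_minus)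
  qed
 next
  case nthin: False
  have nl: "t ~: loops" using nthin loopsD(1)[of t] by (auto simp: thin_def)
  show ?thesis
  proof (cases "P = {}")
   case True
   show ?thesis unfolding P_def[symmetric] True using nl by simp
  next
   case False
   then obtain p where p: "p \<in> P" by blast
   have xs1: "\<forall>e\<in>set xs. t e <= 1" using Pr(3)[OF p] by blast
   have tr2: "t r <= 2" using Pr(2)[OF p] loop_pairsD(4)[of p t r] p by (simp add: P_def)
   have "t r ~= 1"
   proof
    assume "t r = 1"
    then have "thin (map t es)" using xs1 ys unfolding es by (auto simp: thin_def)
    then show False using nthin by simp
   qed
   then have tr: "t r = 2" using tr2 r by simp
   have W: "Wl (map t es) = Wl (map t xs) @ LB # Wl (map t ys)" unfolding es Wl_def by (simp add: tr)
   have PV: "P = {p. p \<in> loop_pairs t & cut_letters p = Wl (map t es)}" using PC[OF xs1 tr2] tr unfolding W by simp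
   have szV: "map lsz (Wl (map t es)) = map t es"
    using xs1 ys tr unfolding W unfolding es Wl_def by (auto simp: le_Suc_eq)
   have ot: "one_thick (map t es)" using one_thick_append[of "map t xs" "map t ys"] xs1 ys unfolding es by (simp add: tr thin_def)
   have k: "1 - int (fst p r) = 0" if "p \<in> P" for p using Pr(2)[OF that] tr by simp
   have iz: "inverse z ~= 0" using z by simp
   have "S z = S (inverse z)" using walk_thick[OF z size_steps_cut[OF t] ot] D1[OF PV szV z] D1[OF PV szV iz] by simp
   then show ?thesis using rhs[OF k] nl by simp
  qed
 qed
qed

end

section \<open>The quantum torus\<close>

locale quantum_torus =
 fixes E :: "'e set" and om :: "('e => nat) => ('e => nat) => int" and z :: "'a::field"
 assumes finite_E: "finite E" and z0: "z ~= 0"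
  and om_add_left: "!!a b c. om (%e. a e + b e) c = om a c + om b c"
  and om_add_right: "!!a b c. om c (%e. a e + b e) = om c a + om c b"
  and om_antisym: "!!a b. om a b = - om b a"
begin

definition vecs :: "('e => nat) set" where "vecs = {t. ALL e. e ~: E --> t e = 0}"

definition dec :: "('e => nat) => (('e => nat) \<times> ('e => nat)) set" where
 "dec t = {(a, b). t \<in> vecs & (ALL e. a e + b e = t e)}"

text \<open>Coefficientwise product in the algebra with generators X^a and X^a X^b = z^(om a b)
  X^(a+b). The condition \<open>t \<in> vecs\<close> in \<open>dec\<close> keeps the sums
  finite.\<close>

definition conv :: "(('e => nat) => 'a) => (('e => nat) => 'a) => ('e => nat) => 'a" where
 "conv f g t = (\<Sum>(a, b)\<in>dec t. z powi om a b * f a * g b)"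

definition unit :: "('e => nat) => 'a" where "unit t = (if t = (%_. 0) then 1 else 0)"

lemma om_zero [simp]: "om (%_. 0) c = 0" "om c (%_. 0) = 0"
proof -
 have "om (%e. 0 + 0) c = om (%_. 0) c + om (%_. 0) c" by (rule om_add_left)
 then show "om (%_. 0) c = 0" by simp
 then show "om c (%_. 0) = 0" using om_antisym[of c "%_. 0"] by simp
qed

lemma decD: "(a, b) \<in> dec t ==> t = (%e. a e + b e)" "(a, b) \<in> dec t ==> t \<in> vecs"
 "(a, b) \<in> dec t ==> a \<in> vecs" "(a, b) \<in> dec t ==> b \<in> vecs"
proof -
 assume d: "(a, b) \<in> dec t"
 then show t: "t = (%e. a e + b e)" and "t \<in> vecs" unfolding dec_def by auto
 have "a e + b e = 0" if "e ~: E" for e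
  using \<open>t \<in> vecs\<close> that unfolding t vecs_def by simp
 then show "a \<in> vecs" "b \<in> vecs" unfolding vecs_def by auto
qed

lemma decI: "a \<in> vecs ==> b \<in> vecs ==> (a, b) \<in> dec (%e. a e + b e)"
 by (auto simp: dec_def vecs_def)

lemma finite_dec: "finite (dec t)"
proof (cases "t \<in> vecs")
 case True
 define B where "B = {f. ALL x. (x \<in> E --> f x \<in> {..sum t E}) & (x ~: E --> f x = 0)}"
 have fB: "finite B" unfolding B_def by (intro finite_set_of_finite_funs finite_E finite_atMost)
 have le: "t e <= sum t E" if "e \<in> E" for e using finite_E that by (intro member_le_sum) auto
 have "dec t <= B \<times> B"
 proof
  fix p assume p: "p \<in> dec t"
  obtain a b where ab: "p = (a, b)" by (cases p)
  have v: "a \<in> vecs" "b \<in> vecs" "t = (%e. a e + b e)" using decD[of a b t] p ab by auto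
  have "a e <= sum t E" "b e <= sum t E" if "e \<in> E" for e
   using le[OF that] fun_cong[OF v(3), of e] by linarith+
  then show "p \<in> B \<times> B" using v(1,2) unfolding ab B_def vecs_def by simp
 qed
 then show ?thesis by (rule finite_subset) (simp add: fB)
next
 case False
 then have "dec t = {}" by (auto simp: dec_def)
 then show ?thesis by simp
qed

text \<open>Bilinearity of \<open>om\<close> is the cocycle condition for z to the power
  \<open>om\<close>.\<close>

lemma conv_assoc: "conv (conv f g) h = conv f (conv g h)"
proof
 fix t
 define X where "X = (SIGMA p:dec t. dec (fst p))"
 define Y where "Y = (SIGMA p:dec t. dec (snd p))"
 define wX where "wX = (%(p, r). z powi om (fst p) (snd p) * (z powi om (fst r) (snd r) * f (fst r) * g (snd r)) * h (snd p))"
 define wY where "wY = (%(p, r). z powi om (fst p) (snd p) * f (fst p) * (z powi om (fst r) (snd r) * g (fst r) * h (snd r)))"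
 have "conv (conv f g) h t = (\<Sum>p\<in>dec t. \<Sum>r\<in>dec (fst p). wX (p, r))"
  unfolding conv_def wX_def by (simp add: case_prod_unfold sum_distrib_left sum_distrib_right)
 also have "... = sum wX X" unfolding X_def by (subst sum.Sigma) (auto simp: finite_dec)
 also have "... = sum wY Y"
 proof (rule sum.reindex_bij_witness[of _
   "%(p, r). ((%e. fst p e + fst r e, snd r), (fst p, fst r))" "%(p, r). ((fst r, %e. snd r e + snd p e), (snd r, snd p))"])
  fix x assume x: "x \<in> X"
  obtain a b c d where x': "x = ((a, b), (c, d))" by (metis prod.collapse)
  have d: "(a, b) \<in> dec t" "(c, d) \<in> dec a" using x unfolding X_def x' by auto
  have a: "a = (%e. c e + d e)" and t: "t = (%e. a e + b e)" using decD(1)[OF d(1)] decD(1)[OF d(2)] by auto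
  show "(case case x of (p, r) => ((fst r, %e. snd r e + snd p e), (snd r, snd p)) of
    (p, r) => ((%e. fst p e + fst r e, snd r), (fst p, fst r))) = x" unfolding x' by (simp add: a)
  have v: "c \<in> vecs" "d \<in> vecs" "b \<in> vecs" "t \<in> vecs" using decD[OF d(1)] decD[OF d(2)] by auto
  have "(c, %e. d e + b e) \<in> dec t" using v(4) unfolding dec_def t a by (simp add: add.assoc)
  moreover have "(d, b) \<in> dec (%e. d e + b e)" by (rule decI[OF v(2,3)])
  ultimately show "(case x of (p, r) => ((fst r, %e. snd r e + snd p e), (snd r, snd p))) \<in> Y"
   unfolding x' Y_def by simp
  have "om a b + om c d = om c (%e. d e + b e) + om d b"
   unfolding a om_add_left om_add_right by simp
  then have "z powi om a b * z powi om c d = z powi om c (%e. d e + b e) * z powi om d b"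
   using z0 by (simp add: power_int_add[symmetric])
  then show "wY (case x of (p, r) => ((fst r, %e. snd r e + snd p e), (snd r, snd p))) = wX x"
   unfolding x' wX_def wY_def by (simp add: mult_ac)
 next
  fix x assume x: "x \<in> Y"
  obtain a b c d where x': "x = ((a, b), (c, d))" by (metis prod.collapse)
  have d: "(a, b) \<in> dec t" "(c, d) \<in> dec b" using x unfolding Y_def x' by auto
  have b: "b = (%e. c e + d e)" and t: "t = (%e. a e + b e)" using decD(1)[OF d(1)] decD(1)[OF d(2)] by auto
  show "(case case x of (p, r) => ((%e. fst p e + fst r e, snd r), (fst p, fst r)) of
    (p, r) => ((fst r, %e. snd r e + snd p e), (snd r, snd p))) = x" unfolding x' by (simp add: b)
  have v: "a \<in> vecs" "c \<in> vecs" "t \<in> vecs" using decD[OF d(1)] decD[OF d(2)] by auto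
  have "(%e. a e + c e, d) \<in> dec t" using v(3) unfolding dec_def t b by (simp add: add.assoc)
  moreover have "(a, c) \<in> dec (%e. a e + c e)" by (rule decI[OF v(1,2)])
  ultimately show "(case x of (p, r) => ((%e. fst p e + fst r e, snd r), (fst p, fst r))) \<in> X"
   unfolding x' X_def by simp
 qed
 also have "... = (\<Sum>p\<in>dec t. \<Sum>r\<in>dec (snd p). wY (p, r))" unfolding Y_def by (subst sum.Sigma) (auto simp: finite_dec)
 also have "... = conv f (conv g h) t"
  unfolding conv_def wY_def by (simp add: case_prod_unfold sum_distrib_left sum_distrib_right)
 finally show "conv (conv f g) h t = conv f (conv g h) t" .
qed

lemma conv_add_left: "conv (%t. f t + c * g t) k = (%t. conv f k t + c * conv g k t)"
 by (rule ext) (simp add: conv_def case_prod_unfold sum.distrib sum_distrib_left algebra_simps)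

lemma conv_add_right: "conv k (%t. f t + c * g t) = (%t. conv k f t + c * conv k g t)"
 by (rule ext) (simp add: conv_def case_prod_unfold sum.distrib sum_distrib_left algebra_simps)

lemma conv_unit:
 assumes "!!t. t ~: vecs ==> f t = 0"
 shows "conv unit f = f" "conv f unit = f"
proof -
 have v: "(%_. 0) \<in> vecs" by (simp add: vecs_def)
 have "conv unit f t = f t & conv f unit t = f t" for t
 proof (cases "t \<in> vecs")
  case True
  have d: "(%_. 0, t) \<in> dec t" "(t, %_. 0) \<in> dec t" using True by (simp_all add: dec_def)
  have "conv unit f t = (\<Sum>p\<in>{(%_. 0, t)}. z powi om (fst p) (snd p) * unit (fst p) * f (snd p))"
   unfolding conv_def case_prod_unfold
  proof (rule sum.mono_neutral_right[OF finite_dec])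
   show "{(%_. 0, t)} <= dec t" using d by simp
   show "\<forall>p\<in>dec t - {(%_. 0, t)}. z powi om (fst p) (snd p) * unit (fst p) * f (snd p) = 0"
   proof
    fix p assume p: "p \<in> dec t - {(%_. 0, t)}"
    have "fst p ~= (%_. 0)" using p decD(1)[of "fst p" "snd p" t] by (cases p) auto
    then show "z powi om (fst p) (snd p) * unit (fst p) * f (snd p) = 0" by (simp add: unit_def)
   qed
  qed
  moreover have "conv f unit t = (\<Sum>p\<in>{(t, %_. 0)}. z powi om (fst p) (snd p) * f (fst p) * unit (snd p))"
   unfolding conv_def case_prod_unfold
  proof (rule sum.mono_neutral_right[OF finite_dec])
   show "{(t, %_. 0)} <= dec t" using d by simp
   show "\<forall>p\<in>dec t - {(t, %_. 0)}. z powi om (fst p) (snd p) * f (fst p) * unit (snd p) = 0"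
   proof
    fix p assume p: "p \<in> dec t - {(t, %_. 0)}"
    have "snd p ~= (%_. 0)" using p decD(1)[of "fst p" "snd p" t] by (cases p) auto
    then show "z powi om (fst p) (snd p) * f (fst p) * unit (snd p) = 0" by (simp add: unit_def)
   qed
  qed
  ultimately show ?thesis by (simp add: unit_def)
 next
  case False
  then have "dec t = {}" by (auto simp: dec_def)
  then show ?thesis using assms[OF False] by (simp add: conv_def)
 qed
 then show "conv unit f = f" "conv f unit = f" by auto
qed

lemma conv_outside: "t ~: vecs ==> conv f g t = 0"
 by (auto simp: conv_def dec_def intro: sum.neutral)

text \<open>A multiplicative function of the exponent acts as an endomorphism of the algebra. It is
  applied to z to plus or minus the flow on one edge of the cut.\<close>

lemma conv_scale_weight:
 assumes "!!a b. rh (%e. a e + b e) = rh a * rh b"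
 shows "conv (%t. rh t * f t) (%t. rh t * g t) = (%t. rh t * conv f g t)"
proof
 fix t
 have "z powi om a b * (rh a * f a) * (rh b * g b) = rh t * (z powi om a b * f a * g b)" if "(a, b) \<in> dec t" for a b
  using assms[of a b] decD(1)[OF that] by simp
 then show "conv (%t. rh t * f t) (%t. rh t * g t) t = rh t * conv f g t"
  unfolding conv_def sum_distrib_left by (intro sum.cong refl) (auto simp del: decD)
qed

fun cprod :: "(('e => nat) => 'a) list => ('e => nat) => 'a" where
 "cprod [] = unit" | "cprod (f # fs) = conv f (cprod fs)"

lemma cprod_outside: "t ~: vecs ==> cprod fs t = 0"
 by (cases fs) (auto simp: conv_outside unit_def vecs_def)

definition lsumv :: "('e => nat) list => 'e => nat" where "lsumv gs = (%e. \<Sum>g\<leftarrow>gs. g e)"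

lemma lsumv_simps [simp]: "lsumv [] = (%_. 0)" "lsumv (g # gs) = (%e. g e + lsumv gs e)"
 by (auto simp: lsumv_def)

fun linv :: "('e => nat) list => int" where
 "linv [] = 0" | "linv (g # gs) = om g (lsumv gs) + linv gs"

lemma cprod_explicit:
 assumes S: "finite S" "S <= vecs" and fs: "!!f t. f \<in> set fs ==> t ~: S ==> f t = 0"
 shows "cprod fs t = (\<Sum>gs | length gs = length fs & set gs <= S & lsumv gs = t.
  z powi linv gs * prod_list (map (%p. fst p (snd p)) (zip fs gs)))"
 using fs
proof (induction fs arbitrary: t)
 case Nil
 have "{gs::('e => nat) list. length gs = length ([]::(('e => nat) => 'a) list) & set gs <= S & lsumv gs = t} = (if t = (%_. 0) then {[]} else {})" by auto
 then show ?case by (simp add: unit_def)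
next
 case (Cons f fs)
 let ?A = "%n t. {gs. length gs = n & set gs <= S & lsumv gs = t}"
 have fin: "finite (?A n t)" for n t
  by (rule finite_subset[OF _ finite_lists_length_eq[OF S(1), of n]]) auto
 have lv: "set gs <= S ==> lsumv gs \<in> vecs" for gs
 proof (induction gs)
  case (Cons g gs)
  then show ?case using S(2) by (auto simp: vecs_def)
 qed (simp add: vecs_def)
 have f0: "f t ~= 0 ==> t \<in> S" for t using Cons.prems[of f t] by auto
 let ?w = "%fs gs. z powi linv gs * prod_list (map (%p. fst p (snd p)) (zip fs gs))"
 have "cprod (f # fs) t = (\<Sum>p\<in>dec t. \<Sum>gs\<in>?A (length fs) (snd p). z powi om (fst p) (snd p) * f (fst p) * ?w fs gs)"
  unfolding cprod.simps conv_def case_prod_unfold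
  by (intro sum.cong refl, subst Cons.IH) (use Cons.prems in \<open>auto simp: sum_distrib_left\<close>)
 also have "... = (\<Sum>(p, gs)\<in>(SIGMA p:dec t. ?A (length fs) (snd p)). z powi om (fst p) (snd p) * f (fst p) * ?w fs gs)"
  by (subst sum.Sigma) (auto simp: finite_dec fin)
 also have "... = (\<Sum>(p, gs)\<in>{x \<in> (SIGMA p:dec t. ?A (length fs) (snd p)). fst (fst x) \<in> S}. z powi om (fst p) (snd p) * f (fst p) * ?w fs gs)"
  by (rule sum.mono_neutral_right) (auto simp: finite_dec fin intro!: finite_SigmaI dest: f0)
 also have "... = (\<Sum>gs\<in>?A (length (f # fs)) t. ?w (f # fs) gs)"
 proof (rule sum.reindex_bij_witness[of _ "%gs. ((hd gs, lsumv (tl gs)), tl gs)" "%(p, gs). fst p # gs"])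
  fix x assume x: "x \<in> {x \<in> (SIGMA p:dec t. ?A (length fs) (snd p)). fst (fst x) \<in> S}"
  obtain a b gs where x': "x = ((a, b), gs)" by (metis prod.collapse)
  have d: "(a, b) \<in> dec t" "length gs = length fs" "set gs <= S" "lsumv gs = b" "a \<in> S" using x unfolding x' by auto
  show "((hd (case x of (p, gs) => fst p # gs), lsumv (tl (case x of (p, gs) => fst p # gs))), tl (case x of (p, gs) => fst p # gs)) = x"
   unfolding x' by (simp add: d(4))
  show "(case x of (p, gs) => fst p # gs) \<in> ?A (length (f # fs)) t"
   unfolding x' using d(2,3,5) decD(1)[OF d(1)] by (simp add: d(4))
  show "?w (f # fs) (case x of (p, gs) => fst p # gs) = (case x of (p, gs) => z powi om (fst p) (snd p) * f (fst p) * ?w fs gs)"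
   unfolding x' using z0 by (simp add: d(4) power_int_add mult_ac)
 next
  fix gs assume gs: "gs \<in> ?A (length (f # fs)) t"
  then obtain g gs' where g: "gs = g # gs'" by (cases gs) auto
  show "(case ((hd gs, lsumv (tl gs)), tl gs) of (p, gs) => fst p # gs) = gs" by (simp add: g)
  have "(g, lsumv gs') \<in> dec t" using gs S(2) lv[of gs'] decI[of g "lsumv gs'"] unfolding g by auto
  then show "((hd gs, lsumv (tl gs)), tl gs) \<in> {x \<in> (SIGMA p:dec t. ?A (length fs) (snd p)). fst (fst x) \<in> S}"
   using gs unfolding g by auto
 qed
 finally show ?case .
qed

lemma cprod_perm:
 assumes "!!f g. f \<in> set fs ==> g \<in> set fs ==> conv f g = conv g f" "mset fs = mset gs"
 shows "cprod fs = cprod gs"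
 using assms
proof (induction fs arbitrary: gs)
 case (Cons f fs)
 have fg: "f \<in> set gs" using Cons.prems(2) by (metis list.set_intros(1) set_mset_mset)
 obtain us vs where gs: "gs = us @ f # vs" using split_list[OF fg] by blast
 have sub: "set us <= set (f # fs)" using Cons.prems(2) gs by (metis Un_upper1 set_append set_mset_mset)
 note comm = Cons.prems(1)
 have move: "set us <= set (f # fs) ==> cprod (us @ f # vs) = conv f (cprod (us @ vs))" for us
 proof (induction us)
  case (Cons u us)
  have "conv u f = conv f u" by (rule comm) (use Cons.prems in auto)
  then show ?case using Cons by (simp add: conv_assoc[symmetric])
 qed simp
 have "cprod fs = cprod (us @ vs)"
  by (rule Cons.IH) (use Cons.prems gs in auto)
 then show ?case using move[OF sub] by (simp add: gs)
qed auto

fun geo :: "'a => nat => 'a list" where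
 "geo c 0 = []" | "geo c (Suc N) = c # geo (c / z\<^sup>2) N"

text \<open>Every factor of the product is moved past \<open>1 + y A\<close> at the cost of multiplying \<open>y\<close> by \<open>z\<^sup>2\<close>;
  along a geometric progression these moves telescope.\<close>

lemma geo_commute:
 assumes rh: "!!a b. rh (%e. a e + b e) = rh a * rh b" "rh (%_. 0) = 1"
  and sg: "!!a b. sg (%e. a e + b e) = sg a * sg b" "sg (%_. 0) = 1"
  and A: "!!t. t ~: vecs ==> A t = 0"
  and K: "!!x t. rh t * Gn x t + inverse z * x * conv (%t. rh t * Gn x t) A t
   = sg t * Gn x t + z * x * conv A (%t. sg t * Gn x t) t"
 shows "(%t. rh t * cprod (map Gn (geo c N)) t + z * c / z ^ (2 * N) * conv (%t. rh t * cprod (map Gn (geo c N)) t) A t)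
   = (%t. sg t * cprod (map Gn (geo c N)) t + z * c * conv A (%t. sg t * cprod (map Gn (geo c N)) t) t)"
proof (induction N arbitrary: c)
 case 0
 have u: "rh t * unit t = unit t" "sg t * unit t = unit t" for t using rh(2) sg(2) by (auto simp: unit_def)
 show ?case by (simp add: u conv_unit[OF A])
next
 case (Suc N)
 define H where "H = cprod (map Gn (geo (c / z\<^sup>2) N))"
 define k where "k = z * c / z ^ (2 * Suc N)"
 \<comment> \<open>Consecutive parameters have ratio z^2, so the factor z (c / z^2) produced by the
   tail of the product is the factor c / z that the hypothesis on \<open>Gn c\<close>
   accepts.\<close>
 have k': "inverse z * c / z ^ (2 * N) = k" "z * (c / z\<^sup>2) = inverse z * c"
  using z0 by (simp_all add: k_def field_simps power2_eq_square)
 note IH = Suc.IH[of "c / z\<^sup>2", folded H_def, unfolded k'(2), unfolded k'(1)]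
 have KK: "(%t. rh t * Gn c t + inverse z * c * conv (%t. rh t * Gn c t) A t)
   = (%t. sg t * Gn c t + z * c * conv A (%t. sg t * Gn c t) t)" by (rule ext) (rule K)
 have c1: "(%t. rh t * conv (Gn c) H t) = conv (%t. rh t * Gn c t) (%t. rh t * H t)"
  by (rule conv_scale_weight[OF rh(1), symmetric])
 have c2: "(%t. sg t * conv (Gn c) H t) = conv (%t. sg t * Gn c t) (%t. sg t * H t)"
  by (rule conv_scale_weight[OF sg(1), symmetric])
 have "(%t. rh t * conv (Gn c) H t + k * conv (%t. rh t * conv (Gn c) H t) A t)
  = conv (%t. rh t * Gn c t) (%t. rh t * H t + k * conv (%t. rh t * H t) A t)"
  unfolding conv_add_right conv_assoc[symmetric] c1[symmetric] ..
 also have "... = conv (%t. rh t * Gn c t) (%t. sg t * H t + inverse z * c * conv A (%t. sg t * H t) t)"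
  unfolding IH ..
 also have "... = conv (%t. rh t * Gn c t + inverse z * c * conv (%t. rh t * Gn c t) A t) (%t. sg t * H t)"
  unfolding conv_add_right conv_add_left conv_assoc ..
 also have "... = (%t. sg t * conv (Gn c) H t + z * c * conv A (%t. sg t * conv (Gn c) H t) t)"
  unfolding KK conv_add_left conv_assoc c2[symmetric] ..
 finally show ?case unfolding geo.simps list.map cprod.simps H_def[symmetric] k_def .
qed

end

section \<open>Generating functions of loops\<close>

locale cut_web_q = cut_web w h y L0 ss
 for w :: "'e web" and h y :: real and L0 :: "('e \<times> int) list" and ss :: "('e \<times> int, real \<times> complex) lvstep list" +
 fixes z :: "'a::field"
 assumes z_nz: "z ~= 0" and z_pow: "!!n::nat. n > 0 ==> z ^ n ~= 1"

sublocale cut_web_q \<subseteq> quantum_torus "edges w" cross z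
proof
 fix a b c :: "'e => nat"
 show "cross (%e. a e + b e) c = cross a c + cross b c"
  unfolding cross_def sum.distrib[symmetric] by (rule sum.cong[OF refl]) (simp add: algebra_simps)
 show "cross c (%e. a e + b e) = cross c a + cross c b"
  unfolding cross_def sum.distrib[symmetric] by (rule sum.cong[OF refl]) (simp add: algebra_simps)
 show "cross a b = - cross b a"
  unfolding cross_def sum_negf[symmetric] by (rule sum.cong[OF refl]) (simp add: algebra_simps)
qed (rule finite_edges z_nz)+

context cut_web_q begin

lemma loops_vecs: "loops <= vecs"
 using loopsD(2) by (auto simp: vecs_def)

text \<open>Flow on an edge off the cut comes from an edge of smaller rank, so it can be traced back
  to the cut. A loop that avoids the cut is therefore empty.\<close>

lemma loop_zero_cut:
 assumes g: "g \<in> loops" and c: "!!e. e \<in> set es ==> g e = 0"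
 shows "g = (%_. 0)"
proof
 fix e
 obtain rank :: "'e => nat" where rank: "\<forall>e\<in>edges w. e \<in> set es \<or>
  (\<exists>v\<in>vertices w. e \<in> out_edges w v & (\<forall>e'\<in>in_edges w v. rank e' < rank e))"
  using rank_exists by blast
 show "g e = 0"
 proof (induction "rank e" arbitrary: e rule: less_induct)
  case less
  show ?case
  proof (cases "e \<in> edges w & e ~: set es")
   case True
   then obtain v where v: "v \<in> vertices w" "e \<in> out_edges w v" "\<forall>e'\<in>in_edges w v. rank e' < rank e"
    using rank by blast
   have "sum g (in_edges w v) = 0" using less v(3) by (intro sum.neutral) blast
   then have "sum g (out_edges w v) = 0" using loopsD(3)[OF g] v(1) by (simp add: conserved_def)
   moreover have "finite (out_edges w v)" using finite_edges by (simp add: out_edges_def)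
   ultimately show ?thesis using v(2) by simp
  next
   case False
   then show ?thesis using c loopsD(2)[OF g] by blast
  qed
 qed
qed

lemma cut_size_zero: "g \<in> loops ==> cut_size g = 0 ==> g = (%_. 0)"
 by (rule loop_zero_cut) (auto simp: cut_size_def)

lemma cut_size_add: "cut_size (%e. a e + b e) = cut_size a + cut_size b"
 by (simp add: cut_size_def sum_list_addf)

lemma zero_loop: "(%_. 0) \<in> loops" by (simp add: loops_def conserved_def)

lemma flow_add: "flow a ==> flow b ==> flow (%e. a e + b e)"
 by (simp add: flow_def conserved_def sum.distrib)

lemma loops_flow: "g \<in> loops ==> flow g" using loopsD(2,3) by (simp add: flow_def)

lemma loop_pairs_flow: "p \<in> loop_pairs t ==> flow t & cut_size (fst p) + cut_size (snd p) = cut_size t"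
proof -
 assume p: "p \<in> loop_pairs t"
 have t: "t = (%e. fst p e + snd p e)" using loopsD loop_pairsD(3)[OF p] by auto
 show ?thesis by (subst (1 2) t) (use flow_add loops_flow loop_pairsD(1,2)[OF p] cut_size_add in auto)
qed

lemma loop_pairs_dec: "{p \<in> dec t. fst p \<in> loops & snd p \<in> loops} = loop_pairs t"
proof -
 have "t \<in> vecs" if "p \<in> loop_pairs t" for p
  using loop_pairs_flow[OF that] by (simp add: flow_def vecs_def)
 then show ?thesis by (force simp: dec_def loop_pairs_def)
qed

definition loop_ser :: "nat => ('e => nat) => 'a" where
 "loop_ser k t = (if t \<in> loops & cut_size t = k then 1 else 0)"

lemma conv_loop_ser:
 "conv (loop_ser k) (loop_ser l) t =
  (\<Sum>p | p \<in> loop_pairs t & cut_size (fst p) = k & cut_size (snd p) = l. z powi cross (fst p) (snd p))"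
proof -
 have "conv (loop_ser k) (loop_ser l) t = (\<Sum>p\<in>{p \<in> dec t. (fst p \<in> loops & cut_size (fst p) = k) & (snd p \<in> loops & cut_size (snd p) = l)}.
   z powi cross (fst p) (snd p))"
  unfolding conv_def case_prod_unfold loop_ser_def
  by (rule sum.mono_neutral_cong_right) (auto simp: finite_dec)
 also have "{p \<in> dec t. (fst p \<in> loops & cut_size (fst p) = k) & (snd p \<in> loops & cut_size (snd p) = l)}
   = {p. p \<in> loop_pairs t & cut_size (fst p) = k & cut_size (snd p) = l}"
  unfolding loop_pairs_dec[symmetric] by blast
 finally show ?thesis .
qed

text \<open>In the coefficient of \<open>t\<close> the two cut sizes add up to that of
  \<open>t\<close>, so prescribing both is the same as prescribing their difference, whose sign may
  be reversed by \<open>loop_pairs_symmetric\<close>.\<close>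

lemma loop_ser_commute: "conv (loop_ser k) (loop_ser l) = conv (loop_ser l) (loop_ser k)"
proof
 fix t
 have nz: "flow t & cut_size t = k + l" if "{p. p \<in> loop_pairs t & cut_size (fst p) = k & cut_size (snd p) = l} ~= {}" for k l
 proof -
  from that obtain p where "p \<in> loop_pairs t" "cut_size (fst p) = k" "cut_size (snd p) = l" by blast
  then show ?thesis using loop_pairs_flow[of p t] by simp
 qed
 show "conv (loop_ser k) (loop_ser l) t = conv (loop_ser l) (loop_ser k) t"
 proof (cases "flow t & cut_size t = k + l")
  case True
  have "{p. p \<in> loop_pairs t & cut_size (fst p) = i & cut_size (snd p) = j} =
   {p. p \<in> loop_pairs t & int (cut_size (fst p)) - int (cut_size (snd p)) = int i - int j}" if "i + j = k + l" for i j
  proof -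
   have "(cut_size (fst p) = i & cut_size (snd p) = j) = (int (cut_size (fst p)) - int (cut_size (snd p)) = int i - int j)"
    if "p \<in> loop_pairs t" for p
    using loop_pairs_flow[OF that] True \<open>i + j = k + l\<close> by linarith
   then show ?thesis by blast
  qed
  from this[of k l] this[of l k] show ?thesis
   unfolding conv_loop_ser using loop_pairs_symmetric[of t z "int k - int l"] True z_nz z_pow by simp
 next
  case False
  have e: "{p. p \<in> loop_pairs t & cut_size (fst p) = k & cut_size (snd p) = l} = {}"
   using nz[of k l] False by argo
  have e': "{p. p \<in> loop_pairs t & cut_size (fst p) = l & cut_size (snd p) = k} = {}"
   using nz[of l k] False by (simp only: add.commute) argo
  show ?thesis unfolding conv_loop_ser e e' ..
 qed
qed

lemma loop_ser_zero: "loop_ser 0 = unit"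
proof
 fix t
 have "t \<in> loops & cut_size t = 0 \<longleftrightarrow> t = (%_. 0)" 
 proof
  assume "t \<in> loops & cut_size t = 0"
  then show "t = (%_. 0)" using cut_size_zero by blast
 next
  assume t: "t = (%_. 0)"
  show "t \<in> loops & cut_size t = 0" unfolding t using zero_loop by (simp add: cut_size_def)
 qed
 then show "loop_ser 0 t = unit t" by (simp add: loop_ser_def unit_def)
qed

text \<open>The sum of x^k \<open>loop_ser k\<close> over all k.\<close>

definition gen :: "'a => ('e => nat) => 'a" where "gen x t = (if t \<in> loops then x ^ cut_size t else 0)"

definition bracket :: "int => 'a" where "bracket m = z powi m - z powi (- m)"

definition tip_dec :: "'e => ('e => nat) => (('e => nat) \<times> ('e => nat)) set" where
 "tip_dec r t = {p \<in> dec t. snd p \<in> loops & tip r (snd p)}"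

lemma finite_tip_dec: "finite (tip_dec r t)" unfolding tip_dec_def using finite_dec by simp

lemma tip_size: "tip r g ==> r \<in> set es ==> cut_size g = 1"
proof -
 assume r: "tip r g" "r \<in> set es"
 have "cut_size g = sum g (set es)" unfolding cut_size_def by (rule sum_list_distinct_conv_sum_set[OF distinct_es])
 also have "... = (\<Sum>e\<in>set es. if e = r then 1 else 0)" using r(1) by (intro sum.cong) (auto simp: tip_def)
 finally show ?thesis using r(2) by simp
qed

lemma powi_add3: "z powi a * z powi b = z powi (a + b)" using z_nz by (simp add: power_int_add)

section \<open>Removal of a label at the last occupied edge of the cut\<close>

context
 fixes xs r ys assumes es: "es = xs @ r # ys"
begin

text \<open>Truncation to flows that vanish to the right of r. This puts every flow in the scope of
  \<open>tip_pairs_sum\<close> and leaves the coefficients at such flows unchanged, by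
  \<open>cprod_gen_r\<close>.\<close>

definition gen_r :: "'a => ('e => nat) => 'a" where
 "gen_r x t = (if \<forall>e\<in>set ys. t e = 0 then gen x t else 0)"
definition tip_ser :: "('e => nat) => 'a" where "tip_ser t = (if t \<in> loops & tip r t then 1 else 0)"

lemma r_in: "r \<in> set es" "r ~: set ys" using es distinct_es by auto

lemma tip_ys: "tip r g ==> e \<in> set ys ==> g e = 0"
 using r_in es by (auto simp: tip_def)

lemma tip_r: "tip r g ==> g r = 1" using r_in by (simp add: tip_def)

lemma conv_tip_right: "conv f tip_ser t = (\<Sum>p\<in>tip_dec r t. z powi cross (fst p) (snd p) * f (fst p))"
 unfolding conv_def case_prod_unfold tip_dec_def
 by (rule sum.mono_neutral_cong_right) (auto simp: finite_dec tip_ser_def)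

lemma conv_tip_left: "conv tip_ser f t = (\<Sum>p\<in>tip_dec r t. z powi (- cross (fst p) (snd p)) * f (fst p))"
proof -
 have "conv tip_ser f t = (\<Sum>p\<in>dec t. z powi (- cross (fst p) (snd p)) * f (fst p) * tip_ser (snd p))"
  unfolding conv_def case_prod_unfold
 proof (rule sum.reindex_bij_witness[of _ prod.swap prod.swap])
  fix p assume p: "p \<in> dec t"
  show "prod.swap p \<in> dec t" using p by (auto simp: dec_def add.commute)
  show "z powi (- cross (fst (prod.swap p)) (snd (prod.swap p))) * f (fst (prod.swap p)) * tip_ser (snd (prod.swap p)) =
   z powi cross (fst p) (snd p) * tip_ser (fst p) * f (snd p)"
   using om_antisym[of "fst p" "snd p"] by simp
 qed (auto simp: dec_def add.commute)
 also have "... = (\<Sum>p\<in>tip_dec r t. z powi (- cross (fst p) (snd p)) * f (fst p))"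
  unfolding tip_dec_def by (rule sum.mono_neutral_cong_right) (auto simp: finite_dec tip_ser_def)
 finally show ?thesis .
qed

text \<open>With A the series of loops that tip r, and G twisted by z to plus or minus the flow on
  r, this reads G_+ (1 + (x/z) A) = (1 + x z A) G_-. Its coefficients are the identity of
  \<open>tip_pairs_sum\<close>; the factor x pays for the unit of cut size carried by A.\<close>

lemma tip_relation:
 "z powi int (t r) * gen_r x t + inverse z * x * conv (%t. z powi int (t r) * gen_r x t) tip_ser t
 = z powi (- int (t r)) * gen_r x t + z * x * conv tip_ser (%t. z powi (- int (t r)) * gen_r x t) t"
proof (cases "\<forall>e\<in>set ys. t e = 0")
 case False
 then obtain e where e: "e \<in> set ys" "t e ~= 0" by blast
 have "gen_r x (fst p) = 0" if p: "p \<in> tip_dec r t" for p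
 proof -
  have "(fst p, snd p) \<in> dec t" "tip r (snd p)" using p by (auto simp: tip_dec_def)
  then have "fst p e + snd p e = t e" "snd p e = 0" using tip_ys e(1) by (auto simp: dec_def)
  then have "fst p e ~= 0" using e(2) by simp
  then show ?thesis using e(1) by (auto simp: gen_r_def)
 qed
 then have S0: "(\<Sum>p\<in>tip_dec r t. z powi m p * (z powi k p * gen_r x (fst p))) = 0" for m k
  by (intro sum.neutral) simp
 have g0: "gen_r x t = 0" unfolding gen_r_def using False by (rule if_not_P)
 show ?thesis unfolding conv_tip_left conv_tip_right S0 g0 by simp
next
 case True
 define P where "P = {p. p \<in> loop_pairs t & tip r (snd p)}"
 have Ps: "P = {p \<in> tip_dec r t. fst p \<in> loops}" unfolding P_def tip_dec_def loop_pairs_dec[symmetric] by blast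
 have gz: "gen_r x (fst p) = (if fst p \<in> loops then x ^ cut_size (fst p) else 0)" if p: "p \<in> tip_dec r t" for p
 proof -
  have "(fst p, snd p) \<in> dec t" using p by (auto simp: tip_dec_def)
  then have "fst p e + snd p e = t e" for e by (auto simp: dec_def)
  then have "\<forall>e\<in>set ys. fst p e = 0" using True by (metis add_is_0)
  then show ?thesis by (simp add: gen_r_def gen_def)
 qed
 have red: "(\<Sum>p\<in>tip_dec r t. z powi m p * (z powi k p * gen_r x (fst p))) = (\<Sum>p\<in>P. z powi (m p + k p) * x ^ cut_size (fst p))" for m k
  unfolding Ps by (rule sum.mono_neutral_cong_right) (auto simp: finite_tip_dec gz powi_add3[symmetric] mult.assoc)
 have sz: "x * x ^ cut_size (fst p) = x ^ cut_size t" if "p \<in> P" for p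
  using loop_pairs_flow[of p t] that tip_size[of r "snd p"] r_in(1) unfolding P_def by (auto simp flip: power_Suc)
 have zz: "inverse z = z powi (- 1)" "z = z powi 1" by (simp_all add: power_int_minus)
 have first: "inverse z * x * (\<Sum>p\<in>P. z powi (cross (fst p) (snd p) + int (fst p r)) * x ^ cut_size (fst p))
  = x ^ cut_size t * (\<Sum>p\<in>P. z powi (- (1 - int (fst p r) - cross (fst p) (snd p))))"
  unfolding sum_distrib_left
 proof (rule sum.cong[OF refl])
  fix p assume p: "p \<in> P"
  have "inverse z * z powi (cross (fst p) (snd p) + int (fst p r)) = z powi (- (1 - int (fst p r) - cross (fst p) (snd p)))"
   unfolding zz(1) powi_add3 by (simp add: algebra_simps)
  note E = this
  have "inverse z * x * (z powi (cross (fst p) (snd p) + int (fst p r)) * x ^ cut_size (fst p)) =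
   (x * x ^ cut_size (fst p)) * (inverse z * z powi (cross (fst p) (snd p) + int (fst p r)))" by (simp only: mult_ac)
  then show "inverse z * x * (z powi (cross (fst p) (snd p) + int (fst p r)) * x ^ cut_size (fst p)) =
   x ^ cut_size t * z powi (- (1 - int (fst p r) - cross (fst p) (snd p)))"
   unfolding E sz[OF p] .
 qed
 have second: "z * x * (\<Sum>p\<in>P. z powi (- cross (fst p) (snd p) + (- int (fst p r))) * x ^ cut_size (fst p))
  = x ^ cut_size t * (\<Sum>p\<in>P. z powi (1 - int (fst p r) - cross (fst p) (snd p)))"
  unfolding sum_distrib_left
 proof (rule sum.cong[OF refl])
  fix p assume p: "p \<in> P"
  have "z * z powi (- cross (fst p) (snd p) + (- int (fst p r))) = z powi (1 - int (fst p r) - cross (fst p) (snd p))"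
   using powi_add3[of 1 "- cross (fst p) (snd p) + (- int (fst p r))"] by (simp add: algebra_simps)
  note E = this
  have "z * x * (z powi (- cross (fst p) (snd p) + (- int (fst p r))) * x ^ cut_size (fst p)) =
   (x * x ^ cut_size (fst p)) * (z * z powi (- cross (fst p) (snd p) + (- int (fst p r))))" by (simp only: mult_ac)
  then show "z * x * (z powi (- cross (fst p) (snd p) + (- int (fst p r))) * x ^ cut_size (fst p)) =
   x ^ cut_size t * z powi (1 - int (fst p r) - cross (fst p) (snd p))"
   unfolding E sz[OF p] .
 qed
 have gt: "gen_r x t = (if t \<in> loops then x ^ cut_size t else 0)" using True by (simp add: gen_r_def gen_def)
 have key: "(if t \<in> loops then z powi int (t r) - z powi (- int (t r)) else 0) =
  (\<Sum>p\<in>P. z powi (1 - int (fst p r) - cross (fst p) (snd p)) - z powi (- (1 - int (fst p r) - cross (fst p) (snd p))))"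
 proof (cases "flow t & t r > 0")
  case fl: True
  show ?thesis unfolding P_def by (rule tip_pairs_sum[OF _ z_nz es]) (use fl True in auto)
 next
  case False
  have "P = {}"
  proof (rule equals0I)
   fix p assume p: "p \<in> P"
   then have "flow t" using loop_pairs_flow unfolding P_def by blast
   moreover have "t r > 0" using loop_pairsD(3)[of p t r] tip_r[of "snd p"] p unfolding P_def by simp
   ultimately show False using False by simp
  qed
  moreover have "t \<in> loops ==> t r = 0" using False loops_flow[of t] by simp
  ultimately show ?thesis by simp
 qed
 have "z powi int (t r) * gen_r x t - z powi (- int (t r)) * gen_r x t =
  x ^ cut_size t * (if t \<in> loops then z powi int (t r) - z powi (- int (t r)) else 0)"
  unfolding gt by (simp add: algebra_simps)
 then show ?thesis unfolding conv_tip_left conv_tip_right red first second key sum_subtractf by (simp add: algebra_simps)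
qed

lemma cprod_gen_r:
 "(\<forall>e\<in>set ys. t e = 0) ==> cprod (map gen_r l) t = cprod (map gen l) t"
proof (induction l arbitrary: t)
 case (Cons x l)
 have "gen_r x (fst p) = gen x (fst p) & cprod (map gen_r l) (snd p) = cprod (map gen l) (snd p)" if p: "p \<in> dec t" for p
 proof -
  have "fst p e + snd p e = t e" for e using p by (auto simp: dec_def)
  then have z: "\<forall>e\<in>set ys. fst p e = 0" "\<forall>e\<in>set ys. snd p e = 0" using Cons.prems by (metis add_is_0)+
  have "gen_r x (fst p) = gen x (fst p)" unfolding gen_r_def using z(1) by (rule if_P)
  then show ?thesis using Cons.IH[OF z(2)] by (rule conjI)
 qed
 then show ?case unfolding list.map cprod.simps conv_def case_prod_unfold by (intro sum.cong refl) simp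
qed simp

text \<open>For the progression starting at z^(N-1) the outer factors z c and z c / z^(2N) of the
  telescoped identity are z^N and z^(-N). Bringing both products with \<open>tip_ser\<close> to one
  side turns the exponents into brackets.\<close>

theorem gen_recursion:
 assumes ys: "\<forall>e\<in>set ys. t e = 0"
 shows "bracket (int (t r)) * cprod (map gen (geo (z powi (int N - 1)) N)) t =
  (\<Sum>p\<in>tip_dec r t. bracket (int N - (int (fst p r) + cross (fst p) (snd p))) *
   cprod (map gen (geo (z powi (int N - 1)) N)) (fst p))"
proof -
 let ?l = "geo (z powi (int N - 1)) N"
 let ?H = "cprod (map gen_r ?l)"
 have c: "z * z powi (int N - 1) = z powi int N" "z * z powi (int N - 1) / z ^ (2 * N) = z powi (- int N)"
 proof -
  show 1: "z * z powi (int N - 1) = z powi int N" using powi_add3[of 1 "int N - 1"] by simp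
  have "z powi (- int N) * z ^ (2 * N) = z powi int N"
   unfolding power_int_of_nat[of z "2 * N", symmetric] powi_add3 by simp
  then show "z * z powi (int N - 1) / z ^ (2 * N) = z powi (- int N)" unfolding 1 using z_nz by (simp add: field_simps)
 qed
 have geo: "z powi int (t r) * ?H t + z powi (- int N) * conv (%t. z powi int (t r) * ?H t) tip_ser t
  = z powi (- int (t r)) * ?H t + z powi int N * conv tip_ser (%t. z powi (- int (t r)) * ?H t) t"
 proof -
  have T0: "!!t. t ~: vecs ==> tip_ser t = 0" using loops_vecs by (auto simp: tip_ser_def)
  have r1: "!!a b. z powi int (a r + b r) = z powi int (a r) * z powi int (b r)" unfolding powi_add3 of_nat_add ..
  have r2: "!!a b. z powi (- int (a r + b r)) = z powi (- int (a r)) * z powi (- int (b r))" by (simp add: powi_add3)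
  note G = geo_commute[of "%t. z powi int (t r)" "%t. z powi (- int (t r))" tip_ser gen_r "z powi (int N - 1)" N,
   unfolded c(2), unfolded c(1)]
  have "(%t. z powi int (t r) * ?H t + z powi (- int N) * conv (%t. z powi int (t r) * ?H t) tip_ser t)
  = (%t. z powi (- int (t r)) * ?H t + z powi int N * conv tip_ser (%t. z powi (- int (t r)) * ?H t) t)"
   by (rule G) (rule r1, simp, rule r2, simp, rule T0, assumption, rule tip_relation)
  then show ?thesis by (rule fun_cong)
 qed
 have HH: "?H (fst p) = cprod (map gen ?l) (fst p)" if "p \<in> tip_dec r t" for p
 proof (rule cprod_gen_r)
  have "fst p e + snd p e = t e" for e using that by (auto simp: tip_dec_def dec_def)
  then show "\<forall>e\<in>set ys. fst p e = 0" using ys by (metis add_is_0)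
 qed
 have "bracket (int (t r)) * ?H t = z powi int N * conv tip_ser (%t. z powi (- int (t r)) * ?H t) t
   - z powi (- int N) * conv (%t. z powi int (t r) * ?H t) tip_ser t"
  using geo by (simp add: bracket_def algebra_simps)
 also have "... = (\<Sum>p\<in>tip_dec r t. bracket (int N - (int (fst p r) + cross (fst p) (snd p))) * ?H (fst p))"
  unfolding conv_tip_left conv_tip_right sum_distrib_left sum_subtractf[symmetric]
 proof (rule sum.cong[OF refl])
  fix p
  let ?c = "cross (fst p) (snd p)" and ?a = "int (fst p r)"
  have "z powi int N * (z powi (- ?c) * z powi (- ?a)) = z powi (int N - (?a + ?c))"
   "z powi (- int N) * (z powi ?c * z powi ?a) = z powi (- (int N - (?a + ?c)))"
   unfolding powi_add3 by (simp_all add: algebra_simps)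
  then show "z powi int N * (z powi (- ?c) * (z powi (- ?a) * ?H (fst p))) - z powi (- int N) * (z powi ?c * (z powi ?a * ?H (fst p)))
   = bracket (int N - (?a + ?c)) * ?H (fst p)" unfolding bracket_def left_diff_distrib by (simp only: mult.assoc[symmetric])
 qed
 also have "... = (\<Sum>p\<in>tip_dec r t. bracket (int N - (int (fst p r) + cross (fst p) (snd p))) * cprod (map gen ?l) (fst p))"
  by (rule sum.cong[OF refl]) (simp add: HH)
 finally show ?thesis unfolding cprod_gen_r[OF ys] .
qed

end

text \<open>The edges of the cut with multiplicity, read from right to left: the order in which
  units of flow are removed.\<close>

definition labels :: "('e => nat) => 'e list" where "labels t = rev (concat (map (%e. replicate (t e) e) es))"

lemma labels_Cons:
 assumes "labels t = r # rs"
 shows "EX xs ys. es = xs @ r # ys & (\<forall>e\<in>set ys. t e = 0) & t r > 0 &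
  (ALL t'. (\<forall>e\<in>set es. t' e + (if e = r then 1 else 0) = t e) --> rs = labels t')"
proof -
 have "distinct l ==> rev (concat (map (%e. replicate (t e) e) l)) = r # rs ==>
  EX xs ys. l = xs @ r # ys & (\<forall>e\<in>set ys. t e = 0) & t r > 0 &
  (ALL t'. (\<forall>e\<in>set l. t' e + (if e = r then 1 else 0) = t e) --> rs = rev (concat (map (%e. replicate (t' e) e) l)))" for l rs
 proof (induction l arbitrary: rs rule: rev_induct)
  case (snoc x l)
  show ?case
  proof (cases "t x")
   case 0
   then have "rev (concat (map (%e. replicate (t e) e) l)) = r # rs" using snoc.prems by simp
   with snoc obtain xs ys where *: "l = xs @ r # ys" "\<forall>e\<in>set ys. t e = 0" "t r > 0"
    "ALL t'. (\<forall>e\<in>set l. t' e + (if e = r then 1 else 0) = t e) --> rs = rev (concat (map (%e. replicate (t' e) e) l))"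
    by auto
   show ?thesis
   proof (rule exI[of _ xs], rule exI[of _ "ys @ [x]"], intro conjI allI impI)
    fix t' assume t': "\<forall>e\<in>set (l @ [x]). t' e + (if e = r then 1 else 0) = t e"
    then have "t' x = 0" using 0 by simp
    moreover have "rs = rev (concat (map (%e. replicate (t' e) e) l))" using *(4) t' by simp
    ultimately show "rs = rev (concat (map (%e. replicate (t' e) e) (l @ [x])))" by simp
   qed (use * 0 in auto)
  next
   case (Suc k)
   then have r: "r = x" "rs = replicate k x @ rev (concat (map (%e. replicate (t e) e) l))" using snoc.prems by (auto simp: replicate_app_Cons_same)
   show ?thesis
   proof (rule exI[of _ l], rule exI[of _ "[]"], intro conjI allI impI)
    fix t' assume t': "\<forall>e\<in>set (l @ [x]). t' e + (if e = r then 1 else 0) = t e"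
    have "t' x = k" using t' Suc r(1) by auto
    moreover have m: "map (%e. replicate (t' e) e) l = map (%e. replicate (t e) e) l"
    proof (rule map_cong[OF refl])
     fix e assume "e \<in> set l"
     then have "e ~= r" "t' e + (if e = r then 1 else 0) = t e" using snoc.prems(1) r(1) t' by auto
     then show "replicate (t' e) e = replicate (t e) e" by simp
    qed
    ultimately have tx: "t' x = k" by simp
    show "rs = rev (concat (map (%e. replicate (t' e) e) (l @ [x])))"
     unfolding map_append concat_append rev_append m r(2) by (simp add: tx)
   qed (use r(1) Suc in auto)
  qed
 qed simp
 from this[OF distinct_es] assms show ?thesis unfolding labels_def by blast
qed

lemma count_labels: "e \<in> set es ==> count_list (labels t) e = t e"
proof -
 have cr: "count_list (replicate n x) e = (if x = e then n else 0)" for n and x :: 'e by (induction n) auto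
 have "count_list (concat (map (%e. replicate (t e) e) l)) e = (if e \<in> set l then t e else 0)" if "distinct l" for l
  using that by (induction l) (auto simp: cr)
 then show "e \<in> set es ==> count_list (labels t) e = t e" using distinct_es by (simp add: labels_def)
qed

text \<open>The multiplicity \<open>count_list rs r\<close> plays the role of the flow
  \<open>fst p r\<close> in the recursion; both agree while \<open>rs\<close> lists the labels of
  the remaining flow.\<close>

fun peel :: "nat => 'e list => ('e => nat) => 'a" where
 "peel N [] t = unit t"
| "peel N (r # rs) t = (\<Sum>p\<in>tip_dec r t. bracket (int N - (int (count_list rs r) + cross (fst p) (snd p))) * peel N rs (fst p))"

definition bfact :: "nat => 'a" where "bfact n = (\<Prod>i=1..n. bracket (int i))"

lemma cprod_gen_zero:
 "(\<forall>e\<in>set es. t e = 0) ==> cprod (map gen l) t = unit t"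
proof (induction l arbitrary: t)
 case (Cons x l)
 have "gen x (fst p) = unit (fst p) & cprod (map gen l) (snd p) = unit (snd p)" if p: "p \<in> dec t" for p
 proof -
  have "fst p e + snd p e = t e" for e using p by (auto simp: dec_def)
  then have z: "\<forall>e\<in>set es. fst p e = 0" "\<forall>e\<in>set es. snd p e = 0" using Cons.prems by (metis add_is_0)+
  have "gen x (fst p) = unit (fst p)"
  proof (cases "fst p \<in> loops")
   case True
   have f: "fst p = (%_. 0)" by (rule loop_zero_cut[OF True]) (rule bspec[OF z(1)])
   show ?thesis unfolding f using zero_loop by (simp add: gen_def unit_def cut_size_def)
  next
   case False
   have "fst p ~= (%_. 0)"
   proof
    assume f: "fst p = (%_. 0)"
    show False using False zero_loop unfolding f by (rule notE)
   qed
   then show ?thesis using False by (simp add: gen_def unit_def)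
  qed
  then show ?thesis using Cons.IH z(2) by simp
 qed
 then have "cprod (map gen (x # l)) t = conv unit unit t"
  unfolding list.map cprod.simps conv_def case_prod_unfold by (intro sum.cong refl) simp
 also have "... = unit t" by (subst conv_unit(1)) (auto simp: unit_def vecs_def)
 finally show ?case .
qed simp

text \<open>Each removal from an edge is paid by the bracket of its current flow, so a complete
  removal costs the bracket factorial of every edge of the cut.\<close>

theorem gen_peel:
 "rs = labels t ==> (\<Prod>e\<in>set es. bfact (t e)) * cprod (map gen (geo (z powi (int N - 1)) N)) t = peel N rs t"
proof (induction rs arbitrary: t)
 case Nil
 have z: "\<forall>e\<in>set es. t e = 0" using count_labels[of _ t] unfolding Nil[symmetric] by simp
 then show ?case using cprod_gen_zero[OF z] by (simp add: bfact_def)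
next
 case (Cons r rs)
 from labels_Cons[OF Cons.prems[symmetric]] obtain xs ys where *: "es = xs @ r # ys" "\<forall>e\<in>set ys. t e = 0" "t r > 0"
  "!!t'. (\<forall>e\<in>set es. t' e + (if e = r then 1 else 0) = t e) ==> rs = labels t'" by blast
 have rin: "r \<in> set es" unfolding *(1) by simp
 let ?H = "cprod (map gen (geo (z powi (int N - 1)) N))"
 define F where "F t = (\<Prod>e\<in>set es. bfact (t e))" for t :: "'e => nat"
 define G where "G = bfact (t r - 1) * (\<Prod>e\<in>set es - {r}. bfact (t e))"
 have FG: "F t = G * bracket (int (t r))"
 proof -
  have "bfact (t r) = bfact (t r - 1) * bracket (int (t r))" using *(3) by (cases "t r") (simp_all add: bfact_def)
  then show ?thesis unfolding F_def G_def using prod.remove[OF _ rin, of "%e. bfact (t e)"] by (simp add: mult_ac)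
 qed
 have "F t * ?H t = G * (\<Sum>p\<in>tip_dec r t. bracket (int N - (int (fst p r) + cross (fst p) (snd p))) * ?H (fst p))"
  unfolding FG gen_recursion[OF *(1,2), symmetric] by (simp only: mult.assoc)
 also have "... = (\<Sum>p\<in>tip_dec r t. bracket (int N - (int (count_list rs r) + cross (fst p) (snd p))) * peel N rs (fst p))"
  unfolding sum_distrib_left
 proof (rule sum.cong[OF refl])
  fix p assume p: "p \<in> tip_dec r t"
  have eq: "fst p e + snd p e = t e" for e using p by (auto simp: tip_dec_def dec_def)
  have tp: "tip r (snd p)" using p by (simp add: tip_dec_def)
  have t': "\<forall>e\<in>set es. fst p e + (if e = r then 1 else 0) = t e"
   
  proof
   fix e assume "e \<in> set es"
   then show "fst p e + (if e = r then 1 else 0) = t e" using tp eq[of e] by (simp add: tip_def)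
  qed
  have rs: "rs = labels (fst p)" by (rule *(4)[OF t'])
  have G: "G = F (fst p)"
  proof -
   have "fst p r = t r - 1" using bspec[OF t' rin] by simp
   moreover have "(\<Prod>e\<in>set es - {r}. bfact (t e)) = (\<Prod>e\<in>set es - {r}. bfact (fst p e))"
   proof (rule prod.cong[OF refl])
    fix e assume "e \<in> set es - {r}"
    then show "bfact (t e) = bfact (fst p e)" using bspec[OF t', of e] by simp
   qed
   ultimately show ?thesis unfolding F_def G_def using prod.remove[OF _ rin, of "%e. bfact (fst p e)"] by simp
  qed
  have cr: "count_list rs r = fst p r" unfolding rs by (rule count_labels[OF rin])
  have "F (fst p) * ?H (fst p) = peel N rs (fst p)" unfolding F_def by (rule Cons.IH[OF rs])
  then show "G * (bracket (int N - (int (fst p r) + cross (fst p) (snd p))) * ?H (fst p)) =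
   bracket (int N - (int (count_list rs r) + cross (fst p) (snd p))) * peel N rs (fst p)"
   unfolding cr G by (simp add: mult_ac)
 qed
 finally show ?case unfolding F_def by simp
qed

fun dd :: "'e list => ('e => nat) list => int list" where
 "dd (r # rs) (g # gs) = (int (count_list rs r) + cross (lsumv gs) g) # dd rs gs"
| "dd _ _ = []"

definition tip_lists :: "'e list => ('e => nat) => ('e => nat) list set" where
 "tip_lists rs t = {gs. list_all2 (%r g. g \<in> loops & tip r g) rs gs & lsumv gs = t}"

lemma finite_tip_lists: "finite (tip_lists rs t)"
proof (rule finite_subset)
 show "tip_lists rs t <= {gs. set gs <= loops & length gs = length rs}"
  unfolding tip_lists_def by (auto simp: list_all2_conv_all_nth in_set_conv_nth)
qed (rule finite_lists_length_eq[OF finite_loops])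

theorem peel_explicit: "peel N rs t = (\<Sum>gs\<in>tip_lists rs t. \<Prod>d\<leftarrow>dd rs gs. bracket (int N - d))"
proof (induction rs arbitrary: t)
 case Nil
 have "tip_lists [] t = (if t = (%_. 0) then {[]} else {})" by (auto simp: tip_lists_def)
 then show ?case by (simp add: unit_def)
next
 case (Cons r rs)
 have "peel N (r # rs) t = (\<Sum>p\<in>tip_dec r t. \<Sum>gs\<in>tip_lists rs (fst p).
   bracket (int N - (int (count_list rs r) + cross (fst p) (snd p))) * (\<Prod>d\<leftarrow>dd rs gs. bracket (int N - d)))"
  by (simp add: Cons.IH sum_distrib_left)
 also have "... = (\<Sum>(p, gs)\<in>(SIGMA p:tip_dec r t. tip_lists rs (fst p)).
   bracket (int N - (int (count_list rs r) + cross (fst p) (snd p))) * (\<Prod>d\<leftarrow>dd rs gs. bracket (int N - d)))"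
  by (subst sum.Sigma) (auto simp: finite_tip_dec finite_tip_lists)
 also have "... = (\<Sum>gs\<in>tip_lists (r # rs) t. \<Prod>d\<leftarrow>dd (r # rs) gs. bracket (int N - d))"
 proof (rule sum.reindex_bij_witness[of _ "%gs. ((lsumv (tl gs), hd gs), tl gs)" "%(p, gs). snd p # gs"])
  fix x assume x: "x \<in> (SIGMA p:tip_dec r t. tip_lists rs (fst p))"
  obtain a b gs where x': "x = ((a, b), gs)" by (metis prod.collapse)
  have d: "(a, b) \<in> dec t" "b \<in> loops" "tip r b" "list_all2 (%r g. g \<in> loops & tip r g) rs gs" "lsumv gs = a"
   using x unfolding x' by (auto simp: tip_dec_def tip_lists_def)
  show "((lsumv (tl (case x of (p, gs) => snd p # gs)), hd (case x of (p, gs) => snd p # gs)), tl (case x of (p, gs) => snd p # gs)) = x"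
   unfolding x' by (simp add: d(5))
  show "(case x of (p, gs) => snd p # gs) \<in> tip_lists (r # rs) t"
   unfolding x' tip_lists_def using d decD(1)[OF d(1)] by (simp add: add.commute)
  show "(\<Prod>d\<leftarrow>dd (r # rs) (case x of (p, gs) => snd p # gs). bracket (int N - d)) =
   (case x of (p, gs) => bracket (int N - (int (count_list rs r) + cross (fst p) (snd p))) * (\<Prod>d\<leftarrow>dd rs gs. bracket (int N - d)))"
   unfolding x' by (simp add: d(5))
 next
  fix gs assume gs: "gs \<in> tip_lists (r # rs) t"
  then obtain g gs' where g: "gs = g # gs'" by (cases gs) (auto simp: tip_lists_def)
  have all: "g \<in> loops" "tip r g" "list_all2 (%r g. g \<in> loops & tip r g) rs gs'" "t = (%e. g e + lsumv gs' e)"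
   using gs unfolding g tip_lists_def by auto
  have "lsumv gs' \<in> vecs" using all(3)
  proof (induction rs gs' rule: list_all2_induct)
   case (Cons r rs g gs)
   then show ?case using loopsD(2)[of g] by (simp add: vecs_def)
  qed (simp add: vecs_def)
  then have "(lsumv gs', g) \<in> dec t"
   using decI[of "lsumv gs'" g] all(1) loops_vecs unfolding all(4) by (auto simp: add.commute)
  then show "((lsumv (tl gs), hd gs), tl gs) \<in> (SIGMA p:tip_dec r t. tip_lists rs (fst p))"
   using all(1-3) unfolding g by (simp add: tip_dec_def tip_lists_def)
  show "(case ((lsumv (tl gs), hd gs), tl gs) of (p, gs) => snd p # gs) = gs" by (simp add: g)
 qed
 finally show ?case .
qed

end

section \<open>Colorings as lists of loops\<close>

locale homfly_web = cut_web_q w h y L0 ss q_var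
 for w :: "'e web" and h y :: real and L0 :: "('e \<times> int) list" and ss :: "('e \<times> int, real \<times> complex) lvstep list"

context annular_graph begin

lemma vertex_shape:
 assumes "v \<in> vertices w"
 obtains (Merge) a b c where "v \<in> merges w" "a ~= b" "in_edges w v = {a, b}" "out_edges w v = {c}"
  | (Split) a b c where "v \<in> splits w" "a ~= b" "in_edges w v = {c}" "out_edges w v = {a, b}"
 using vertex_kind[OF assms]
proof
 assume m: "v \<in> merges w"
 then have "card (in_edges w v) = 2" "card (out_edges w v) = 1" by (auto simp: merges_def)
 then obtain a b c where "in_edges w v = {a, b}" "a ~= b" "out_edges w v = {c}"
  by (metis card_2_iff card_1_singletonE)
 then show thesis using Merge[OF m] by blast
next
 assume m: "v \<in> splits w"
 then have "card (in_edges w v) = 1" "card (out_edges w v) = 2" by (auto simp: splits_def)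
 then obtain a b c where "out_edges w v = {a, b}" "a ~= b" "in_edges w v = {c}"
  by (metis card_2_iff card_1_singletonE)
 then show thesis using Split[OF m] by blast
qed

definition thick :: "'e => nat" where "thick e = (if e \<in> edges w then thickness w e else 0)"

lemma in_out_edges: "e \<in> in_edges w v ==> e \<in> edges w" "e \<in> out_edges w v ==> e \<in> edges w"
 by (simp_all add: in_edges_def out_edges_def)

text \<open>Color i + 1 sits at list position i. The length M is a parameter because every single
  coloring is bounded while no bound holds for all of them.\<close>

definition loop_list :: "nat => ('e => nat set) => ('e => nat) list" where
 "loop_list M c = map (%i e. if e \<in> edges w & Suc i \<in> c e then 1 else 0) [0..<M]"

definition list_coloring :: "('e => nat) list => 'e => nat set" where
 "list_coloring gs = (%e. if e \<in> edges w then {Suc i | i. i < length gs & (gs ! i) e = 1} else undefined)"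

definition bounded_colorings :: "nat => ('e => nat set) set" where
 "bounded_colorings M = {c \<in> colorings w. \<forall>e\<in>edges w. c e <= {1..M}}"

definition loop_lists :: "nat => ('e => nat) list set" where
 "loop_lists M = {gs. length gs = M & set gs <= loops & (ALL e. (\<Sum>g\<leftarrow>gs. g e) = thick e)}"

lemma loop_list_nth: "i < M ==> (loop_list M c ! i) e = (if e \<in> edges w & Suc i \<in> c e then 1 else 0)"
 and length_loop_list [simp]: "length (loop_list M c) = M"
 by (simp_all add: loop_list_def)

lemma count_colors:
 assumes "S <= {1..M}"
 shows "(\<Sum>i<M. if Suc i \<in> S then 1 else 0) = card S"
proof -
 have "S = Suc ` {i \<in> {..<M}. Suc i \<in> S}"
 proof (intro equalityI subsetI)
  fix x assume x: "x \<in> S"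
  then have "x \<in> {1..M}" using assms by blast
  then obtain i where "x = Suc i" "i < M" by (cases x) auto
  then show "x \<in> Suc ` {i \<in> {..<M}. Suc i \<in> S}" using x by blast
 qed auto
 then have "card S = card {i \<in> {..<M}. Suc i \<in> S}" by (metis card_image inj_Suc inj_on_subset subset_UNIV)
 then show ?thesis by (simp add: sum.If_cases Int_def)
qed

lemma coloringsD:
 assumes "c \<in> colorings w"
 shows "e \<in> edges w ==> finite (c e)" "e \<in> edges w ==> c e <= {1..}" "e \<in> edges w ==> card (c e) = thickness w e"
  "e ~: edges w ==> c e = undefined" "v \<in> vertices w ==> (\<Union>e\<in>in_edges w v. c e) = (\<Union>e\<in>out_edges w v. c e)"
proof -
 have c: "c \<in> (\<Pi>\<^sub>E e\<in>edges w. {S. finite S & S <= {1..} & card S = thickness w e})"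
  "\<forall>v\<in>vertices w. (\<Union>e\<in>in_edges w v. c e) = (\<Union>e\<in>out_edges w v. c e)"
  using assms unfolding colorings_def by blast+
 show "e \<in> edges w ==> finite (c e)" "e \<in> edges w ==> c e <= {1..}" "e \<in> edges w ==> card (c e) = thickness w e"
  using PiE_mem[OF c(1), of e] by auto
 show "e ~: edges w ==> c e = undefined" using PiE_arb[OF c(1)] .
 show "v \<in> vertices w ==> (\<Union>e\<in>in_edges w v. c e) = (\<Union>e\<in>out_edges w v. c e)" using bspec[OF c(2)] .
qed

lemma thickness_conserved: "v \<in> vertices w ==> sum (thickness w) (in_edges w v) = sum (thickness w) (out_edges w v)"
 using aw unfolding annular_web_def by blast

text \<open>The thicknesses force the colors of the two edges on one side of a vertex to be disjoint.\<close>

lemma coloring_vertex: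
 assumes c: "c \<in> colorings w" and v: "v \<in> vertices w"
 obtains (Merge) a b d where "v \<in> merges w" "a ~= b" "in_edges w v = {a, b}" "out_edges w v = {d}"
   "c d = c a Un c b" "c a Int c b = {}"
  | (Split) a b d where "v \<in> splits w" "a ~= b" "in_edges w v = {d}" "out_edges w v = {a, b}"
   "c d = c a Un c b" "c a Int c b = {}"
proof -
 note D = coloringsD[OF c]
 have dj: "c a Int c b = {}" if "a \<in> edges w" "b \<in> edges w" "d \<in> edges w" "c d = c a Un c b"
  "thickness w d = thickness w a + thickness w b" for a b d
 proof -
  have "card (c a) + card (c b) = card (c a Un c b) + card (c a Int c b)" by (rule card_Un_Int) (rule D(1), rule that)+
  moreover have "card (c a) + card (c b) = card (c a Un c b)" unfolding that(4)[symmetric]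
   using D(3)[OF that(1)] D(3)[OF that(2)] D(3)[OF that(3)] that(5) by simp
  ultimately have "card (c a Int c b) = 0" by simp
  moreover have "finite (c a Int c b)" using D(1)[OF that(1)] by simp
  ultimately show ?thesis by simp
 qed
 from v show thesis
 proof (cases rule: vertex_shape)
  case (Merge a b d)
  have e: "a \<in> edges w" "b \<in> edges w" "d \<in> edges w" using in_out_edges[of _ v] unfolding Merge(3,4) by simp_all
  have u: "c d = c a Un c b" using D(5)[OF v] unfolding Merge(3,4) by simp
  have "thickness w d = thickness w a + thickness w b" using thickness_conserved[OF v] Merge(2) unfolding Merge(3,4) by simp
  then show thesis using that(1)[OF Merge u] dj[OF e u] by blast
 next
  case (Split a b d)
  have e: "a \<in> edges w" "b \<in> edges w" "d \<in> edges w" using in_out_edges[of _ v] unfolding Split(3,4) by simp_all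
  have u: "c d = c a Un c b" using D(5)[OF v] unfolding Split(3,4) by simp
  have "thickness w d = thickness w a + thickness w b" using thickness_conserved[OF v] Split(2) unfolding Split(3,4) by simp
  then show thesis using that(2)[OF Split u] dj[OF e u] by blast
 qed
qed

lemma loop_list_in:
 assumes c: "c \<in> bounded_colorings M"
 shows "loop_list M c \<in> loop_lists M"
proof -
 have cc: "c \<in> colorings w" and cM: "!!e. e \<in> edges w ==> c e <= {1..M}" using c by (auto simp: bounded_colorings_def)
 have L: "(%e. if e \<in> edges w & x \<in> c e then 1 else 0) \<in> loops" (is "?g \<in> loops") for x
 proof -
  have ind: "(if x \<in> A then 1 else 0) + (if x \<in> B then 1 else 0) = (if x \<in> A Un B then 1 else (0::nat))" if "A Int B = {}" for A B
   using that by auto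
  have le: "(if x \<in> A then 1 else (0::nat)) <= 1" for A by simp
  have "sum ?g (in_edges w v) = sum ?g (out_edges w v) & sum ?g (in_edges w v) <= 1" if v: "v \<in> vertices w" for v
  proof -
   from cc v show ?thesis
   proof (cases rule: coloring_vertex)
    case (Merge a b d)
    have e: "a \<in> edges w" "b \<in> edges w" "d \<in> edges w" using in_out_edges[of _ v] unfolding Merge(3,4) by simp_all
    show ?thesis unfolding Merge(3,4) using Merge(2) e ind[OF Merge(6)] le[of "c a Un c b"] Merge(5) by simp
   next
    case (Split a b d)
    have e: "a \<in> edges w" "b \<in> edges w" "d \<in> edges w" using in_out_edges[of _ v] unfolding Split(3,4) by simp_all
    show ?thesis unfolding Split(3,4) using Split(2) e ind[OF Split(6)] le[of "c a Un c b"] Split(5) by simp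
   qed
  qed
  then have v1: "sum ?g (in_edges w v) = sum ?g (out_edges w v)" and v2: "sum ?g (in_edges w v) <= 1" if "v \<in> vertices w" for v
   using that by blast+
  show ?thesis unfolding loops_def conserved_def mem_Collect_eq by (intro conjI allI ballI impI v1 v2) simp_all
 qed
 have "(\<Sum>g\<leftarrow>loop_list M c. g e) = thick e" for e
 proof -
  have "(\<Sum>g\<leftarrow>loop_list M c. g e) = (\<Sum>i<M. if e \<in> edges w & Suc i \<in> c e then 1 else 0)"
   unfolding loop_list_def by (simp add: sum_list_distinct_conv_sum_set comp_def atLeast0LessThan)
  also have "... = thick e" using count_colors[OF cM, of e] coloringsD(3)[OF cc, of e] by (simp add: thick_def)
  finally show ?thesis .
 qed
 moreover have "set (loop_list M c) <= loops" unfolding loop_list_def using L by auto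
 ultimately show ?thesis by (simp add: loop_lists_def)
qed

lemma list_coloring_loop_list:
 assumes c: "c \<in> bounded_colorings M"
 shows "list_coloring (loop_list M c) = c"
proof
 fix e
 have cc: "c \<in> colorings w" and cM: "!!e. e \<in> edges w ==> c e <= {1..M}" using c by (auto simp: bounded_colorings_def)
 show "list_coloring (loop_list M c) e = c e"
 proof (cases "e \<in> edges w")
  case True
  have "{Suc i | i. i < M & (loop_list M c ! i) e = 1} = c e"
  proof (intro equalityI subsetI)
   fix x assume x: "x \<in> c e"
   then have "x \<in> {1..M}" using cM[OF True] by blast
   then obtain i where "x = Suc i" "i < M" by (cases x) auto
   then show "x \<in> {Suc i | i. i < M & (loop_list M c ! i) e = 1}" using x True by (auto simp: loop_list_nth)
  qed (auto simp: loop_list_nth split: if_splits)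
  then show ?thesis using True by (simp add: list_coloring_def)
 qed (simp add: list_coloring_def coloringsD(4)[OF cc])
qed

lemma list_coloring_in:
 assumes gs: "gs \<in> loop_lists M"
 shows "list_coloring gs \<in> bounded_colorings M" "loop_list M (list_coloring gs) = gs"
proof -
 have len: "length gs = M" and lp: "!!i. i < M ==> gs ! i \<in> loops" and sm: "!!e. (\<Sum>g\<leftarrow>gs. g e) = thick e"
  using gs by (auto simp: loop_lists_def)
 define c where "c = list_coloring gs"
 have mem: "Suc i \<in> c e \<longleftrightarrow> i < M & (gs ! i) e = 1" if "e \<in> edges w" for i e
  using that len by (simp add: c_def list_coloring_def)
 have sub: "c e <= {1..M}" if "e \<in> edges w" for e using that len by (auto simp: c_def list_coloring_def)
 have val: "(gs ! i) e = (if e \<in> edges w & Suc i \<in> c e then 1 else 0)" if "i < M" for i e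
 proof (cases "e \<in> edges w")
  case True
  have "(gs ! i) e <= 1" by (rule loopsD(1)[OF lp[OF that]])
  then show ?thesis using mem[OF True, of i] that True by auto
 next
  case False
  then show ?thesis using loopsD(2)[OF lp[OF that]] by simp
 qed
 show "loop_list M (list_coloring gs) = gs"
  by (rule nth_equalityI) (auto simp: len loop_list_nth val c_def[symmetric])
 have cd: "card (c e) = thickness w e" if e: "e \<in> edges w" for e
 proof -
  have "(\<Sum>g\<leftarrow>gs. g e) = (\<Sum>i<M. (gs ! i) e)" using sum_list_sum_nth[of "map (%g. g e) gs"] len by (simp add: atLeast0LessThan)
  also have "... = (\<Sum>i<M. if Suc i \<in> c e then 1 else 0)" using e by (intro sum.cong) (auto simp: val)
  also have "... = card (c e)" by (rule count_colors[OF sub[OF e]])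
  finally show ?thesis using sm[of e] e by (simp add: thick_def)
 qed
 have un: "(\<Union>e\<in>in_edges w v. c e) = (\<Union>e\<in>out_edges w v. c e)" if v: "v \<in> vertices w" for v
 proof -
  have key: "c d = c a Un c b" if e: "a \<in> edges w" "b \<in> edges w" "d \<in> edges w"
   and eq: "!!i. i < M ==> (gs ! i) d = (gs ! i) a + (gs ! i) b" for a b d
  proof (rule set_eqI)
   fix x show "x \<in> c d \<longleftrightarrow> x \<in> c a Un c b"
   proof (cases x)
    case 0
    then show ?thesis using sub[OF e(1)] sub[OF e(2)] sub[OF e(3)] by auto
   next
    case (Suc i)
    show ?thesis
    proof (cases "i < M")
     case True
     have "(gs ! i) d <= 1" by (rule loopsD(1)[OF lp[OF True]])
     then show ?thesis unfolding Suc Un_iff mem[OF e(1)] mem[OF e(2)] mem[OF e(3)] using eq[OF True] by linarith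
    next
     case False
     then show ?thesis unfolding Suc Un_iff mem[OF e(1)] mem[OF e(2)] mem[OF e(3)] by simp
    qed
   qed
  qed
  have cons: "sum (gs ! i) (in_edges w v) = sum (gs ! i) (out_edges w v)" if "i < M" for i
   using loopsD(3)[OF lp[OF that]] v by (simp add: conserved_def)
  from v show ?thesis
  proof (cases rule: vertex_shape)
   case (Merge a b d)
   have e: "a \<in> edges w" "b \<in> edges w" "d \<in> edges w" using in_out_edges[of _ v] unfolding Merge(3,4) by simp_all
   have "c d = c a Un c b" by (rule key[OF e]) (use cons Merge(2) in \<open>simp add: Merge(3,4)\<close>)
   then show ?thesis unfolding Merge(3,4) by simp
  next
   case (Split a b d)
   have e: "a \<in> edges w" "b \<in> edges w" "d \<in> edges w" using in_out_edges[of _ v] unfolding Split(3,4) by simp_all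
   have "c d = c a Un c b" by (rule key[OF e]) (use cons Split(2) in \<open>simp add: Split(3,4)\<close>)
   then show ?thesis unfolding Split(3,4) by simp
  qed
 qed
 have "c \<in> colorings w"
  unfolding colorings_def mem_Collect_eq
 proof (intro conjI ballI un)
  show "c \<in> (\<Pi>\<^sub>E e\<in>edges w. {S. finite S & S <= {1..} & card S = thickness w e})"
  proof (rule PiE_I)
   fix e assume e: "e \<in> edges w"
   have "finite (c e)" by (rule finite_subset[OF sub[OF e]]) simp
   moreover have "c e <= {1..}" using sub[OF e] by auto
   ultimately show "c e \<in> {S. finite S & S <= {1..} & card S = thickness w e}" using cd[OF e] by simp
  next
   fix e assume "e ~: edges w"
   then show "c e = undefined" by (simp add: c_def list_coloring_def)
  qed
 qed
 then show "list_coloring gs \<in> bounded_colorings M" unfolding bounded_colorings_def c_def[symmetric] using sub by blast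
qed

lemma coloring_bounded: "c \<in> colorings w ==> EX M0. \<forall>M\<ge>M0. c \<in> bounded_colorings M"
proof -
 assume c: "c \<in> colorings w"
 have f: "finite (\<Union>e\<in>edges w. c e)" using finite_edges coloringsD(1)[OF c] by blast
 have "c \<in> bounded_colorings M" if M: "M >= Max (insert 0 (\<Union>e\<in>edges w. c e))" for M
 proof -
  have "c e <= {1..M}" if e: "e \<in> edges w" for e
  proof
   fix x assume x: "x \<in> c e"
   then have "x <= Max (insert 0 (\<Union>e\<in>edges w. c e))" using f e by (intro Max_ge) auto
   moreover have "x >= 1" using x coloringsD(2)[OF c e] by auto
   ultimately show "x \<in> {1..M}" using M by simp
  qed
  then show ?thesis using c by (simp add: bounded_colorings_def)
 qed
 then show ?thesis by blast
qed

text \<open>Inversions between two edges in terms of list positions. Splitting off the first loop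
  shows that, summed over all merges, it obeys the recursion of \<open>linv\<close>.\<close>

definition pair_sum :: "('e => nat) list => 'e => 'e => int" where
 "pair_sum gs a b = (\<Sum>j<length gs. \<Sum>i<length gs. sgn (int j - int i) * (int ((gs ! i) a) * int ((gs ! j) b)))"

lemma sgn_Suc: "sgn (int (Suc j) - int (Suc i)) = sgn (int j - int i)" "sgn (int (Suc j) - int 0) = 1" "sgn (int 0 - int (Suc j)) = - 1"
 by (simp_all add: sgn_if)

lemma pair_sum_Cons:
 "pair_sum (g # gs) a b = int (g a) * int (\<Sum>u\<leftarrow>gs. u b) - int (g b) * int (\<Sum>u\<leftarrow>gs. u a) + pair_sum gs a b"
proof -
 have s: "int (\<Sum>u\<leftarrow>gs. u e) = (\<Sum>i<length gs. int ((gs ! i) e))" for e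
  using sum_list_sum_nth[of "map (%g. g e) gs"] by (simp add: atLeast0LessThan)
 show ?thesis unfolding pair_sum_def s length_Cons sum.lessThan_Suc_shift nth_Cons_0 nth_Cons_Suc sgn_Suc
  by (simp add: sum.distrib sum_distrib_left sum_negf mult.commute)
qed

end

section \<open>The series of the web as a coefficient in the quantum torus\<close>

context homfly_web begin

lemma linv_pair_sum: "linv gs = (\<Sum>v\<in>merges w. pair_sum gs (left_edge w v) (right_edge w v))"
proof (induction gs)
 case (Cons g gs)
 show ?case unfolding linv.simps Cons.IH pair_sum_Cons sum.distrib lsumv_def cross_def[of g "%e. \<Sum>g\<leftarrow>gs. g e"] ..
qed (simp add: pair_sum_def)

lemma coloring_inv_linv:
 assumes c: "c \<in> bounded_colorings M"
 shows "coloring_inv w c = linv (loop_list M c)"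
 unfolding coloring_inv_def linv_pair_sum
proof (rule sum.cong[OF refl])
 fix v assume v: "v \<in> merges w"
 have cM: "!!e. e \<in> edges w ==> c e <= {1..M}" using c by (auto simp: bounded_colorings_def)
 have vv: "v \<in> vertices w" using v by (simp add: merges_def)
 obtain xs ins outs where s: "(xs, ins, outs, Some v) \<in> set ss" using vertex_step[OF vv] by (elim exE)
 have e: "left_edge w v \<in> edges w & right_edge w v \<in> edges w" using s
 proof (cases rule: step_cases)
  case (Merge u a b c)
  then have "left_edge w v \<in> in_edges w v" "right_edge w v \<in> in_edges w v" by simp_all
  then show ?thesis using in_out_edges by blast
 next
  case (Split u a b c)
  then show ?thesis using v merges_splits_disjoint by auto
 qed simp
 have conv: "(\<Sum>x\<in>c e. f x) = (\<Sum>i<M. int ((loop_list M c ! i) e) * f (Suc i))" if e: "e \<in> edges w" for e and f :: "nat => int"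
 proof -
  have "c e = Suc ` {i \<in> {..<M}. Suc i \<in> c e}"
  proof (intro equalityI subsetI)
   fix x assume x: "x \<in> c e"
   then have "x \<in> {1..M}" using cM[OF e] by blast
   then obtain i where "x = Suc i" "i < M" by (cases x) auto
   then show "x \<in> Suc ` {i \<in> {..<M}. Suc i \<in> c e}" using x by blast
  qed auto
  then have "(\<Sum>x\<in>c e. f x) = (\<Sum>i\<in>{i \<in> {..<M}. Suc i \<in> c e}. f (Suc i))"
   by (metis (no_types, lifting) comp_apply inj_Suc inj_on_subset subset_UNIV sum.cong sum.reindex)
  also have "... = (\<Sum>i<M. if Suc i \<in> c e then f (Suc i) else 0)" by (rule sum.inter_filter) simp
  also have "... = (\<Sum>i<M. int ((loop_list M c ! i) e) * f (Suc i))"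
   using e by (intro sum.cong) (auto simp: loop_list_nth)
  finally show ?thesis .
 qed
 show "(\<Sum>r\<in>c (right_edge w v). \<Sum>l\<in>c (left_edge w v). sgn (int r - int l)) = pair_sum (loop_list M c) (left_edge w v) (right_edge w v)"
  unfolding conv[OF conjunct1[OF e]] conv[OF conjunct2[OF e]] pair_sum_def length_loop_list sum_distrib_left
  by (intro sum.cong refl) (simp add: mult_ac)
qed

text \<open>By \<open>components_curve\<close> the number of components of a color is a cut size;
  the exponents of the series thereby become additive in the loops.\<close>

lemma monomial_lookup:
 assumes c: "c \<in> bounded_colorings M"
 shows "lkp (coloring_monomial w c) i = (if i < M then cut_size (loop_list M c ! i) else 0)"
proof -
 have cM: "!!e. e \<in> edges w ==> c e <= {1..M}" using c by (auto simp: bounded_colorings_def)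
 have ll: "loop_list M c ! i \<in> loops" if "i < M" for i using loop_list_in[OF c] that by (auto simp: loop_lists_def)
 have f: "card (components (color_curve w c (Suc i))) = (if i < M then cut_size (loop_list M c ! i) else 0)" for i
 proof (cases "i < M")
  case True
  have "color_curve w c (Suc i) = curve (loop_list M c ! i)"
   unfolding color_curve_def curve_def using True by (intro arg_cong[where f = "%S. \<Union>e\<in>S. edge_image w e"]) (auto simp: loop_list_nth)
  then show ?thesis using components_curve[OF ll[OF True]] True by (simp add: cut_size_def)
 next
  case False
  have "{e \<in> edges w. Suc i \<in> c e} = {}" using cM False by fastforce
  then have "color_curve w c (Suc i) = {}" unfolding color_curve_def by (simp only: UN_empty)
  then show ?thesis using False by simp
 qed
 have "finite {i. (if i < M then cut_size (loop_list M c ! i) else 0) ~= 0}"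
  by (rule finite_subset[of _ "{..<M}"]) auto
 then show ?thesis unfolding coloring_monomial_def f by (simp add: Abs_poly_mapping_inverse)
qed

text \<open>A color in use gives a nonempty loop, which must meet the cut and hence shows up in the
  monomial.\<close>

lemma coloring_bounded_keys:
 assumes c: "c \<in> colorings w" and k: "kys (coloring_monomial w c) <= {..<M}"
 shows "c \<in> bounded_colorings M"
proof -
 obtain M0 where M0: "\<forall>M\<ge>M0. c \<in> bounded_colorings M" using coloring_bounded[OF c] by blast
 define K where "K = max M M0"
 have cK: "c \<in> bounded_colorings K" using M0 by (simp add: K_def)
 have "c e <= {1..M}" if e: "e \<in> edges w" for e
 proof
  fix x assume x: "x \<in> c e"
  have "c e <= {1..K}" using cK e unfolding bounded_colorings_def by blast
  then have "x \<in> {1..K}" using x by (rule subsetD)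
  then obtain i where i: "x = Suc i" "i < K" by (cases x) auto
  have "i < M"
  proof (rule ccontr)
   assume "\<not> i < M"
   then have "i ~: kys (coloring_monomial w c)" using k by auto
   then have "cut_size (loop_list K c ! i) = 0" using monomial_lookup[OF cK, of i] i(2) by (simp add: in_keys_iff)
   moreover have "loop_list K c ! i \<in> loops" using loop_list_in[OF cK] i(2) by (auto simp: loop_lists_def)
   ultimately have z: "loop_list K c ! i = (%_. 0)" using cut_size_zero by blast
   have "(loop_list K c ! i) e = 1" unfolding loop_list_nth[OF i(2)] using e x i(1) by simp
   then show False unfolding z by simp
  qed
  then show "x \<in> {1..M}" using i(1) by simp
 qed
 then show ?thesis using c by (simp add: bounded_colorings_def)
qed

lemma web_series_loop_lists:
 assumes m: "kys m <= {..<M}"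
 shows "web_series w m = (\<Sum>gs | gs \<in> loop_lists M & map cut_size gs = map (lkp m) [0..<M]. q_var powi linv gs)"
 unfolding web_series_def
proof (rule sum.reindex_bij_witness[of _ list_coloring "loop_list M"])
 have eqv: "coloring_monomial w c = m \<longleftrightarrow> map cut_size (loop_list M c) = map (lkp m) [0..<M]" if c: "c \<in> bounded_colorings M" for c
 proof
  assume cm: "coloring_monomial w c = m"
  show "map cut_size (loop_list M c) = map (lkp m) [0..<M]"
   by (rule nth_equalityI) (use monomial_lookup[OF c, unfolded cm] in auto)
 next
  assume l: "map cut_size (loop_list M c) = map (lkp m) [0..<M]"
  have "lkp (coloring_monomial w c) i = lkp m i" for i
  proof (cases "i < M")
   case True
   have "map cut_size (loop_list M c) ! i = map (lkp m) [0..<M] ! i" unfolding l ..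
   then show ?thesis using monomial_lookup[OF c, of i] True by simp
  next
   case False
   then have "i ~: kys m" using m by auto
   then show ?thesis using monomial_lookup[OF c, of i] False by (simp add: in_keys_iff)
  qed
  then show "coloring_monomial w c = m" by (intro poly_mapping_eqI)
 qed
 fix c assume c: "c \<in> {c. c \<in> colorings w & coloring_monomial w c = m}"
 then have cb: "c \<in> bounded_colorings M" using coloring_bounded_keys m by blast
 show "list_coloring (loop_list M c) = c" by (rule list_coloring_loop_list[OF cb])
 show "loop_list M c \<in> {gs. gs \<in> loop_lists M & map cut_size gs = map (lkp m) [0..<M]}"
  using loop_list_in[OF cb] eqv[OF cb] c by blast
 show "q_var powi linv (loop_list M c) = q_var powi coloring_inv w c" unfolding coloring_inv_linv[OF cb] ..
next
 fix gs assume gs: "gs \<in> {gs. gs \<in> loop_lists M & map cut_size gs = map (lkp m) [0..<M]}"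
 have g: "gs \<in> loop_lists M" "map cut_size gs = map (lkp m) [0..<M]" using gs by blast+
 note lc = list_coloring_in[OF g(1)]
 show "loop_list M (list_coloring gs) = gs" by (rule lc(2))
 have "lkp (coloring_monomial w (list_coloring gs)) i = lkp m i" for i
 proof (cases "i < M")
  case True
  have "length gs = M" using g(1) by (simp add: loop_lists_def)
  moreover have "map cut_size gs ! i = map (lkp m) [0..<M] ! i" unfolding g(2) ..
  ultimately show ?thesis using monomial_lookup[OF lc(1), of i] True unfolding lc(2) by simp
 next
  case False
  then have "i ~: kys m" using m by auto
  then show ?thesis using monomial_lookup[OF lc(1), of i] False by (simp add: in_keys_iff)
 qed
 then have "coloring_monomial w (list_coloring gs) = m" by (intro poly_mapping_eqI)
 then show "list_coloring gs \<in> {c. c \<in> colorings w & coloring_monomial w c = m}"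
  using lc(1) by (simp add: bounded_colorings_def)
qed

lemma loop_lists_lsumv: "loop_lists M = {gs. length gs = M & set gs <= loops & lsumv gs = thick}"
 unfolding loop_lists_def lsumv_def fun_eq_iff ..

lemma finite_loop_lists: "finite (loop_lists M)"
 by (rule finite_subset[OF _ finite_lists_length_eq[OF finite_loops, of M]]) (auto simp: loop_lists_def)

lemma web_series_cprod:
 assumes m: "kys m <= {..<M}"
 shows "web_series w m = cprod (map loop_ser (map (lkp m) [0..<M])) thick"
proof -
 define ks where "ks = map (lkp m) [0..<M]"
 have len: "length ks = M" by (simp add: ks_def)
 have pr: "length gs = length ks ==> set gs <= loops ==>
  prod_list (map (%p. fst p (snd p)) (zip (map loop_ser ks) gs)) = (if map cut_size gs = ks then 1 else 0)" for gs ks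
 proof (induction gs ks rule: list_induct2')
  case (4 g gs k ks)
  then show ?case by (simp add: loop_ser_def)
 qed simp_all
 have "cprod (map loop_ser ks) thick = (\<Sum>gs\<in>loop_lists M. q_var powi linv gs * prod_list (map (%p. fst p (snd p)) (zip (map loop_ser ks) gs)))"
  unfolding loop_lists_lsumv
  by (subst cprod_explicit[OF finite_loops loops_vecs]) (auto simp: loop_ser_def len)
 also have "... = (\<Sum>gs\<in>loop_lists M. if map cut_size gs = ks then q_var powi linv gs else 0)"
 proof (rule sum.cong[OF refl])
  fix gs assume "gs \<in> loop_lists M"
  then have "length gs = length ks" "set gs <= loops" by (auto simp: loop_lists_def len)
  from pr[OF this] show "q_var powi linv gs * prod_list (map (%p. fst p (snd p)) (zip (map loop_ser ks) gs)) =
   (if map cut_size gs = ks then q_var powi linv gs else 0)" by simp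
 qed
 also have "... = (\<Sum>gs | gs \<in> loop_lists M & map cut_size gs = ks. q_var powi linv gs)"
  by (rule sum.inter_filter[symmetric, OF finite_loop_lists])
 finally show ?thesis unfolding web_series_loop_lists[OF m] ks_def by simp
qed

lemma cprod_filter: "cprod (map loop_ser ks) = cprod (map loop_ser (filter (%k. k ~= 0) ks))"
proof (induction ks)
 case (Cons k ks)
 have "conv unit (cprod (map loop_ser ks)) = cprod (map loop_ser ks)" by (rule conv_unit(1)) (rule cprod_outside)
 then show ?case using Cons by (simp add: loop_ser_zero)
qed simp

lemma mset_nonzero_values:
 assumes "kys m <= {..<M}"
 shows "mset (filter (%k. k ~= 0) (map (lkp m) [0..<M])) = vals m"
proof -
 have "mset (filter (%k. k ~= 0) (map (lkp m) [0..<M])) = image_mset (lkp m) (filter_mset (%i. lkp m i ~= 0) (mset [0..<M]))"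
  by (simp add: mset_filter filter_mset_image_mset comp_def)
 also have "filter_mset (%i. lkp m i ~= 0) (mset [0..<M]) = mset_set {i \<in> {0..<M}. lkp m i ~= 0}"
  by (simp add: filter_mset_mset_set)
 also have "{i \<in> {0..<M}. lkp m i ~= 0} = kys m" using assms by (auto simp: in_keys_iff)
 finally show ?thesis unfolding vals_def .
qed

lemma vals_map_key: "bij pm ==> vals (Poly_Mapping.map_key pm m) = vals m"
proof -
 assume b: "bij (pm :: nat => nat)"
 have lk: "lkp (Poly_Mapping.map_key pm m) i = lkp m (pm i)" for i by (rule lookup_map_key) (rule bij_is_inj[OF b])
 have k: "pm ` kys (Poly_Mapping.map_key pm m) = kys m"
 proof (intro equalityI subsetI)
  fix x assume "x \<in> kys m"
  moreover obtain i where "x = pm i" using bij_is_surj[OF b] by (metis surjD)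
  ultimately show "x \<in> pm ` kys (Poly_Mapping.map_key pm m)" by (simp add: in_keys_iff lk)
 qed (auto simp: in_keys_iff lk)
 have "vals (Poly_Mapping.map_key pm m) = image_mset (lkp m) (image_mset pm (mset_set (kys (Poly_Mapping.map_key pm m))))"
  unfolding vals_def multiset.map_comp by (rule image_mset_cong) (simp add: lk)
 also have "image_mset pm (mset_set (kys (Poly_Mapping.map_key pm m))) = mset_set (kys m)"
  unfolding k[symmetric] by (rule image_mset_mset_set) (rule inj_on_subset[OF bij_is_inj[OF b] subset_UNIV])
 finally show ?thesis by (simp add: vals_def)
qed

lemma cut_size_lsumv: "cut_size (lsumv gs) = sum_list (map cut_size gs)"
proof (induction gs)
 case (Cons g gs)
 then show ?case by (simp add: cut_size_add)
qed (simp add: cut_size_def)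

lemma web_series_degree:
 assumes "web_series w m ~= 0"
 shows "total_degree m <= cut_size thick"
proof -
 obtain M where M: "kys m <= {..<M}" using finite_nat_iff_bounded finite_keys by metis
 have "{gs. gs \<in> loop_lists M & map cut_size gs = map (lkp m) [0..<M]} ~= {}"
  using assms unfolding web_series_loop_lists[OF M] by (metis sum.empty)
 then obtain gs where gs: "gs \<in> loop_lists M" "map cut_size gs = map (lkp m) [0..<M]" by blast
 have "cut_size thick = sum_list (map (lkp m) [0..<M])"
  using gs cut_size_lsumv[of gs] unfolding loop_lists_lsumv by auto
 also have "... = (\<Sum>i<M. lkp m i)" by (simp add: sum_list_distinct_conv_sum_set atLeast0LessThan)
 also have "... >= total_degree m" unfolding total_degree_def by (rule sum_mono2) (use M in auto)
 finally show ?thesis .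
qed

theorem web_series_symmetric: "web_series w \<in> symmetric_functions"
proof -
 have "web_series w (Poly_Mapping.map_key pm m) = web_series w m" if b: "bij pm" for pm m
 proof -
  have fin: "finite (kys m Un kys (Poly_Mapping.map_key pm m))" by simp
  obtain M where "kys m Un kys (Poly_Mapping.map_key pm m) <= {..<M}" using fin finite_nat_iff_bounded by blast
  then have M: "kys m <= {..<M}" "kys (Poly_Mapping.map_key pm m) <= {..<M}" by auto
  let ?f = "%m. filter (%k. k ~= 0) (map (lkp m) [0..<M])"
  have "cprod (map loop_ser (?f (Poly_Mapping.map_key pm m))) = cprod (map loop_ser (?f m))"
  proof (rule cprod_perm)
   have "mset (?f (Poly_Mapping.map_key pm m)) = mset (?f m)"
    unfolding mset_nonzero_values[OF M(1)] mset_nonzero_values[OF M(2)] by (rule vals_map_key[OF b])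
   then show "mset (map loop_ser (?f (Poly_Mapping.map_key pm m))) = mset (map loop_ser (?f m))" by (simp only: mset_map)
  qed (use loop_ser_commute in auto)
  then show ?thesis unfolding web_series_cprod[OF M(1)] web_series_cprod[OF M(2)]
   cprod_filter[of "map (lkp m) [0..<M]"] cprod_filter[of "map (lkp (Poly_Mapping.map_key pm m)) [0..<M]"] by simp
 qed
 then show ?thesis unfolding symmetric_functions_def using web_series_degree by blast
qed

text \<open>Loop lists are grouped by their monomial \<open>mo\<close>; each loop carries the power
  of its own variable, which is the coefficient of \<open>gen\<close>.\<close>

theorem series_eval_web_series: "series_eval xs (web_series w) = cprod (map gen xs) thick"
proof -
 define N where "N = length xs"
 define d where "d = cut_size thick"
 define mo where "mo gs = Abs_poly_mapping (%i. if i < N then cut_size (gs ! i) else 0)" for gs :: "('e => nat) list"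
 have mu: "lkp (mo gs) i = (if i < N then cut_size (gs ! i) else 0)" for gs i
 proof -
  have "finite {i. (if i < N then cut_size (gs ! i) else 0) ~= 0}" by (rule finite_subset[of _ "{..<N}"]) auto
  then show ?thesis unfolding mo_def by (simp add: Abs_poly_mapping_inverse)
 qed
 define W where "W gs = q_var powi linv gs * (\<Prod>i<N. xs ! i ^ cut_size (gs ! i))" for gs
 have "series_eval xs (web_series w) = (\<Sum>m\<in>pm_bounded N d. web_series w m * pm_eval xs m)"
  using series_eval_bounded[of "web_series w" d xs] web_series_degree unfolding N_def d_def by blast
 also have "... = (\<Sum>m\<in>pm_bounded N d. \<Sum>gs\<in>{gs \<in> loop_lists N. mo gs = m}. W gs)"
 proof (rule sum.cong[OF refl])
  fix m assume "m \<in> pm_bounded N d"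
  then have k: "kys m <= {..<N}" by (simp add: pm_bounded_def)
  have S: "{gs. gs \<in> loop_lists N & map cut_size gs = map (lkp m) [0..<N]} = {gs \<in> loop_lists N. mo gs = m}"
  proof -
   have "map cut_size gs = map (lkp m) [0..<N] \<longleftrightarrow> mo gs = m" if gs: "gs \<in> loop_lists N" for gs
   proof
    have len: "length gs = N" using gs by (simp add: loop_lists_def)
    assume l: "map cut_size gs = map (lkp m) [0..<N]"
    show "mo gs = m"
    proof (rule poly_mapping_eqI)
     fix i
     show "lkp (mo gs) i = lkp m i"
     proof (cases "i < N")
      case True
      have "map cut_size gs ! i = map (lkp m) [0..<N] ! i" unfolding l ..
      then show ?thesis using True len by (simp add: mu)
     next
      case False
      then have "i ~: kys m" using k by auto
      then show ?thesis using False by (simp add: mu in_keys_iff)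
     qed
    qed
   next
    have len: "length gs = N" using gs by (simp add: loop_lists_def)
    assume "mo gs = m"
    then have "lkp m i = (if i < N then cut_size (gs ! i) else 0)" for i using mu[of gs i] by simp
    then show "map cut_size gs = map (lkp m) [0..<N]" by (intro nth_equalityI) (simp_all add: len)
   qed
   then show ?thesis by blast
  qed
  have "q_var powi linv gs * pm_eval xs m = W gs" if gs: "gs \<in> {gs \<in> loop_lists N. mo gs = m}" for gs
  proof -
   have "mo gs = m" using gs by blast
   then have "lkp m i = cut_size (gs ! i)" if "i < N" for i using mu[of gs i] that by simp
   then show ?thesis unfolding W_def pm_eval_def N_def[symmetric] by simp
  qed
  then show "web_series w m * pm_eval xs m = (\<Sum>gs\<in>{gs \<in> loop_lists N. mo gs = m}. W gs)"
   unfolding web_series_loop_lists[OF k] S sum_distrib_right by (intro sum.cong refl)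
 qed
 also have "... = (\<Sum>gs\<in>loop_lists N. W gs)"
 proof (rule sum.group[OF finite_loop_lists])
  show "finite (pm_bounded N d)" by (rule finite_pm_bounded)
  show "mo ` loop_lists N <= pm_bounded N d"
  proof (rule image_subsetI)
   fix gs assume gs: "gs \<in> loop_lists N"
   have len: "length gs = N" using gs by (simp add: loop_lists_def)
   have k: "kys (mo gs) <= {..<N}" by (auto simp: in_keys_iff mu split: if_splits)
   have "total_degree (mo gs) <= (\<Sum>i<N. lkp (mo gs) i)" unfolding total_degree_def by (rule sum_mono2) (use k in auto)
   also have "... = (\<Sum>i<N. cut_size (gs ! i))" by (rule sum.cong) (auto simp: mu)
   also have "... = sum_list (map cut_size gs)" using len by (simp add: sum_list_sum_nth atLeast0LessThan)
   also have "... = d" using gs cut_size_lsumv[of gs] unfolding d_def loop_lists_lsumv by simp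
   finally show "mo gs \<in> pm_bounded N d" using k by (simp add: pm_bounded_def)
  qed
 qed
 also have "... = (\<Sum>gs\<in>loop_lists N. q_var powi linv gs * prod_list (map (%p. fst p (snd p)) (zip (map gen xs) gs)))"
 proof (rule sum.cong[OF refl])
  fix gs assume gs: "gs \<in> loop_lists N"
  then have len: "length gs = N" and lp: "!!i. i < N ==> gs ! i \<in> loops" by (auto simp: loop_lists_def)
  have "prod_list (map (%p. fst p (snd p)) (zip (map gen xs) gs)) = (\<Prod>i<N. xs ! i ^ cut_size (gs ! i))"
   unfolding prod.list_conv_set_nth using len N_def lp by (simp add: atLeast0LessThan gen_def)
  then show "W gs = q_var powi linv gs * prod_list (map (%p. fst p (snd p)) (zip (map gen xs) gs))" by (simp add: W_def)
 qed
 also have "... = cprod (map gen xs) thick"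
  unfolding loop_lists_lsumv
  by (subst cprod_explicit[OF finite_loops loops_vecs]) (auto simp: gen_def N_def)
 finally show ?thesis .
qed

end

section \<open>Loop decompositions and hook tableaux\<close>

context annular_graph begin

text \<open>A translate of the second level by whole turns lies above the first one and has the same
  edges, so conservation along the sweep between them applies.\<close>

lemma levels_lsum:
 assumes "generic_on {y1}" "generic_on {y2}" "level y1 L1" "level y2 L2" and f: "conserved f"
 shows "lsum f L1 = lsum f L2"
proof -
 have shift: "EX L'. level (y2 + real n) L' & generic_on {y2 + real n} & lsum f L' = lsum f L2" for n
 proof (induction n)
  case 0
  then show ?case using assms by auto
 next
  case (Suc n)
  then obtain L' where L': "level (y2 + real n) L'" "generic_on {y2 + real n}" "lsum f L' = lsum f L2" by blast
  have e: "y2 + real (Suc n) = y2 + real n + 1" by simp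
  show ?case unfolding e
  proof (intro exI conjI)
   show "level (y2 + real n + 1) (map sh L')" by (rule level_shift[OF L'(1)])
   show "generic_on {y2 + real n + 1}" by (rule generic_shift[OF L'(2)])
   show "lsum f (map sh L') = lsum f L2" using L'(3) by (simp add: lsum_def comp_def)
  qed
 qed
 obtain n where n: "y1 - y2 < real n" using reals_Archimedean2 by blast
 obtain L' where L': "level (y2 + real n) L'" "generic_on {y2 + real n}" "lsum f L' = lsum f L2" using shift by blast
 have "y1 < y2 + real n" using n by simp
 from evolve_levels[OF this assms(1) L'(2) assms(3) L'(1) empty_subsetI] obtain ss where "evolve wok {} L1 ss L'" by blast
 from evolve_lsum[OF f this] L'(3) show ?thesis by simp
qed

lemma web_degree_cut:
 assumes h: "radial_cut w h"
 shows "web_degree w = sum_list (initial_thickness w h)"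
proof -
 have lev: "EX y L. generic_on {y} & level y L & sum_list (initial_thickness w h) = lsum (thickness w) L" if hh: "radial_cut w h" for h
 proof -
  obtain y L where "generic_on {y}" "level y L" "map fst L = cut_edges w h" using scheme_exists[OF hh] by blast
  note L = this
  have "sum_list (initial_thickness w h) = lsum (thickness w) L"
   unfolding initial_thickness_def L(3)[symmetric] lsum_def map_map comp_def ..
  then show ?thesis using L(1,2) by (intro exI conjI)
 qed
 have cons: "conserved (thickness w)" using thickness_conserved by (simp add: conserved_def)
 have "sum_list (initial_thickness w h') = sum_list (initial_thickness w h)" if "radial_cut w h'" for h'
 proof -
  from lev[OF that] obtain y1 L1 where 1: "generic_on {y1}" "level y1 L1" "sum_list (initial_thickness w h') = lsum (thickness w) L1" by blast
  from lev[OF h] obtain y2 L2 where 2: "generic_on {y2}" "level y2 L2" "sum_list (initial_thickness w h) = lsum (thickness w) L2" by blast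
  show ?thesis unfolding 1(3) 2(3) by (rule levels_lsum[OF 1(1) 2(1) 1(2) 2(2) cons])
 qed
 note all = this
 show ?thesis unfolding web_degree_def
 proof (rule the_equality)
  show "ALL h'. radial_cut w h' --> sum_list (initial_thickness w h') = sum_list (initial_thickness w h)"
   by (intro allI impI) (rule all)
  fix n assume "ALL h'. radial_cut w h' --> sum_list (initial_thickness w h') = n"
  then show "n = sum_list (initial_thickness w h)" using h by (blast intro: sym)
 qed
qed

end

section \<open>Blocks of labels and hook tableaux\<close>

definition block_word :: "('c => nat) => 'c list => 'c list" where
 "block_word t l = concat (map (%e. replicate (t e) e) l)"

lemma length_block_word: "length (block_word t l) = sum_list (map t l)"
 by (simp add: block_word_def length_concat comp_def)

lemma set_block_word: "set (block_word t l) <= set l" by (auto simp: block_word_def)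

text \<open>Positions are counted from 0 and labels from 1, hence position i of the word belongs to
  the label \<open>Suc i\<close>.\<close>

lemma nth_block_word:
 "distinct l ==> i < length (block_word t l) ==> j < length l ==>
  block_word t l ! i = l ! j \<longleftrightarrow> Suc i \<in> block (map t l) j"
proof (induction l arbitrary: i j)
 case (Cons e l)
 have bw: "block_word t (e # l) = replicate (t e) e @ block_word t l" by (simp add: block_word_def)
 have b0: "block (map t (e # l)) 0 = {1..t e}" by (simp add: block_def)
 have bS: "Suc i \<in> block (map t (e # l)) (Suc j') \<longleftrightarrow> t e <= i & Suc (i - t e) \<in> block (map t l) j'" for j'
  by (auto simp: block_def)
 show ?case
 proof (cases "i < t e")
  case True
  then have n: "block_word t (e # l) ! i = e" by (simp add: bw nth_append)
  show ?thesis
  proof (cases j)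
   case 0
   show ?thesis unfolding n 0 b0 using True by simp
  next
   case (Suc j')
   have "l ! j' \<in> set l" using Cons.prems(3) Suc by simp
   then have "e ~= l ! j'" using Cons.prems(1) by auto
   then show ?thesis unfolding n Suc bS using True by simp
  qed
 next
  case False
  then have n: "block_word t (e # l) ! i = block_word t l ! (i - t e)" by (simp add: bw nth_append)
  have i: "i - t e < length (block_word t l)" using Cons.prems(2) False by (simp add: bw)
  show ?thesis
  proof (cases j)
   case 0
   have m: "block_word t l ! (i - t e) \<in> set l" by (rule subsetD[OF set_block_word nth_mem[OF i]])
   have en: "e ~: set l" using Cons.prems(1) by simp
   have "block_word t l ! (i - t e) ~= e"
   proof
    assume eq: "block_word t l ! (i - t e) = e"
    show False using m en unfolding eq by (rule notE[rotated])
   qed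
   then show ?thesis unfolding n 0 b0 using False by simp
  next
   case (Suc j')
   then show ?thesis using Cons.IH[OF _ i, of j'] Cons.prems False unfolding n Suc bS by simp
  qed
 qed
qed simp

lemma block_subset: "block \<alpha> j <= {1..sum_list \<alpha>}"
proof -
 have "sum_list (take k \<alpha>) + sum_list (drop k \<alpha>) = sum_list \<alpha>" for k
  by (metis append_take_drop_id sum_list_append)
 then have "sum_list (take k \<alpha>) <= sum_list \<alpha>" for k by (metis le_add1)
 then show ?thesis unfolding block_def by (meson atLeastatMost_subset_iff le_add2)
qed

text \<open>A hook filling encoded by its first row, where \<open>S\<close> is shifted down by 1.
  The lemmas on rows and signs hold for every \<open>S\<close>, while \<open>SYT_hook\<close>
  restricts to sets containing 0.\<close>

definition tab :: "nat => nat set => nat list list" where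
 "tab n S = sorted_list_of_set (Suc ` S) # map (%x. [x]) (sorted_list_of_set (Suc ` ({..<n} - S)))"

lemma row_of_tab:
 assumes S: "S <= {..<n}"
 shows "i \<in> S ==> row_of (tab n S) (Suc i) = 1"
  "i < n ==> i ~: S ==> \<exists>k<length (sorted_list_of_set (Suc ` ({..<n} - S))).
   row_of (tab n S) (Suc i) = Suc (Suc k) & sorted_list_of_set (Suc ` ({..<n} - S)) ! k = Suc i"
proof -
 define r cs where "r = sorted_list_of_set (Suc ` S)" and "cs = sorted_list_of_set (Suc ` ({..<n} - S))"
 have fS: "finite S" using S finite_subset by blast
 have sr: "set r = Suc ` S" and sc: "set cs = Suc ` ({..<n} - S)" and dc: "distinct cs"
  using fS by (simp_all add: r_def cs_def)
 have t: "tab n S = r # map (%x. [x]) cs" by (simp add: tab_def r_def cs_def)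
 have disj: "set r Int set cs = {}" unfolding sr sc by auto
 have mem: "(1 <= k & k <= length (tab n S) & u \<in> set (tab n S ! (k - 1))) \<longleftrightarrow>
  (k = 1 & u \<in> set r) \<or> (\<exists>k'<length cs. k = Suc (Suc k') & u = cs ! k')" for k u
 proof (cases k)
  case (Suc k1)
  then show ?thesis by (cases k1) (auto simp: t)
 qed simp
 { assume "i \<in> S"
  then have u: "Suc i \<in> set r" by (simp add: sr)
  then have "Suc i ~: set cs" using disj by blast
  then show "row_of (tab n S) (Suc i) = 1" unfolding row_of_def mem using u by (intro the_equality) (auto dest: nth_mem)
 }
 { assume "i < n" "i ~: S"
  then have u: "Suc i \<in> set cs" by (simp add: sc)
  then have nr: "Suc i ~: set r" using disj by blast
  obtain k where k: "k < length cs" "cs ! k = Suc i" using u by (auto simp: in_set_conv_nth)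
  have "row_of (tab n S) (Suc i) = Suc (Suc k)" unfolding row_of_def mem
   by (rule the_equality) (use k nr dc in \<open>auto simp: nth_eq_iff_index_eq\<close>)
  then show "\<exists>k<length cs. row_of (tab n S) (Suc i) = Suc (Suc k) & cs ! k = Suc i" using k by blast
 }
qed

text \<open>If the larger label is in the first row, its row is minimal and a tie is decided against
  it. Otherwise it lies strictly below every smaller label, as the entries below the first row
  increase downward. In both cases the smaller label is irrelevant for the sign.\<close>

lemma attack_sign_tab:
 assumes S: "S <= {..<n}" and ki: "k < i" "i < n"
 shows "attack_sign (row_of (tab n S)) (Suc k) (Suc i) = (if i \<in> S then - 1 else 1)"
  "attack_sign (row_of (tab n S)) (Suc i) (Suc k) = - (if i \<in> S then - 1 else 1)"
proof -
 let ?cs = "sorted_list_of_set (Suc ` ({..<n} - S))"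
 note r = row_of_tab[OF S]
 have k1: "row_of (tab n S) (Suc k) >= 1" using r(1)[of k] r(2)[of k] ki by (cases "k \<in> S") force+
 have "attack_sign (row_of (tab n S)) (Suc k) (Suc i) = (if i \<in> S then - 1 else 1) &
  attack_sign (row_of (tab n S)) (Suc i) (Suc k) = - (if i \<in> S then - 1 else 1)"
 proof (cases "i \<in> S")
  case True
  then show ?thesis using r(1)[OF True] k1 ki by (auto simp: attack_sign_def)
 next
  case False
  obtain i' where i': "i' < length ?cs" "row_of (tab n S) (Suc i) = Suc (Suc i')" "?cs ! i' = Suc i"
   using r(2)[OF ki(2) False] by blast
  have "row_of (tab n S) (Suc k) < row_of (tab n S) (Suc i)"
  proof (cases "k \<in> S")
   case True
   then show ?thesis using r(1)[OF True] i' by simp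
  next
   case kS: False
   obtain k' where k': "k' < length ?cs" "row_of (tab n S) (Suc k) = Suc (Suc k')" "?cs ! k' = Suc k"
    using r(2)[of k] kS ki by auto
   have "k' < i'"
   proof (rule ccontr)
    assume "\<not> k' < i'"
    then have "?cs ! i' <= ?cs ! k'" using k'(1) by (intro sorted_nth_mono) auto
    then show False using k'(3) i'(3) ki(1) by simp
   qed
   then show ?thesis using k'(2) i'(2) by simp
  qed
  then show ?thesis using False by (auto simp: attack_sign_def)
 qed
 then show "attack_sign (row_of (tab n S)) (Suc k) (Suc i) = (if i \<in> S then - 1 else 1)"
  "attack_sign (row_of (tab n S)) (Suc i) (Suc k) = - (if i \<in> S then - 1 else 1)" by blast+
qed

text \<open>A hook tableau is determined by its first row, and the conditions on rows and columns
  amount to the label 1 lying in it.\<close>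

lemma SYT_hook:
 assumes j: "1 <= j" "j <= n"
 shows "SYT (hook n j) = tab n ` {S. S <= {..<n} & 0 \<in> S & card S = j}"
proof (intro equalityI subsetI)
 have sh: "sum_list (hook n j) = n" using j by (simp add: hook_def sum_list_replicate)
 fix \<tau> assume "\<tau> \<in> SYT (hook n j)"
 then have T: "map length \<tau> = hook n j" "distinct (concat \<tau>)" "set (concat \<tau>) = {1..n}" "\<forall>row\<in>set \<tau>. sorted_wrt (<) row"
  "!!i k. Suc i < length \<tau> ==> k < length (\<tau> ! Suc i) ==> \<tau> ! i ! k < \<tau> ! Suc i ! k"
  unfolding SYT_def sh by blast+
 obtain r rs where t: "\<tau> = r # rs" "length r = j" "map length rs = replicate (n - j) 1"
  using T(1) unfolding hook_def by (cases \<tau>) auto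
 define cs where "cs = map hd rs"
 have ln: "length x = 1" if "x \<in> set rs" for x
  using t(3) that by (metis in_set_replicate length_map list.set_map image_eqI)
 have rs: "rs = map (%x. [x]) cs" unfolding cs_def map_map
 proof (rule map_idI[symmetric])
  fix x assume "x \<in> set rs"
  from ln[OF this] show "((%x. [x]) \<circ> hd) x = x" by (cases x) auto
 qed
 have "concat (map (%x. [x]) cs) = cs" by (induction cs) auto
 then have cc: "concat \<tau> = r @ cs" unfolding t(1) rs by simp
 have D: "distinct (r @ cs)" "set r Un set cs = {1..n}" "sorted_wrt (<) r" using T(2-4) cc t(1) by auto
 have step: "(hd r # cs) ! i < (hd r # cs) ! Suc i" if i: "Suc i < length (hd r # cs)" for i
 proof -
  have l: "Suc i < length \<tau>" using i t(1) rs by simp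
  have len: "length (\<tau> ! Suc i) = 1" using l t(1) ln by simp
  have a: "\<tau> ! Suc i ! 0 = (hd r # cs) ! Suc i" using i l unfolding t(1) rs by simp
  have b: "\<tau> ! i ! 0 = (hd r # cs) ! i"
  proof (cases i)
   case 0
   then show ?thesis using t(1,2) j by (cases r) auto
  next
   case (Suc i')
   then show ?thesis using i unfolding t(1) rs by simp
  qed
  have "\<tau> ! i ! 0 < \<tau> ! Suc i ! 0" by (rule T(5)[OF l]) (simp add: len)
  then show ?thesis unfolding a b .
 qed
 have so: "sorted_wrt (<) (hd r # cs)"
  using step by (subst sorted_wrt_iff_nth_Suc_transp) auto
 define S where "S = {i. Suc i \<in> set r}"
 have rpos: "x >= 1 & x <= n" if "x \<in> set r Un set cs" for x using that unfolding D(2) by simp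
 have sS: "Suc ` S = set r"
 proof (intro equalityI subsetI)
  fix x assume x: "x \<in> set r"
  then have "1 <= x" using rpos[of x] by blast
  then obtain i where "x = Suc i" using Suc_le_D[of 0 x] by auto
  then show "x \<in> Suc ` S" using x by (simp add: S_def)
 qed (auto simp: S_def)
 have Sn: "S <= {..<n}" using rpos by (force simp: S_def)
 have sC: "Suc ` ({..<n} - S) = set cs"
 proof (intro equalityI subsetI)
  fix x assume "x \<in> Suc ` ({..<n} - S)"
  then obtain i where i: "x = Suc i" "i < n" "i ~: S" by blast
  then have "x \<in> {1..n}" "x ~: set r" by (auto simp: S_def)
  then show "x \<in> set cs" using D(2) by blast
 next
  fix x assume x: "x \<in> set cs"
  then have x1: "1 <= x" "x <= n" using rpos[of x] by blast+
  then obtain i where i: "x = Suc i" "i < n" using Suc_le_D[of 0 x] by auto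
  have "x ~: set r" using D(1) x by auto
  then show "x \<in> Suc ` ({..<n} - S)" using i by (auto simp: S_def)
 qed
 have "tab n S = \<tau>"
 proof -
  have "sorted_list_of_set (set r) = r" using D(1,3) by (intro sorted_list_of_set.idem_if_sorted_distinct) (auto simp: strict_sorted_iff)
  moreover have "sorted_list_of_set (set cs) = cs" using D(1) so by (intro sorted_list_of_set.idem_if_sorted_distinct) (auto simp: strict_sorted_iff)
  ultimately show ?thesis unfolding tab_def sS sC t(1) rs by simp
 qed
 moreover have "0 \<in> S"
 proof -
  have "1 \<in> set r Un set cs" unfolding D(2) using j by simp
  moreover have "1 ~: set cs"
  proof
   assume "1 \<in> set cs"
   moreover have "\<forall>x\<in>set cs. hd r < x" using so by simp
   ultimately have "hd r < 1" by (rule bspec[rotated])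
   moreover have "hd r \<in> set r" using t(2) j by (cases r) auto
   ultimately show False using rpos[of "hd r"] by simp
  qed
  ultimately show ?thesis by (simp add: S_def)
 qed
 moreover have "card S = j"
 proof -
  have "card S = card (set r)" unfolding sS[symmetric] by (simp add: card_image)
  then show ?thesis using D(1) t(2) by (simp add: distinct_card)
 qed
 ultimately show "\<tau> \<in> tab n ` {S. S <= {..<n} & 0 \<in> S & card S = j}" using Sn by blast
next
 have sh: "sum_list (hook n j) = n" using j by (simp add: hook_def sum_list_replicate)
 fix \<tau> assume "\<tau> \<in> tab n ` {S. S <= {..<n} & 0 \<in> S & card S = j}"
 then obtain S where S: "\<tau> = tab n S" "S <= {..<n}" "0 \<in> S" "card S = j" by blast
 define r cs where "r = sorted_list_of_set (Suc ` S)" and "cs = sorted_list_of_set (Suc ` ({..<n} - S))"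
 have fS: "finite S" using S(2) finite_subset by blast
 have t: "\<tau> = r # map (%x. [x]) cs" by (simp add: S(1) tab_def r_def cs_def)
 have sr: "set r = Suc ` S" and sc: "set cs = Suc ` ({..<n} - S)" using fS by (simp_all add: r_def cs_def)
 have so: "sorted_wrt (<) r" "sorted_wrt (<) cs" by (simp_all add: r_def cs_def)
 have lr: "length r = j" unfolding r_def using S(4) by (simp add: card_image)
 have lc: "length cs = n - j" unfolding cs_def using S(2,4) fS by (simp add: card_image card_Diff_subset)
 have "concat (map (%x. [x]) cs) = cs" by (induction cs) auto
 then have cc: "concat \<tau> = r @ cs" unfolding t by simp
 have "set r Int set cs = {}" unfolding sr sc by auto
 then have dc: "distinct (concat \<tau>)" unfolding cc by (simp add: r_def cs_def)
 have st: "set (concat \<tau>) = {1..n}"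
 proof -
  have "S Un ({..<n} - S) = {..<n}" using S(2) by blast
  then have "set (concat \<tau>) = Suc ` {..<n}" unfolding cc set_append sr sc image_Un[symmetric] by (rule arg_cong)
  then show ?thesis using image_Suc_lessThan by simp
 qed
 have hd: "r ! 0 = 1"
 proof -
  have "1 \<in> set r" using S(3) by (simp add: sr)
  then obtain k where k: "k < length r" "r ! k = 1" by (auto simp: in_set_conv_nth)
  have "sorted r" unfolding r_def by simp
  then have "r ! 0 <= r ! k" by (rule sorted_nth_mono) (use k in auto)
  moreover have "0 < length r" using k(1) by linarith
  then have "r ! 0 \<in> set r" by (rule nth_mem)
  then have "r ! 0 >= 1" unfolding sr by auto
  ultimately show ?thesis using k(2) by simp
 qed
 have col: "\<tau> ! i ! k < \<tau> ! Suc i ! k" if "Suc i < length \<tau>" "k < length (\<tau> ! Suc i)" for i k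
 proof -
  have k: "k = 0" and ic: "i < length cs" using that by (auto simp: t)
  show ?thesis
  proof (cases i)
   case 0
   have "cs ! 0 \<in> Suc ` ({..<n} - S)" using ic 0 nth_mem[of 0 cs] unfolding sc by simp
   then have "cs ! 0 > 1" using S(3) by (auto intro: gr0I)
   then show ?thesis using ic unfolding k 0 t by (simp add: hd[unfolded One_nat_def])
  next
   case (Suc i')
   have "cs ! i' < cs ! Suc i'" using so(2) ic Suc by (simp add: sorted_wrt_iff_nth_less)
   then show ?thesis using ic unfolding k Suc t by simp
  qed
 qed
 have "map length \<tau> = hook n j"
  unfolding t hook_def using lr lc by (simp add: comp_def map_replicate_const)
 moreover have "\<forall>row\<in>set \<tau>. sorted_wrt (<) row" using so(1) by (auto simp: t)
 ultimately show "\<tau> \<in> SYT (hook n j)" unfolding SYT_def sh using dc st col by blast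
qed

lemma tab_inj: "inj_on (tab n) {S. S <= {..<n}}"
proof (rule inj_onI)
 fix S T assume S: "S \<in> {S. S <= {..<n}}" "T \<in> {S. S <= {..<n}}" "tab n S = tab n T"
 have "finite S" "finite T" using S(1,2) finite_subset by blast+
 moreover have "sorted_list_of_set (Suc ` S) = sorted_list_of_set (Suc ` T)" using S(3) by (simp add: tab_def)
 ultimately have "Suc ` S = Suc ` T" by (metis finite_imageI set_sorted_list_of_set)
 then show "S = T" by (simp add: inj_image_eq_iff)
qed

lemma sum_mset_sum: "finite A ==> (\<Sum>x\<in>#(\<Sum>j\<in>A. M j). f x) = (\<Sum>j\<in>A. \<Sum>x\<in>#M j. f x)"
 by (induction A rule: finite_induct) auto

lemma sum_label_pairs:
 fixes f :: "nat => nat => int"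
 assumes "A <= {1..n}" "B <= {1..n}"
 shows "(\<Sum>(u, v)\<in>{(u, v). u \<in> A & v \<in> B & P u v}. f u v) =
  (\<Sum>i<n. \<Sum>k<n. if Suc k \<in> A & Suc i \<in> B & P (Suc k) (Suc i) then f (Suc k) (Suc i) else 0)"
proof -
 have fin: "finite {(i, k). i < n & k < n}" by (rule finite_subset[of _ "{..<n} \<times> {..<n}"]) auto
 have "(\<Sum>i<n. \<Sum>k<n. if Suc k \<in> A & Suc i \<in> B & P (Suc k) (Suc i) then f (Suc k) (Suc i) else 0) =
  (\<Sum>p\<in>{..<n} \<times> {..<n}. if Suc (snd p) \<in> A & Suc (fst p) \<in> B & P (Suc (snd p)) (Suc (fst p)) then f (Suc (snd p)) (Suc (fst p)) else 0)"
  by (simp add: sum.cartesian_product case_prod_unfold)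
 also have "... = (\<Sum>p\<in>{p \<in> {..<n} \<times> {..<n}. Suc (snd p) \<in> A & Suc (fst p) \<in> B & P (Suc (snd p)) (Suc (fst p))}. f (Suc (snd p)) (Suc (fst p)))"
  by (rule sum.inter_filter[symmetric]) simp
 also have "... = (\<Sum>(u, v)\<in>{(u, v). u \<in> A & v \<in> B & P u v}. f u v)"
  by (rule sum.reindex_bij_witness[of _ "%(u, v). (v - 1, u - 1)" "%p. (Suc (snd p), Suc (fst p))"])
   (use assms in \<open>force+\<close>)
 finally show ?thesis by simp
qed

lemma sum_square_halves:
 fixes H :: "nat => nat => int"
 assumes "!!i. H i i = 0"
 shows "(\<Sum>i<n. \<Sum>k<n. H k i) = (\<Sum>i<n. \<Sum>k<i. H k i + H i k)"
proof (induction n)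
 case (Suc n)
 then show ?case using assms[of n] by (simp add: sum.distrib)
qed simp

section \<open>Inversions of hook tableaux and the expansion in powers of a\<close>

context homfly_web begin

definition lab :: "'e list" where "lab = block_word thick es"

text \<open>The shift d_v(L) of the product formula for the label v = i + 1; it involves only labels
  smaller than v.\<close>

definition degree_at :: "('e => nat) list => nat => int" where
 "degree_at gs i = (\<Sum>k<i. cross (gs ! k) (gs ! i) + (if lab ! k = lab ! i then 1 else 0))"

definition deg :: nat where "deg = cut_size thick"

lemma thick_es: "map thick es = initial_thickness w h"
 unfolding initial_thickness_def using set_es by (auto simp: thick_def)

lemma length_lab: "length lab = deg" by (simp add: lab_def length_block_word deg_def cut_size_def)

lemma lab_rev: "labels thick = rev lab" by (simp add: labels_def lab_def block_word_def)

text \<open>Peeling starts with the largest label, so the labels still present are the smaller ones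
  and the recursive shifts appear in reverse order.\<close>

lemma dd_rev:
 "length ls = length gs ==> dd (rev ls) (rev gs) =
  rev (map (%i. \<Sum>k<i. cross (gs ! k) (gs ! i) + (if ls ! k = ls ! i then 1 else 0)) [0..<length gs])"
proof (induction gs arbitrary: ls rule: rev_induct)
 case (snoc g gs)
 then obtain ls' x where ls: "ls = ls' @ [x]" "length ls' = length gs" by (cases ls rule: rev_cases) auto
 have c: "int (count_list (rev l) x) = (\<Sum>k<length l. if l ! k = x then 1 else 0)" for l
 proof (induction l rule: rev_induct)
  case (snoc a l)
  have "(\<Sum>k<length l. if (l @ [a]) ! k = x then 1 else 0) = (\<Sum>k<length l. if l ! k = x then 1 else (0::int))"
   by (rule sum.cong) (auto simp: nth_append)
  then show ?case using snoc by simp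
 qed simp
 have L1: "cross (lsumv us) g = (\<Sum>u\<leftarrow>us. cross u g)" for us
  by (induction us) (simp_all add: om_add_left)
 have l: "cross (lsumv (rev gs)) g = (\<Sum>k<length gs. cross (gs ! k) g)"
  by (simp only: L1 rev_map[symmetric] sum_list_rev) (simp add: sum_list_sum_nth atLeast0LessThan)
 have m: "map (%i. \<Sum>k<i. cross ((gs @ [g]) ! k) ((gs @ [g]) ! i) + (if ls ! k = ls ! i then 1 else 0)) [0..<length gs]
  = map (%i. \<Sum>k<i. cross (gs ! k) (gs ! i) + (if ls' ! k = ls' ! i then 1 else 0)) [0..<length gs]"
  by (rule map_cong[OF refl], rule sum.cong) (auto simp: nth_append ls)
 have e: "(\<Sum>k<length gs. cross ((gs @ [g]) ! k) ((gs @ [g]) ! length gs) + (if ls ! k = ls ! length gs then 1 else 0)) =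
  int (count_list (rev ls') x) + cross (lsumv (rev gs)) g"
  unfolding c l ls(2) sum.distrib[symmetric] by (rule sum.cong) (auto simp: nth_append ls)
 have "dd (rev ls) (rev (gs @ [g])) = (int (count_list (rev ls') x) + cross (lsumv (rev gs)) g) # dd (rev ls') (rev gs)"
  by (simp add: ls(1))
 also have "... = rev (map (%i. \<Sum>k<i. cross ((gs @ [g]) ! k) ((gs @ [g]) ! i) + (if ls ! k = ls ! i then 1 else 0)) [0..<length (gs @ [g])])"
  unfolding snoc.IH[OF ls(2)] m[symmetric] e[symmetric] by simp
 finally show ?case .
qed simp

text \<open>Read edge by edge, the condition says that the label sets on the cut are the blocks;
  read label by label, it says that each loop meets the cut exactly in the edge of its own
  block.\<close>

lemma cut_tip_iff:
 assumes c: "c \<in> bounded_colorings deg"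
 shows "(\<forall>j<length es. c (es ! j) = block (map thick es) j) \<longleftrightarrow> (\<forall>i<deg. tip (lab ! i) (loop_list deg c ! i))"
proof -
 have B: "lab ! i = es ! j \<longleftrightarrow> Suc i \<in> block (map thick es) j" if "i < deg" "j < length es" for i j
  unfolding lab_def by (rule nth_block_word[OF distinct_es]) (use that in \<open>simp_all add: length_block_word deg_def cut_size_def\<close>)
 have T: "tip (lab ! i) (loop_list deg c ! i) \<longleftrightarrow> (\<forall>j<length es. Suc i \<in> c (es ! j) \<longleftrightarrow> Suc i \<in> block (map thick es) j)" if i: "i < deg" for i
 proof -
  have "tip (lab ! i) (loop_list deg c ! i) \<longleftrightarrow> (\<forall>j<length es. (loop_list deg c ! i) (es ! j) = (if es ! j = lab ! i then 1 else 0))"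
   unfolding tip_def all_set_conv_all_nth ..
  also have "... \<longleftrightarrow> (\<forall>j<length es. Suc i \<in> c (es ! j) \<longleftrightarrow> Suc i \<in> block (map thick es) j)"
  proof (intro all_cong1 imp_cong refl)
   fix j assume j: "j < length es"
   have "es ! j \<in> edges w" using set_es nth_mem[OF j] by blast
   then show "(loop_list deg c ! i) (es ! j) = (if es ! j = lab ! i then 1 else 0) \<longleftrightarrow> (Suc i \<in> c (es ! j) \<longleftrightarrow> Suc i \<in> block (map thick es) j)"
    using B[OF i j] by (auto simp: loop_list_nth[OF i])
  qed
  finally show ?thesis .
 qed
 have sub: "c (es ! j) <= {1..deg}" "block (map thick es) j <= {1..deg}" if j: "j < length es" for j
 proof -
  have "es ! j \<in> edges w" using set_es nth_mem[OF j] by blast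
  then show "c (es ! j) <= {1..deg}" using c unfolding bounded_colorings_def by blast
  show "block (map thick es) j <= {1..deg}" unfolding deg_def cut_size_def by (rule block_subset)
 qed
 have set_eq: "A = B \<longleftrightarrow> (\<forall>i<deg. Suc i \<in> A \<longleftrightarrow> Suc i \<in> B)" if "A <= {1..deg}" "B <= {1..deg}" for A B
 proof (rule iffI)
  assume a: "\<forall>i<deg. Suc i \<in> A \<longleftrightarrow> Suc i \<in> B"
  show "A = B"
  proof (rule set_eqI)
  fix x
  show "x \<in> A \<longleftrightarrow> x \<in> B"
  proof (cases "x \<in> {1..deg}")
   case True
   then obtain i where "x = Suc i" "i < deg" by (cases x) auto
   then show ?thesis using a by blast
  next
   case False
   then show ?thesis using that by blast
  qed
  qed
 qed simp
 show ?thesis using T set_eq[OF sub] by blast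
qed

text \<open>Loop decompositions are colorings with n colors. Conversely the disjointness at the
  vertices follows from \<open>coloring_vertex\<close>, because the thicknesses add up.\<close>

lemma SLD_iff:
 assumes h: "radial_cut w h"
 shows "L \<in> SLD w h \<longleftrightarrow> L \<in> bounded_colorings deg & (\<forall>j<length es. L (es ! j) = block (map thick es) j)"
proof -
 have n: "web_degree w = deg" unfolding web_degree_cut[OF h] thick_es[symmetric] deg_def cut_size_def ..
 show ?thesis
 proof
  assume L: "L \<in> SLD w h"
  have P: "L \<in> (\<Pi>\<^sub>E e\<in>edges w. {S. S <= {1..deg} & card S = thickness w e})"
   and B: "\<forall>j<length es. L (es ! j) = block (map thick es) j"
   and U: "!!v. v \<in> vertices w ==> (\<Union>e\<in>in_edges w v. L e) = (\<Union>e\<in>out_edges w v. L e)"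
   using L unfolding SLD_def n thick_es by blast+
  have "L \<in> colorings w" unfolding colorings_def mem_Collect_eq
  proof (intro conjI ballI U)
   show "L \<in> (\<Pi>\<^sub>E e\<in>edges w. {S. finite S & S <= {1..} & card S = thickness w e})"
   proof (rule PiE_I)
    fix e assume e: "e \<in> edges w"
    have "L e <= {1..deg}" "card (L e) = thickness w e" using PiE_mem[OF P e] by blast+
    moreover from this(1) have "finite (L e)" "L e <= {1..}" by (auto dest: finite_subset)
    ultimately show "L e \<in> {S. finite S & S <= {1..} & card S = thickness w e}" by blast
   qed (rule PiE_arb[OF P])
  qed
  moreover have "\<forall>e\<in>edges w. L e <= {1..deg}" using PiE_mem[OF P] by blast
  ultimately show "L \<in> bounded_colorings deg & (\<forall>j<length es. L (es ! j) = block (map thick es) j)"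
   using B by (simp add: bounded_colorings_def)
 next
  assume L: "L \<in> bounded_colorings deg & (\<forall>j<length es. L (es ! j) = block (map thick es) j)"
  have Lc: "L \<in> colorings w" and Ls: "!!e. e \<in> edges w ==> L e <= {1..deg}" and Lb: "\<forall>j<length es. L (es ! j) = block (map thick es) j"
   using L unfolding bounded_colorings_def by blast+
  note D = coloringsD[OF Lc]
  have dj: "disjoint_family_on L (in_edges w v) & disjoint_family_on L (out_edges w v)" if v: "v \<in> vertices w" for v
  proof -
   have two: "disjoint_family_on L {a, b}" if "L a Int L b = {}" for a b
    using that unfolding disjoint_family_on_def by (auto simp: Int_commute)
   have one: "disjoint_family_on L {d}" for d unfolding disjoint_family_on_def by simp
   from Lc v show ?thesis
   proof (cases rule: coloring_vertex)
    case (Merge a b d)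
    show ?thesis unfolding Merge(3,4) using two[OF Merge(6)] one by blast
   next
    case (Split a b d)
    show ?thesis unfolding Split(3,4) using two[OF Split(6)] one by blast
   qed
  qed
  show "L \<in> SLD w h" unfolding SLD_def n mem_Collect_eq thick_es[symmetric]
  proof (intro conjI Lb ballI)
   show "L \<in> (\<Pi>\<^sub>E e\<in>edges w. {S. S <= {1..deg} & card S = thickness w e})"
    by (rule PiE_I) (use Ls D(3,4) in blast)+
   fix v assume v: "v \<in> vertices w"
   show "disjoint_family_on L (in_edges w v)" "disjoint_family_on L (out_edges w v)" using dj[OF v] by blast+
   show "(\<Union>e\<in>in_edges w v. L e) = (\<Union>e\<in>out_edges w v. L e)" by (rule D(5)[OF v])
  qed
 qed
qed

lemma tip_lists_iff:
 "gs \<in> tip_lists (labels thick) thick \<longleftrightarrow> rev gs \<in> loop_lists deg & (\<forall>i<deg. tip (lab ! i) (rev gs ! i))"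
proof -
 have a: "list_all2 P (rev lab) gs \<longleftrightarrow> list_all2 P lab (rev gs)" for P
  using list_all2_rev[of P lab "rev gs"] by simp
 have b: "lsumv gs = lsumv (rev gs)" by (simp add: lsumv_def rev_map[symmetric] sum_list_rev)
 have c: "(deg = length xs & (\<forall>i<deg. xs ! i \<in> loops & tip (lab ! i) (xs ! i))) & lsumv xs = thick \<longleftrightarrow>
  (length xs = deg & set xs <= loops & lsumv xs = thick) & (\<forall>i<deg. tip (lab ! i) (xs ! i))" for xs
  unfolding subset_iff in_set_conv_nth by (cases "length xs = deg") auto
 have "gs \<in> tip_lists (labels thick) thick \<longleftrightarrow> list_all2 (%r g. g \<in> loops & tip r g) lab (rev gs) & lsumv (rev gs) = thick"
  unfolding tip_lists_def mem_Collect_eq lab_rev a by (subst b) (rule refl)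
 also have "... \<longleftrightarrow> (deg = length (rev gs) & (\<forall>i<deg. rev gs ! i \<in> loops & tip (lab ! i) (rev gs ! i))) & lsumv (rev gs) = thick"
  unfolding list_all2_conv_all_nth length_lab ..
 finally show ?thesis unfolding c loop_lists_lsumv mem_Collect_eq .
qed

lemma peel_SLD:
 assumes h: "radial_cut w h"
 shows "peel N (labels thick) thick = (\<Sum>L\<in>SLD w h. \<Prod>i<deg. bracket (int N - degree_at (loop_list deg L) i))"
 unfolding peel_explicit
proof (rule sum.reindex_bij_witness[of _ "%L. rev (loop_list deg L)" "%gs. list_coloring (rev gs)"])
 fix gs assume gs: "gs \<in> tip_lists (labels thick) thick"
 then have g: "rev gs \<in> loop_lists deg" "\<forall>i<deg. tip (lab ! i) (rev gs ! i)" unfolding tip_lists_iff by blast+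
 note lc = list_coloring_in[OF g(1)]
 show "rev (loop_list deg (list_coloring (rev gs))) = gs" unfolding lc(2) by simp
 show "list_coloring (rev gs) \<in> SLD w h" unfolding SLD_iff[OF h] cut_tip_iff[OF lc(1)] lc(2) using lc(1) g(2) by blast
 have len: "length (rev gs) = deg" using g(1) by (simp add: loop_lists_def)
 have "dd (labels thick) gs = rev (map (degree_at (rev gs)) [0..<deg])"
  using dd_rev[of lab "rev gs"] len length_lab unfolding lab_rev degree_at_def by simp
 then show "(\<Prod>i<deg. bracket (int N - degree_at (loop_list deg (list_coloring (rev gs))) i)) = (\<Prod>d\<leftarrow>dd (labels thick) gs. bracket (int N - d))"
  unfolding lc(2) by (simp add: rev_map[symmetric] prod_list.rev comp_def prod.distinct_set_conv_list[symmetric] atLeast0LessThan)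
next
 fix L assume L: "L \<in> SLD w h"
 then have l: "L \<in> bounded_colorings deg" "\<forall>i<deg. tip (lab ! i) (loop_list deg L ! i)"
  using SLD_iff[OF h] cut_tip_iff by blast+
 show "list_coloring (rev (rev (loop_list deg L))) = L" using list_coloring_loop_list[OF l(1)] by simp
 show "rev (loop_list deg L) \<in> tip_lists (labels thick) thick"
  unfolding tip_lists_iff rev_rev_ident using l(2) loop_list_in[OF l(1)] by blast
qed

definition energy :: "('e => nat set) => nat set => int" where
 "energy L S = (\<Sum>i<deg. (if i \<in> S then - 1 else 1) * degree_at (loop_list deg L) i)"

text \<open>Every attacking pair is charged to its larger label i, whose membership in
  \<open>S\<close> alone decides the sign. Block pairs produce the same-edge term of
  \<open>degree_at\<close>, and merge pairs produce \<open>cross\<close>, with the orientation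
  deciding which of its two terms is hit.\<close>

lemma labeling_inv_energy:
 assumes h: "radial_cut w h" and L: "L \<in> SLD w h" and S: "S <= {..<deg}"
 shows "labeling_inv w h L (row_of (tab deg S)) = energy L S"
proof -
 let ?sg = "attack_sign (row_of (tab deg S))"
 let ?s = "%i. if i \<in> S then - 1 else (1::int)"
 let ?g = "%i. loop_list deg L ! i"
 let ?B = "block (map thick es)"
 have Lb: "L \<in> bounded_colorings deg" using L SLD_iff[OF h] by blast
 have Lc: "L \<in> colorings w" and Ls: "!!e. e \<in> edges w ==> L e <= {1..deg}" using Lb unfolding bounded_colorings_def by blast+
 have sign: "?sg (Suc k) (Suc i) = ?s i" "?sg (Suc i) (Suc k) = - ?s i" if "k < i" "i < deg" for k i
  by (rule attack_sign_tab[OF S that])+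
 have lr: "left_edge w p \<in> edges w" "right_edge w p \<in> edges w" "L (left_edge w p) Int L (right_edge w p) = {}" if p: "p \<in> merges w" for p
 proof -
  have pv: "p \<in> vertices w" using p by (simp add: merges_def)
  obtain xs ins outs where s: "(xs, ins, outs, Some p) \<in> set ss" using vertex_step[OF pv] by (elim exE)
  have e: "left_edge w p \<in> in_edges w p & right_edge w p \<in> in_edges w p & left_edge w p ~= right_edge w p" using s
  proof (cases rule: step_cases)
   case (Merge u a b c)
   then show ?thesis by simp
  next
   case (Split u a b c)
   then show ?thesis using p merges_splits_disjoint by auto
  qed simp
  then show "left_edge w p \<in> edges w" "right_edge w p \<in> edges w" using in_out_edges by blast+
  have "disjoint_family_on L (in_edges w p)" using L pv unfolding SLD_def by blast
  then show "L (left_edge w p) Int L (right_edge w p) = {}" using e unfolding disjoint_family_on_def by blast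
 qed
 have blk: "lab ! i = es ! j \<longleftrightarrow> Suc i \<in> ?B j" if "i < deg" "j < length es" for i j
  unfolding lab_def by (rule nth_block_word[OF distinct_es]) (use that in \<open>simp_all add: length_block_word deg_def cut_size_def\<close>)
 have Bsub: "?B j <= {1..deg}" for j unfolding deg_def cut_size_def by (rule block_subset)
 have same: "(\<Sum>j<length es. if Suc k \<in> ?B j & Suc i \<in> ?B j then 1 else 0) = (if lab ! k = lab ! i then 1 else (0::int))"
  if "k < i" "i < deg" for k i
 proof -
  have kd: "k < deg" using that by simp
  have "lab ! k \<in> set es" using nth_mem[of k lab] kd length_lab set_block_word[of thick es] unfolding lab_def by auto
  then obtain j0 where j0: "j0 < length es" "es ! j0 = lab ! k" by (auto simp: in_set_conv_nth)
  have "(\<Sum>j<length es. if Suc k \<in> ?B j & Suc i \<in> ?B j then 1 else (0::int)) = (\<Sum>j<length es. if j = j0 then (if lab ! k = lab ! i then 1 else 0) else 0)"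
  proof (rule sum.cong[OF refl])
   fix j assume "j \<in> {..<length es}"
   then have j: "j < length es" by simp
   have jj: "lab ! k = es ! j \<longleftrightarrow> j = j0" using j0 j nth_eq_iff_index_eq[OF distinct_es j j0(1)] by auto
   show "(if Suc k \<in> ?B j & Suc i \<in> ?B j then 1 else (0::int)) = (if j = j0 then (if lab ! k = lab ! i then 1 else 0) else 0)"
    unfolding blk[OF kd j, symmetric] blk[OF that(2) j, symmetric] jj using j0(2) by auto
  qed
  also have "... = (if lab ! k = lab ! i then 1 else 0)" using j0(1) by simp
  finally show ?thesis .
 qed
 have restrict: "(\<Sum>k<deg. if k < i then f k else 0) = (\<Sum>k<i. f k)" if "i < deg" for i and f :: "nat => int"
 proof -
  have "(\<Sum>k<deg. if k < i then f k else 0) = (\<Sum>k\<in>{k \<in> {..<deg}. k < i}. f k)" by (rule sum.inter_filter[symmetric]) simp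
  also have "{k \<in> {..<deg}. k < i} = {..<i}" using that by auto
  finally show ?thesis .
 qed
 have blocks: "(\<Sum>j<length es. \<Sum>(u, v)\<in>{(u, v). u \<in> ?B j & v \<in> ?B j & u < v}. ?sg u v) =
  (\<Sum>i<deg. \<Sum>k<i. ?s i * (if lab ! k = lab ! i then 1 else 0))"
 proof -
  have "(\<Sum>j<length es. \<Sum>(u, v)\<in>{(u, v). u \<in> ?B j & v \<in> ?B j & u < v}. ?sg u v) =
   (\<Sum>j<length es. \<Sum>i<deg. \<Sum>k<i. if Suc k \<in> ?B j & Suc i \<in> ?B j then ?s i else 0)"
  proof (rule sum.cong[OF refl])
   fix j
   have row: "(\<Sum>k<deg. if Suc k \<in> ?B j & Suc i \<in> ?B j & Suc k < Suc i then ?sg (Suc k) (Suc i) else 0) =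
    (\<Sum>k<i. if Suc k \<in> ?B j & Suc i \<in> ?B j then ?s i else 0)" if i: "i < deg" for i
    unfolding restrict[OF i, symmetric] by (rule sum.cong[OF refl]) (use sign(1) i in auto)
   show "(\<Sum>(u, v)\<in>{(u, v). u \<in> ?B j & v \<in> ?B j & u < v}. ?sg u v) =
    (\<Sum>i<deg. \<Sum>k<i. if Suc k \<in> ?B j & Suc i \<in> ?B j then ?s i else 0)"
    unfolding sum_label_pairs[OF Bsub Bsub] by (rule sum.cong[OF refl], rule row) simp
  qed
  also have "... = (\<Sum>i<deg. \<Sum>k<i. \<Sum>j<length es. if Suc k \<in> ?B j & Suc i \<in> ?B j then ?s i else 0)"
   by (subst sum.swap) (intro sum.cong refl sum.swap)
  also have "... = (\<Sum>i<deg. \<Sum>k<i. ?s i * (if lab ! k = lab ! i then 1 else 0))"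
  proof (intro sum.cong refl)
   fix i k assume "i \<in> {..<deg}" "k \<in> {..<i}"
   then have ki: "k < i" "i < deg" by auto
   show "(\<Sum>j<length es. if Suc k \<in> ?B j & Suc i \<in> ?B j then ?s i else 0) = ?s i * (if lab ! k = lab ! i then 1 else 0)"
    unfolding same[OF ki, symmetric] sum_distrib_left by (intro sum.cong refl) simp
  qed
  finally show ?thesis .
 qed
 have merge: "(\<Sum>(u, v)\<in>L (left_edge w p) \<times> L (right_edge w p). ?sg u v) =
  (\<Sum>i<deg. \<Sum>k<i. ?s i * (int (?g k (left_edge w p)) * int (?g i (right_edge w p)) - int (?g k (right_edge w p)) * int (?g i (left_edge w p))))"
  if p: "p \<in> merges w" for p
 proof -
  let ?l = "left_edge w p" and ?r = "right_edge w p"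
  \<comment> \<open>Loop k enters from the left and loop i from the right. The diagonal terms vanish
    since the two label sets are disjoint, which permits folding the square onto pairs k <
    i.\<close>
  define H where "H k i = (if Suc k \<in> L ?l & Suc i \<in> L ?r then ?sg (Suc k) (Suc i) else 0)" for k i
  have "L ?l \<times> L ?r = {(u, v). u \<in> L ?l & v \<in> L ?r & True}" by auto
  then have "(\<Sum>(u, v)\<in>L ?l \<times> L ?r. ?sg u v) = (\<Sum>(u, v)\<in>{(u, v). u \<in> L ?l & v \<in> L ?r & True}. ?sg u v)" by (simp only:)
  also have "... = (\<Sum>i<deg. \<Sum>k<deg. H k i)"
   unfolding sum_label_pairs[OF Ls[OF lr(1)[OF p]] Ls[OF lr(2)[OF p]]] H_def by simp
  also have "... = (\<Sum>i<deg. \<Sum>k<i. H k i + H i k)"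
   by (rule sum_square_halves) (use lr(3)[OF p] in \<open>auto simp: H_def\<close>)
  also have "... = (\<Sum>i<deg. \<Sum>k<i. ?s i * (int (?g k ?l) * int (?g i ?r) - int (?g k ?r) * int (?g i ?l)))"
  proof (intro sum.cong refl)
   fix i k assume "i \<in> {..<deg}" "k \<in> {..<i}"
   then have ki: "k < i" "i < deg" "k < deg" by auto
   show "H k i + H i k = ?s i * (int (?g k ?l) * int (?g i ?r) - int (?g k ?r) * int (?g i ?l))"
    unfolding H_def sign[OF ki(1,2)] loop_list_nth[OF ki(2)] loop_list_nth[OF ki(3)] using lr(1,2)[OF p] by simp
  qed
  finally show ?thesis .
 qed
 have "labeling_inv w h L (row_of (tab deg S)) =
  (\<Sum>j<length es. \<Sum>(u, v)\<in>{(u, v). u \<in> ?B j & v \<in> ?B j & u < v}. ?sg u v) +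
  (\<Sum>p\<in>merges w. \<Sum>(u, v)\<in>L (left_edge w p) \<times> L (right_edge w p). ?sg u v)"
 proof -
  have fm: "finite (merges w)" using finite_vertices by (simp add: merges_def)
  show ?thesis unfolding labeling_inv_def attacking_pairs_def thick_es image_mset_union sum_mset.union
   sum_mset_sum[OF finite_lessThan] sum_mset_sum[OF fm] sum_unfold_sum_mset[symmetric] ..
 qed
 also have "... = (\<Sum>i<deg. \<Sum>k<i. ?s i * (if lab ! k = lab ! i then 1 else 0)) +
  (\<Sum>i<deg. \<Sum>k<i. ?s i * cross (?g k) (?g i))"
 proof -
  have "(\<Sum>p\<in>merges w. \<Sum>(u, v)\<in>L (left_edge w p) \<times> L (right_edge w p). ?sg u v) =
   (\<Sum>p\<in>merges w. \<Sum>i<deg. \<Sum>k<i. ?s i * (int (?g k (left_edge w p)) * int (?g i (right_edge w p)) - int (?g k (right_edge w p)) * int (?g i (left_edge w p))))"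
   by (rule sum.cong[OF refl]) (rule merge)
  also have "... = (\<Sum>i<deg. \<Sum>k<i. \<Sum>p\<in>merges w. ?s i * (int (?g k (left_edge w p)) * int (?g i (right_edge w p)) - int (?g k (right_edge w p)) * int (?g i (left_edge w p))))"
   by (subst sum.swap) (intro sum.cong refl sum.swap)
  also have "... = (\<Sum>i<deg. \<Sum>k<i. ?s i * cross (?g k) (?g i))"
   unfolding cross_def sum_distrib_left ..
  finally show ?thesis unfolding blocks by simp
 qed
 also have "... = energy L S"
  unfolding energy_def degree_at_def sum.distrib[symmetric] sum_distrib_left
  by (intro sum.cong refl) (simp add: distrib_left)
 finally show ?thesis .
qed

lemma hook_sum_energy:
 assumes h: "radial_cut w h"
 shows "hook_sum w h j = (\<Sum>L\<in>SLD w h. \<Sum>S | S <= {..<deg} & 0 \<in> S & card S = j. q_var powi energy L S)"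
proof -
 have n: "web_degree w = deg" unfolding web_degree_cut[OF h] thick_es[symmetric] deg_def cut_size_def ..
 show ?thesis
 proof (cases "1 <= j & j <= deg")
  case True
  have inj: "inj_on (tab deg) {S. S <= {..<deg} & 0 \<in> S & card S = j}"
   by (rule inj_on_subset[OF tab_inj]) auto
  have "(\<Sum>\<tau>\<in>SYT (hook deg j). q_var powi labeling_inv w h L (row_of \<tau>)) =
   (\<Sum>S | S <= {..<deg} & 0 \<in> S & card S = j. q_var powi energy L S)" if L: "L \<in> SLD w h" for L
   unfolding SYT_hook[OF conjunct1[OF True] conjunct2[OF True]] sum.reindex[OF inj] comp_def
   by (rule sum.cong[OF refl]) (use labeling_inv_energy[OF h L] in auto)
  then show ?thesis unfolding hook_sum_def n using True by simp
 next
  case False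
  have "{S. S <= {..<deg} & 0 \<in> S & card S = j} = {}"
  proof (rule equals0I)
   fix S assume "S \<in> {S. S <= {..<deg} & 0 \<in> S & card S = j}"
   then have S: "S <= {..<deg}" "0 \<in> S" "card S = j" by blast+
   have "finite S" using S(1) finite_subset by blast
   then have "card S > 0" using S(2) by (auto simp: card_gt_0_iff)
   moreover have "card S <= card {..<deg}" by (rule card_mono) (use S(1) in auto)
   ultimately show False using False S(3) by simp
  qed
  then show ?thesis unfolding hook_sum_def n using False by (simp only: sum.empty if_False sum.neutral_const)
 qed
qed

text \<open>The smallest label has degree 0, so it may be moved into or out of the first row.\<close>

lemma hook_sum_pair:
 assumes h: "radial_cut w h" and n: "deg >= 1"
 shows "hook_sum w h k + hook_sum w h (k + 1) = (\<Sum>L\<in>SLD w h. \<Sum>S | S <= {..<deg} & card S = k. q_var powi energy L S)"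
 unfolding hook_sum_energy[OF h] sum.distrib[symmetric]
proof (rule sum.cong[OF refl])
 fix L
 let ?T = "{S. S <= {..<deg} & card S = k}"
 have fin: "finite ?T" by (rule finite_subset[of _ "Pow {..<deg}"]) auto
 have z: "degree_at gs 0 = 0" for gs by (simp add: degree_at_def)
 have en: "energy L (insert 0 S) = energy L S" for S
  unfolding energy_def by (rule sum.cong[OF refl]) (use z in auto)
 have "(\<Sum>S | S <= {..<deg} & 0 \<in> S & card S = k + 1. q_var powi energy L S) = (\<Sum>S\<in>{S \<in> ?T. 0 ~: S}. q_var powi energy L S)"
 proof (rule sum.reindex_bij_witness[of _ "insert 0" "%S. S - {0}"])
  fix S assume "S \<in> {S. S <= {..<deg} & 0 \<in> S & card S = k + 1}"
  then have S: "S <= {..<deg}" "0 \<in> S" "card S = k + 1" by blast+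
  show i: "insert 0 (S - {0}) = S" using S(2) by blast
  show "S - {0} \<in> {S \<in> ?T. 0 ~: S}" using S by auto
  show "q_var powi energy L (S - {0}) = q_var powi energy L S" using en[of "S - {0}"] unfolding i by simp
 next
  fix S assume "S \<in> {S \<in> ?T. 0 ~: S}"
  then have S: "S <= {..<deg}" "0 ~: S" "card S = k" by blast+
  show "insert 0 S - {0} = S" using S(2) by blast
  have "finite S" using S(1) finite_subset by blast
  then show "insert 0 S \<in> {S. S <= {..<deg} & 0 \<in> S & card S = k + 1}" using S n by auto
 qed
 moreover have "{S. S <= {..<deg} & 0 \<in> S & card S = k} = {S \<in> ?T. 0 \<in> S}" by auto
 moreover have "(\<Sum>S\<in>?T. q_var powi energy L S) = (\<Sum>S\<in>{S \<in> ?T. 0 \<in> S}. q_var powi energy L S) + (\<Sum>S\<in>{S \<in> ?T. 0 ~: S}. q_var powi energy L S)"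
 proof -
  have "?T = {S \<in> ?T. 0 \<in> S} Un {S \<in> ?T. 0 ~: S}" by blast
  moreover have "(\<Sum>S\<in>{S \<in> ?T. 0 \<in> S} Un {S \<in> ?T. 0 ~: S}. q_var powi energy L S) = (\<Sum>S\<in>{S \<in> ?T. 0 \<in> S}. q_var powi energy L S) + (\<Sum>S\<in>{S \<in> ?T. 0 ~: S}. q_var powi energy L S)"
   by (rule sum.union_disjoint) (use fin in auto)
  ultimately show ?thesis by (simp only:)
 qed
 ultimately show "(\<Sum>S | S <= {..<deg} & 0 \<in> S & card S = k. q_var powi energy L S) +
   (\<Sum>S | S <= {..<deg} & 0 \<in> S & card S = k + 1. q_var powi energy L S) = (\<Sum>S\<in>?T. q_var powi energy L S)"
  by (simp only:)
qed

lemma powi_sum: "finite A ==> q_var powi (\<Sum>i\<in>A. f i) = (\<Prod>i\<in>A. q_var powi f i)"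
 by (induction A rule: finite_induct) (simp_all add: power_int_add q_var_nz)

text \<open>Taking the positive term of the bracket for i in \<open>S\<close> and the negative one
  elsewhere gives q to the power N (2 |S| - deg) plus the energy of \<open>S\<close>. With a = q^N
  the size of \<open>S\<close> thus becomes the exponent of a.\<close>

lemma prod_bracket_expand:
 "(\<Prod>i<deg. bracket (int N - degree_at (loop_list deg L) i)) =
  (\<Sum>k\<le>deg. (- 1) ^ (deg - k) * (q_var ^ N) powi (2 * int k - int deg) * (\<Sum>S | S <= {..<deg} & card S = k. q_var powi energy L S))"
proof -
 let ?d = "degree_at (loop_list deg L)"
 have trm: "(\<Prod>i\<in>S. q_var powi (int N - ?d i)) * (\<Prod>i\<in>{..<deg} - S. - (q_var powi (- (int N - ?d i)))) =
  (- 1) ^ (deg - card S) * (q_var ^ N) powi (2 * int (card S) - int deg) * q_var powi energy L S" if S: "S <= {..<deg}" for S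
 proof -
  have fS: "finite S" using S finite_subset by blast
  have cS: "card ({..<deg} - S) = deg - card S" "card S <= deg"
   using S fS card_mono[OF finite_lessThan S] by (simp_all add: card_Diff_subset)
  have neg: "(\<Prod>i\<in>{..<deg} - S. - (q_var powi (- (int N - ?d i)))) = (- 1) ^ (deg - card S) * (\<Prod>i\<in>{..<deg} - S. q_var powi (- (int N - ?d i)))"
   unfolding cS(1)[symmetric] prod_constant[symmetric] prod.distrib[symmetric] by (rule prod.cong) auto
  have "energy L S = (\<Sum>i\<in>S. - ?d i) + (\<Sum>i\<in>{..<deg} - S. ?d i)"
   unfolding energy_def sum.subset_diff[OF S finite_lessThan, of "%i. (if i \<in> S then - 1 else 1) * ?d i"]
   by (simp add: add.commute)
  then have ex: "(\<Sum>i\<in>S. int N - ?d i) + (\<Sum>i\<in>{..<deg} - S. - (int N - ?d i)) = int N * (2 * int (card S) - int deg) + energy L S"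
   using cS by (simp add: sum_subtractf sum_negf of_nat_diff algebra_simps)
  have qN: "(q_var ^ N) powi (2 * int (card S) - int deg) = q_var powi (int N * (2 * int (card S) - int deg))"
   unfolding power_int_mult power_int_of_nat ..
  let ?P = "\<Prod>i\<in>S. q_var powi (int N - ?d i)" and ?P' = "\<Prod>i\<in>{..<deg} - S. q_var powi (- (int N - ?d i))"
  have "?P * ?P' = q_var powi (\<Sum>i\<in>S. int N - ?d i) * q_var powi (\<Sum>i\<in>{..<deg} - S. - (int N - ?d i))"
   unfolding powi_sum[OF fS] powi_sum[OF finite_Diff[OF finite_lessThan]] ..
  also have "... = q_var powi (int N * (2 * int (card S) - int deg) + energy L S)" unfolding powi_add3 ex ..
  also have "... = q_var powi (int N * (2 * int (card S) - int deg)) * q_var powi energy L S" by (rule powi_add3[symmetric])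
  finally have M: "?P * ?P' = q_var powi (int N * (2 * int (card S) - int deg)) * q_var powi energy L S" .
  have "?P * ((- 1) ^ (deg - card S) * ?P') = (- 1) ^ (deg - card S) * (?P * ?P')" by (rule mult.left_commute)
  then show ?thesis unfolding neg M qN by (simp only: mult.assoc)
 qed
 have "(\<Prod>i<deg. bracket (int N - ?d i)) = (\<Prod>i<deg. q_var powi (int N - ?d i) + - (q_var powi (- (int N - ?d i))))"
  unfolding bracket_def by simp
 also have "... = (\<Sum>S\<in>Pow {..<deg}. (\<Prod>i\<in>S. q_var powi (int N - ?d i)) * (\<Prod>i\<in>{..<deg} - S. - (q_var powi (- (int N - ?d i)))))"
  by (rule prod_add) simp
 also have "... = (\<Sum>S\<in>Pow {..<deg}. (- 1) ^ (deg - card S) * (q_var ^ N) powi (2 * int (card S) - int deg) * q_var powi energy L S)"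
  by (rule sum.cong[OF refl]) (use trm in blast)
 also have "... = (\<Sum>k\<le>deg. \<Sum>S\<in>{S \<in> Pow {..<deg}. card S = k}. (- 1) ^ (deg - card S) * (q_var ^ N) powi (2 * int (card S) - int deg) * q_var powi energy L S)"
  by (rule sum.group[symmetric]) (auto dest: card_mono[OF finite_lessThan])
 also have "... = (\<Sum>k\<le>deg. (- 1) ^ (deg - k) * (q_var ^ N) powi (2 * int k - int deg) * (\<Sum>S | S <= {..<deg} & card S = k. q_var powi energy L S))"
  unfolding sum_distrib_left by (intro sum.cong refl) auto
 finally show ?thesis .
qed

lemma geo_princ: "geo (q_var powi (int N - 1)) N = princ N"
proof -
 have G: "geo c N = map (%i. c * q_var powi (- 2 * int i)) [0..<N]" for c
 proof (induction N arbitrary: c)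
  case (Suc N)
  have "map (%i. c * q_var powi (- 2 * int i)) [0..<Suc N] = c # map (%i. c * q_var powi (- 2 * int (Suc i))) [0..<N]"
   unfolding upt_conv_Cons[OF zero_less_Suc] map_Suc_upt[symmetric] by (simp add: comp_def)
  moreover have "c * q_var powi (- 2 * int (Suc i)) = c / q_var\<^sup>2 * q_var powi (- 2 * int i)" for i
  proof -
   have "q_var powi (- 2 * int (Suc i)) = q_var powi (- 2) * q_var powi (- 2 * int i)"
    unfolding powi_add3 by (simp add: algebra_simps)
   then show ?thesis by (simp add: power_int_minus divide_inverse mult_ac)
  qed
  ultimately show ?case using Suc[of "c / q_var\<^sup>2"] by simp
 qed simp
 show ?thesis unfolding princ_def G powi_add3 by simp
qed

text \<open>Each bracket is q - 1/q times a quantum integer; collected over the cut these factors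
  form the power of q - 1/q in the denominator of the result.\<close>

lemma q_fact_bracket: "q_fact k * (q_var - inverse q_var) ^ k = bfact k"
proof -
 have nz: "q_var - inverse q_var ~= 0" using q_pow_diff_nz[of 1] by simp
 have "q_int i * (q_var - inverse q_var) = bracket (int i)" for i
  using nz by (simp add: q_int_def bracket_def power_int_minus power_inverse)
 then have "bfact k = (\<Prod>i=1..k. q_int i * (q_var - inverse q_var))" by (simp add: bfact_def)
 then show ?thesis by (simp add: prod.distrib q_fact_def)
qed

lemma bfact_nz: "bfact k ~= 0"
proof -
 have "bracket (int i) ~= 0" if "i \<in> {1..k}" for i
  using q_pow_diff_nz[of i] that by (simp add: bracket_def power_int_minus power_inverse)
 then show ?thesis by (simp add: bfact_def)
qed

lemma q_fact_comp_bfact: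
 "q_fact_comp (initial_thickness w h) * (q_var - inverse q_var) ^ deg = (\<Prod>e\<in>set es. bfact (thick e))"
proof -
 have "prod_list (map q_fact (map thick l)) * (q_var - inverse q_var) ^ sum_list (map thick l) = prod_list (map (%e. bfact (thick e)) l)" for l
 proof (induction l)
  case (Cons e l)
  let ?x = "q_var - inverse q_var"
  have "prod_list (map q_fact (map thick (e # l))) * ?x ^ sum_list (map thick (e # l)) =
   (q_fact (thick e) * ?x ^ thick e) * (prod_list (map q_fact (map thick l)) * ?x ^ sum_list (map thick l))"
   by (simp only: list.map prod_list.Cons sum_list.Cons power_add mult_ac)
  then show ?case unfolding q_fact_bracket Cons.IH by simp
 qed simp
 then show ?thesis unfolding q_fact_comp_def thick_es[symmetric] deg_def cut_size_def prod.distinct_set_conv_list[OF distinct_es] .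
qed

text \<open>The principal specialisations come from \<open>gen_peel\<close> and
  \<open>peel_SLD\<close> after division by the bracket factorials, which are nonzero. The
  expression \<open>nat ((m + int deg) div 2)\<close> recovers k from m = 2k - deg.\<close>

theorem homfly_expansion:
 assumes h: "radial_cut w h" and n: "deg >= 1"
 shows "laurent_expansion (homfly w)
  (%m. if \<exists>k\<le>deg. m = 2 * int k - int deg then (- 1) ^ (deg - nat ((m + int deg) div 2)) *
   (hook_sum w h (nat ((m + int deg) div 2)) + hook_sum w h (nat ((m + int deg) div 2) + 1)) /
   (q_fact_comp (initial_thickness w h) * (q_var - inverse q_var) ^ deg) else 0)"
 unfolding homfly_def
proof (rule homfly_from_princ[OF web_series_symmetric])
 fix N
 define F where "F = (\<Prod>e\<in>set es. bfact (thick e))"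
 have F0: "F ~= 0" unfolding F_def using bfact_nz by simp
 have "F * series_eval (princ N) (web_series w) = peel N (labels thick) thick"
  unfolding series_eval_web_series geo_princ[symmetric] F_def by (rule gen_peel) (rule refl)
 also have "... = (\<Sum>L\<in>SLD w h. \<Sum>k\<le>deg. (- 1) ^ (deg - k) * (q_var ^ N) powi (2 * int k - int deg) * (\<Sum>S | S <= {..<deg} & card S = k. q_var powi energy L S))"
  unfolding peel_SLD[OF h] prod_bracket_expand ..
 also have "... = (\<Sum>k\<le>deg. (- 1) ^ (deg - k) * (q_var ^ N) powi (2 * int k - int deg) * (hook_sum w h k + hook_sum w h (k + 1)))"
  unfolding hook_sum_pair[OF h n] sum_distrib_left by (rule sum.swap)
 finally have E: "series_eval (princ N) (web_series w) = (\<Sum>k\<le>deg. (- 1) ^ (deg - k) * (q_var ^ N) powi (2 * int k - int deg) * (hook_sum w h k + hook_sum w h (k + 1))) / F"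
  using F0 by (simp add: field_simps)
 show "series_eval (princ N) (web_series w) = (\<Sum>k\<le>deg. (- 1) ^ (deg - k) * (hook_sum w h k + hook_sum w h (k + 1)) /
   (q_fact_comp (initial_thickness w h) * (q_var - inverse q_var) ^ deg) * (q_var ^ N) powi (2 * int k - int deg))"
  unfolding E q_fact_comp_bfact F_def[symmetric] sum_divide_distrib by (intro sum.cong refl) simp
qed

end

theorem theorem3:
  fixes w :: "'e web" and h :: real and n :: nat and \<alpha> :: "nat list"
  assumes "annular_web w" and "web_degree w = n" and "n \<ge> 1"
    and "radial_cut w h" and "initial_thickness w h = \<alpha>"
  shows "laurent_polynomial (homfly w) \<and>
    (\<forall>k\<le>n. a_coeff (homfly w) (2 * int k - int n) =
       (- 1) ^ (n - k) * (hook_sum w h k + hook_sum w h (k + 1)) /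
       (q_fact_comp \<alpha> * (q_var - inverse q_var) ^ n)) \<and>
    (\<forall>m. (\<forall>k\<le>n. m \<noteq> 2 * int k - int n) \<longrightarrow> a_coeff (homfly w) m = 0)"
proof -
 obtain y L0 ss where cw: "cut_web w h y L0 ss" using cut_web_exists[OF assms(1,4)] by blast
 interpret cut_web w h y L0 ss by (rule cw)
 interpret homfly_web w h y L0 ss by unfold_locales (simp_all add: q_var_nz q_var_power_neq_1)
 have n: "deg = n" using web_degree_cut[OF assms(4)] assms(2) unfolding thick_es[symmetric] deg_def cut_size_def by simp
 have dn: "deg >= 1" using n assms(3) by simp
 note ex = homfly_expansion[OF assms(4) dn, unfolded n assms(5)]
 have co: "nat ((2 * int k - int n + int n) div 2) = k" for k by simp
 show ?thesis
 proof (intro conjI allI impI)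
  show "laurent_polynomial (homfly w)" unfolding laurent_polynomial_def by (rule exI, rule ex)
  fix k assume k: "k <= n"
  then have "\<exists>k'\<le>n. 2 * int k - int n = 2 * int k' - int n" by blast
  then show "a_coeff (homfly w) (2 * int k - int n) = (- 1) ^ (n - k) * (hook_sum w h k + hook_sum w h (k + 1)) /
   (q_fact_comp \<alpha> * (q_var - inverse q_var) ^ n)"
   unfolding a_coeff_eq[OF ex] co by (simp only: if_True)
 next
  fix m assume "\<forall>k\<le>n. m ~= 2 * int k - int n"
  then have "\<not> (\<exists>k\<le>n. m = 2 * int k - int n)" by blast
  then show "a_coeff (homfly w) m = 0" unfolding a_coeff_eq[OF ex] by (rule if_not_P)
 qed
qed

end
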